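(* There exists a sampling algorithm with the following guarantee. Given integers $\Delta\ge 1$ and $q\geq 2\Delta$, and any graph $G$ on $n$ vertices with maximum degree $\Delta$, the algorithm $\epsilon$-approximately samples a uniformly random equitable $q$-coloring of $G$, with high probability, and its running time is $O\!\left(n^{(q+1)/2}\,\log n\,\log(1/\epsilon)^2\right)$.
   Context: A (proper) $q$-coloring of $G=(V,E)$ is a map $\sigma:V\to[q]$ with $\sigma(u)\ne\sigma(v)$ for every edge $uv\in E$. An equitable $q$-coloring is a proper $q$-coloring in which the sizes of any two color classes $\sigma^{-1}(i),\sigma^{-1}(j)$ differ by at most $1$. An algorithm $\epsilon$-approximately samples from a target distribution $\mu$ if the distribution $\nu$ of its output satisfies $\|\nu-\mu\|_{TV}\le\epsilon$; here $\mu$ is the uniform distribution on equitable $q$-colorings of $G$. The constants in the $O(\cdot)$ may depend on $q$ and $\Delta$. *)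

theory Defs
  imports "HOL-Probability.Probability"
begin

section \<open>Graphs and equitable colorings\<close>

text \<open>A graph on \<open>n\<close> vertices has vertex set \<open>{..<n}\<close>; edges are two-element sets.\<close>

definition simple_graph :: "nat \<Rightarrow> nat set set \<Rightarrow> bool" where
  "simple_graph n E \<longleftrightarrow> E \<subseteq> {{u, v} |u v. u < n \<and> v < n \<and> u \<noteq> v}"

definition degree_of :: "nat set set \<Rightarrow> nat \<Rightarrow> nat" where
  "degree_of E v = card {e \<in> E. v \<in> e}"

definition max_degree :: "nat \<Rightarrow> nat set set \<Rightarrow> nat" where
  "max_degree n E = Max (degree_of E ` {..<n})"

definition proper_colorings :: "nat \<Rightarrow> nat set set \<Rightarrow> nat \<Rightarrow> (nat \<Rightarrow> nat) set" where
  "proper_colorings n E q =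
     {\<sigma> \<in> {..<n} \<rightarrow>\<^sub>E {1..q}. \<forall>u v. {u, v} \<in> E \<longrightarrow> \<sigma> u \<noteq> \<sigma> v}"

definition color_class :: "nat \<Rightarrow> (nat \<Rightarrow> nat) \<Rightarrow> nat \<Rightarrow> nat set" where
  "color_class n \<sigma> i = {v \<in> {..<n}. \<sigma> v = i}"

definition equitable_colorings :: "nat \<Rightarrow> nat set set \<Rightarrow> nat \<Rightarrow> (nat \<Rightarrow> nat) set" where
  "equitable_colorings n E q =
     {\<sigma> \<in> proper_colorings n E q. \<forall>i \<in> {1..q}. \<forall>j \<in> {1..q}.
        \<bar>int (card (color_class n \<sigma> i)) - int (card (color_class n \<sigma> j))\<bar> \<le> 1}"


section \<open>Approximate sampling\<close>

definition tv_dist :: "'a pmf \<Rightarrow> 'a pmf \<Rightarrow> real" where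
  "tv_dist \<nu> \<mu> = (SUP A. \<bar>measure_pmf.prob \<nu> A - measure_pmf.prob \<mu> A\<bar>)"

definition approx_samples :: "real \<Rightarrow> 'a pmf \<Rightarrow> 'a pmf \<Rightarrow> bool" where
  "approx_samples \<epsilon> \<nu> \<mu> \<longleftrightarrow> tv_dist \<nu> \<mu> \<le> \<epsilon>"


section \<open>Randomized random-access machines\<close>

text \<open>
  A program is a finite list of instructions acting on a memory of natural numbers indexed by
  addresses. Each instruction takes one unit of time. \<open>Rand d a\<close> writes a uniformly
  random element of \<open>{0..<m a}\<close> to cell \<open>d\<close>. To rule out packing large computations
  into single arithmetic operations, unit cost is only meaningful together with
  \<open>words_bounded\<close> below for a bound polynomial in the input size (the word-RAM convention:
  words of logarithmically many bits).
\<close>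

type_synonym memory = "nat \<Rightarrow> nat"

datatype instr =
    Const nat nat
  | Add nat nat nat
  | Sub nat nat nat
  | Mul nat nat nat
  | Div nat nat nat
  | Load nat nat
  | Store nat nat
  | Rand nat nat
  | Jump_Less nat nat nat

type_synonym state = "nat \<times> memory"

fun exec :: "instr \<Rightarrow> state \<Rightarrow> state pmf" where
  "exec (Const d c) (pc, m) = return_pmf (Suc pc, m(d := c))"
| "exec (Add d a b) (pc, m) = return_pmf (Suc pc, m(d := m a + m b))"
| "exec (Sub d a b) (pc, m) = return_pmf (Suc pc, m(d := m a - m b))"
| "exec (Mul d a b) (pc, m) = return_pmf (Suc pc, m(d := m a * m b))"
| "exec (Div d a b) (pc, m) = return_pmf (Suc pc, m(d := m a div m b))"
| "exec (Load d a) (pc, m) = return_pmf (Suc pc, m(d := m (m a)))"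
| "exec (Store a b) (pc, m) = return_pmf (Suc pc, m(m a := m b))"
| "exec (Rand d a) (pc, m) =
     (if m a = 0 then return_pmf (Suc pc, m(d := 0))
      else map_pmf (\<lambda>x. (Suc pc, m(d := x))) (pmf_of_set {..<m a}))"
| "exec (Jump_Less a b l) (pc, m) = return_pmf (if m a < m b then l else Suc pc, m)"

text \<open>The machine halts as soon as the program counter leaves the program.\<close>

definition halted :: "instr list \<Rightarrow> state \<Rightarrow> bool" where
  "halted P s \<longleftrightarrow> length P \<le> fst s"

definition step :: "instr list \<Rightarrow> state \<Rightarrow> state pmf" where
  "step P s = (if halted P s then return_pmf s else exec (P ! fst s) s)"

definition initial_state :: "nat list \<Rightarrow> state" where
  "initial_state xs = (0, \<lambda>i. if i < length xs then xs ! i else 0)"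

fun run :: "instr list \<Rightarrow> nat list \<Rightarrow> nat \<Rightarrow> state pmf" where
  "run P xs 0 = return_pmf (initial_state xs)"
| "run P xs (Suc t) = bind_pmf (run P xs t) (step P)"

definition halts_within :: "instr list \<Rightarrow> nat list \<Rightarrow> nat \<Rightarrow> bool" where
  "halts_within P xs T \<longleftrightarrow> (\<forall>s \<in> set_pmf (run P xs T). halted P s)"

definition words_bounded :: "instr list \<Rightarrow> nat list \<Rightarrow> nat \<Rightarrow> bool" where
  "words_bounded P xs B \<longleftrightarrow> (\<forall>t. \<forall>s \<in> set_pmf (run P xs t). \<forall>i. snd s i \<le> B)"


section \<open>Input and output of a coloring sampler\<close>

text \<open>A graph is presented by its edges, listed once each, in any order and orientation.\<close>

definition lists_edges :: "(nat \<times> nat) list \<Rightarrow> nat set set \<Rightarrow> bool" where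
  "lists_edges es E \<longleftrightarrow>
     distinct (map (\<lambda>(u, v). {u, v}) es) \<and> set (map (\<lambda>(u, v). {u, v}) es) = E"

text \<open>A real accuracy \<open>\<epsilon>\<close> is not a finite object; the machine is given the least
  \<open>k\<close> with \<open>2 ^ (- k) \<le> \<epsilon>\<close>.\<close>

definition precision :: "real \<Rightarrow> nat" where
  "precision \<epsilon> = nat \<lceil>log 2 (1 / \<epsilon>)\<rceil>"

definition encode_input :: "nat \<Rightarrow> nat \<Rightarrow> nat \<Rightarrow> (nat \<times> nat) list \<Rightarrow> real \<Rightarrow> nat list" where
  "encode_input \<Delta> q n es \<epsilon> =
     [\<Delta>, q, n, precision \<epsilon>, length es] @ concat (map (\<lambda>(u, v). [u, v]) es)"

text \<open>Cell \<open>0\<close> of the final memory tells whether the machine reports failure (value \<open>0\<close>);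
  otherwise the color of vertex \<open>v\<close> is in cell \<open>v + 1\<close>.\<close>

definition decode_output :: "nat \<Rightarrow> memory \<Rightarrow> (nat \<Rightarrow> nat) option" where
  "decode_output n m = (if m 0 = 0 then None else Some (restrict (\<lambda>v. m (v + 1)) {..<n}))"

definition output_dist ::
  "instr list \<Rightarrow> nat list \<Rightarrow> nat \<Rightarrow> nat \<Rightarrow> (nat \<Rightarrow> nat) option pmf" where
  "output_dist P xs T n = map_pmf (\<lambda>s. decode_output n (snd s)) (run P xs T)"

definition success_prob :: "'a option pmf \<Rightarrow> real" where
  "success_prob \<nu> = measure_pmf.prob \<nu> (range Some)"

text \<open>The law of the output conditioned on success; only meaningful if
  \<open>success_prob \<nu> > 0\<close>.\<close>

definition given_success :: "'a option pmf \<Rightarrow> 'a pmf" where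
  "given_success \<nu> = map_pmf the (cond_pmf \<nu> (range Some))"

end

(*
  The machine runs a Markov chain on all maps V -> [q]: the end points of a random edge get a uniformly random pair of
  distinct colours that are compatible with their other neighbours, and a random isolated vertex gets a random colour.
  As 2 Delta <= q, one step shrinks the Lipschitz constant (for the Hamming distance) of every function by the factor
  1 - 1/(q^2 (|E| + n)). Hence the chain is 2^-k-close to a uniform proper colouring after O(n (k + log n)) steps, and
  a Lipschitz function of a uniform proper colouring has variance O(n). After so many steps the machine looks whether the
  colouring is equitable, and if not, it goes on with the chain for as many steps.

  Equitable colourings have density at least c n^(-(q-1)/2) among the proper ones, so that O(n^((q-1)/2) k) trials all
  fail with probability at most 2^-k. To see this, split an independent set of linear size into parts
  I_1, ..., I_(q-1). By Chebyshev's inequality, linearly many vertices of each I_i are free to switch between the colours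
  i and i + 1, and the numbers of vertices of colour at most i are within O(sqrt n) of their targets. Given everything
  else, the switches in I_i move that number by a binomial random variable, which hits the target with probability at least
  c / sqrt n, independently for the different i.
*)

theory Submission imports Defs
begin

section \<open>Structured programs\<close>

text \<open>For updates of single vertices the one-step bound is neutral at
  \<open>q = 2 * \<Delta>\<close>: a disagreement at \<open>u\<close> reaches up to
  \<open>\<Delta>\<close> neighbours, each with as few as \<open>q - \<Delta> = \<Delta>\<close>
  colours to choose from, and loss and gain cancel. Updating both ends of an edge lets each end
  ignore the other. The lists then have at least \<open>\<Delta> + 1\<close> colours, and this
  produces the margin \<open>1 / q\<^sup>2\<close> of \<open>infl_bound\<close>. Contraction holds
  from every start. If all trials fail, the machine returns the last state; failure is thus charged
  to the sampling error, and success is certain. The density argument breaks down in two cases. For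
  \<open>q = 2\<close> a vertex with neighbours is never free to switch, and there an exact count
  replaces concentration. For small \<open>n\<close> Chebyshev says nothing, and the mere existence
  of an equitable colouring is used. That existence needs only a weak form of the Hajnal-Szemeredi
  theorem, since \<open>q \<ge> 2 * \<Delta>\<close>.\<close>

definition mem_bounded :: "nat \<Rightarrow> memory \<Rightarrow> bool" where
  "mem_bounded B m \<longleftrightarrow> (\<forall>i. m i \<le> B)"

text \<open>\<open>M\<close> is the law at a stopping time, not at a fixed one: each successor
  continues with its own \<open>M s'\<close>, so branches may need different numbers of steps, and
  \<open>t\<close> only bounds the longest of them.\<close>

inductive reaches :: "instr list \<Rightarrow> nat \<Rightarrow> state \<Rightarrow> state pmf \<Rightarrow> nat \<Rightarrow> bool" for P B where
  stop: "mem_bounded B (snd s) \<Longrightarrow> reaches P B s (return_pmf s) t"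
| step: "mem_bounded B (snd s) \<Longrightarrow> (\<And>s'. s' \<in> set_pmf (step P s) \<Longrightarrow> reaches P B s' (M s') t) \<Longrightarrow>
    reaches P B s (bind_pmf (step P s) M) (Suc t)"

lemma reaches_mono: "reaches P B s M t \<Longrightarrow> t \<le> t' \<Longrightarrow> reaches P B s M t'"
proof (induction arbitrary: t' rule: reaches.induct)
  case (step s M t)
  then obtain t'' where "t' = Suc t''" "t \<le> t''" by (cases t') auto
  with step show ?case by (auto intro!: reaches.step)
qed (auto intro: reaches.stop)

lemma reaches_bind:
  "reaches P B s M t \<Longrightarrow> (\<And>s'. s' \<in> set_pmf M \<Longrightarrow> reaches P B s' (N s') u) \<Longrightarrow>
    reaches P B s (bind_pmf M N) (t + u)"
proof (induction rule: reaches.induct)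
  case (stop s t)
  then have "reaches P B s (N s) u" by simp
  then show ?case by (simp add: bind_return_pmf reaches_mono)
next
  case (step s M t)
  have "reaches P B s (bind_pmf (step P s) (\<lambda>x. bind_pmf (M x) N)) (Suc (t + u))"
  proof (rule reaches.step[OF step.hyps(1)])
    fix s' assume s': "s' \<in> set_pmf (step P s)"
    show "reaches P B s' (bind_pmf (M s') N) (t + u)"
      by (rule step.IH[OF s']) (use step.prems s' in \<open>simp, blast\<close>)
  qed
  then show ?case by (simp add: bind_assoc_pmf)
qed

text \<open>Unlike \<open>run\<close>, this unrolls the first step, which is the direction in which
  \<open>reaches\<close> is built.\<close>

fun steps :: "instr list \<Rightarrow> nat \<Rightarrow> state \<Rightarrow> state pmf" where
  "steps P 0 s = return_pmf s"
| "steps P (Suc k) s = bind_pmf (step P s) (steps P k)"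

lemma steps_Suc_right: "steps P (Suc k) s = bind_pmf (steps P k s) (step P)"
proof (induction k arbitrary: s)
  case 0
  have "steps P 0 = return_pmf" by (rule ext) simp
  then show ?case by (simp add: bind_return_pmf bind_return_pmf')
next
  case (Suc k)
  have *: "steps P (Suc k) = (\<lambda>x. bind_pmf (steps P k x) (step P))" by (rule ext) (rule Suc.IH)
  have "steps P (Suc (Suc k)) s = bind_pmf (step P s) (\<lambda>x. bind_pmf (steps P k x) (step P))"
    by (subst steps.simps(2), subst *) (rule refl)
  also have "\<dots> = bind_pmf (steps P (Suc k) s) (step P)"
    by (simp add: bind_assoc_pmf)
  finally show ?case .
qed

lemma run_eq_steps: "run P xs t = steps P t (initial_state xs)"
  by (induction t) (simp_all only: run.simps steps_Suc_right, simp)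

lemma steps_halted: "halted P s \<Longrightarrow> steps P k s = return_pmf s"
  by (induction k) (auto simp: step_def bind_return_pmf)

text \<open>Halted states are fixed by \<open>step\<close>. Branches that stop early just wait, and
  so the stopping-time law is also the law at time \<open>t\<close>.\<close>

lemma reaches_steps:
  "reaches P B s M t \<Longrightarrow> (\<And>s'. s' \<in> set_pmf M \<Longrightarrow> halted P s') \<Longrightarrow> steps P t s = M"
proof (induction rule: reaches.induct)
  case (step s M t)
  have "steps P t s' = M s'" if s': "s' \<in> set_pmf (step P s)" for s'
    by (rule step.IH[OF s']) (use step.prems s' in \<open>simp, blast\<close>)
  then show ?case unfolding steps.simps by (intro bind_pmf_cong) simp_all
qed (simp add: steps_halted)

text \<open>\<open>words_bounded\<close> speaks about all times, also those beyond the time bound;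
  there the state is halted and repeats its last memory.\<close>

lemma reaches_bounded:
  "reaches P B s M t \<Longrightarrow> (\<And>s'. s' \<in> set_pmf M \<Longrightarrow> halted P s') \<Longrightarrow>
    s'' \<in> set_pmf (steps P k s) \<Longrightarrow> mem_bounded B (snd s'')"
proof (induction arbitrary: k s'' rule: reaches.induct)
  case (step s M t)
  show ?case
  proof (cases k)
    case 0
    then show ?thesis using step.hyps(1) step.prems by simp
  next
    case (Suc k')
    then obtain s' where s': "s' \<in> set_pmf (step P s)" "s'' \<in> set_pmf (steps P k' s')"
      using step.prems by (auto simp del: split_paired_Ex)
    show ?thesis
      by (rule step.IH[OF s'(1) _ s'(2)]) (use step.prems s'(1) in \<open>simp, blast\<close>)
  qed
qed (simp add: steps_halted)

text \<open>Each control construct compiles to a single \<open>Jump_Less\<close>: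
  \<open>Unless a b c\<close> jumps over \<open>c\<close>, and \<open>DoWhile\<close> jumps back
  after its body. A loop therefore runs its body at least once, which is visible in the side
  conditions of all loop rules.\<close>

datatype com =
    Blk "instr list"
  | Rnd nat nat
  | Seq com com  (infixr ";;" 60)
  | Unless nat nat com
  | DoWhile com nat nat

fun len :: "com \<Rightarrow> nat" where
  "len (Blk is) = length is"
| "len (Rnd d a) = 1"
| "len (c1 ;; c2) = len c1 + len c2"
| "len (Unless a b c) = Suc (len c)"
| "len (DoWhile c a b) = Suc (len c)"

fun compile :: "nat \<Rightarrow> com \<Rightarrow> instr list" where
  "compile l (Blk is) = is"
| "compile l (Rnd d a) = [Rand d a]"
| "compile l (c1 ;; c2) = compile l c1 @ compile (l + len c1) c2"
| "compile l (Unless a b c) = Jump_Less a b (l + Suc (len c)) # compile (Suc l) c"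
| "compile l (DoWhile c a b) = compile l c @ [Jump_Less a b l]"

lemma length_compile [simp]: "length (compile l c) = len c"
  by (induction c arbitrary: l) auto

text \<open>An instruction without jump or randomness writes exactly one cell; \<open>val\<close>
  and \<open>dest\<close> describe this write. The values for \<open>Rand\<close> and
  \<open>Jump_Less\<close> are dummies, which \<open>no_jump\<close> excludes.\<close>

fun val :: "instr \<Rightarrow> memory \<Rightarrow> nat" where
  "val (Const d c) m = c"
| "val (Add d a b) m = m a + m b"
| "val (Sub d a b) m = m a - m b"
| "val (Mul d a b) m = m a * m b"
| "val (Div d a b) m = m a div m b"
| "val (Load d a) m = m (m a)"
| "val (Store a b) m = m b"
| "val (Rand d a) m = 0"
| "val (Jump_Less a b l) m = 0"

fun dest :: "instr \<Rightarrow> memory \<Rightarrow> nat" where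
  "dest (Const d c) m = d"
| "dest (Add d a b) m = d"
| "dest (Sub d a b) m = d"
| "dest (Mul d a b) m = d"
| "dest (Div d a b) m = d"
| "dest (Load d a) m = d"
| "dest (Store a b) m = m a"
| "dest (Rand d a) m = 0"
| "dest (Jump_Less a b l) m = 0"

fun no_jump :: "instr \<Rightarrow> bool" where
  "no_jump (Rand d a) = False"
| "no_jump (Jump_Less a b l) = False"
| "no_jump _ = True"

text \<open>The written values that memory bounds do not bound by themselves.\<close>

fun small :: "nat \<Rightarrow> instr \<Rightarrow> memory \<Rightarrow> bool" where
  "small B (Const d c) m = (c \<le> B)"
| "small B (Add d a b) m = (m a + m b \<le> B)"
| "small B (Mul d a b) m = (m a * m b \<le> B)"
| "small B _ m = True"

fun exec_all :: "instr list \<Rightarrow> memory \<Rightarrow> memory" where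
  "exec_all [] m = m"
| "exec_all (i # is) m = exec_all is (m(dest i m := val i m))"

fun all_small :: "nat \<Rightarrow> instr list \<Rightarrow> memory \<Rightarrow> bool" where
  "all_small B [] m = True"
| "all_small B (i # is) m \<longleftrightarrow> no_jump i \<and> small B i m \<and> all_small B is (m(dest i m := val i m))"

lemma exec_no_jump: "no_jump i \<Longrightarrow> exec i (l, m) = return_pmf (Suc l, m(dest i m := val i m))"
  by (cases i) auto

lemma bounded_val: "mem_bounded B m \<Longrightarrow> small B i m \<Longrightarrow> no_jump i \<Longrightarrow> val i m \<le> B"
  by (cases i) (auto simp: mem_bounded_def intro: le_trans[OF div_le_dividend] le_trans[OF diff_le_self])

lemma mem_bounded_upd [simp]: "mem_bounded B m \<Longrightarrow> v \<le> B \<Longrightarrow> mem_bounded B (m(d := v))"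
  by (simp add: mem_bounded_def)

lemma all_small_bounded: "mem_bounded B m \<Longrightarrow> all_small B is m \<Longrightarrow> mem_bounded B (exec_all is m)"
  by (induction "is" arbitrary: m) (auto simp: bounded_val)

text \<open>Time is an upper bound, so that a command gets one bound for all branches. The word
  bound \<open>B\<close> is checked in blocks only, because a random value lies below the content of
  a cell. The rule \<open>rnd\<close> leaves out the modulus 0, for which the machine writes a
  default.\<close>

inductive sem :: "nat \<Rightarrow> com \<Rightarrow> memory \<Rightarrow> memory pmf \<Rightarrow> nat \<Rightarrow> bool" for B where
  blk: "all_small B is m \<Longrightarrow> length is \<le> t \<Longrightarrow> sem B (Blk is) m (return_pmf (exec_all is m)) t"
| rnd: "0 < m a \<Longrightarrow> 0 < t \<Longrightarrow> sem B (Rnd d a) m (map_pmf (\<lambda>x. m(d := x)) (pmf_of_set {..<m a})) t"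
| seq: "sem B c1 m M t1 \<Longrightarrow> (\<And>m'. m' \<in> set_pmf M \<Longrightarrow> sem B c2 m' (N m') t2) \<Longrightarrow> t1 + t2 \<le> t \<Longrightarrow>
    sem B (c1 ;; c2) m (bind_pmf M N) t"
| skip: "m a < m b \<Longrightarrow> 0 < t \<Longrightarrow> sem B (Unless a b c) m (return_pmf m) t"
| enter: "m b \<le> m a \<Longrightarrow> sem B c m M t \<Longrightarrow> sem B (Unless a b c) m M (Suc t)"
| loop: "sem B c m M t1 \<Longrightarrow>
    (\<And>m'. m' \<in> set_pmf M \<Longrightarrow> m' a < m' b \<Longrightarrow> sem B (DoWhile c a b) m' (N m') t2) \<Longrightarrow>
    (\<And>m'. m' \<in> set_pmf M \<Longrightarrow> m' b \<le> m' a \<Longrightarrow> N m' = return_pmf m') \<Longrightarrow> Suc t1 + t2 \<le> t \<Longrightarrow>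
    sem B (DoWhile c a b) m (bind_pmf M N) t"

lemma sem_mono: "sem B c m M t \<Longrightarrow> t \<le> t' \<Longrightarrow> sem B c m M t'"
proof (induction arbitrary: t' rule: sem.induct)
  case (enter m b a c M t)
  then obtain t'' where "t' = Suc t''" "t \<le> t''" by (cases t') auto
  with enter show ?case by (auto intro!: sem.enter)
next
  case (seq c1 m M t1 c2 N t2 t)
  show ?case by (rule sem.seq[OF seq.hyps(1,2)]) (use seq in auto)
next
  case (loop c m M t1 a b N t2 t)
  show ?case by (rule sem.loop[OF loop.hyps(1,2,3)]) (use loop in auto)
qed (auto intro: sem.blk sem.rnd sem.skip)

lemma sem_bounded: "sem B c m M t \<Longrightarrow> mem_bounded B m \<Longrightarrow> m' \<in> set_pmf M \<Longrightarrow> mem_bounded B m'"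
proof (induction arbitrary: m' rule: sem.induct)
  case (blk "is" m t)
  then show ?case by (auto simp: all_small_bounded)
next
  case (rnd m a t d)
  have "x \<le> B" if "x < m a" for x
    using that rnd.prems(1)[unfolded mem_bounded_def, THEN spec, of a] by simp
  moreover have "set_pmf (pmf_of_set {..<m a}) = {..<m a}"
    using rnd by (intro set_pmf_of_set) auto
  ultimately show ?case using rnd.prems by (auto simp del: fun_upd_apply)
next
  case (loop c m M t1 a b N t2 t)
  from loop.prems obtain m1 where m1: "m1 \<in> set_pmf M" "m' \<in> set_pmf (N m1)" by auto
  have b: "mem_bounded B m1" by (rule loop.IH(1)[OF loop.prems(1) m1(1)])
  show ?case
  proof (cases "m1 a < m1 b")
    case True
    show ?thesis by (rule loop.IH(2)[OF m1(1) True b m1(2)])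
  next
    case False
    then have "N m1 = return_pmf m1" by (intro loop.hyps(3)[OF m1(1)]) simp
    then show ?thesis using m1(2) b by simp
  qed
next
  case (seq c1 m M t1 c2 N t2 t)
  from seq.prems obtain m1 where m1: "m1 \<in> set_pmf M" "m' \<in> set_pmf (N m1)" by auto
  show ?case by (rule seq.IH(2)[OF m1(1) seq.IH(1)[OF seq.prems(1) m1(1)] m1(2)])
next
  case (skip m a b t c)
  then show ?case by simp
next
  case (enter m b a c M t)
  then show ?case by blast
qed

inductive_cases sem_BlkE: "sem B (Blk is) m M t"
inductive_cases sem_RndE: "sem B (Rnd d a) m M t"
inductive_cases sem_UnlessE: "sem B (Unless a b c) m M t"
inductive_cases sem_SeqE: "sem B (c1 ;; c2) m M t"
inductive_cases sem_DoWhileE: "sem B (DoWhile c a b) m M t"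

text \<open>Determinism is what lets \<open>achieves_seq\<close> and \<open>achieves_dowhile\<close>
  choose one continuation per memory: the laws promised for different ghost values with the same
  memory must coincide.\<close>

lemma sem_unique: "sem B c m M t \<Longrightarrow> sem B c m M' t' \<Longrightarrow> M = M'"
proof (induction arbitrary: M' t' rule: sem.induct)
  case (blk "is" m t)
  from blk.prems show ?case by (rule sem_BlkE) simp
next
  case (rnd m a t d)
  from rnd.prems show ?case by (rule sem_RndE) simp
next
  case (skip m a b t c)
  from skip.prems show ?case by (rule sem_UnlessE) (use skip.hyps in simp_all)
next
  case (enter m b a c M t)
  from enter.prems show ?case
  proof (rule sem_UnlessE)
    fix t'' assume "sem B c m M' t''"
    then show ?thesis by (rule enter.IH)
  qed (use enter.hyps in simp)
next
  case (seq c1 m M t1 c2 N t2 t)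
  from seq.prems show ?case
  proof (rule sem_SeqE)
    fix M2 t3 N2 t4
    assume 2: "M' = bind_pmf M2 N2" "sem B c1 m M2 t3"
      "\<And>m'. m' \<in> set_pmf M2 \<Longrightarrow> sem B c2 m' (N2 m') t4"
    have M: "M = M2" by (rule seq.IH(1)[OF 2(2)])
    have "N m' = N2 m'" if m': "m' \<in> set_pmf M" for m'
      by (rule seq.IH(2)[OF m' 2(3)[OF m'[unfolded M]]])
    then show ?thesis unfolding 2(1) M[symmetric] by (intro bind_pmf_cong) simp_all
  qed
next
  case (loop c m M t1 a b N t2 t)
  from loop.prems show ?case
  proof (rule sem_DoWhileE)
    fix M2 t3 N2 t4
    assume 2: "M' = bind_pmf M2 N2" "sem B c m M2 t3"
      "\<And>m'. m' \<in> set_pmf M2 \<Longrightarrow> m' a < m' b \<Longrightarrow> sem B (DoWhile c a b) m' (N2 m') t4"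
      "\<And>m'. m' \<in> set_pmf M2 \<Longrightarrow> m' b \<le> m' a \<Longrightarrow> N2 m' = return_pmf m'"
    have M: "M = M2" by (rule loop.IH(1)[OF 2(2)])
    have "N m' = N2 m'" if m': "m' \<in> set_pmf M" for m'
    proof (cases "m' a < m' b")
      case True
      show ?thesis by (rule loop.IH(2)[OF m' True 2(3)[OF m'[unfolded M] True]])
    next
      case False
      then have *: "m' b \<le> m' a" by simp
      show ?thesis unfolding loop.hyps(3)[OF m' *] 2(4)[OF m'[unfolded M] *] by (rule refl)
    qed
    then show ?thesis unfolding 2(1) M[symmetric] by (intro bind_pmf_cong) simp_all
  qed
qed

text \<open>This lets a continuation be supplied only for those ghost values that can occur.\<close>

lemma rel_pmf_set:
  assumes "rel_pmf R p q"
  shows "rel_pmf (\<lambda>x y. x \<in> set_pmf p \<and> R x y) p q"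
proof -
  obtain pq where pq: "\<And>x y. (x, y) \<in> set_pmf pq \<Longrightarrow> R x y" "map_pmf fst pq = p" "map_pmf snd pq = q"
    using assms by (auto elim: rel_pmf.cases)
  show ?thesis
  proof (rule rel_pmf.intros[of pq])
    fix x y assume xy: "(x, y) \<in> set_pmf pq"
    then have "fst (x, y) \<in> fst ` set_pmf pq" by (rule imageI)
    then show "x \<in> set_pmf p \<and> R x y" using pq(1)[OF xy] by (simp flip: pq(2))
  qed (use pq in simp_all)
qed

section \<open>Compiled code follows the structured semantics\<close>

lemma step_at: "length pre = l \<Longrightarrow> step (pre @ i # post) (l, m) = exec i (l, m)"
  by (auto simp: step_def halted_def)

lemma reaches_return_step:
  assumes "step P s = return_pmf s1" "mem_bounded B (snd s)" "reaches P B s1 M t"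
  shows "reaches P B s M (Suc t)"
proof -
  have "reaches P B s (bind_pmf (step P s) (\<lambda>_. M)) (Suc t)"
    by (rule reaches.step) (use assms in simp_all)
  then show ?thesis by (simp add: assms bind_return_pmf)
qed

lemma reaches_blk:
  "all_small B is m \<Longrightarrow> mem_bounded B m \<Longrightarrow> length pre = l \<Longrightarrow>
    reaches (pre @ is @ post) B (l, m) (return_pmf (l + length is, exec_all is m)) (length is)"
proof (induction "is" arbitrary: m l pre)
  case (Cons i "is")
  let ?m = "m(dest i m := val i m)"
  let ?P = "pre @ i # is @ post"
  have st: "step ?P (l, m) = return_pmf (Suc l, ?m)"
    using Cons step_at[of pre l i "is @ post" m] by (simp add: exec_no_jump)
  have "reaches ((pre @ [i]) @ is @ post) B (Suc l, ?m)
      (return_pmf (Suc l + length is, exec_all is ?m)) (length is)"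
    by (rule Cons.IH) (use Cons.prems in \<open>simp_all add: bounded_val del: fun_upd_apply\<close>)
  then have "reaches ?P B (l, m) (bind_pmf (step ?P (l, m))
     (\<lambda>_. return_pmf (Suc l + length is, exec_all is ?m))) (Suc (length is))"
    using Cons.prems by (intro reaches.step) (auto simp: st)
  then show ?case by (simp add: st bind_return_pmf)
qed (auto intro: reaches.stop)

text \<open>Jump targets are absolute, hence a compiled command is correct only at its own position
  \<open>l\<close>. Embedding it between arbitrary \<open>pre\<close> and \<open>post\<close> is
  what carries the induction through sequences and loops.\<close>

theorem sem_reaches:
  "sem B c m M t \<Longrightarrow> mem_bounded B m \<Longrightarrow> length pre = l \<Longrightarrow>
    reaches (pre @ compile l c @ post) B (l, m) (map_pmf (Pair (l + len c)) M) t"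
proof (induction arbitrary: l pre post rule: sem.induct)
  case (blk "is" m t)
  then show ?case by (auto intro: reaches_mono[OF reaches_blk])
next
  case (rnd m a t d)
  let ?P = "pre @ Rand d a # post"
  have st: "step ?P (l, m) = map_pmf (\<lambda>x. (Suc l, m(d := x))) (pmf_of_set {..<m a})"
    using rnd step_at[of pre l "Rand d a" post m] by simp
  have "sem B (Rnd d a) m (map_pmf (\<lambda>x. m(d := x)) (pmf_of_set {..<m a})) t"
    using rnd by (intro sem.rnd)
  then have "\<And>s'. s' \<in> set_pmf (step ?P (l, m)) \<Longrightarrow> mem_bounded B (snd s')"
    using rnd(3) by (auto simp: st simp del: fun_upd_apply intro: sem_bounded)
  then have "reaches ?P B (l, m) (bind_pmf (step ?P (l, m)) return_pmf) (Suc 0)"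
    using rnd by (intro reaches.step) (auto intro: reaches.stop)
  then have "reaches ?P B (l, m) (step ?P (l, m)) t"
    using rnd by (simp add: bind_return_pmf' reaches_mono)
  then show ?case by (simp add: st map_pmf_comp)
next
  case (seq c1 m M t1 c2 N t2 t)
  let ?P = "pre @ compile l (c1 ;; c2) @ post"
  have 1: "reaches ?P B (l, m) (map_pmf (Pair (l + len c1)) M) t1"
    using seq.IH(1)[of pre l "compile (l + len c1) c2 @ post"] seq by simp
  have 2: "reaches ?P B (l + len c1, m') (map_pmf (Pair (l + len (c1 ;; c2))) (N m')) t2"
    if "m' \<in> set_pmf M" for m'
    using seq.IH(2)[OF that, of "pre @ compile l c1" "l + len c1" post]
      sem_bounded[OF seq.hyps(1)] that seq.prems by (simp add: add.assoc)
  have "reaches ?P B (l, m) (bind_pmf (map_pmf (Pair (l + len c1)) M)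
     (\<lambda>s. map_pmf (Pair (l + len (c1 ;; c2))) (N (snd s)))) (t1 + t2)"
    by (rule reaches_bind[OF 1]) (use 2 in auto)
  then have "reaches ?P B (l, m) (bind_pmf (map_pmf (Pair (l + len c1)) M)
     (\<lambda>s. map_pmf (Pair (l + len (c1 ;; c2))) (N (snd s)))) t"
    using seq.hyps(3) by (rule reaches_mono)
  then show ?case by (simp add: bind_map_pmf map_bind_pmf)
next
  case (skip m a b t c)
  let ?P = "pre @ compile l (Unless a b c) @ post"
  have st: "step ?P (l, m) = return_pmf (l + Suc (len c), m)"
    using skip step_at[of pre l _ "compile (Suc l) c @ post" m] by simp
  have "reaches ?P B (l, m) (return_pmf (l + Suc (len c), m)) (Suc 0)"
    by (rule reaches_return_step[OF st]) (use skip in \<open>auto intro: reaches.stop\<close>)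
  then have "reaches ?P B (l, m) (return_pmf (l + Suc (len c), m)) t"
    using skip by (simp add: reaches_mono)
  then show ?case by simp
next
  case (enter m b a c M t)
  let ?P = "pre @ compile l (Unless a b c) @ post"
  have st: "step ?P (l, m) = return_pmf (Suc l, m)"
    using enter step_at[of pre l _ "compile (Suc l) c @ post" m] by simp
  have "reaches ?P B (Suc l, m) (map_pmf (Pair (l + len (Unless a b c))) M) t"
    using enter.IH[of "pre @ [Jump_Less a b (l + Suc (len c))]" "Suc l" post] enter.prems by simp
  then show ?case
    by (rule reaches_return_step[OF st, rotated]) (use enter in simp)
next
  case (loop c m M t1 a b N t2 t)
  let ?P = "pre @ compile l (DoWhile c a b) @ post" and ?e = "l + len (DoWhile c a b)"
  have 1: "reaches ?P B (l, m) (map_pmf (Pair (l + len c)) M) t1"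
    using loop.IH(1)[of pre l "Jump_Less a b l # post"] loop.prems by simp
  have 2: "reaches ?P B (l + len c, m') (map_pmf (Pair ?e) (N m')) (Suc t2)"
    if m': "m' \<in> set_pmf M" for m'
  proof -
    have b: "mem_bounded B m'" using sem_bounded[OF loop.hyps(1)] m' loop.prems by simp
    have st: "step ?P (l + len c, m') = return_pmf (if m' a < m' b then l else Suc (l + len c), m')"
      using step_at[of "pre @ compile l c" "l + len c" "Jump_Less a b l" post m'] loop.prems by simp
    show ?thesis
    proof (rule reaches_return_step[OF st])
      show "reaches ?P B (if m' a < m' b then l else Suc (l + len c), m') (map_pmf (Pair ?e) (N m')) t2"
      proof (cases "m' a < m' b")
        case True
        then show ?thesis using loop.IH(2)[OF m' True b loop.prems(2)] by simp
      next
        case False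
        then show ?thesis using loop.hyps(3)[OF m'] b by (auto intro: reaches.stop)
      qed
    qed (use b in simp)
  qed
  have "reaches ?P B (l, m) (bind_pmf (map_pmf (Pair (l + len c)) M)
     (\<lambda>s. map_pmf (Pair ?e) (N (snd s)))) (t1 + Suc t2)"
    by (rule reaches_bind[OF 1]) (use 2 in auto)
  then have "reaches ?P B (l, m) (bind_pmf (map_pmf (Pair (l + len c)) M)
     (\<lambda>s. map_pmf (Pair ?e) (N (snd s)))) t"
    by (rule reaches_mono) (use loop.hyps in simp)
  then show ?case by (simp add: bind_map_pmf map_bind_pmf)
qed

corollary sem_run:
  assumes "sem B c (snd (initial_state xs)) M t" "mem_bounded B (snd (initial_state xs))"
  shows "run (compile 0 c) xs t = map_pmf (Pair (len c)) M"
    and "halts_within (compile 0 c) xs t" and "words_bounded (compile 0 c) xs B"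
proof -
  have r: "reaches (compile 0 c) B (initial_state xs) (map_pmf (Pair (len c)) M) t"
    using sem_reaches[OF assms, of "[]" 0 "[]"] by (simp add: initial_state_def)
  have h: "halted (compile 0 c) s" if "s \<in> set_pmf (map_pmf (Pair (len c)) M)" for s
    using that by (auto simp: halted_def)
  show run: "run (compile 0 c) xs t = map_pmf (Pair (len c)) M"
    unfolding run_eq_steps by (rule reaches_steps[OF r h])
  show "halts_within (compile 0 c) xs t"
    by (auto simp: halts_within_def run halted_def)
  show "words_bounded (compile 0 c) xs B"
    using reaches_bounded[OF r h] by (simp add: words_bounded_def run_eq_steps mem_bounded_def)
qed

text \<open>
  \<open>achieves B c m t D J\<close>: started from \<open>m\<close>, the command \<open>c\<close> produces within time \<open>t\<close> a random memory that
  is coupled by \<open>J\<close> with a random ghost value of law \<open>D\<close>.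
\<close>

definition achieves :: "nat \<Rightarrow> com \<Rightarrow> memory \<Rightarrow> nat \<Rightarrow> 'b pmf \<Rightarrow> ('b \<Rightarrow> memory \<Rightarrow> bool) \<Rightarrow> bool" where
  "achieves B c m t D J \<longleftrightarrow> (\<exists>M. sem B c m M t \<and> rel_pmf J D M)"

definition ensures :: "nat \<Rightarrow> com \<Rightarrow> memory \<Rightarrow> nat \<Rightarrow> (memory \<Rightarrow> bool) \<Rightarrow> bool" where
  "ensures B c m t Q \<longleftrightarrow> (\<exists>m'. sem B c m (return_pmf m') t \<and> Q m')"

lemma achieves_seq:
  assumes "achieves B c1 m t1 D J" "\<And>d m'. d \<in> set_pmf D \<Longrightarrow> J d m' \<Longrightarrow> achieves B c2 m' t2 (F d) J'"
    and "t1 + t2 \<le> t"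
  shows "achieves B (c1 ;; c2) m t (bind_pmf D F) J'"
proof -
  obtain M where M: "sem B c1 m M t1" "rel_pmf J D M" using assms by (auto simp: achieves_def)
  \<comment> \<open>The continuation may depend on the memory only, whereas the hypothesis supplies
    one for each ghost value \<open>d\<close>. By \<open>sem_unique\<close> any choice agrees with
    all of them.\<close>
  define N where "N m' = (SOME N. sem B c2 m' N t2)" for m'
  have N: "sem B c2 m' (N m') t2 \<and> rel_pmf J' (F d) (N m')" if "d \<in> set_pmf D" "J d m'" for d m'
  proof -
    have "achieves B c2 m' t2 (F d) J'" by (rule assms(2)) (use that in auto)
    then obtain N' where N': "sem B c2 m' N' t2" "rel_pmf J' (F d) N'"
      by (auto simp: achieves_def)
    then have "N m' = N'" unfolding N_def by (blast intro: sem_unique)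
    with N' show ?thesis by simp
  qed
  have "sem B (c1 ;; c2) m (bind_pmf M N) t"
  proof (rule sem.seq[OF M(1) _ assms(3)])
    fix m' assume "m' \<in> set_pmf M"
    then obtain d where "d \<in> set_pmf D" "J d m'"
      using rel_pmf_imp_rel_set[OF M(2)] by (auto simp: rel_set_def)
    then show "sem B c2 m' (N m') t2" using N by blast
  qed
  moreover have "rel_pmf J' (bind_pmf D F) (bind_pmf M N)"
    by (rule rel_pmf_bindI[OF rel_pmf_set[OF M(2)]]) (use N in auto)
  ultimately show ?thesis by (auto simp: achieves_def)
qed

lemma ensures_blk:
  "all_small B is m \<Longrightarrow> length is \<le> t \<Longrightarrow> Q (exec_all is m) \<Longrightarrow> ensures B (Blk is) m t Q"
  by (auto simp: ensures_def intro: sem.blk)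

lemma ensures_seq:
  assumes "ensures B c1 m t1 Q1" "\<And>m'. Q1 m' \<Longrightarrow> ensures B c2 m' t2 Q" "t1 + t2 \<le> t"
  shows "ensures B (c1 ;; c2) m t Q"
proof -
  obtain m1 where 1: "sem B c1 m (return_pmf m1) t1" "Q1 m1" using assms(1) by (auto simp: ensures_def)
  obtain m2 where 2: "sem B c2 m1 (return_pmf m2) t2" "Q m2"
    using assms(2)[OF 1(2)] by (auto simp: ensures_def)
  have "sem B (c1 ;; c2) m (bind_pmf (return_pmf m1) (\<lambda>_. return_pmf m2)) t"
    by (rule sem.seq[OF 1(1) _ assms(3)]) (use 2 in simp)
  with 2(2) show ?thesis by (auto simp: ensures_def bind_return_pmf)
qed

lemma ensures_unless:
  assumes "m a < m b \<Longrightarrow> Q m" "m b \<le> m a \<Longrightarrow> ensures B c m t' Q" "Suc t' \<le> t"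
  shows "ensures B (Unless a b c) m t Q"
proof (cases "m a < m b")
  case True
  have "sem B (Unless a b c) m (return_pmf m) t" by (rule sem.skip) (use True assms in simp_all)
  then show ?thesis using assms(1)[OF True] by (auto simp: ensures_def)
next
  case False
  then obtain m' where m': "sem B c m (return_pmf m') t'" "Q m'"
    using assms(2) by (auto simp: ensures_def)
  have "sem B (Unless a b c) m (return_pmf m') (Suc t')" by (rule sem.enter) (use False m' in simp_all)
  then show ?thesis using m' assms(3) by (auto simp: ensures_def intro: sem_mono)
qed

lemma ensures_mono:
  assumes "ensures B c m t Q" "\<And>m'. Q m' \<Longrightarrow> Q' m'" "t \<le> t'"
  shows "ensures B c m t' Q'"
  using assms by (auto simp: ensures_def intro: sem_mono)

lemma ensures_dowhile:
  assumes "ensures B c m t1 Q1"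
    and "\<And>m'. Q1 m' \<Longrightarrow> m' a < m' b \<Longrightarrow> ensures B (DoWhile c a b) m' t2 Q"
    and "\<And>m'. Q1 m' \<Longrightarrow> m' b \<le> m' a \<Longrightarrow> Q m'" and "Suc t1 + t2 \<le> t"
  shows "ensures B (DoWhile c a b) m t Q"
proof -
  obtain m1 where 1: "sem B c m (return_pmf m1) t1" "Q1 m1" using assms(1) by (auto simp: ensures_def)
  obtain m2 where 2: "m1 a < m1 b \<Longrightarrow> sem B (DoWhile c a b) m1 (return_pmf m2) t2"
    "m1 b \<le> m1 a \<Longrightarrow> m2 = m1" "Q m2"
    using assms(2)[OF 1(2)] assms(3)[OF 1(2)]
    by (cases "m1 a < m1 b") (auto simp: ensures_def)
  have "sem B (DoWhile c a b) m (bind_pmf (return_pmf m1) (\<lambda>_. return_pmf m2)) t"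
    by (rule sem.loop[OF 1(1) _ _ assms(4)]) (use 2 in simp_all)
  with 2(3) show ?thesis by (auto simp: ensures_def bind_return_pmf)
qed

text \<open>The test after round \<open>i\<close> has to agree with \<open>Suc i < N\<close>, so the
  invariant fixes the number of rounds. \<open>0 < N\<close> is forced by the body running before
  the test.\<close>

lemma ensures_loop:
  assumes "\<And>i m. i < N \<Longrightarrow> I i m \<Longrightarrow> ensures B c m t (\<lambda>m'. I (Suc i) m' \<and> (m' a < m' b \<longleftrightarrow> Suc i < N))"
    and "I 0 m" "0 < N" "N * Suc t \<le> T"
  shows "ensures B (DoWhile c a b) m T (I N)"
proof -
  \<comment> \<open>The loop unfolds at its front, so the induction is on the number
    \<open>k\<close> of rounds left.\<close>
  have "ensures B (DoWhile c a b) m' (k * Suc t) (I N)" if "I (N - k) m'" "0 < k" "k \<le> N" for k m'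
    using that
  proof (induction k arbitrary: m')
    case (Suc k)
    have s: "Suc (N - Suc k) = N - k" using Suc.prems by simp
    show ?case
    proof (rule ensures_dowhile[OF assms(1)[OF _ Suc.prems(1)]])
      show "N - Suc k < N" using Suc.prems by simp
    next
      fix m'' assume "I (Suc (N - Suc k)) m'' \<and> (m'' a < m'' b \<longleftrightarrow> Suc (N - Suc k) < N)" "m'' a < m'' b"
      then show "ensures B (DoWhile c a b) m'' (k * Suc t) (I N)"
        using Suc.prems unfolding s by (intro Suc.IH) auto
    next
      fix m'' assume *: "I (Suc (N - Suc k)) m'' \<and> (m'' a < m'' b \<longleftrightarrow> Suc (N - Suc k) < N)" "m'' b \<le> m'' a"
      then have "k = 0" using Suc.prems unfolding s by auto
      with * show "I N m''" unfolding s by simp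
    qed simp
  qed simp
  from this[of N m] assms(2,3) have "ensures B (DoWhile c a b) m (N * Suc t) (I N)" by simp
  then show ?thesis by (rule ensures_mono[OF _ _ assms(4)])
qed

lemma achieves_ensures:
  "ensures B c m t (J d) \<Longrightarrow> achieves B c m t (return_pmf d) J"
  by (auto simp: ensures_def achieves_def rel_pmf_return_pmf1)

lemma achieves_rnd:
  assumes "0 < m a" "0 < t" "\<And>x. x < m a \<Longrightarrow> J x (m(d := x))"
  shows "achieves B (Rnd d a) m t (pmf_of_set {..<m a}) J"
proof -
  have "sem B (Rnd d a) m (map_pmf (\<lambda>x. m(d := x)) (pmf_of_set {..<m a})) t"
    using assms by (intro sem.rnd)
  moreover have "set_pmf (pmf_of_set {..<m a}) = {..<m a}"
    using assms(1) by (intro set_pmf_of_set) auto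
  then have "rel_pmf J (pmf_of_set {..<m a}) (map_pmf (\<lambda>x. m(d := x)) (pmf_of_set {..<m a}))"
    using assms(3) by (subst pmf.rel_map) (auto intro!: rel_pmf_reflI simp del: fun_upd_apply)
  ultimately show ?thesis by (auto simp: achieves_def)
qed

lemma achieves_map:
  assumes "achieves B c m t D J" "D' = map_pmf g D" "\<And>d m'. d \<in> set_pmf D \<Longrightarrow> J d m' \<Longrightarrow> J' (g d) m'" "t \<le> t'"
  shows "achieves B c m t' D' J'"
proof -
  obtain M where M: "sem B c m M t" "rel_pmf J D M" using assms(1) by (auto simp: achieves_def)
  have "rel_pmf J' D' M"
    unfolding assms(2) pmf.rel_map by (rule pmf.rel_mono_strong[OF M(2)]) (use assms(3) in simp)
  then show ?thesis using sem_mono[OF M(1) assms(4)] by (auto simp: achieves_def)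
qed

lemma achieves_unless:
  assumes "m a < m b \<Longrightarrow> \<exists>d. D = return_pmf d \<and> J d m" "m b \<le> m a \<Longrightarrow> achieves B c m t' D J" "Suc t' \<le> t"
  shows "achieves B (Unless a b c) m t D J"
proof (cases "m a < m b")
  case True
  have "sem B (Unless a b c) m (return_pmf m) t" by (rule sem.skip) (use True assms in simp_all)
  then show ?thesis using assms(1)[OF True] by (auto simp: achieves_def rel_pmf_return_pmf1)
next
  case False
  then obtain M where M: "sem B c m M t'" "rel_pmf J D M"
    using assms(2) by (auto simp: achieves_def)
  have "sem B (Unless a b c) m M (Suc t')" by (rule sem.enter) (use False M in simp_all)
  then show ?thesis using M assms(3) by (auto simp: achieves_def intro: sem_mono)
qed

lemma achieves_dowhile:
  assumes "achieves B c m t1 D J"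
    and "\<And>d m'. d \<in> set_pmf D \<Longrightarrow> J d m' \<Longrightarrow> m' a < m' b \<Longrightarrow> achieves B (DoWhile c a b) m' t2 (F d) J'"
    and "\<And>d m'. d \<in> set_pmf D \<Longrightarrow> J d m' \<Longrightarrow> m' b \<le> m' a \<Longrightarrow> \<exists>e. F d = return_pmf e \<and> J' e m'"
    and "Suc t1 + t2 \<le> t"
  shows "achieves B (DoWhile c a b) m t (bind_pmf D F) J'"
proof -
  obtain M where M: "sem B c m M t1" "rel_pmf J D M" using assms by (auto simp: achieves_def)
  define N where "N m' = (if m' a < m' b then SOME N. sem B (DoWhile c a b) m' N t2 else return_pmf m')" for m'
  have N: "(m' a < m' b \<longrightarrow> sem B (DoWhile c a b) m' (N m') t2) \<and> rel_pmf J' (F d) (N m')"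
    if "d \<in> set_pmf D" "J d m'" for d m'
  proof (cases "m' a < m' b")
    case True
    have "achieves B (DoWhile c a b) m' t2 (F d) J'" by (rule assms(2)) (use that True in auto)
    then obtain N' where N': "sem B (DoWhile c a b) m' N' t2" "rel_pmf J' (F d) N'"
      by (auto simp: achieves_def)
    then have "N m' = N'" using True unfolding N_def by (auto intro: sem_unique)
    with N' show ?thesis by simp
  next
    case False
    then show ?thesis using assms(3)[OF that] by (auto simp: N_def rel_pmf_return_pmf1)
  qed
  have "sem B (DoWhile c a b) m (bind_pmf M N) t"
  proof (rule sem.loop[OF M(1) _ _ assms(4)])
    fix m' assume "m' \<in> set_pmf M" "m' a < m' b"
    moreover from this(1) obtain d where "d \<in> set_pmf D" "J d m'"
      using rel_pmf_imp_rel_set[OF M(2)] by (auto simp: rel_set_def)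
    ultimately show "sem B (DoWhile c a b) m' (N m') t2" using N by blast
  qed (simp add: N_def)
  moreover have "rel_pmf J' (bind_pmf D F) (bind_pmf M N)"
    by (rule rel_pmf_bindI[OF rel_pmf_set[OF M(2)]]) (use N in blast)
  ultimately show ?thesis by (auto simp: achieves_def)
qed

section \<open>Loops that iterate a random kernel\<close>

fun iter :: "('a \<Rightarrow> 'a pmf) \<Rightarrow> nat \<Rightarrow> 'a \<Rightarrow> 'a pmf" where
  "iter K 0 x = return_pmf x"
| "iter K (Suc t) x = bind_pmf (K x) (iter K t)"

lemma achieves_iter:
  assumes "\<And>i x m. i < N \<Longrightarrow> I i x m \<Longrightarrow>
      achieves B c m t (K x) (\<lambda>x' m'. I (Suc i) x' m' \<and> (m' a < m' b \<longleftrightarrow> Suc i < N))"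
    and "I 0 x m" "0 < N" "N * Suc t \<le> T"
  shows "achieves B (DoWhile c a b) m T (iter K N x) (I N)"
proof -
  have "achieves B (DoWhile c a b) m' (k * Suc t) (iter K k x') (I N)"
    if "I (N - k) x' m'" "0 < k" "k \<le> N" for k x' m'
    using that
  proof (induction k arbitrary: m' x')
    case (Suc k)
    have s: "Suc (N - Suc k) = N - k" using Suc.prems by simp
    show ?case unfolding iter.simps
    proof (rule achieves_dowhile[OF assms(1)[OF _ Suc.prems(1)]])
      show "N - Suc k < N" using Suc.prems by simp
    next
      fix x'' m'' assume "I (Suc (N - Suc k)) x'' m'' \<and> (m'' a < m'' b \<longleftrightarrow> Suc (N - Suc k) < N)" "m'' a < m'' b"
      then show "achieves B (DoWhile c a b) m'' (k * Suc t) (iter K k x'') (I N)"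
        using Suc.prems unfolding s by (intro Suc.IH) auto
    next
      fix x'' m'' assume *: "I (Suc (N - Suc k)) x'' m'' \<and> (m'' a < m'' b \<longleftrightarrow> Suc (N - Suc k) < N)" "m'' b \<le> m'' a"
      then have "k = 0" using Suc.prems unfolding s by auto
      with * show "\<exists>e. iter K k x'' = return_pmf e \<and> I N e m''" unfolding s by simp
    qed simp
  qed simp
  from this[of N x m] assms(2,3) have "achieves B (DoWhile c a b) m (N * Suc t) (iter K N x) (I N)" by simp
  then show ?thesis by (rule achieves_map[OF _ _ _ assms(4), where g = "\<lambda>x. x"]) simp_all
qed

text \<open>A trial continues from the state that the previous one reached. When all trials fail,
  the last state is returned, so the result is always a colouring and never a missing value.\<close>

fun search :: "('a \<Rightarrow> 'a pmf) \<Rightarrow> ('a \<Rightarrow> bool) \<Rightarrow> nat \<Rightarrow> 'a \<Rightarrow> 'a pmf" where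
  "search K ok 0 x = return_pmf x"
| "search K ok (Suc t) x = bind_pmf (K x) (\<lambda>y. if ok y then return_pmf y else search K ok t y)"

text \<open>The loop has no exit but its counter test. An early success is signalled by raising the
  counter, hence the clause \<open>m' b \<le> m' a\<close>.\<close>

lemma achieves_search:
  assumes "\<And>i x m. i < N \<Longrightarrow> I i x m \<Longrightarrow>
      achieves B c m t (K x) (\<lambda>x' m'. if ok x' then J x' m' \<and> m' b \<le> m' a
        else I (Suc i) x' m' \<and> (m' a < m' b \<longleftrightarrow> Suc i < N))"
    and "\<And>x m. I N x m \<Longrightarrow> J x m"
    and "I 0 x m" "0 < N" "N * Suc t \<le> T"
  shows "achieves B (DoWhile c a b) m T (search K ok N x) J"
proof -
  have "achieves B (DoWhile c a b) m' (k * Suc t) (search K ok k x') J"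
    if "I (N - k) x' m'" "0 < k" "k \<le> N" for k x' m'
    using that
  proof (induction k arbitrary: m' x')
    case (Suc k)
    have s: "Suc (N - Suc k) = N - k" using Suc.prems by simp
    let ?Q = "\<lambda>x' m'. if ok x' then J x' m' \<and> m' b \<le> m' a
        else I (N - k) x' m' \<and> (m' a < m' b \<longleftrightarrow> N - k < N)"
    have body: "achieves B c m' t (K x') ?Q"
      using assms(1)[OF _ Suc.prems(1)] Suc.prems unfolding s by simp
    show ?case unfolding search.simps
    proof (rule achieves_dowhile[OF body])
      fix x'' m'' assume *: "?Q x'' m''" "m'' a < m'' b"
      then have "\<not> ok x''" by auto
      with * have "I (N - k) x'' m''" "0 < k" by auto
      then have "achieves B (DoWhile c a b) m'' (k * Suc t) (search K ok k x'') J"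
        using Suc.prems by (intro Suc.IH) auto
      with \<open>\<not> ok x''\<close> show "achieves B (DoWhile c a b) m'' (k * Suc t)
          (if ok x'' then return_pmf x'' else search K ok k x'') J" by simp
    next
      fix x'' m'' assume *: "?Q x'' m''" "m'' b \<le> m'' a"
      show "\<exists>e. (if ok x'' then return_pmf x'' else search K ok k x'') = return_pmf e \<and> J e m''"
      proof (cases "ok x''")
        case False
        with * have "I (N - k) x'' m''" "\<not> (N - k < N)" by auto
        then have "k = 0" using Suc.prems by auto
        with \<open>I (N - k) x'' m''\<close> False show ?thesis using assms(2) by auto
      qed (use * in auto)
    qed simp
  qed simp
  from this[of N x m] assms(3,4) have "achieves B (DoWhile c a b) m (N * Suc t) (search K ok N x) J" by simp
  then show ?thesis by (rule achieves_map[OF _ _ _ assms(5), where g = "\<lambda>x. x"]) simp_all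
qed

section \<open>Averages over lists of allowed colours\<close>

text \<open>Let \<open>L'\<close> be the heavier set. The deviations from the mean over
  \<open>L\<close> cancel on \<open>L\<close>, so the deviations over \<open>L'\<close> sum to those
  of the added elements minus those of the removed ones. As the removed weight is at most the added
  weight, the two together cost only the added weight times \<open>G\<close>, and not the sum of
  both weights.\<close>

lemma weighted_mean_diff:
  fixes w g :: "'a \<Rightarrow> real"
  assumes fin: "finite L" "finite L'" and w: "\<And>x. x \<in> L \<union> L' \<Longrightarrow> 0 \<le> w x"
    and pos: "0 < sum w L" "0 < sum w L'"
    and osc: "\<And>x y. x \<in> L \<union> L' \<Longrightarrow> y \<in> L \<union> L' \<Longrightarrow> g x - g y \<le> G"
    and th: "sum w (L' - L) \<le> \<theta> * sum w L'" "sum w (L - L') \<le> \<theta> * sum w L"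
  shows "\<bar>(\<Sum>x\<in>L. w x * g x) / sum w L - (\<Sum>x\<in>L'. w x * g x) / sum w L'\<bar> \<le> \<theta> * G"
proof -
  have main: "\<bar>(\<Sum>x\<in>L. w x * g x) / sum w L - (\<Sum>x\<in>L'. w x * g x) / sum w L'\<bar> \<le> \<theta> * G"
    if fin: "finite L" "finite L'" and w: "\<And>x. x \<in> L \<union> L' \<Longrightarrow> 0 \<le> w x"
    and pos: "0 < sum w L" "0 < sum w L'"
    and osc: "\<And>x y. x \<in> L \<union> L' \<Longrightarrow> y \<in> L \<union> L' \<Longrightarrow> g x - g y \<le> G"
    and th: "sum w (L' - L) \<le> \<theta> * sum w L'" and le: "sum w L \<le> sum w L'" for L L' :: "'a set"
  proof -
    define a where "a = (\<Sum>x\<in>L. w x * g x) / sum w L"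
    define lo where "lo = Min (g ` (L \<union> L'))"
    have ne: "L \<noteq> {}" using pos by auto
    have "lo \<in> g ` (L \<union> L')" unfolding lo_def using fin ne by (intro Min_in) auto
    then obtain z where z: "z \<in> L \<union> L'" "lo = g z" by auto
    have lo: "lo \<le> g x" "g x \<le> lo + G" if "x \<in> L \<union> L'" for x
      using fin that osc[OF that z(1)] z(2) by (auto simp: lo_def intro!: Min_le simp flip: z(2))
    have alo: "lo \<le> a" "a \<le> lo + G"
    proof -
      have "sum w L * lo \<le> (\<Sum>x\<in>L. w x * g x)" "(\<Sum>x\<in>L. w x * g x) \<le> sum w L * (lo + G)"
        unfolding sum_distrib_right using w lo by (intro sum_mono mult_left_mono; simp)+
      then show "lo \<le> a" "a \<le> lo + G" unfolding a_def using pos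
        by (simp_all add: pos_le_divide_eq pos_divide_le_eq mult.commute)
    qed
    have z0: "(\<Sum>x\<in>L. w x * (g x - a)) = 0"
    proof -
      have "(\<Sum>x\<in>L. w x * (g x - a)) = (\<Sum>x\<in>L. w x * g x) - sum w L * a"
        by (simp add: right_diff_distrib sum_subtractf sum_distrib_right)
      then show ?thesis using pos by (simp add: a_def)
    qed
    have "(\<Sum>x\<in>L. w x * (g x - a)) = (\<Sum>x\<in>L \<inter> L'. w x * (g x - a)) + (\<Sum>x\<in>L - L'. w x * (g x - a))"
      using fin by (subst sum.union_disjoint[symmetric]) (auto intro: sum.cong)
    moreover have "(\<Sum>x\<in>L'. w x * (g x - a)) = (\<Sum>x\<in>L \<inter> L'. w x * (g x - a)) + (\<Sum>x\<in>L' - L. w x * (g x - a))"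
      using fin by (subst sum.union_disjoint[symmetric]) (auto intro: sum.cong)
    ultimately have eq: "(\<Sum>x\<in>L'. w x * (g x - a)) = (\<Sum>x\<in>L' - L. w x * (g x - a)) - (\<Sum>x\<in>L - L'. w x * (g x - a))"
      using z0 by simp
    define A where "A = sum w (L' - L)"
    define D where "D = sum w (L - L')"
    have "sum w L = sum w (L \<inter> L') + D" "sum w L' = sum w (L \<inter> L') + A" unfolding A_def D_def
      using fin by (subst sum.union_disjoint[symmetric]; force intro: sum.cong)+
    then have DA: "D \<le> A" using le by simp
    have D0: "0 \<le> D" "0 \<le> A" unfolding D_def A_def using w by (auto intro: sum_nonneg)
    have 1: "A * (lo - a) \<le> (\<Sum>x\<in>L' - L. w x * (g x - a))" "(\<Sum>x\<in>L' - L. w x * (g x - a)) \<le> A * (lo + G - a)"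
      unfolding A_def sum_distrib_right using w lo by (intro sum_mono mult_left_mono; simp)+
    have 2: "D * (lo - a) \<le> (\<Sum>x\<in>L - L'. w x * (g x - a))" "(\<Sum>x\<in>L - L'. w x * (g x - a)) \<le> D * (lo + G - a)"
      unfolding D_def sum_distrib_right using w lo by (intro sum_mono mult_left_mono; simp)+
    \<comment> \<open>With \<open>D\<close> replaced by \<open>A\<close>, the one-sided ranges of
      the added and the removed terms complement each other: \<open>lo + G - a\<close> and
      \<open>a - lo\<close> add up to \<open>G\<close>.\<close>
    have 3: "D * (a - lo) \<le> A * (a - lo)" "D * (lo + G - a) \<le> A * (lo + G - a)"
      using DA alo by (auto intro: mult_right_mono)
    have "\<bar>\<Sum>x\<in>L'. w x * (g x - a)\<bar> \<le> A * G"
      unfolding eq using 1 2 3 by (simp add: algebra_simps abs_le_iff)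
    also have "\<dots> \<le> \<theta> * sum w L' * G"
      using th osc[OF z(1) z(1)] by (auto simp: A_def intro: mult_right_mono)
    finally have *: "\<bar>\<Sum>x\<in>L'. w x * (g x - a)\<bar> \<le> \<theta> * G * sum w L'" by (simp add: mult_ac)
    have "(\<Sum>x\<in>L'. w x * (g x - a)) = (\<Sum>x\<in>L'. w x * g x) - a * sum w L'"
      by (simp add: right_diff_distrib sum_subtractf sum_distrib_left mult.commute)
    then have "(\<Sum>x\<in>L'. w x * g x) / sum w L' - a = (\<Sum>x\<in>L'. w x * (g x - a)) / sum w L'"
      using pos by (simp add: field_simps)
    then have "\<bar>(\<Sum>x\<in>L'. w x * g x) / sum w L' - a\<bar> = \<bar>\<Sum>x\<in>L'. w x * (g x - a)\<bar> / sum w L'"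
      using pos by (simp add: abs_divide)
    also have "\<dots> \<le> \<theta> * G" using * pos by (simp add: divide_le_eq)
    finally show ?thesis unfolding a_def[symmetric] by (simp add: abs_minus_commute)
  qed
  show ?thesis
  proof (cases "sum w L \<le> sum w L'")
    case True
    show ?thesis by (rule main[OF fin w pos osc th(1) True])
  next
    case False
    have "\<bar>(\<Sum>x\<in>L'. w x * g x) / sum w L' - (\<Sum>x\<in>L. w x * g x) / sum w L\<bar> \<le> \<theta> * G"
      by (rule main[OF fin(2,1) _ pos(2,1) _ th(2)]) (use w osc False in auto)
    then show ?thesis by (simp add: abs_minus_commute)
  qed
qed

section \<open>Means over pairs of different colours\<close>

definition off_diag :: "'a set \<Rightarrow> 'a set \<Rightarrow> ('a \<times> 'a) set" where
  "off_diag L M = {(x, y). x \<in> L \<and> y \<in> M \<and> x \<noteq> y}"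

definition pair_mean :: "'a set \<Rightarrow> 'a set \<Rightarrow> ('a \<Rightarrow> 'a \<Rightarrow> real) \<Rightarrow> real" where
  "pair_mean L M h = (\<Sum>(x, y)\<in>off_diag L M. h x y) / real (card (off_diag L M))"

lemma off_diag_Sigma: "off_diag L M = (SIGMA x:L. M - {x})"
  by (auto simp: off_diag_def)

lemma finite_off_diag [simp]: "finite L \<Longrightarrow> finite M \<Longrightarrow> finite (off_diag L M)"
  by (simp add: off_diag_Sigma)

lemma pair_mean_swap: "pair_mean L M h = pair_mean M L (\<lambda>y x. h x y)"
proof -
  have b: "bij_betw prod.swap (off_diag L M) (off_diag M L)"
    by (rule bij_betw_byWitness[where f' = prod.swap]) (auto simp: off_diag_def)
  show ?thesis unfolding pair_mean_def using bij_betw_same_card[OF b]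
    by (simp add: sum.reindex_bij_betw[OF b, symmetric] case_prod_unfold)
qed

text \<open>The mean over pairs is a mean of \<open>g x\<close>, weighted by the number
  \<open>w x\<close> of partners of \<open>x\<close>. Two values of \<open>g\<close> differ by at
  most \<open>D\<close> for the change of \<open>x\<close> plus \<open>D / (l - 1)\<close> for the
  change of the partner list. One colour carries at most the share
  \<open>l / (l\<^sup>2 - l + 1)\<close> of the weight. The bound is the product of the two.\<close>

lemma pair_mean_list_change:
  fixes h :: "'a \<Rightarrow> 'a \<Rightarrow> real"
  assumes fin: "finite L" "finite L'" "finite M"
    and l: "2 \<le> l" "l \<le> card L" "l \<le> card L'" "l \<le> card M"
    and d: "card (L - L') \<le> 1" "card (L' - L) \<le> 1"
    and h1: "\<And>x x' y. x \<in> L \<union> L' \<Longrightarrow> x' \<in> L \<union> L' \<Longrightarrow> y \<in> M \<Longrightarrow> \<bar>h x y - h x' y\<bar> \<le> D"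
    and h2: "\<And>x y y'. x \<in> L \<union> L' \<Longrightarrow> y \<in> M \<Longrightarrow> y' \<in> M \<Longrightarrow> \<bar>h x y - h x y'\<bar> \<le> D"
  shows "\<bar>pair_mean L M h - pair_mean L' M h\<bar> \<le> D * (real l)\<^sup>2 / ((real l - 1) * ((real l)\<^sup>2 - real l + 1))"
proof -
  define w where "w x = real (card (M - {x}))" for x
  define g where "g x = (\<Sum>y\<in>M - {x}. h x y) / w x" for x
  have wb: "real (card M) - 1 \<le> w x" "w x \<le> real (card M)" for x
    using fin l by (auto simp: w_def card_Diff_singleton_if)
  have w1: "real l - 1 \<le> w x" "1 \<le> w x" for x using wb(1)[of x] l by linarith+
  have pm: "pair_mean K M h = (\<Sum>x\<in>K. w x * g x) / sum w K" if "finite K" for K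
  proof -
    have "(\<Sum>(x, y)\<in>off_diag K M. h x y) = (\<Sum>x\<in>K. \<Sum>y\<in>M - {x}. h x y)"
      unfolding off_diag_Sigma using that fin by (subst sum.Sigma) auto
    also have "\<dots> = (\<Sum>x\<in>K. w x * g x)"
    proof (intro sum.cong refl)
      fix x assume "x \<in> K"
      show "(\<Sum>y\<in>M - {x}. h x y) = w x * g x" using w1(2)[of x] by (simp add: g_def)
    qed
    finally show ?thesis
      using that fin by (simp add: pair_mean_def off_diag_Sigma w_def)
  qed
  have gd: "g x - g x' \<le> D * real l / (real l - 1)" if x: "x \<in> L \<union> L'" "x' \<in> L \<union> L'" for x x'
  proof -
    have "(\<Sum>y\<in>M - {x}. h x y) / w x - (\<Sum>y\<in>M - {x}. h x' y) / w x \<le> D"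
    proof -
      have "(\<Sum>y\<in>M - {x}. h x y - h x' y) \<le> (\<Sum>y\<in>M - {x}. D)"
        using h1[OF x] by (intro sum_mono) (auto simp: abs_le_iff)
      then show ?thesis using w1(2)[of x]
        by (simp add: sum_subtractf w_def diff_divide_distrib[symmetric] divide_le_eq mult.commute)
    qed
    moreover have "\<bar>(\<Sum>y\<in>M - {x}. 1 * h x' y) / sum (\<lambda>_. 1) (M - {x}) - (\<Sum>y\<in>M - {x'}. 1 * h x' y) / sum (\<lambda>_. 1) (M - {x'})\<bar>
        \<le> (1 / (real l - 1)) * D"
    proof (rule weighted_mean_diff)
      have s: "real (card (M - {a} - (M - {b}))) \<le> 1" for a b
      proof -
        have "card (M - {a} - (M - {b})) \<le> card {b}" by (rule card_mono) auto
        then show ?thesis by simp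
      qed
      have 1: "1 \<le> w x / (real l - 1)" for x using w1[of x] l by (simp add: le_divide_eq)
      have "1 \<le> real (card (M - {x})) / (real l - 1)" "1 \<le> real (card (M - {x'})) / (real l - 1)"
        using 1[of x] 1[of x'] by (simp_all add: w_def)
      with s[of x' x] s[of x x'] show "(\<Sum>_\<in>M - {x'} - (M - {x}). 1::real) \<le> 1 / (real l - 1) * (\<Sum>_\<in>M - {x'}. 1)"
        "(\<Sum>_\<in>M - {x} - (M - {x'}). 1::real) \<le> 1 / (real l - 1) * (\<Sum>_\<in>M - {x}. 1)"
        unfolding sum_constant by (simp_all only: mult_1_right times_divide_eq_left mult_1_left)
      show "0 < (\<Sum>_\<in>M - {x}. 1::real)" "0 < (\<Sum>_\<in>M - {x'}. 1::real)"
        using w1(2)[of x] w1(2)[of x'] by (simp_all add: w_def del: card_Diff_insert)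
    qed (use fin h2[OF x(2)] in \<open>auto simp: abs_le_iff\<close>)
    ultimately have "g x - g x' \<le> D + D / (real l - 1)"
      by (simp add: g_def w_def abs_le_iff)
    also have "\<dots> = D * real l / (real l - 1)" using l by (simp add: field_simps)
    finally show ?thesis .
  qed
  let ?\<theta> = "real l / ((real l)\<^sup>2 - real l + 1)"
  have lpos: "0 < (real l)\<^sup>2 - real l + 1"
    using l mult_right_mono[of 1 "real l" "real l"] unfolding power2_eq_square by linarith
  \<comment> \<open>The colour \<open>a\<close> has weight at most \<open>\<mu>\<close>, and at
    least \<open>l - 1\<close> others have weight at least \<open>\<mu> - 1\<close> each. The share
    of \<open>a\<close> is largest at \<open>\<mu> = l\<close>, where it is
    \<open>l / (l + (l - 1)\<^sup>2)\<close>.\<close>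
  have key: "sum w (K' - K) \<le> ?\<theta> * sum w K'"
    if K: "finite K" "finite K'" "l \<le> card K'" "card (K' - K) \<le> 1" for K K'
  proof (cases "K' - K = {}")
    case True
    have "0 \<le> ?\<theta> * sum w K'" using lpos by (intro mult_nonneg_nonneg sum_nonneg) (simp_all add: w_def)
    then show ?thesis unfolding True by simp
  next
    case False
    with K(2) have "card (K' - K) \<noteq> 0" by simp
    with K(4) have "card (K' - K) = 1" by linarith
    then obtain a where a: "K' - K = {a}" by (auto simp: card_1_singleton_iff)
    define \<mu> where "\<mu> = real (card M)"
    have "sum w K' = w a + sum w (K' - {a})"
      using a K by (subst sum.remove[of _ a]) auto
    moreover have "(\<Sum>x\<in>K' - {a}. \<mu> - 1) \<le> sum w (K' - {a})"
      using wb(1) by (intro sum_mono) (simp add: \<mu>_def)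
    then have "real (card (K' - {a})) * (\<mu> - 1) \<le> sum w (K' - {a})" by simp
    moreover have "real l - 1 \<le> real (card (K' - {a}))"
    proof -
      have "a \<in> K'" using a by auto
      then show ?thesis using K(2,3) by (simp add: card_Diff_singleton)
    qed
    then have "(real l - 1) * (\<mu> - 1) \<le> real (card (K' - {a})) * (\<mu> - 1)"
      using l by (intro mult_right_mono) (auto simp: \<mu>_def)
    ultimately have s: "w a + (real l - 1) * (\<mu> - 1) \<le> sum w K'" by linarith
    have "(real l - 1)\<^sup>2 * w a \<le> (real l - 1)\<^sup>2 * \<mu>" using wb(2) by (simp add: \<mu>_def mult_left_mono)
    also have "\<dots> = (real l - 1) * ((real l - 1) * \<mu>)" by (simp add: power2_eq_square)
    also have "\<dots> \<le> (real l - 1) * (real l * (\<mu> - 1))"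
      using l by (intro mult_left_mono) (auto simp: \<mu>_def algebra_simps)
    finally have "w a * ((real l)\<^sup>2 - real l + 1) \<le> real l * (w a + (real l - 1) * (\<mu> - 1))"
      by (simp add: power2_eq_square algebra_simps)
    also have "\<dots> \<le> real l * sum w K'" using s by (intro mult_left_mono) auto
    finally show ?thesis using lpos by (simp add: a pos_le_divide_eq)
  qed
  have "\<bar>pair_mean L M h - pair_mean L' M h\<bar> \<le> ?\<theta> * (D * real l / (real l - 1))"
    unfolding pm[OF fin(1)] pm[OF fin(2)]
  proof (rule weighted_mean_diff)
    have "0 < w x" for x using w1(2)[of x] by simp
    moreover have "L \<noteq> {}" "L' \<noteq> {}" using l by auto
    ultimately show "0 < sum w L" "0 < sum w L'" using fin by (auto intro!: sum_pos)
    show "0 \<le> w x" for x by (simp add: w_def)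
    show "sum w (L' - L) \<le> ?\<theta> * sum w L'" by (rule key) (use fin l d in auto)
    show "sum w (L - L') \<le> ?\<theta> * sum w L" by (rule key) (use fin l d in auto)
  qed (use fin gd in auto)
  also have "\<dots> = D * (real l)\<^sup>2 / ((real l - 1) * ((real l)\<^sup>2 - real l + 1))"
    by (simp add: power2_eq_square mult_ac)
  finally show ?thesis .
qed


text \<open>The sets \<open>C \<sigma>\<close> are the classes of an equivalence relation on
  \<open>X\<close>, and averaging within classes keeps the total. This serves twice: for the
  stationarity of the chain and for the switches.\<close>

lemma sum_class_mean:
  fixes f :: "'a \<Rightarrow> real"
  assumes fin: "finite X" and C: "\<And>\<sigma>. \<sigma> \<in> X \<Longrightarrow> \<sigma> \<in> C \<sigma>" "\<And>\<sigma>. \<sigma> \<in> X \<Longrightarrow> C \<sigma> \<subseteq> X"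
    "\<And>\<sigma> \<tau>. \<sigma> \<in> X \<Longrightarrow> \<tau> \<in> C \<sigma> \<Longrightarrow> C \<tau> = C \<sigma>"
  shows "(\<Sum>\<sigma>\<in>X. (\<Sum>\<tau>\<in>C \<sigma>. f \<tau>) / real (card (C \<sigma>))) = sum f X"
proof -
  have "(\<Sum>\<sigma>\<in>X. (\<Sum>\<tau>\<in>C \<sigma>. f \<tau>) / real (card (C \<sigma>)))
      = (\<Sum>\<sigma>\<in>X. \<Sum>\<tau>\<in>X. if \<tau> \<in> C \<sigma> then f \<tau> / real (card (C \<tau>)) else 0)"
  proof (intro sum.cong refl)
    fix \<sigma> assume \<sigma>: "\<sigma> \<in> X"
    have "(\<Sum>\<tau>\<in>C \<sigma>. f \<tau>) / real (card (C \<sigma>)) = (\<Sum>\<tau>\<in>C \<sigma>. f \<tau> / real (card (C \<tau>)))"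
      using C(3)[OF \<sigma>] by (simp add: sum_divide_distrib)
    also have "\<dots> = (\<Sum>\<tau>\<in>X. if \<tau> \<in> C \<sigma> then f \<tau> / real (card (C \<tau>)) else 0)"
      using C(2)[OF \<sigma>] fin by (intro sum.mono_neutral_cong_left) auto
    finally show "(\<Sum>\<tau>\<in>C \<sigma>. f \<tau>) / real (card (C \<sigma>)) = (\<Sum>\<tau>\<in>X. if \<tau> \<in> C \<sigma> then f \<tau> / real (card (C \<tau>)) else 0)" .
  qed
  also have "\<dots> = (\<Sum>\<tau>\<in>X. \<Sum>\<sigma>\<in>X. if \<tau> \<in> C \<sigma> then f \<tau> / real (card (C \<tau>)) else 0)"
    by (rule sum.swap)
  also have "\<dots> = sum f X"
  proof (intro sum.cong refl)
    fix \<tau> assume \<tau>: "\<tau> \<in> X"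
    have eq: "\<sigma> \<in> X \<and> \<tau> \<in> C \<sigma> \<longleftrightarrow> \<sigma> \<in> C \<tau>" for \<sigma>
      using C \<tau> by blast
    have "(\<Sum>\<sigma>\<in>X. if \<tau> \<in> C \<sigma> then f \<tau> / real (card (C \<tau>)) else 0) = (\<Sum>\<sigma>\<in>{\<sigma> \<in> X. \<tau> \<in> C \<sigma>}. f \<tau> / real (card (C \<tau>)))"
      using fin by (rule sum.inter_filter[symmetric])
    also have "{\<sigma> \<in> X. \<tau> \<in> C \<sigma>} = C \<tau>" using eq by auto
    also have "card (C \<tau>) \<noteq> 0" using C(1,2)[OF \<tau>] finite_subset[OF C(2)[OF \<tau>] fin] by (auto simp: card_eq_0_iff)
    then have "(\<Sum>\<sigma>\<in>C \<tau>. f \<tau> / real (card (C \<tau>))) = f \<tau>" by simp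
    finally show "(\<Sum>\<sigma>\<in>X. if \<tau> \<in> C \<sigma> then f \<tau> / real (card (C \<tau>)) else 0) = f \<tau>" .
  qed
  finally show ?thesis .
qed

abbreviation expect :: "'a pmf \<Rightarrow> ('a \<Rightarrow> real) \<Rightarrow> real" where
  "expect p f \<equiv> measure_pmf.expectation p f"

lemma expect_bind:
  assumes "finite (set_pmf p)" "\<And>x. x \<in> set_pmf p \<Longrightarrow> finite (set_pmf (f x))"
  shows "expect (bind_pmf p f) h = expect p (\<lambda>x. expect (f x) h)"
  using assms by (simp add: pmf_expectation_bind[of "set_pmf p"] integral_measure_pmf[of "set_pmf p"])

lemma expect_mono_finite:
  assumes "finite (set_pmf p)" "\<And>x. x \<in> set_pmf p \<Longrightarrow> f x \<le> g x"
  shows "expect p f \<le> expect p g"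
  using assms by (simp add: integral_measure_pmf[of "set_pmf p"] sum_mono mult_left_mono)

section \<open>The block dynamics\<close>

locale colouring_graph =
  fixes n \<Delta> q :: nat and E :: "nat set set" and es :: "(nat \<times> nat) list"
  assumes n_pos: "0 < n" and simple: "simple_graph n E" and deg: "\<And>v. degree_of E v \<le> \<Delta>"
    and \<Delta>_pos: "1 \<le> \<Delta>" and q_ge: "2 * \<Delta> \<le> q" and es: "lists_edges es E"
begin

definition nb :: "nat \<Rightarrow> nat set" where
  "nb v = {u. {u, v} \<in> E}"

lemma q2: "2 \<le> q" using \<Delta>_pos q_ge by simp

lemma edgeD: "{u, v} \<in> E \<Longrightarrow> u < n \<and> v < n \<and> u \<noteq> v"
proof -
  assume "{u, v} \<in> E"
  then have "{u, v} \<in> {{u, v} |u v. u < n \<and> v < n \<and> u \<noteq> v}" using simple by (auto simp: simple_graph_def)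
  then show ?thesis by (auto simp: doubleton_eq_iff)
qed

lemma edge_cases: assumes "e \<in> E" obtains u v where "e = {u, v}" "u < n" "v < n" "u \<noteq> v"
proof -
  have "e \<in> {{u, v} |u v. u < n \<and> v < n \<and> u \<noteq> v}" using simple assms by (auto simp: simple_graph_def)
  then show ?thesis using that by blast
qed

lemma nb_sym: "u \<in> nb v \<longleftrightarrow> v \<in> nb u"
  by (simp add: nb_def insert_commute)

lemma nb_lt: "u \<in> nb v \<Longrightarrow> u < n" "u \<in> nb v \<Longrightarrow> v < n"
  using edgeD by (auto simp: nb_def)

lemma nb_irrefl: "v \<notin> nb v"
  using edgeD[of v v] by (auto simp: nb_def)

lemma finite_nb [simp]: "finite (nb v)"
  by (rule finite_subset[of _ "{..<n}"]) (auto dest: nb_lt)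

lemma finite_E [simp]: "finite E"
  using es by (auto simp: lists_edges_def)

lemma bij_incident: "bij_betw (\<lambda>u. {u, v}) (nb v) {e \<in> E. v \<in> e}"
proof (rule bij_betw_imageI)
  show "inj_on (\<lambda>u. {u, v}) (nb v)" by (auto simp: inj_on_def doubleton_eq_iff)
  show "(\<lambda>u. {u, v}) ` nb v = {e \<in> E. v \<in> e}"
  proof (intro equalityI subsetI)
    fix e assume "e \<in> {e \<in> E. v \<in> e}"
    then have e: "e \<in> E" "v \<in> e" by auto
    obtain a b where "e = {a, b}" by (rule edge_cases[OF e(1)])
    with e(2) have "e = {a, v} \<or> e = {b, v}" by (auto simp: insert_commute)
    with e(1) show "e \<in> (\<lambda>u. {u, v}) ` nb v" by (auto simp: nb_def)
  qed (auto simp: nb_def)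
qed

lemma card_nb: "card (nb v) = degree_of E v"
  using bij_betw_same_card[OF bij_incident] by (simp add: degree_of_def)

lemma card_nb_le: "card (nb v) \<le> \<Delta>"
  using deg by (simp add: card_nb)

abbreviation M :: nat where "M \<equiv> length es + n"

definition src where "src r = fst (es ! r)"
definition tgt where "tgt r = snd (es ! r)"

lemma bij_edges: "bij_betw (\<lambda>r. {src r, tgt r}) {..<length es} E"
proof -
  have "bij_betw (\<lambda>r. map (\<lambda>(u, v). {u, v}) es ! r) {..<length (map (\<lambda>(u, v). {u, v}) es)} E"
    using es by (intro bij_betw_nth) (auto simp: lists_edges_def)
  then have "bij_betw (\<lambda>r. map (\<lambda>(u, v). {u, v}) es ! r) {..<length es} E" by simp
  then show ?thesis
    by (rule bij_betw_cong[THEN iffD1, rotated]) (simp add: src_def tgt_def case_prod_unfold)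
qed

lemma edge_at: "r < length es \<Longrightarrow> {src r, tgt r} \<in> E"
  using bij_betwE[OF bij_edges] by auto

lemma edge_at_nb: "r < length es \<Longrightarrow> src r \<in> nb (tgt r)" "r < length es \<Longrightarrow> tgt r \<in> nb (src r)"
  using edge_at by (auto simp: nb_def insert_commute)

definition \<Omega> :: "(nat \<Rightarrow> nat) set" where "\<Omega> = {..<n} \<rightarrow>\<^sub>E {1..q}"

lemma finite_\<Omega> [simp]: "finite \<Omega>"
  by (simp add: \<Omega>_def finite_PiE)

lemma \<Omega>_upd: "\<sigma> \<in> \<Omega> \<Longrightarrow> v < n \<Longrightarrow> c \<in> {1..q} \<Longrightarrow> \<sigma>(v := c) \<in> \<Omega>"
  by (auto simp: \<Omega>_def PiE_iff extensional_def)

lemma \<Omega>_range: "\<sigma> \<in> \<Omega> \<Longrightarrow> v < n \<Longrightarrow> \<sigma> v \<in> {1..q}"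
  using PiE_mem[of \<sigma> "{..<n}" "\<lambda>_. {1..q}" v] by (simp add: \<Omega>_def)

text \<open>The partner \<open>w\<close> is left out because it is recoloured together with
  \<open>v\<close>; \<open>off_diag\<close> takes care of a clash between the two.\<close>

definition allowed :: "nat \<Rightarrow> nat \<Rightarrow> (nat \<Rightarrow> nat) \<Rightarrow> nat set" where
  "allowed v w \<sigma> = {1..q} - \<sigma> ` (nb v - {w})"

lemma finite_allowed [simp]: "finite (allowed v w \<sigma>)"
  by (simp add: allowed_def)

text \<open>Besides \<open>w\<close>, only \<open>\<Delta> - 1\<close> neighbours can forbid a
  colour.\<close>

lemma card_allowed:
  assumes "w \<in> nb v"
  shows "q - \<Delta> + 1 \<le> card (allowed v w \<sigma>)"
proof -
  have "card (\<sigma> ` (nb v - {w})) \<le> card (nb v - {w})" by (simp add: card_image_le)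
  also have "\<dots> \<le> \<Delta> - 1" using assms card_nb_le[of v] by simp
  finally have "card (\<sigma> ` (nb v - {w})) \<le> \<Delta> - 1" .
  moreover have "card {1..q} - card (\<sigma> ` (nb v - {w})) \<le> card (allowed v w \<sigma>)"
    unfolding allowed_def by (rule diff_card_le_card_Diff) simp
  ultimately show ?thesis using \<Delta>_pos q_ge by simp
qed

lemma allowed_pairs_ne:
  assumes "w \<in> nb v"
  shows "off_diag (allowed v w \<sigma>) (allowed w v \<sigma>) \<noteq> {}"
proof -
  have v: "v \<in> nb w" using assms nb_sym by simp
  have "2 \<le> card (allowed v w \<sigma>)" "2 \<le> card (allowed w v \<sigma>)"
    using card_allowed[OF assms, of \<sigma>] card_allowed[OF v, of \<sigma>] \<Delta>_pos q_ge by linarith+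
  then obtain x where x: "x \<in> allowed v w \<sigma>" by (metis card.empty equals0I not_numeral_le_zero)
  have "\<not> allowed w v \<sigma> \<subseteq> {x}"
    using \<open>2 \<le> card (allowed w v \<sigma>)\<close> card_mono[of "{x}" "allowed w v \<sigma>"] by auto
  with x show ?thesis by (auto simp: off_diag_def)
qed

definition heat_bath :: "nat \<Rightarrow> nat \<Rightarrow> (nat \<Rightarrow> nat) \<Rightarrow> (nat \<Rightarrow> nat) pmf" where
  "heat_bath v w \<sigma> = map_pmf (\<lambda>(x, y). \<sigma>(v := x, w := y)) (pmf_of_set (off_diag (allowed v w \<sigma>) (allowed w v \<sigma>)))"

text \<open>Indices from \<open>length es\<close> on stand for vertices, and those of non-isolated
  vertices are idle. This costs a constant factor and spares the machine a list of the isolated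
  vertices.\<close>

definition move :: "nat \<Rightarrow> (nat \<Rightarrow> nat) \<Rightarrow> (nat \<Rightarrow> nat) pmf" where
  "move r \<sigma> = (if r < length es then heat_bath (src r) (tgt r) \<sigma>
     else if nb (r - length es) = {} then map_pmf (\<lambda>c. \<sigma>(r - length es := c)) (pmf_of_set {1..q})
     else return_pmf \<sigma>)"

definition kernel :: "(nat \<Rightarrow> nat) \<Rightarrow> (nat \<Rightarrow> nat) pmf" where
  "kernel \<sigma> = bind_pmf (pmf_of_set {..<M}) (\<lambda>r. move r \<sigma>)"

lemma set_heat_bath:
  assumes "w \<in> nb v"
  shows "set_pmf (heat_bath v w \<sigma>) = (\<lambda>(x, y). \<sigma>(v := x, w := y)) ` off_diag (allowed v w \<sigma>) (allowed w v \<sigma>)"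
  using allowed_pairs_ne[OF assms] by (simp add: heat_bath_def set_pmf_of_set)

text \<open>That at most two vertices change keeps the chain in \<open>\<Omega>\<close> and later
  gives the bound \<open>2 * D\<close> for one step in the variance.\<close>

lemma set_move:
  assumes "r < M"
  shows "finite (set_pmf (move r \<sigma>))"
    and "\<tau> \<in> set_pmf (move r \<sigma>) \<Longrightarrow> \<exists>v w x y. v < n \<and> w < n \<and> x \<in> {1..q} \<and> y \<in> {1..q} \<and>
        (\<tau> = \<sigma>(v := x, w := y) \<or> \<tau> = \<sigma>(v := x) \<or> \<tau> = \<sigma>)"
proof -
  show "finite (set_pmf (move r \<sigma>))"
    using q2 by (auto simp: move_def set_heat_bath edge_at_nb set_pmf_of_set)
  assume \<tau>: "\<tau> \<in> set_pmf (move r \<sigma>)"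
  let ?P = "\<lambda>v w x y. v < n \<and> w < n \<and> x \<in> {1..q} \<and> y \<in> {1..q} \<and>
        (\<tau> = \<sigma>(v := x, w := y) \<or> \<tau> = \<sigma>(v := x) \<or> \<tau> = \<sigma>)"
  have 1: "1 \<in> {1..q}" using q2 by simp
  show "\<exists>v w x y. ?P v w x y"
  proof (cases "r < length es")
    case True
    then obtain x y where "(x, y) \<in> off_diag (allowed (src r) (tgt r) \<sigma>) (allowed (tgt r) (src r) \<sigma>)"
      "\<tau> = \<sigma>(src r := x, tgt r := y)"
      using \<tau> by (auto simp: move_def set_heat_bath edge_at_nb)
    then have "?P (src r) (tgt r) x y"
      using nb_lt[OF edge_at_nb(1)[OF True]] by (auto simp: off_diag_def allowed_def)
    then show ?thesis by blast
  next
    case False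
    then have r: "r - length es < n" using assms by simp
    show ?thesis
    proof (cases "nb (r - length es) = {}")
      case True
      then obtain c where "c \<in> {1..q}" "\<tau> = \<sigma>(r - length es := c)"
        using \<tau> False q2 by (auto simp: move_def set_pmf_of_set)
      then have "?P (r - length es) 0 c 1" using r n_pos 1 by blast
      then show ?thesis by blast
    next
      case nonempty: False
      have "?P 0 0 1 1" using \<tau> False nonempty n_pos 1 by (simp add: move_def)
      then show ?thesis by blast
    qed
  qed
qed

lemma move_\<Omega>: "r < M \<Longrightarrow> \<sigma> \<in> \<Omega> \<Longrightarrow> \<tau> \<in> set_pmf (move r \<sigma>) \<Longrightarrow> \<tau> \<in> \<Omega>"
  using set_move(2)[of r \<tau> \<sigma>] by (auto intro!: \<Omega>_upd simp del: atLeastAtMost_iff)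

lemma set_uniform_block: "set_pmf (pmf_of_set {..<M}) = {..<M}"
  using n_pos by (intro set_pmf_of_set) auto

lemma kernel_\<Omega>: "\<sigma> \<in> \<Omega> \<Longrightarrow> set_pmf (kernel \<sigma>) \<subseteq> \<Omega>"
  using move_\<Omega> by (auto simp: kernel_def set_uniform_block)

lemma finite_kernel [simp]: "finite (set_pmf (kernel \<sigma>))"
  by (auto simp: kernel_def set_uniform_block set_move)

section \<open>One step contracts Lipschitz constants\<close>

definition avg :: "((nat \<Rightarrow> nat) \<Rightarrow> real) \<Rightarrow> (nat \<Rightarrow> nat) \<Rightarrow> real" where
  "avg f \<sigma> = expect (kernel \<sigma>) f"

lemma avg_eq: "avg f \<sigma> = (\<Sum>r<M. expect (move r \<sigma>) f) / real M"
proof -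
  have "avg f \<sigma> = (\<Sum>r\<in>{..<M}. expect (move r \<sigma>) f /\<^sub>R real (card {..<M}))"
    unfolding avg_def kernel_def using n_pos set_move(1)
    by (intro pmf_expectation_bind_pmf_of_set) auto
  then show ?thesis by (simp add: sum_distrib_left[symmetric] divide_inverse mult.commute)
qed

text \<open>The Hamming distance is taken on all of \<open>\<Omega>\<close>, improper maps included:
  a path between two proper colourings that changes one vertex at a time may have to pass through
  improper maps. The contraction of such constants is the dual form of path coupling.\<close>

definition Lip :: "real \<Rightarrow> ((nat \<Rightarrow> nat) \<Rightarrow> real) \<Rightarrow> bool" where
  "Lip D f \<longleftrightarrow> (\<forall>\<sigma>\<in>\<Omega>. \<forall>u<n. \<forall>c\<in>{1..q}. \<bar>f (\<sigma>(u := c)) - f \<sigma>\<bar> \<le> D)"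

lemma LipD: "Lip D f \<Longrightarrow> \<sigma> \<in> \<Omega> \<Longrightarrow> u < n \<Longrightarrow> c \<in> {1..q} \<Longrightarrow> \<bar>f (\<sigma>(u := c)) - f \<sigma>\<bar> \<le> D"
  by (auto simp: Lip_def)

lemma const_\<Omega>: "(\<lambda>v\<in>{..<n}. 1) \<in> \<Omega>" using q2 by (auto simp: \<Omega>_def)

lemma Lip_nonneg: "Lip D f \<Longrightarrow> 0 \<le> D"
  using LipD[OF _ const_\<Omega> n_pos, of D f 1] q2 by force

lemma expect_heat_bath:
  assumes "w \<in> nb v"
  shows "expect (heat_bath v w \<sigma>) f = pair_mean (allowed v w \<sigma>) (allowed w v \<sigma>) (\<lambda>x y. f (\<sigma>(v := x, w := y)))"
  using allowed_pairs_ne[OF assms]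
  by (simp add: heat_bath_def integral_pmf_of_set pair_mean_def case_prod_unfold)

text \<open>The bound of \<open>pair_mean_list_change\<close> for \<open>D = 1\<close> at the least
  possible list length \<open>l = q - \<Delta> + 1\<close>.\<close>

definition infl :: real where
  "infl = (let l = real (q - \<Delta> + 1) in l\<^sup>2 / ((l - 1) * (l\<^sup>2 - l + 1)))"

text \<open>From \<open>2 * \<Delta> \<le> q\<close> comes \<open>\<Delta> - 1 \<le> l - 2\<close>,
  and \<open>(l - 2) * l\<^sup>2\<close> falls short of the denominator of \<open>infl\<close> by
  exactly \<open>2 * l - 1\<close>. Relative to the denominator this margin is at least
  \<open>1 / l\<^sup>2\<close>.\<close>

lemma infl_bound: "0 \<le> infl" "(real \<Delta> - 1) * infl \<le> 1 - 1 / (real q)\<^sup>2"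
proof -
  define l where "l = real (q - \<Delta> + 1)"
  have l: "real \<Delta> + 1 \<le> l" "l \<le> real q" "2 \<le> l" using \<Delta>_pos q_ge by (auto simp: l_def)
  have A: "0 < l\<^sup>2 - l + 1" 
    using l mult_right_mono[of 1 l l] unfolding power2_eq_square by linarith
  have B: "0 < (l - 1) * (l\<^sup>2 - l + 1)" using A l by simp
  show i0: "0 \<le> infl" using B l unfolding infl_def Let_def l_def[symmetric] by simp
  have "(real \<Delta> - 1) * infl \<le> (l - 2) * infl" using i0 l by (intro mult_right_mono) auto
  also have "\<dots> = 1 - (2 * l - 1) / ((l - 1) * (l\<^sup>2 - l + 1))"
    unfolding infl_def Let_def l_def[symmetric] using B
    by (simp add: field_simps power2_eq_square)
  also have "1 / (real q)\<^sup>2 \<le> 1 / l\<^sup>2" using l by (intro divide_left_mono power_mono) auto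
  moreover have "1 / l\<^sup>2 \<le> (2 * l - 1) / ((l - 1) * (l\<^sup>2 - l + 1))"
  proof -
    have "(l - 1) * (l\<^sup>2 - l + 1) \<le> l * l\<^sup>2" using A l by (intro mult_mono) auto
    also have "\<dots> \<le> (2 * l - 1) * l\<^sup>2" using l by (intro mult_right_mono) auto
    finally show ?thesis using B l by (simp add: field_simps)
  qed
  ultimately show "(real \<Delta> - 1) * infl \<le> 1 - 1 / (real q)\<^sup>2" by linarith
qed

text \<open>Three changes are made in turn: the colour of \<open>u\<close> inside \<open>f\<close>,
  which costs \<open>D\<close>, then the list of \<open>v\<close>, then the list of
  \<open>w\<close>. A list gains and loses at most one colour, and only if \<open>u\<close> is
  adjacent to its vertex.\<close>

lemma heat_bath_diff:
  assumes f: "Lip D f" and \<sigma>: "\<sigma> \<in> \<Omega>" and u: "u < n" and c: "c \<in> {1..q}" and vw: "w \<in> nb v" and ne: "u \<noteq> v" "u \<noteq> w"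
  shows "\<bar>expect (heat_bath v w (\<sigma>(u := c))) f - expect (heat_bath v w \<sigma>) f\<bar>
    \<le> D * (1 + infl * (of_bool (u \<in> nb v) + of_bool (u \<in> nb w)))"
proof -
  let ?\<tau> = "\<sigma>(u := c)"
  define h where "h x y = f (\<sigma>(v := x, w := y))" for x y
  define h' where "h' x y = f (?\<tau>(v := x, w := y))" for x y
  have wv: "v \<in> nb w" using vw nb_sym by simp
  have lt: "v < n" "w < n" using vw nb_lt by auto
  have vw_ne: "v \<noteq> w" using vw nb_irrefl by auto
  have sub: "allowed a b \<rho> \<subseteq> {1..q}" for a b \<rho> by (auto simp: allowed_def)
  have upd: "\<sigma>(v := x, w := y) \<in> \<Omega>" if "x \<in> {1..q}" "y \<in> {1..q}" for x y
    using that lt \<sigma> by (intro \<Omega>_upd)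
  have D0: "0 \<le> D" using f by (rule Lip_nonneg)
  have hh': "\<bar>h' x y - h x y\<bar> \<le> D" if "x \<in> {1..q}" "y \<in> {1..q}" for x y
  proof -
    have "?\<tau>(v := x, w := y) = (\<sigma>(v := x, w := y))(u := c)" using ne by (auto simp: fun_upd_twist)
    then show ?thesis unfolding h_def h'_def using LipD[OF f upd[OF that] u c] by simp
  qed
  have h1: "\<bar>h x y - h x' y\<bar> \<le> D" if "x \<in> {1..q}" "x' \<in> {1..q}" "y \<in> {1..q}" for x x' y
  proof -
    have "\<sigma>(v := x, w := y) = (\<sigma>(v := x', w := y))(v := x)" using vw_ne by (auto simp: fun_upd_twist)
    then show ?thesis unfolding h_def using LipD[OF f upd[OF that(2,3)] lt(1) that(1)] by simp
  qed
  have h2: "\<bar>h x y - h x y'\<bar> \<le> D" if "x \<in> {1..q}" "y \<in> {1..q}" "y' \<in> {1..q}" for x y y'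
    unfolding h_def using LipD[OF f upd[OF that(1,3)] lt(2) that(2)] by simp
  let ?L = "allowed v w \<sigma>" and ?L' = "allowed v w ?\<tau>" and ?W = "allowed w v \<sigma>" and ?W' = "allowed w v ?\<tau>"
  let ?l = "q - \<Delta> + 1"
  have l2: "2 \<le> ?l" using \<Delta>_pos q_ge by simp
  have inf: "D * (real ?l)\<^sup>2 / ((real ?l - 1) * ((real ?l)\<^sup>2 - real ?l + 1)) = D * infl"
    by (simp add: infl_def Let_def)
  have diff: "card (allowed a b \<sigma> - allowed a b ?\<tau>) \<le> 1" "card (allowed a b ?\<tau> - allowed a b \<sigma>) \<le> 1" for a b
  proof -
    have "card (allowed a b \<sigma> - allowed a b ?\<tau>) \<le> card {c}" by (rule card_mono) (auto simp: allowed_def)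
    moreover have "card (allowed a b ?\<tau> - allowed a b \<sigma>) \<le> card {\<sigma> u}"
      by (rule card_mono) (auto simp: allowed_def)
    ultimately show "card (allowed a b \<sigma> - allowed a b ?\<tau>) \<le> 1" "card (allowed a b ?\<tau> - allowed a b \<sigma>) \<le> 1" by auto
  qed
  have same: "allowed a b ?\<tau> = allowed a b \<sigma>" if "u \<notin> nb a" for a b
    using that unfolding allowed_def by (auto simp: image_iff)
  have A: "\<bar>pair_mean ?L' ?W' h' - pair_mean ?L' ?W' h\<bar> \<le> D"
  proof -
    have ne: "off_diag ?L' ?W' \<noteq> {}" by (rule allowed_pairs_ne[OF vw])
    have "\<bar>(\<Sum>(x, y)\<in>off_diag ?L' ?W'. h' x y) - (\<Sum>(x, y)\<in>off_diag ?L' ?W'. h x y)\<bar>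
        \<le> (\<Sum>(x, y)\<in>off_diag ?L' ?W'. \<bar>h' x y - h x y\<bar>)"
      unfolding sum_subtractf[symmetric] case_prod_unfold by (rule sum_abs)
    also have "\<dots> \<le> (\<Sum>_\<in>off_diag ?L' ?W'. D)"
      using sub by (intro sum_mono) (auto simp: off_diag_def simp del: atLeastAtMost_iff intro!: hh' dest: subsetD[OF sub])
    finally have "\<bar>(\<Sum>(x, y)\<in>off_diag ?L' ?W'. h' x y) - (\<Sum>(x, y)\<in>off_diag ?L' ?W'. h x y)\<bar>
        \<le> D * real (card (off_diag ?L' ?W'))" by (simp add: mult.commute)
    moreover have "0 < real (card (off_diag ?L' ?W'))" using ne by (simp add: card_gt_0_iff)
    ultimately show ?thesis
      unfolding pair_mean_def diff_divide_distrib[symmetric] abs_divide by (simp add: divide_le_eq)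
  qed
  have B: "\<bar>pair_mean ?L' ?W' h - pair_mean ?L ?W' h\<bar> \<le> D * infl * of_bool (u \<in> nb v)"
  proof (cases "u \<in> nb v")
    case True
    have "\<bar>pair_mean ?L' ?W' h - pair_mean ?L ?W' h\<bar> \<le> D * (real ?l)\<^sup>2 / ((real ?l - 1) * ((real ?l)\<^sup>2 - real ?l + 1))"
      by (rule pair_mean_list_change)
        (use card_allowed[OF vw] card_allowed[OF wv] diff l2 sub h1 h2 in \<open>auto simp del: atLeastAtMost_iff intro!: h1 h2 dest!: subsetD[OF sub]\<close>)
    then show ?thesis using True inf by simp
  qed (simp add: same)
  have C: "\<bar>pair_mean ?L ?W' h - pair_mean ?L ?W h\<bar> \<le> D * infl * of_bool (u \<in> nb w)"
  proof (cases "u \<in> nb w")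
    case True
    have "\<bar>pair_mean ?W' ?L (\<lambda>y x. h x y) - pair_mean ?W ?L (\<lambda>y x. h x y)\<bar> \<le> D * (real ?l)\<^sup>2 / ((real ?l - 1) * ((real ?l)\<^sup>2 - real ?l + 1))"
      by (rule pair_mean_list_change)
        (use card_allowed[OF vw] card_allowed[OF wv] diff l2 sub in \<open>auto simp del: atLeastAtMost_iff intro!: h1 h2 dest!: subsetD[OF sub]\<close>)
    then show ?thesis using True inf by (simp add: pair_mean_swap[of ?L])
  qed (simp add: same)
  have "expect (heat_bath v w ?\<tau>) f = pair_mean ?L' ?W' h'" "expect (heat_bath v w \<sigma>) f = pair_mean ?L ?W h"
    unfolding expect_heat_bath[OF vw] h_def h'_def by simp_all
  moreover have "\<bar>pair_mean ?L' ?W' h' - pair_mean ?L ?W h\<bar> \<le> D + D * infl * of_bool (u \<in> nb v) + D * infl * of_bool (u \<in> nb w)"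
    using A B C by linarith
  ultimately show ?thesis by (simp add: algebra_simps)
qed

text \<open>The new pair does not depend on the old colours of the two ends, so an edge at
  \<open>u\<close> removes the disagreement.\<close>

lemma heat_bath_same:
  assumes vw: "w \<in> nb v" and u: "u = v \<or> u = w"
  shows "expect (heat_bath v w (\<sigma>(u := c))) f = expect (heat_bath v w \<sigma>) f"
proof -
  have "allowed v w (\<sigma>(u := c)) = allowed v w \<sigma>" "allowed w v (\<sigma>(u := c)) = allowed w v \<sigma>"
    using u nb_irrefl by (auto simp: allowed_def image_iff)
  moreover have "(\<sigma>(u := c))(v := x, w := y) = \<sigma>(v := x, w := y)" for x y
    using u by auto
  ultimately show ?thesis by (simp add: expect_heat_bath[OF vw])
qed

text \<open>Double counting: a neighbour of \<open>u\<close> has at most \<open>\<Delta> - 1\<close>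
  edges besides the one to \<open>u\<close>.\<close>

lemma incidence_count:
  "(\<Sum>e\<in>{e \<in> E. u \<notin> e}. card (e \<inter> nb u)) \<le> card (nb u) * (\<Delta> - 1)"
proof -
  have "(\<Sum>e\<in>{e \<in> E. u \<notin> e}. card (e \<inter> nb u)) = (\<Sum>e\<in>{e \<in> E. u \<notin> e}. \<Sum>v\<in>nb u. of_bool (v \<in> e))"
    by (simp add: sum.inter_filter[symmetric] Int_def conj_commute of_bool_def flip: card_eq_sum)
  also have "\<dots> = (\<Sum>v\<in>nb u. \<Sum>e\<in>{e \<in> E. u \<notin> e}. of_bool (v \<in> e))" by (rule sum.swap)
  also have "\<dots> = (\<Sum>v\<in>nb u. card {e \<in> E. u \<notin> e \<and> v \<in> e})"
    by (intro sum.cong refl) (simp add: sum.inter_filter[symmetric] of_bool_def conj_ac flip: card_eq_sum)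
  also have "\<dots> \<le> (\<Sum>v\<in>nb u. \<Delta> - 1)"
  proof (rule sum_mono)
    fix v assume v: "v \<in> nb u"
    have "{e \<in> E. u \<notin> e \<and> v \<in> e} \<subseteq> {e \<in> E. v \<in> e} - {{u, v}}" by auto
    then have "card {e \<in> E. u \<notin> e \<and> v \<in> e} \<le> card ({e \<in> E. v \<in> e} - {{u, v}})" by (intro card_mono) auto
    also have "\<dots> = degree_of E v - 1"
      using v by (subst card_Diff_singleton) (auto simp: degree_of_def nb_def insert_commute)
    also have "\<dots> \<le> \<Delta> - 1" using deg[of v] by simp
    finally show "card {e \<in> E. u \<notin> e \<and> v \<in> e} \<le> \<Delta> - 1" .
  qed
  finally show ?thesis by simp
qed

text \<open>The \<open>card (nb u)\<close> edges at \<open>u\<close> save \<open>D\<close> each. The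
  other edges lose at most \<open>D * infl\<close> for each endpoint next to \<open>u\<close>, and
  there are at most \<open>card (nb u) * (\<Delta> - 1)\<close> of these. By
  \<open>infl_bound\<close> a net saving of \<open>D / q\<^sup>2\<close> per neighbour of
  \<open>u\<close> remains.\<close>

lemma edge_sum_bound:
  assumes "0 \<le> D"
  shows "(\<Sum>e\<in>E. if u \<in> e then 0 else D * (1 + infl * real (card (e \<inter> nb u)))) \<le> D * (real (length es) - real (card (nb u)) / (real q)\<^sup>2)"
proof -
  have card: "card E = length es" using bij_betw_same_card[OF bij_edges] by simp
  have "card {e \<in> E. u \<in> e} = card (nb u)" by (simp add: card_nb degree_of_def)
  moreover have "card {e \<in> E. u \<in> e} + card {e \<in> E. u \<notin> e} = card E"
    by (subst card_Un_disjoint[symmetric]) (auto intro: arg_cong[where f = card])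
  ultimately have c: "real (card {e \<in> E. u \<notin> e}) = real (length es) - real (card (nb u))" using card by linarith
  have "(\<Sum>e\<in>E. if u \<in> e then 0 else D * (1 + infl * real (card (e \<inter> nb u))))
      = (\<Sum>e\<in>{e \<in> E. u \<notin> e}. D * (1 + infl * real (card (e \<inter> nb u))))"
    by (intro sum.mono_neutral_cong_right) auto
  also have "\<dots> = D * (real (card {e \<in> E. u \<notin> e}) + infl * real (\<Sum>e\<in>{e \<in> E. u \<notin> e}. card (e \<inter> nb u)))"
    by (simp add: sum_distrib_left sum.distrib distrib_left)
  also have "\<dots> \<le> D * (real (card {e \<in> E. u \<notin> e}) + infl * real (card (nb u) * (\<Delta> - 1)))"
    using incidence_count[of u] infl_bound(1) assms by (intro mult_left_mono add_left_mono) (simp_all only: of_nat_le_iff)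
  also have "\<dots> = D * (real (length es) - real (card (nb u)) + real (card (nb u)) * ((real \<Delta> - 1) * infl))"
    using \<Delta>_pos unfolding c by (simp add: of_nat_diff mult_ac)
  also have "\<dots> \<le> D * (real (length es) - real (card (nb u)) + real (card (nb u)) * (1 - 1 / (real q)\<^sup>2))"
    using infl_bound(2) assms by (intro mult_left_mono add_left_mono) auto
  finally show ?thesis by (simp add: algebra_simps)
qed

definition \<kappa> :: real where "\<kappa> = 1 - 1 / ((real q)\<^sup>2 * real M)"

text \<open>The isolated vertex \<open>u\<close> is only reached by its own move, the others by the edges at \<open>u\<close>.\<close>

lemma Lip_avg:
  assumes f: "Lip D f"
  shows "Lip (D * \<kappa>) (avg f)"
  unfolding Lip_def
proof (intro ballI allI impI)
  fix \<sigma> u c assume \<sigma>: "\<sigma> \<in> \<Omega>" and u: "u < n" and c: "c \<in> {1..q}"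
  let ?\<tau> = "\<sigma>(u := c)"
  define d where "d r = \<bar>expect (move r ?\<tau>) f - expect (move r \<sigma>) f\<bar>" for r
  have D0: "0 \<le> D" using f by (rule Lip_nonneg)
  have \<tau>: "?\<tau> \<in> \<Omega>" using \<sigma> u c by (rule \<Omega>_upd)
  have edge: "d r \<le> (if u \<in> {src r, tgt r} then 0 else D * (1 + infl * real (card ({src r, tgt r} \<inter> nb u))))"
    if r: "r < length es" for r
  proof (cases "u \<in> {src r, tgt r}")
    case True
    then show ?thesis using r heat_bath_same[OF edge_at_nb(2)[OF r]] by (auto simp: d_def move_def)
  next
    case False
    have "src r \<noteq> tgt r" using edge_at_nb[OF r] nb_irrefl by auto
    then have "real (card ({src r, tgt r} \<inter> nb u)) = of_bool (u \<in> nb (src r)) + of_bool (u \<in> nb (tgt r))"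
      using nb_sym[of u] by (auto simp: Int_insert_left)
    then show ?thesis using heat_bath_diff[OF f \<sigma> u c edge_at_nb(2)[OF r]] False r by (auto simp: d_def move_def)
  qed
  have vert: "d (length es + v) \<le> (if v = u \<and> nb u = {} then 0 else D)" if v: "v < n" for v
  proof (cases "nb v = {}")
    case True
    have e: "expect (move (length es + v) \<rho>) f = (\<Sum>x\<in>{1..q}. f (\<rho>(v := x))) / real q" for \<rho>
      using True q2 by (simp add: move_def integral_pmf_of_set)
    have "\<bar>f (?\<tau>(v := x)) - f (\<sigma>(v := x))\<bar> \<le> (if v = u then 0 else D)" if "x \<in> {1..q}" for x
      using LipD[OF f \<Omega>_upd[OF \<sigma> v that] u c] by (auto simp: fun_upd_twist)
    then have "(\<Sum>x\<in>{1..q}. \<bar>f (?\<tau>(v := x)) - f (\<sigma>(v := x))\<bar>) \<le> (\<Sum>x\<in>{1..q}. if v = u then 0 else D)"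
      by (intro sum_mono)
    then have "\<bar>(\<Sum>x\<in>{1..q}. f (?\<tau>(v := x))) - (\<Sum>x\<in>{1..q}. f (\<sigma>(v := x)))\<bar> \<le> real q * (if v = u then 0 else D)"
      unfolding sum_subtractf[symmetric] by (intro order_trans[OF sum_abs]) simp
    then have "d (length es + v) \<le> (if v = u then 0 else D)"
      using q2 unfolding d_def e diff_divide_distrib[symmetric] abs_divide by (simp add: divide_le_eq mult.commute)
    then show ?thesis using True D0 by (auto split: if_splits)
  next
    case False
    then show ?thesis using LipD[OF f \<sigma> u c] by (auto simp: d_def move_def)
  qed
  have "(\<Sum>r<M. d r) = (\<Sum>r<length es. d r) + (\<Sum>v<n. d (length es + v))"
    by (induction n) (simp_all add: add.assoc)
  also have "(\<Sum>r<length es. d r) \<le> (\<Sum>r<length es. if u \<in> {src r, tgt r} then 0 else D * (1 + infl * real (card ({src r, tgt r} \<inter> nb u))))"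
    using edge by (intro sum_mono) auto
  also have "\<dots> = (\<Sum>e\<in>E. if u \<in> e then 0 else D * (1 + infl * real (card (e \<inter> nb u))))"
    by (rule sum.reindex_bij_betw[OF bij_edges])
  also have "\<dots> \<le> D * (real (length es) - real (card (nb u)) / (real q)\<^sup>2)"
    by (rule edge_sum_bound[OF D0])
  also have "(\<Sum>v<n. d (length es + v)) \<le> D * (real n - of_bool (nb u = {}))"
  proof -
    have "(\<Sum>v<n. d (length es + v)) \<le> (\<Sum>v<n. if v = u \<and> nb u = {} then 0 else D)"
      using vert by (intro sum_mono) auto
    also have "\<dots> = (\<Sum>v<n. D - (if v = u then D * of_bool (nb u = {}) else 0))"
      by (intro sum.cong) auto
    also have "\<dots> = D * (real n - of_bool (nb u = {}))"
      using u by (simp add: sum_subtractf algebra_simps)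
    finally show ?thesis .
  qed
  finally have "(\<Sum>r<M. d r) \<le> D * (real (length es) - real (card (nb u)) / (real q)\<^sup>2) + D * (real n - of_bool (nb u = {}))"
    by simp
  also have "\<dots> = D * (real M - (real (card (nb u)) / (real q)\<^sup>2 + of_bool (nb u = {})))"
    by (simp add: algebra_simps)
  also have "\<dots> \<le> D * (real M - 1 / (real q)\<^sup>2)"
  proof -
    have "1 / (real q)\<^sup>2 \<le> real (card (nb u)) / (real q)\<^sup>2 + of_bool (nb u = {})"
    proof (cases "nb u = {}")
      case True
      then show ?thesis using q2 by simp
    next
      case False
      then have "1 \<le> card (nb u)" by (simp add: Suc_le_eq card_gt_0_iff)
      then show ?thesis using False by (simp add: divide_right_mono)
    qed
    then show ?thesis using D0 by (intro mult_left_mono) auto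
  qed
  finally have s: "(\<Sum>r<M. d r) \<le> D * (real M - 1 / (real q)\<^sup>2)" .
  have "\<bar>avg f ?\<tau> - avg f \<sigma>\<bar> = \<bar>\<Sum>r<M. expect (move r ?\<tau>) f - expect (move r \<sigma>) f\<bar> / real M"
    unfolding avg_eq diff_divide_distrib[symmetric] sum_subtractf abs_divide by simp
  also have "\<dots> \<le> (\<Sum>r<M. d r) / real M" unfolding d_def by (intro divide_right_mono sum_abs) simp
  also have "\<dots> \<le> D * (real M - 1 / (real q)\<^sup>2) / real M" using s by (intro divide_right_mono) auto
  also have "\<dots> = D * \<kappa>" using n_pos by (simp add: \<kappa>_def right_diff_distrib diff_divide_distrib del: of_nat_add)
  finally show "\<bar>avg f ?\<tau> - avg f \<sigma>\<bar> \<le> D * \<kappa>" .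
qed

end

context colouring_graph begin

section \<open>Mixing and variance\<close>

lemma finite_iter [simp]: "finite (set_pmf (iter kernel t \<sigma>))"
  by (induction t arbitrary: \<sigma>) auto

lemma iter_\<Omega>: "\<sigma> \<in> \<Omega> \<Longrightarrow> set_pmf (iter kernel t \<sigma>) \<subseteq> \<Omega>"
  using kernel_\<Omega> by (induction t arbitrary: \<sigma>) auto

definition avg_iter :: "nat \<Rightarrow> ((nat \<Rightarrow> nat) \<Rightarrow> real) \<Rightarrow> (nat \<Rightarrow> nat) \<Rightarrow> real" where
  "avg_iter t f \<sigma> = expect (iter kernel t \<sigma>) f"

lemma avg_iter_Suc: "avg_iter (Suc t) f = avg (avg_iter t f)"
  by (rule ext) (simp add: avg_iter_def[abs_def] avg_def expect_bind)

lemma avg_iter_0: "avg_iter 0 f = f"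
  by (rule ext) (simp add: avg_iter_def)

lemma \<kappa>_bounds: "0 \<le> \<kappa>" "\<kappa> < 1"
proof -
  have "1 \<le> (real q)\<^sup>2" "1 \<le> real M" using q2 n_pos by (simp_all add: one_le_power)
  then have "1 * 1 \<le> (real q)\<^sup>2 * real M" by (intro mult_mono) auto
  then show "0 \<le> \<kappa>" "\<kappa> < 1" unfolding \<kappa>_def by (simp_all only: mult_1) (simp_all add: divide_le_eq)
qed

lemma Lip_avg_iter: "Lip D f \<Longrightarrow> Lip (D * \<kappa> ^ t) (avg_iter t f)"
proof (induction t)
  case (Suc t)
  then show ?case using Lip_avg[of "D * \<kappa> ^ t" "avg_iter t f"] by (simp add: avg_iter_Suc mult_ac)
qed (simp add: avg_iter_0)

lemma Lip_dist:
  assumes f: "Lip D f" and \<sigma>: "\<sigma> \<in> \<Omega>" and \<tau>: "\<tau> \<in> \<Omega>"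
  shows "\<bar>f \<tau> - f \<sigma>\<bar> \<le> real n * D"
proof -
  define \<rho> where "\<rho> k v = (if v < k then \<tau> v else \<sigma> v)" for k v
  have "\<rho> k \<in> \<Omega> \<and> \<bar>f (\<rho> k) - f \<sigma>\<bar> \<le> real k * D" if "k \<le> n" for k
    using that
  proof (induction k)
    case 0
    have "\<rho> 0 = \<sigma>" by (rule ext) (simp add: \<rho>_def)
    then show ?case using \<sigma> by simp
  next
    case (Suc k)
    then have k: "k < n" "\<rho> k \<in> \<Omega>" "\<bar>f (\<rho> k) - f \<sigma>\<bar> \<le> real k * D" by auto
    have e: "\<rho> (Suc k) = (\<rho> k)(k := \<tau> k)" by (rule ext) (auto simp: \<rho>_def)
    have "\<tau> k \<in> {1..q}" using \<tau> k by (intro \<Omega>_range)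
    then have "\<rho> (Suc k) \<in> \<Omega>" "\<bar>f (\<rho> (Suc k)) - f (\<rho> k)\<bar> \<le> D"
      unfolding e using k f by (auto intro!: \<Omega>_upd LipD simp del: atLeastAtMost_iff)
    then show ?case using k(3) by (auto simp: algebra_simps)
  qed
  from this[of n] have "\<bar>f (\<rho> n) - f \<sigma>\<bar> \<le> real n * D" by simp
  moreover have "\<rho> n = \<tau>"
  proof
    fix v
    show "\<rho> n v = \<tau> v" using \<sigma> \<tau> by (auto simp: \<rho>_def \<Omega>_def PiE_iff extensional_def)
  qed
  ultimately show ?thesis by simp
qed

section \<open>Stationarity of the uniform proper colouring\<close>

abbreviation Pr :: "(nat \<Rightarrow> nat) set" where "Pr \<equiv> proper_colorings n E q"

lemma Pr_\<Omega>: "Pr \<subseteq> \<Omega>" by (auto simp: proper_colorings_def \<Omega>_def)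

lemma finite_Pr [simp]: "finite Pr" using finite_subset[OF Pr_\<Omega>] by simp

lemma PrD: "\<sigma> \<in> Pr \<Longrightarrow> u \<in> nb v \<Longrightarrow> \<sigma> u \<noteq> \<sigma> v"
  by (auto simp: proper_colorings_def nb_def)

lemma PrI: "\<sigma> \<in> \<Omega> \<Longrightarrow> (\<And>u v. u \<in> nb v \<Longrightarrow> \<sigma> u \<noteq> \<sigma> v) \<Longrightarrow> \<sigma> \<in> Pr"
  by (auto simp: proper_colorings_def nb_def \<Omega>_def)

definition block :: "nat \<Rightarrow> nat set" where
  "block r = (if r < length es then {src r, tgt r} else if nb (r - length es) = {} then {r - length es} else {})"

definition fibre :: "nat \<Rightarrow> (nat \<Rightarrow> nat) \<Rightarrow> (nat \<Rightarrow> nat) set" where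
  "fibre r \<sigma> = {\<tau> \<in> Pr. \<forall>v. v \<notin> block r \<longrightarrow> \<tau> v = \<sigma> v}"

text \<open>For a proper \<open>\<sigma>\<close>, pairs of different allowed colours are exactly the
  ways to complete \<open>\<sigma>\<close> off the block to a proper colouring. A move is therefore
  uniform on a class of an equivalence relation.\<close>

lemma move_proper:
  assumes r: "r < M" and \<sigma>: "\<sigma> \<in> Pr"
  shows "move r \<sigma> = pmf_of_set (fibre r \<sigma>)"
proof (cases "r < length es")
  case True
  define v where "v = src r"
  define w where "w = tgt r"
  have vw: "w \<in> nb v" "v \<in> nb w" "v \<noteq> w" "v < n" "w < n"
    using edge_at_nb[OF True] nb_irrefl nb_lt unfolding v_def w_def by auto
  let ?A = "off_diag (allowed v w \<sigma>) (allowed w v \<sigma>)" and ?g = "\<lambda>(x, y). \<sigma>(v := x, w := y)"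
  have inj: "inj_on ?g ?A"
  proof (rule inj_onI, clarify)
    fix x y x' y' assume *: "\<sigma>(v := x, w := y) = \<sigma>(v := x', w := y')"
    show "x = x' \<and> y = y'" using fun_cong[OF *, of v] fun_cong[OF *, of w] vw by auto
  qed
  have "?g ` ?A = fibre r \<sigma>"
  proof (intro equalityI subsetI)
    fix \<tau> assume "\<tau> \<in> ?g ` ?A"
    then obtain x y where xy: "x \<in> allowed v w \<sigma>" "y \<in> allowed w v \<sigma>" "x \<noteq> y" "\<tau> = \<sigma>(v := x, w := y)"
      by (auto simp: off_diag_def)
    have "\<tau> \<in> \<Omega>" using xy vw \<sigma> Pr_\<Omega> by (auto simp: allowed_def intro!: \<Omega>_upd)
    moreover have "\<tau> a \<noteq> \<tau> b" if ab: "a \<in> nb b" for a b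
    proof -
      have ba: "b \<in> nb a" "a \<noteq> b" using ab nb_sym nb_irrefl by auto
      have x: "\<sigma> z \<noteq> x" if "z \<in> nb v" "z \<noteq> w" for z using xy(1) that by (auto simp: allowed_def)
      have y: "\<sigma> z \<noteq> y" if "z \<in> nb w" "z \<noteq> v" for z using xy(2) that by (auto simp: allowed_def)
      show ?thesis
        using PrD[OF \<sigma> ab] x[of a] x[of b] y[of a] y[of b] ab ba xy(3,4) vw(3) by auto
    qed
    ultimately have "\<tau> \<in> Pr" by (rule PrI)
    then show "\<tau> \<in> fibre r \<sigma>" using True xy by (auto simp: fibre_def block_def v_def w_def)
  next
    fix \<tau> assume "\<tau> \<in> fibre r \<sigma>"
    then have \<tau>: "\<tau> \<in> Pr" "\<And>z. z \<noteq> v \<Longrightarrow> z \<noteq> w \<Longrightarrow> \<tau> z = \<sigma> z"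
      using True by (auto simp: fibre_def block_def v_def w_def)
    have rng: "\<tau> v \<in> {1..q}" "\<tau> w \<in> {1..q}" 
      using \<Omega>_range[OF subsetD[OF Pr_\<Omega> \<tau>(1)]] vw by blast+
    have "\<tau> v \<in> allowed v w \<sigma>"
    proof -
      have "\<sigma> z \<noteq> \<tau> v" if "z \<in> nb v" "z \<noteq> w" for z
        using PrD[OF \<tau>(1) that(1)] \<tau>(2)[of z] that nb_irrefl[of v] by metis
      then have "\<tau> v \<notin> \<sigma> ` (nb v - {w})" by fastforce
      then show ?thesis using rng by (simp add: allowed_def)
    qed
    moreover have "\<tau> w \<in> allowed w v \<sigma>"
    proof -
      have "\<sigma> z \<noteq> \<tau> w" if "z \<in> nb w" "z \<noteq> v" for z
        using PrD[OF \<tau>(1) that(1)] \<tau>(2)[of z] that nb_irrefl[of w] by metis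
      then have "\<tau> w \<notin> \<sigma> ` (nb w - {v})" by fastforce
      then show ?thesis using rng by (simp add: allowed_def)
    qed
    moreover have "\<tau> v \<noteq> \<tau> w" using PrD[OF \<tau>(1) vw(2)] .
    moreover have "\<tau> = \<sigma>(v := \<tau> v, w := \<tau> w)" using \<tau>(2) by auto
    ultimately show "\<tau> \<in> ?g ` ?A"
      by (intro image_eqI[of _ _ "(\<tau> v, \<tau> w)"]) (auto simp: off_diag_def)
  qed
  then have "bij_betw ?g ?A (fibre r \<sigma>)" using inj by (simp add: bij_betw_def)
  then have "map_pmf ?g (pmf_of_set ?A) = pmf_of_set (fibre r \<sigma>)"
    using allowed_pairs_ne[OF vw(1)] by (intro map_pmf_of_set_bij_betw) auto
  then show ?thesis using True by (simp add: move_def heat_bath_def v_def w_def)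
next
  case notE: False
  define v where "v = r - length es"
  have vn: "v < n" using r notE by (simp add: v_def)
  show ?thesis
  proof (cases "nb v = {}")
    case True
    have inj: "inj_on (\<lambda>c. \<sigma>(v := c)) {1..q}"
      by (rule inj_onI) (metis fun_upd_same)
    have "(\<lambda>c. \<sigma>(v := c)) ` {1..q} = fibre r \<sigma>"
    proof (intro equalityI subsetI)
      fix \<tau> assume "\<tau> \<in> (\<lambda>c. \<sigma>(v := c)) ` {1..q}"
      then obtain c where c: "c \<in> {1..q}" "\<tau> = \<sigma>(v := c)" by blast
      have "\<tau> \<in> \<Omega>" unfolding c(2) using c(1) vn \<sigma> Pr_\<Omega> by (intro \<Omega>_upd) auto
      moreover have "\<tau> a \<noteq> \<tau> b" if ab: "a \<in> nb b" for a b
      proof -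
        have "a \<noteq> v" "b \<noteq> v" using ab True nb_sym[of a b] by auto
        then show ?thesis using PrD[OF \<sigma> ab] c by simp
      qed
      ultimately have "\<tau> \<in> Pr" by (rule PrI)
      then show "\<tau> \<in> fibre r \<sigma>" using True notE c by (auto simp: fibre_def block_def v_def)
    next
      fix \<tau> assume "\<tau> \<in> fibre r \<sigma>"
      then have \<tau>: "\<tau> \<in> Pr" "\<And>z. z \<noteq> v \<Longrightarrow> \<tau> z = \<sigma> z"
        using True notE by (auto simp: fibre_def block_def v_def)
      then have "\<tau> = \<sigma>(v := \<tau> v)" by auto
      moreover have "\<tau> v \<in> {1..q}" using \<tau>(1) Pr_\<Omega> vn by (intro \<Omega>_range) auto
      ultimately show "\<tau> \<in> (\<lambda>c. \<sigma>(v := c)) ` {1..q}" by blast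
    qed
    then have "bij_betw (\<lambda>c. \<sigma>(v := c)) {1..q} (fibre r \<sigma>)" using inj by (simp add: bij_betw_def)
    then have "map_pmf (\<lambda>c. \<sigma>(v := c)) (pmf_of_set {1..q}) = pmf_of_set (fibre r \<sigma>)"
      using q2 by (intro map_pmf_of_set_bij_betw) auto
    then show ?thesis using True notE by (simp add: move_def v_def)
  next
    case False
    then have "fibre r \<sigma> = {\<sigma>}" using notE \<sigma> by (auto simp: fibre_def block_def v_def)
    then show ?thesis using False notE by (simp add: move_def v_def pmf_of_set_singleton)
  qed
qed

lemma fibre_self: "\<sigma> \<in> Pr \<Longrightarrow> \<sigma> \<in> fibre r \<sigma>"
  by (simp add: fibre_def)

lemma finite_fibre [simp]: "finite (fibre r \<sigma>)"
  by (rule finite_subset[of _ Pr]) (auto simp: fibre_def)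

lemma expect_move_proper:
  assumes "r < M" "\<sigma> \<in> Pr"
  shows "expect (move r \<sigma>) f = sum f (fibre r \<sigma>) / real (card (fibre r \<sigma>))"
  unfolding move_proper[OF assms] using fibre_self[OF assms(2), of r]
  by (intro integral_pmf_of_set) auto

text \<open>Every single move replaces \<open>f\<close> by its means over fibres, and the fibres of
  one block partition \<open>Pr\<close>.\<close>

lemma sum_avg: "(\<Sum>\<sigma>\<in>Pr. avg f \<sigma>) = sum f Pr"
proof -
  have "(\<Sum>\<sigma>\<in>Pr. expect (move r \<sigma>) f) = sum f Pr" if "r < M" for r
  proof -
    have "(\<Sum>\<sigma>\<in>Pr. expect (move r \<sigma>) f) = (\<Sum>\<sigma>\<in>Pr. sum f (fibre r \<sigma>) / real (card (fibre r \<sigma>)))"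
      using that by (intro sum.cong refl expect_move_proper)
    also have "\<dots> = sum f Pr"
      by (rule sum_class_mean) (auto simp: fibre_def)
    finally show ?thesis .
  qed
  then have "(\<Sum>r<M. \<Sum>\<sigma>\<in>Pr. expect (move r \<sigma>) f) = real M * sum f Pr" by simp
  moreover have "(\<Sum>\<sigma>\<in>Pr. avg f \<sigma>) = (\<Sum>r<M. \<Sum>\<sigma>\<in>Pr. expect (move r \<sigma>) f) / real M"
    unfolding avg_eq sum_divide_distrib[symmetric] by (subst sum.swap) simp
  ultimately show ?thesis using n_pos by (simp del: of_nat_add)
qed

lemma sum_avg_iter: "(\<Sum>\<sigma>\<in>Pr. avg_iter t f \<sigma>) = sum f Pr"
  by (induction t) (simp_all add: avg_iter_0 avg_iter_Suc sum_avg)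

definition mean :: "((nat \<Rightarrow> nat) \<Rightarrow> real) \<Rightarrow> real" where
  "mean f = sum f Pr / real (card Pr)"

text \<open>By stationarity, \<open>mean f\<close> is also the mean of \<open>avg_iter t f\<close>,
  and that function has Lipschitz constant \<open>D * \<kappa> ^ t\<close> on a space of diameter
  \<open>n\<close>.\<close>

lemma mixing:
  assumes f: "Lip D f" and \<sigma>: "\<sigma> \<in> \<Omega>" and ne: "Pr \<noteq> {}"
  shows "\<bar>avg_iter t f \<sigma> - mean f\<bar> \<le> real n * (D * \<kappa> ^ t)"
proof -
  have c: "0 < real (card Pr)" using ne by (simp add: card_gt_0_iff)
  have "avg_iter t f \<sigma> - mean f = (\<Sum>\<tau>\<in>Pr. avg_iter t f \<sigma> - avg_iter t f \<tau>) / real (card Pr)"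
    using c ne by (simp add: mean_def sum_avg_iter sum_subtractf diff_divide_distrib)
  also have "\<bar>\<dots>\<bar> \<le> (\<Sum>\<tau>\<in>Pr. \<bar>avg_iter t f \<sigma> - avg_iter t f \<tau>\<bar>) / real (card Pr)"
    by (simp add: abs_divide divide_right_mono sum_abs)
  also have "\<dots> \<le> (\<Sum>\<tau>\<in>Pr. real n * (D * \<kappa> ^ t)) / real (card Pr)"
  proof (intro divide_right_mono sum_mono)
    fix \<tau> assume "\<tau> \<in> Pr"
    then show "\<bar>avg_iter t f \<sigma> - avg_iter t f \<tau>\<bar> \<le> real n * (D * \<kappa> ^ t)"
      using Lip_dist[OF Lip_avg_iter[OF f] _ \<sigma>] Pr_\<Omega> by auto
  qed simp
  also have "\<dots> = real n * (D * \<kappa> ^ t)" using c ne by simp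
  finally show ?thesis .
qed

text \<open>The variance is at most the second moment about the starting value
  \<open>f \<sigma>\<close>, and a move changes at most two vertices.\<close>

lemma one_step_variance:
  assumes f: "Lip D f" and \<sigma>: "\<sigma> \<in> \<Omega>"
  shows "avg (\<lambda>\<tau>. (f \<tau>)\<^sup>2) \<sigma> - (avg f \<sigma>)\<^sup>2 \<le> 4 * D\<^sup>2"
proof -
  have D0: "0 \<le> D" using f by (rule Lip_nonneg)
  have d: "\<bar>f \<tau> - f \<sigma>\<bar> \<le> 2 * D" if "\<tau> \<in> set_pmf (kernel \<sigma>)" for \<tau>
  proof -
    have "\<tau> \<in> (\<Union>r\<in>{..<M}. set_pmf (move r \<sigma>))"
      using that by (simp only: kernel_def set_bind_pmf set_uniform_block)
    then obtain r where "r \<in> {..<M}" and r2: "\<tau> \<in> set_pmf (move r \<sigma>)" by (rule UN_E)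
    then have r: "r < M" "\<tau> \<in> set_pmf (move r \<sigma>)" by simp_all
    obtain v w x y where *: "v < n" "w < n" "x \<in> {1..q}" "y \<in> {1..q}"
      "\<tau> = \<sigma>(v := x, w := y) \<or> \<tau> = \<sigma>(v := x) \<or> \<tau> = \<sigma>"
      using set_move(2)[OF r] by blast
    have "\<bar>f (\<sigma>(v := x)) - f \<sigma>\<bar> \<le> D" "\<bar>f (\<sigma>(v := x, w := y)) - f (\<sigma>(v := x))\<bar> \<le> D"
      using LipD[OF f \<sigma> *(1,3)] LipD[OF f \<Omega>_upd[OF \<sigma> *(1,3)] *(2,4)] by auto
    then show ?thesis using *(5) D0 by auto
  qed
  let ?K = "kernel \<sigma>" and ?e = "f \<sigma>"
  have i: "integrable (measure_pmf ?K) g" for g :: "(nat \<Rightarrow> nat) \<Rightarrow> real"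
    by (rule integrable_measure_pmf_finite) simp
  have "expect ?K (\<lambda>\<tau>. (f \<tau> - ?e)\<^sup>2) = expect ?K (\<lambda>\<tau>. (f \<tau>)\<^sup>2 - 2 * ?e * f \<tau> + ?e\<^sup>2)"
    by (intro Bochner_Integration.integral_cong refl) (simp add: power2_diff)
  also have "\<dots> = avg (\<lambda>\<tau>. (f \<tau>)\<^sup>2) \<sigma> - 2 * ?e * avg f \<sigma> + ?e\<^sup>2"
    using i by (simp add: avg_def)
  finally have 1: "expect ?K (\<lambda>\<tau>. (f \<tau> - ?e)\<^sup>2) = avg (\<lambda>\<tau>. (f \<tau>)\<^sup>2) \<sigma> - 2 * ?e * avg f \<sigma> + ?e\<^sup>2" .
  have "expect ?K (\<lambda>\<tau>. (f \<tau> - ?e)\<^sup>2) \<le> expect ?K (\<lambda>_. (2 * D)\<^sup>2)"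
  proof (rule expect_mono_finite)
    fix \<tau> assume "\<tau> \<in> set_pmf ?K"
    then have "\<bar>f \<tau> - ?e\<bar> \<le> \<bar>2 * D\<bar>" using d by fastforce
    then show "(f \<tau> - ?e)\<^sup>2 \<le> (2 * D)\<^sup>2" by (simp only: abs_le_square_iff)
  qed simp
  then have "expect ?K (\<lambda>\<tau>. (f \<tau> - ?e)\<^sup>2) \<le> 4 * D\<^sup>2" by (simp add: power_mult_distrib)
  moreover have "0 \<le> (avg f \<sigma> - ?e)\<^sup>2" by simp
  ultimately show ?thesis unfolding 1 by (simp add: power2_diff algebra_simps)
qed

text \<open>Applying \<open>avg\<close> changes neither the sum of \<open>f\<close> nor that of its
  square over \<open>Pr\<close>. So the squared deviations of \<open>f\<close> exceed those of
  \<open>avg f\<close> exactly by the sum of the one-step variances.\<close>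

lemma variance_step:
  assumes f: "Lip D f"
  shows "(\<Sum>\<sigma>\<in>Pr. (f \<sigma> - c)\<^sup>2) \<le> real (card Pr) * (4 * D\<^sup>2) + (\<Sum>\<sigma>\<in>Pr. (avg f \<sigma> - c)\<^sup>2)"
proof -
  have "(\<Sum>\<sigma>\<in>Pr. (f \<sigma>)\<^sup>2) - (\<Sum>\<sigma>\<in>Pr. (avg f \<sigma>)\<^sup>2) = (\<Sum>\<sigma>\<in>Pr. avg (\<lambda>\<tau>. (f \<tau>)\<^sup>2) \<sigma> - (avg f \<sigma>)\<^sup>2)"
    by (simp add: sum_avg sum_subtractf)
  also have "\<dots> \<le> (\<Sum>\<sigma>\<in>Pr. 4 * D\<^sup>2)"
    using Pr_\<Omega> by (intro sum_mono one_step_variance[OF f]) auto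
  finally have 1: "(\<Sum>\<sigma>\<in>Pr. (f \<sigma>)\<^sup>2) - (\<Sum>\<sigma>\<in>Pr. (avg f \<sigma>)\<^sup>2) \<le> real (card Pr) * (4 * D\<^sup>2)" by simp
  have 2: "(\<Sum>\<sigma>\<in>Pr. (g \<sigma> - c)\<^sup>2) = (\<Sum>\<sigma>\<in>Pr. (g \<sigma>)\<^sup>2) - 2 * c * sum g Pr + real (card Pr) * c\<^sup>2" for g :: "(nat \<Rightarrow> nat) \<Rightarrow> real"
    by (simp add: power2_diff sum.distrib sum_subtractf sum_distrib_left mult_ac)
  show ?thesis unfolding 2 using 1 by (simp add: sum_avg)
qed

text \<open>\<open>variance_step\<close> is iterated along \<open>avg_iter t f\<close>. As the
  Lipschitz constants decay geometrically, the one-step variances add up to at most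
  \<open>4 * D\<^sup>2 / (1 - \<kappa>)\<close> per colouring, and what is left over vanishes by
  \<open>mixing\<close>.\<close>

theorem variance_bound:
  assumes f: "Lip D f" and ne: "Pr \<noteq> {}"
  shows "(\<Sum>\<sigma>\<in>Pr. (f \<sigma> - mean f)\<^sup>2) \<le> real (card Pr) * (4 * (real q)\<^sup>2 * real M * D\<^sup>2)"
proof -
  let ?c = "real (card Pr)"
  have D0: "0 \<le> D" using f by (rule Lip_nonneg)
  have it: "(\<Sum>\<sigma>\<in>Pr. (f \<sigma> - mean f)\<^sup>2) \<le> ?c * (4 * D\<^sup>2 * (\<Sum>s<t. \<kappa> ^ s)) + (\<Sum>\<sigma>\<in>Pr. (avg_iter t f \<sigma> - mean f)\<^sup>2)" for t
  proof (induction t)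
    case (Suc t)
    have "(\<Sum>\<sigma>\<in>Pr. (avg_iter t f \<sigma> - mean f)\<^sup>2) \<le> ?c * (4 * (D * \<kappa> ^ t)\<^sup>2) + (\<Sum>\<sigma>\<in>Pr. (avg_iter (Suc t) f \<sigma> - mean f)\<^sup>2)"
      unfolding avg_iter_Suc by (rule variance_step[OF Lip_avg_iter[OF f]])
    moreover have "?c * (4 * (D * \<kappa> ^ t)\<^sup>2) \<le> ?c * (4 * D\<^sup>2 * \<kappa> ^ t)"
    proof -
      have "\<kappa> ^ t * \<kappa> ^ t \<le> \<kappa> ^ t * 1" using \<kappa>_bounds by (intro mult_left_mono power_le_one) auto
      then have "D\<^sup>2 * (\<kappa> ^ t * \<kappa> ^ t) \<le> D\<^sup>2 * \<kappa> ^ t" by (intro mult_left_mono) auto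
      then show ?thesis by (intro mult_left_mono) (auto simp: power2_eq_square mult_ac)
    qed
    ultimately show ?case using Suc.IH by (simp add: algebra_simps)
  qed (simp add: avg_iter_0)
  have geo: "(\<Sum>s<t. \<kappa> ^ s) \<le> (real q)\<^sup>2 * real M" for t
  proof -
    have "(\<Sum>s<t. \<kappa> ^ s) = (1 - \<kappa> ^ t) / (1 - \<kappa>)" using \<kappa>_bounds by (simp add: sum_gp_strict)
    also have "\<dots> \<le> 1 / (1 - \<kappa>)" using \<kappa>_bounds by (intro divide_right_mono) auto
    also have "\<dots> = (real q)\<^sup>2 * real M" by (simp add: \<kappa>_def)
    finally show ?thesis .
  qed
  have "(\<Sum>\<sigma>\<in>Pr. (f \<sigma> - mean f)\<^sup>2) \<le> ?c * (4 * D\<^sup>2 * ((real q)\<^sup>2 * real M)) + ?c * (real n * (D * \<kappa> ^ t))\<^sup>2" for t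
  proof -
    have "(\<Sum>\<sigma>\<in>Pr. (avg_iter t f \<sigma> - mean f)\<^sup>2) \<le> (\<Sum>\<sigma>\<in>Pr. (real n * (D * \<kappa> ^ t))\<^sup>2)"
    proof (rule sum_mono)
      fix \<sigma> assume "\<sigma> \<in> Pr"
      then have "\<bar>avg_iter t f \<sigma> - mean f\<bar> \<le> real n * (D * \<kappa> ^ t)"
        using mixing[OF f _ ne] Pr_\<Omega> by auto
      then show "(avg_iter t f \<sigma> - mean f)\<^sup>2 \<le> (real n * (D * \<kappa> ^ t))\<^sup>2"
        by (metis abs_ge_zero power2_abs power_mono)
    qed
    moreover have "?c * (4 * D\<^sup>2 * (\<Sum>s<t. \<kappa> ^ s)) \<le> ?c * (4 * D\<^sup>2 * ((real q)\<^sup>2 * real M))"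
      using geo by (intro mult_left_mono) auto
    moreover have "(\<Sum>\<sigma>\<in>Pr. (real n * (D * \<kappa> ^ t))\<^sup>2) = ?c * (real n * (D * \<kappa> ^ t))\<^sup>2" by simp
    ultimately show ?thesis using it[of t] by linarith
  qed
  moreover have "(\<lambda>t. ?c * (4 * D\<^sup>2 * ((real q)\<^sup>2 * real M)) + ?c * (real n * (D * \<kappa> ^ t))\<^sup>2) \<longlonglongrightarrow>
      ?c * (4 * D\<^sup>2 * ((real q)\<^sup>2 * real M)) + ?c * (real n * (D * 0))\<^sup>2"
    using \<kappa>_bounds by (intro tendsto_intros LIMSEQ_realpow_zero)
  ultimately have "(\<Sum>\<sigma>\<in>Pr. (f \<sigma> - mean f)\<^sup>2) \<le> ?c * (4 * D\<^sup>2 * ((real q)\<^sup>2 * real M)) + ?c * (real n * (D * 0))\<^sup>2"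
    by (intro LIMSEQ_le_const) auto
  then show ?thesis by (simp add: mult_ac)
qed

lemma chebyshev:
  assumes f: "Lip D f" and ne: "Pr \<noteq> {}" and a: "0 < a"
  shows "real (card {\<sigma> \<in> Pr. a \<le> \<bar>f \<sigma> - mean f\<bar>}) \<le> real (card Pr) * (4 * (real q)\<^sup>2 * real M * D\<^sup>2 / a\<^sup>2)"
proof -
  have "real (card {\<sigma> \<in> Pr. a \<le> \<bar>f \<sigma> - mean f\<bar>}) * a\<^sup>2 = (\<Sum>\<sigma>\<in>{\<sigma> \<in> Pr. a \<le> \<bar>f \<sigma> - mean f\<bar>}. a\<^sup>2)" by simp
  also have "\<dots> \<le> (\<Sum>\<sigma>\<in>{\<sigma> \<in> Pr. a \<le> \<bar>f \<sigma> - mean f\<bar>}. (f \<sigma> - mean f)\<^sup>2)"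
  proof (rule sum_mono)
    fix \<sigma> assume "\<sigma> \<in> {\<sigma> \<in> Pr. a \<le> \<bar>f \<sigma> - mean f\<bar>}"
    then have "\<bar>a\<bar> \<le> \<bar>f \<sigma> - mean f\<bar>" using a by simp
    then show "a\<^sup>2 \<le> (f \<sigma> - mean f)\<^sup>2" by (simp only: abs_le_square_iff)
  qed
  also have "\<dots> \<le> (\<Sum>\<sigma>\<in>Pr. (f \<sigma> - mean f)\<^sup>2)" by (intro sum_mono2) auto
  also have "\<dots> \<le> real (card Pr) * (4 * (real q)\<^sup>2 * real M * D\<^sup>2)" by (rule variance_bound[OF f ne])
  finally show ?thesis using a by (simp add: field_simps)
qed

end

section \<open>Binomial coefficients near the middle\<close>

text \<open>Consecutive central coefficients have the ratio
  \<open>2 * (2 * m + 1) / (m + 1)\<close>, and the induction then comes down to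
  \<open>4 * m * (m + 1) \<le> (2 * m + 1)\<^sup>2\<close>. Squaring avoids the root of
  \<open>m\<close>.\<close>

lemma central_binomial_sqrt: "1 \<le> m \<Longrightarrow> (16::real) ^ m \<le> 4 * real m * (real ((2 * m) choose m))\<^sup>2"
proof (induction m rule: nat_induct_at_least)
  case base
  show ?case by (simp add: numeral_2_eq_2)
next
  case (Suc m)
  define c where "c = real ((2 * m) choose m)"
  have r: "real (Suc m) * real ((2 * Suc m) choose Suc m) = 2 * (2 * real m + 1) * c"
  proof -
    have "Suc m * ((2 * Suc m) choose Suc m) = (2 * m + 2) * ((2 * m + 1) choose m)"
      using Suc_times_binomial_eq[of "2 * m + 1" m] by (simp add: mult.commute)
    moreover have "(2 * m + 1) choose m = (2 * m + 1) choose (m + 1)"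
      using binomial_symmetric[of m "2 * m + 1"] by simp
    moreover have "Suc m * ((2 * m + 1) choose Suc m) = (2 * m + 1) * ((2 * m) choose m)"
      using Suc_times_binomial_eq[of "2 * m" m] by (simp add: mult.commute)
    ultimately have "Suc m * (Suc m * ((2 * Suc m) choose Suc m)) = (2 * m + 2) * ((2 * m + 1) * ((2 * m) choose m))"
      by (metis (no_types, lifting) Suc_eq_plus1 mult.left_commute)
    then have "Suc m * (Suc m * ((2 * Suc m) choose Suc m)) = Suc m * (2 * (2 * m + 1) * ((2 * m) choose m))"
      by simp
    then have "Suc m * ((2 * Suc m) choose Suc m) = 2 * (2 * m + 1) * ((2 * m) choose m)"
      by (simp only: mult_cancel1) simp
    then show ?thesis unfolding c_def by (metis (mono_tags, opaque_lifting) of_nat_1 of_nat_add of_nat_mult of_nat_numeral)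
  qed
  have "(16::real) ^ Suc m * real (Suc m) = 16 * real (Suc m) * 16 ^ m" by simp
  also have "\<dots> \<le> 16 * real (Suc m) * (4 * real m * c\<^sup>2)"
    using Suc.IH unfolding c_def by (intro mult_left_mono) auto
  also have "\<dots> = 4 * (4 * (4 * (real m * real (Suc m)))) * c\<^sup>2" by simp
  also have "\<dots> \<le> 4 * (4 * (2 * real m + 1)\<^sup>2) * c\<^sup>2"
    by (intro mult_left_mono mult_right_mono) (auto simp: power2_eq_square algebra_simps)
  also have "\<dots> = 4 * (2 * (2 * real m + 1) * c)\<^sup>2" by (simp add: power2_eq_square algebra_simps)
  also have "\<dots> = 4 * real (Suc m) * (real ((2 * Suc m) choose Suc m))\<^sup>2 * real (Suc m)"
    unfolding r[symmetric] by (simp add: power_mult_distrib power2_eq_square)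
  finally show ?case by (simp only: mult_le_cancel_right)
qed

text \<open>An odd middle coefficient is half of the next central one. The root of any
  \<open>n \<ge> Z\<close> is allowed in place of that of \<open>Z\<close>, so that one
  \<open>\<beta>\<close> serves all colourings, whatever their number of free vertices.\<close>

lemma middle_binomial:
  assumes "Z \<le> n" "1 \<le> n"
  shows "(2::real) ^ Z \<le> 2 * sqrt (real n) * real (Z choose (Z div 2))"
proof -
  have sq: "(4::real) ^ m \<le> 2 * sqrt (real m) * real ((2 * m) choose m)" if "1 \<le> m" for m
  proof (rule power2_le_imp_le)
    have "((4::real) ^ m)\<^sup>2 = 16 ^ m" by (simp add: power_mult[symmetric] mult.commute[of m] power_mult)
    then show "((4::real) ^ m)\<^sup>2 \<le> (2 * sqrt (real m) * real ((2 * m) choose m))\<^sup>2"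
      using central_binomial_sqrt[OF that] by (simp add: power_mult_distrib)
  qed simp
  have mono: "2 * sqrt (real m) * x \<le> 2 * sqrt (real n) * x" if "m \<le> n" "0 \<le> x" for m x
    using that by (intro mult_right_mono) auto
  consider "Z = 0" | m where "Z = 2 * m" "1 \<le> m" | m where "Z = 2 * m + 1"
    by (metis One_nat_def Suc_leI dvd_def evenE neq0_conv nat_0_less_mult_iff oddE odd_pos zero_less_mult_pos)
  then show ?thesis
  proof cases
    case 1
    have "1 \<le> sqrt (real n)" using assms by simp
    then have "1 \<le> 2 * sqrt (real n)" by linarith
    then show ?thesis using 1 by simp
  next
    case (2 m)
    then show ?thesis using order_trans[OF sq[OF 2(2)] mono[of m "real ((2 * m) choose m)"]] assms by (simp add: power_mult)
  next
    case (3 m)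
    have "(2 * Suc m) choose Suc m = 2 * ((2 * m + 1) choose m)"
      using binomial_symmetric[of m "2 * m + 1"] by simp
    then have "2 * (4::real) ^ m \<le> 2 * sqrt (real (Suc m)) * real ((2 * m + 1) choose m)"
      using sq[of "Suc m"] by simp
    also have "\<dots> \<le> 2 * sqrt (real n) * real ((2 * m + 1) choose m)" using 3 assms by (intro mono) auto
    finally show ?thesis using 3 by (simp add: power_mult)
  qed
qed

lemma exp_neg_le_one_minus:
  fixes y :: real
  assumes "0 \<le> y" "y \<le> 1 / 2"
  shows "exp (- 2 * y) \<le> 1 - y"
proof -
  have "- y - 2 * y\<^sup>2 \<le> ln (1 - y)" by (rule ln_one_minus_pos_lower_bound) (use assms in auto)
  moreover have "2 * y\<^sup>2 \<le> y" using assms mult_left_mono[of y "1 / 2" y] by (simp add: power2_eq_square)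
  ultimately have "- 2 * y \<le> ln (1 - y)" by linarith
  then have "exp (- 2 * y) \<le> exp (ln (1 - y))" by (simp only: exp_le_cancel_iff)
  then show ?thesis using assms by simp
qed

text \<open>Going down from the middle, the ratio of \<open>Z choose k\<close> to
  \<open>Z choose Suc k\<close> is \<open>(k + 1) / (Z - k)\<close>, and within distance
  \<open>j\<close> this is at least \<open>1 - 4 * j / Z\<close>.\<close>

lemma binomial_below_middle:
  assumes "j \<le> Z div 2" "8 * j \<le> Z" "0 < Z"
  shows "real (Z choose (Z div 2)) * (1 - 4 * real j / real Z) ^ j \<le> real (Z choose (Z div 2 - j))"
proof -
  let ?h = "Z div 2" and ?y = "1 - 4 * real j / real Z"
  have y: "0 \<le> ?y" using assms by (simp add: divide_le_eq)
  have "real (Z choose ?h) * ?y ^ i \<le> real (Z choose (?h - i))" if "i \<le> j" for i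
    using that
  proof (induction i)
    case (Suc i)
    define k where "k = ?h - Suc i"
    have k: "?h - i = Suc k" using Suc.prems assms by (simp add: k_def)
    have kb: "real Z - real k \<le> real Z / 2 + real j + 1" "real Z / 2 - real j - 1 / 2 \<le> real k + 0" 
      using Suc.prems assms unfolding k_def by linarith+
    have "(Suc k) * (Z choose Suc k) = (Z - k) * (Z choose k)"
      by (metis binomial_absorb_comp binomial_absorption mult.commute)
    then have e: "real (Suc k) * real (Z choose Suc k) = (real Z - real k) * real (Z choose k)"
      using k assms(1) by (metis (no_types, lifting) Suc_leD div_le_dividend k_def diff_le_self le_trans of_nat_diff of_nat_mult)
    have pos: "0 < real Z - real k" using k assms unfolding k_def by linarith
    have "?y * (real Z - real k) \<le> real (Suc k)"
    proof -
      have "real Z - real k - real (Suc k) \<le> 2 * real j" using kb(1) assms Suc.prems unfolding k_def by linarith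
      also have "\<dots> = (4 * real j / real Z) * (real Z / 2)" using assms by simp
      also have "\<dots> \<le> (4 * real j / real Z) * (real Z - real k)"
        using k assms unfolding k_def by (intro mult_left_mono) (linarith, simp)
      finally show ?thesis by (simp add: algebra_simps)
    qed
    then have "?y * (real Z - real k) * real (Z choose Suc k) \<le> real (Suc k) * real (Z choose Suc k)"
      by (intro mult_right_mono) auto
    also have "\<dots> = (real Z - real k) * real (Z choose k)" by (rule e)
    finally have "(?y * real (Z choose Suc k)) * (real Z - real k) \<le> real (Z choose k) * (real Z - real k)"
      by (simp only: mult_ac)
    then have "?y * real (Z choose Suc k) \<le> real (Z choose k)" using pos by (simp only: mult_le_cancel_right_pos)
    moreover have "real (Z choose ?h) * ?y ^ Suc i \<le> ?y * real (Z choose Suc k)"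
    proof -
      have "?y * (real (Z choose ?h) * ?y ^ i) \<le> ?y * real (Z choose Suc k)"
        using Suc y k by (intro mult_left_mono) auto
      then show ?thesis by (simp only: power_Suc mult.left_commute)
    qed
    ultimately show ?case unfolding k_def by simp
  qed simp
  from this[of j] show ?thesis by simp
qed

text \<open>At distance \<open>j\<close> from the middle, \<open>j\<close> ratios of
  \<open>1 - 4 * j / Z\<close> multiply to at least \<open>exp (- 8 * j\<^sup>2 / Z)\<close>, and
  the second condition on \<open>x\<close> makes this at least \<open>exp (- a)\<close>. Replacing
  \<open>exp 1\<close> by 4 keeps the constant an integer.\<close>

lemma binomial_near_middle:
  assumes b: "\<bar>real b - real Z / 2\<bar> \<le> x" and x: "8 * (x + 1) \<le> real Z" "8 * (x + 1)\<^sup>2 \<le> real a * real Z"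
    and Z: "Z \<le> n" "1 \<le> n"
  shows "(2::real) ^ Z \<le> 2 * sqrt (real n) * 4 ^ a * real (Z choose b)"
proof -
  let ?h = "Z div 2"
  have x0: "0 \<le> x" using b by linarith
  have x8: "8 * x + 8 \<le> real Z" using x(1) by (simp add: algebra_simps)
  have "real b \<le> real Z" "0 < real Z" using b x8 x0 by (simp_all add: abs_le_iff)
  then have bZ: "b \<le> Z" and Z0: "0 < Z" by simp_all
  \<comment> \<open>By symmetry it suffices to go below the middle. Rounding in
    \<open>Z div 2\<close> costs the \<open>+ 1\<close> in \<open>jx\<close>.\<close>
  define c where "c = min b (Z - b)"
  define j where "j = ?h - c"
  have ch: "c \<le> ?h" using bZ unfolding c_def by linarith
  have jx: "real j \<le> x + 1" using b bZ unfolding j_def c_def min_def by (auto split: if_splits)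
  have cb: "Z choose c = Z choose b" using bZ binomial_symmetric[OF bZ] by (simp add: c_def min_def)
  have "8 * real j \<le> real Z" using jx x8 by (simp add: algebra_simps)
  then have j8: "8 * j \<le> Z" by linarith
  let ?y = "4 * real j / real Z"
  have y: "0 \<le> ?y" "?y \<le> 1 / 2" using j8 Z0 by (auto simp: divide_le_eq)
  have "real j * real j \<le> (x + 1)\<^sup>2" unfolding power2_eq_square using jx x0 by (intro mult_mono) auto
  then have "8 * real j * real j / real Z \<le> real a" using x(2) Z0 by (simp add: divide_le_eq)
  then have "exp (- real a) \<le> exp (- 2 * ?y * real j)" by simp
  also have "\<dots> = exp (- 2 * ?y) ^ j" by (simp add: exp_of_nat_mult[symmetric] mult_ac)
  also have "\<dots> \<le> (1 - ?y) ^ j" by (intro power_mono exp_neg_le_one_minus y) simp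
  finally have e: "exp (- real a) \<le> (1 - ?y) ^ j" .
  have "exp (real a) \<le> 4 ^ a"
  proof -
    have "exp (real a) = exp 1 ^ a" by (simp add: exp_of_nat_mult[symmetric])
    also have "\<dots> \<le> 4 ^ a" using exp_le by (intro power_mono) auto
    finally show ?thesis .
  qed
  then have "1 \<le> 4 ^ a * exp (- real a)" by (simp add: exp_minus field_simps)
  also have "\<dots> \<le> 4 ^ a * (1 - ?y) ^ j" using e by simp
  finally have 1: "1 \<le> 4 ^ a * (1 - ?y) ^ j" .
  have "(2::real) ^ Z \<le> 2 * sqrt (real n) * real (Z choose ?h)" by (rule middle_binomial[OF Z])
  also have "\<dots> \<le> 2 * sqrt (real n) * real (Z choose ?h) * (4 ^ a * (1 - ?y) ^ j)"
    using mult_left_mono[OF 1, of "2 * sqrt (real n) * real (Z choose ?h)"] by simp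
  also have "\<dots> = 2 * sqrt (real n) * 4 ^ a * (real (Z choose ?h) * (1 - ?y) ^ j)" by (simp only: mult_ac)
  also have "\<dots> \<le> 2 * sqrt (real n) * 4 ^ a * real (Z choose (?h - j))"
    using binomial_below_middle[of j Z] j8 Z0 by (intro mult_left_mono) (auto simp: j_def)
  also have "?h - j = c" using ch by (simp add: j_def)
  finally show ?thesis by (simp add: cb)
qed

context colouring_graph begin

section \<open>Equitable colourings exist\<close>

text \<open>Greedy colouring in the order of the vertices, as \<open>\<Delta> < q\<close>.\<close>

lemma Pr_nonempty: "Pr \<noteq> {}"
proof -
  have "\<exists>\<sigma>\<in>\<Omega>. \<forall>u<k. \<forall>v<k. u \<in> nb v \<longrightarrow> \<sigma> u \<noteq> \<sigma> v" if "k \<le> n" for k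
    using that
  proof (induction k)
    case 0
    then show ?case using const_\<Omega> by auto
  next
    case (Suc k)
    then obtain \<sigma> where \<sigma>: "\<sigma> \<in> \<Omega>" "\<forall>u<k. \<forall>v<k. u \<in> nb v \<longrightarrow> \<sigma> u \<noteq> \<sigma> v" by auto
    have "card (\<sigma> ` nb k) \<le> \<Delta>" using card_image_le[of "nb k" \<sigma>] card_nb_le[of k] by simp
    then have "card (\<sigma> ` nb k) < card {1..q}" using \<Delta>_pos q_ge by simp
    then have "\<not> {1..q} \<subseteq> \<sigma> ` nb k" using card_mono[of "\<sigma> ` nb k" "{1..q}"] by auto
    then obtain c where c: "c \<in> {1..q}" "c \<notin> \<sigma> ` nb k" by blast
    have "(\<sigma>(k := c)) u \<noteq> (\<sigma>(k := c)) v" if "u < Suc k" "v < Suc k" "u \<in> nb v" for u v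
    proof -
      have "v \<in> nb u" "u \<noteq> v" using that nb_sym nb_irrefl by auto
      then show ?thesis using that c(2) \<sigma>(2) by (auto simp: less_Suc_eq)
    qed
    moreover have "\<sigma>(k := c) \<in> \<Omega>" using \<sigma>(1) c(1) Suc.prems by (intro \<Omega>_upd) auto
    ultimately show ?case by blast
  qed
  from this[of n] obtain \<sigma> where \<sigma>: "\<sigma> \<in> \<Omega>" "\<forall>u<n. \<forall>v<n. u \<in> nb v \<longrightarrow> \<sigma> u \<noteq> \<sigma> v" by auto
  have "\<sigma> \<in> Pr" by (rule PrI) (use \<sigma> nb_lt in blast)+
  then show ?thesis by blast
qed

abbreviation cls where "cls \<equiv> color_class n"
definition csize :: "(nat \<Rightarrow> nat) \<Rightarrow> nat \<Rightarrow> nat" where "csize \<sigma> i = card (color_class n \<sigma> i)"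

lemma finite_class [simp]: "finite (color_class n \<sigma> i)" by (simp add: color_class_def)

lemma sum_csize: "\<sigma> \<in> \<Omega> \<Longrightarrow> (\<Sum>i\<in>{1..q}. csize \<sigma> i) = n"
proof -
  assume \<sigma>: "\<sigma> \<in> \<Omega>"
  have "(\<Sum>i\<in>{1..q}. csize \<sigma> i) = card (\<Union>i\<in>{1..q}. color_class n \<sigma> i)"
    unfolding csize_def by (intro card_UN_disjoint[symmetric]) (auto simp: color_class_def)
  also have "(\<Union>i\<in>{1..q}. color_class n \<sigma> i) = {..<n}"
    using \<Omega>_range[OF \<sigma>] by (auto simp: color_class_def)
  finally show ?thesis by simp
qed

text \<open>The auxiliary digraph on the colour classes known from proofs of the Hajnal-Szemeredi
  theorem.\<close>

definition movable :: "(nat \<Rightarrow> nat) \<Rightarrow> (nat \<times> nat) set" where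
  "movable \<sigma> = {(i, j). i \<in> {1..q} \<and> j \<in> {1..q} \<and> i \<noteq> j \<and> (\<exists>v<n. \<sigma> v = i \<and> (\<forall>u\<in>nb v. \<sigma> u \<noteq> j))}"

definition energy :: "(nat \<Rightarrow> nat) \<Rightarrow> nat" where "energy \<sigma> = (\<Sum>i\<in>{1..q}. (csize \<sigma> i)\<^sup>2)"

lemma move_vertex:
  assumes \<sigma>: "\<sigma> \<in> Pr" and v: "v < n" "\<forall>u\<in>nb v. \<sigma> u \<noteq> j" and j: "j \<in> {1..q}" "\<sigma> v \<noteq> j"
  shows "\<sigma>(v := j) \<in> Pr" and "csize (\<sigma>(v := j)) j = csize \<sigma> j + 1" and "csize \<sigma> (\<sigma> v) = csize (\<sigma>(v := j)) (\<sigma> v) + 1"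
    and "c \<noteq> j \<Longrightarrow> c \<noteq> \<sigma> v \<Longrightarrow> csize (\<sigma>(v := j)) c = csize \<sigma> c"
proof -
  show "\<sigma>(v := j) \<in> Pr"
  proof (rule PrI)
    show "\<sigma>(v := j) \<in> \<Omega>" using \<sigma> Pr_\<Omega> v j by (intro \<Omega>_upd) auto
    fix a b assume ab: "a \<in> nb b"
    then have "b \<in> nb a" "a \<noteq> b" using nb_sym nb_irrefl by auto
    then show "(\<sigma>(v := j)) a \<noteq> (\<sigma>(v := j)) b" using PrD[OF \<sigma> ab] v(2) ab by auto
  qed
  have "color_class n (\<sigma>(v := j)) j = insert v (color_class n \<sigma> j)" "v \<notin> color_class n \<sigma> j"
    using v j by (auto simp: color_class_def)
  then show "csize (\<sigma>(v := j)) j = csize \<sigma> j + 1" by (simp add: csize_def)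
  have "color_class n \<sigma> (\<sigma> v) = insert v (color_class n (\<sigma>(v := j)) (\<sigma> v))" "v \<notin> color_class n (\<sigma>(v := j)) (\<sigma> v)"
    using v j by (auto simp: color_class_def)
  then show "csize \<sigma> (\<sigma> v) = csize (\<sigma>(v := j)) (\<sigma> v) + 1" by (simp add: csize_def)
  assume "c \<noteq> j" "c \<noteq> \<sigma> v"
  then have "color_class n (\<sigma>(v := j)) c = color_class n \<sigma> c" by (auto simp: color_class_def)
  then show "csize (\<sigma>(v := j)) c = csize \<sigma> c" by (simp add: csize_def)
qed

lemma energy_split:
  assumes "a \<in> {1..q}" "b \<in> {1..q}" "a \<noteq> b"
  shows "energy \<sigma> = (csize \<sigma> a)\<^sup>2 + (csize \<sigma> b)\<^sup>2 + (\<Sum>i\<in>{1..q} - {a, b}. (csize \<sigma> i)\<^sup>2)"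
proof -
  have "energy \<sigma> = (csize \<sigma> a)\<^sup>2 + (\<Sum>i\<in>{1..q} - {a}. (csize \<sigma> i)\<^sup>2)"
    unfolding energy_def by (rule sum.remove) (use assms in auto)
  also have "(\<Sum>i\<in>{1..q} - {a}. (csize \<sigma> i)\<^sup>2) = (csize \<sigma> b)\<^sup>2 + (\<Sum>i\<in>{1..q} - {a} - {b}. (csize \<sigma> i)\<^sup>2)"
    by (rule sum.remove) (use assms in auto)
  also have "{1..q} - {a} - {b} = {1..q} - {a, b}" by blast
  finally show ?thesis by simp
qed

text \<open>
  Along a shortest chain of movable classes, moving one vertex of the last step either lowers the energy or
  keeps it and shortens the chain.
\<close>

lemma chain_lowers_energy:
  "\<sigma> \<in> Pr \<Longrightarrow> (i, j) \<in> movable \<sigma> ^^ k \<Longrightarrow> csize \<sigma> j + 2 \<le> csize \<sigma> i \<Longrightarrow> \<exists>\<tau>\<in>Pr. energy \<tau> < energy \<sigma>"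
proof (induction k arbitrary: \<sigma> i j rule: less_induct)
  case (less k)
  note \<sigma> = less.prems(1)
  obtain f where f: "f 0 = i" "f k = j" "\<And>t. t < k \<Longrightarrow> (f t, f (Suc t)) \<in> movable \<sigma>"
    using less.prems(2) by (auto simp: relpow_fun_conv)
  have pre: "(i, f t) \<in> movable \<sigma> ^^ t" if "t \<le> k" for t
    using f that by (auto simp: relpow_fun_conv intro!: exI[of _ f])
  have "k \<noteq> 0" using less.prems(2,3) by (intro notI) auto
  then obtain k' where k': "k = Suc k'" by (cases k) auto
  define c where "c = f k'"
  have cj: "(c, j) \<in> movable \<sigma>" using f(3)[of k'] f(2) k' by (simp add: c_def)
  then obtain v where v: "v < n" "\<sigma> v = c" "\<forall>u\<in>nb v. \<sigma> u \<noteq> j" and cq: "c \<in> {1..q}" "j \<in> {1..q}" "c \<noteq> j"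
    by (auto simp: movable_def)
  define \<tau> where "\<tau> = \<sigma>(v := j)"
  have \<tau>: "\<tau> \<in> Pr" "csize \<tau> j = csize \<sigma> j + 1" "csize \<sigma> c = csize \<tau> c + 1" "\<And>a. a \<noteq> j \<Longrightarrow> a \<noteq> c \<Longrightarrow> csize \<tau> a = csize \<sigma> a"
    using move_vertex[OF \<sigma> v(1,3) cq(2)] v(2) cq(3) by (auto simp: \<tau>_def)
  have rest: "(\<Sum>a\<in>{1..q} - {c, j}. (csize \<tau> a)\<^sup>2) = (\<Sum>a\<in>{1..q} - {c, j}. (csize \<sigma> a)\<^sup>2)"
    using \<tau>(4) by (intro sum.cong) auto
  show ?case
  proof (cases "csize \<sigma> j + 2 \<le> csize \<sigma> c")
    case True
    obtain d where d: "csize \<sigma> c = csize \<sigma> j + 2 + d" using True by (metis le_Suc_ex)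
    have "csize \<tau> c = csize \<sigma> j + 1 + d" using \<tau>(3) d by simp
    then have "energy \<tau> < energy \<sigma>"
      unfolding energy_split[OF cq] rest \<tau>(2) d by (simp add: power2_eq_square algebra_simps)
    then show ?thesis using \<tau>(1) by blast
  next
    case False
    then have ic: "i \<noteq> c" "i \<noteq> j" using less.prems(3) by auto
    show ?thesis
    \<comment> \<open>If \<open>c\<close> is no larger than \<open>j\<close>, the chain without its
      last step is still unbalanced. Otherwise \<open>c\<close> has exactly one vertex more than
      \<open>j\<close>, and moving \<open>v\<close> interchanges the two sizes and keeps the
      energy.\<close>
    proof (cases "csize \<sigma> c \<le> csize \<sigma> j")
      case True
      then show ?thesis using less.IH[of k' \<sigma> i c] pre[of k'] \<sigma> less.prems(3) k' c_def by simp
    next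
      case not_le: False
      then have cs: "csize \<sigma> c = csize \<sigma> j + 1" using False by simp
      have en: "energy \<tau> = energy \<sigma>"
        unfolding energy_split[OF cq] rest using \<tau>(2,3) cs by simp
      show ?thesis
      proof (cases "\<exists>t<k. f t = j")
        case True
        then obtain t where "t < k" "f t = j" by blast
        then show ?thesis using less.IH[of t \<sigma> i j] pre[of t] \<sigma> less.prems(3) by simp
      next
        case noj: False
        show ?thesis
        proof (cases "\<exists>t<k'. f t = c")
          case True
          then obtain t where t: "t < k'" "f t = c" by blast
          then have "(i, j) \<in> movable \<sigma> ^^ Suc t" using pre[of t] cj k' by (auto intro: relcompI)
          then show ?thesis using less.IH[of "Suc t" \<sigma> i j] t k' \<sigma> less.prems(3) by simp
        next
          case noc: False
          \<comment> \<open>The first \<open>k'\<close> steps survive the move of \<open>v\<close>: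
            no source is \<open>c\<close>, the class that lost \<open>v\<close>, and no target is
            \<open>j\<close>, the class that gained it. Since \<open>c\<close> now has the old size
            of \<open>j\<close>, the shorter chain from \<open>i\<close> to \<open>c\<close> is
            unbalanced in \<open>\<tau>\<close>.\<close>
          have "(f t, f (Suc t)) \<in> movable \<tau>" if t: "t < k'" for t
          proof -
            obtain w where w: "w < n" "\<sigma> w = f t" "\<forall>u\<in>nb w. \<sigma> u \<noteq> f (Suc t)" "f t \<in> {1..q}" "f (Suc t) \<in> {1..q}" "f t \<noteq> f (Suc t)"
              using f(3)[of t] t k' by (auto simp: movable_def)
            have "f t \<noteq> c" using noc t by blast
            then have "w \<noteq> v" using w(2) v(2) by auto
            moreover have "f (Suc t) \<noteq> j" using noj t k' by auto
            ultimately show ?thesis using w by (auto simp: movable_def \<tau>_def)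
          qed
          then have "(i, c) \<in> movable \<tau> ^^ k'"
            unfolding relpow_fun_conv using f(1) c_def by (intro exI[of _ f]) auto
          moreover have "csize \<tau> c + 2 \<le> csize \<tau> i"
            using \<tau>(3) \<tau>(4)[of i] ic cs less.prems(3) by simp
          ultimately obtain \<rho> where "\<rho> \<in> Pr" "energy \<rho> < energy \<tau>"
            using less.IH[of k' \<tau> i c] \<tau>(1) k' by auto
          then show ?thesis using en by auto
        qed
      qed
    qed
  qed
qed

abbreviation Eq :: "(nat \<Rightarrow> nat) set" where "Eq \<equiv> equitable_colorings n E q"

lemma Eq_Pr: "Eq \<subseteq> Pr" by (auto simp: equitable_colorings_def)

text \<open>In a proper colouring of least energy, let \<open>A\<close> be the classes from which
  some smallest class, of size \<open>s\<close>, can be reached, and \<open>B\<close> the others.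
  Every vertex in \<open>B\<close> has a neighbour in each class of \<open>A\<close>. If some class
  had \<open>s + 2\<close> vertices, counting the edges between the two parts would give
  \<open>card B < \<Delta>\<close>, while a single vertex in \<open>B\<close> gives
  \<open>card A \<le> \<Delta>\<close>. Together this contradicts
  \<open>2 * \<Delta> \<le> q\<close>.\<close>

lemma Eq_nonempty: "Eq \<noteq> {}"
proof -
  obtain \<sigma> where \<sigma>: "\<sigma> \<in> Pr" and min: "\<And>\<tau>. \<tau> \<in> Pr \<Longrightarrow> energy \<sigma> \<le> energy \<tau>"
    using ex_min_if_finite[of "energy ` Pr"] Pr_nonempty by (metis (no_types, lifting) arg_min_if_finite(1) arg_min_least finite_Pr)
  have "csize \<sigma> i \<le> csize \<sigma> j + 1" if ij: "i \<in> {1..q}" "j \<in> {1..q}" for i j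
  proof (rule ccontr)
    assume "\<not> csize \<sigma> i \<le> csize \<sigma> j + 1"
    define s where "s = Min (csize \<sigma> ` {1..q})"
    have s: "s \<le> csize \<sigma> a" if "a \<in> {1..q}" for a using that by (auto simp: s_def)
    have "s \<in> csize \<sigma> ` {1..q}" unfolding s_def using ij by (intro Min_in) auto
    then obtain a0 where a0: "a0 \<in> {1..q}" "csize \<sigma> a0 = s" by auto
    have i2: "s + 2 \<le> csize \<sigma> i" using \<open>\<not> csize \<sigma> i \<le> csize \<sigma> j + 1\<close> s[OF ij(2)] by linarith
    define A where "A = {a \<in> {1..q}. \<exists>b\<in>{1..q}. csize \<sigma> b = s \<and> (a, b) \<in> (movable \<sigma>)\<^sup>*}"
    define B where "B = {1..q} - A"
    \<comment> \<open>A larger class in \<open>A\<close> would start an unbalanced chain, against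
      the least energy.\<close>
    have Aup: "csize \<sigma> a \<le> s + 1" if aA: "a \<in> A" for a
    proof (rule ccontr)
      assume n: "\<not> csize \<sigma> a \<le> s + 1"
      obtain b where b: "csize \<sigma> b = s" "(a, b) \<in> (movable \<sigma>)\<^sup>*" using aA unfolding A_def by blast
      then obtain k where "(a, b) \<in> movable \<sigma> ^^ k" using rtrancl_imp_relpow by blast
      then obtain \<tau> where "\<tau> \<in> Pr" "energy \<tau> < energy \<sigma>"
        using chain_lowers_energy[OF \<sigma>] n b by fastforce
      then show False using min[of \<tau>] by simp
    qed
    have a0A: "a0 \<in> A" using a0 by (auto simp: A_def)
    have iB: "i \<in> B" using Aup[of i] i2 ij by (auto simp: B_def)
    have B1: "s + 1 \<le> csize \<sigma> b" if "b \<in> B" for b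
    proof (rule ccontr)
      assume "\<not> s + 1 \<le> csize \<sigma> b"
      then have "csize \<sigma> b = s" using s[of b] that by (auto simp: B_def)
      then have "b \<in> A" using that by (auto simp: A_def B_def)
      then show False using that by (simp add: B_def)
    qed
    have fin: "finite A" "finite B" by (auto simp: A_def B_def)
    have nbA: "\<exists>u\<in>nb y. \<sigma> u = a" if y: "y < n" "\<sigma> y \<in> B" and a: "a \<in> A" for y a
    proof (rule ccontr)
      assume "\<not> (\<exists>u\<in>nb y. \<sigma> u = a)"
      then have "(\<sigma> y, a) \<in> movable \<sigma>" using y a by (auto simp: movable_def A_def B_def)
      moreover obtain b where "b \<in> {1..q}" "csize \<sigma> b = s" "(a, b) \<in> (movable \<sigma>)\<^sup>*" using a unfolding A_def by blast
      ultimately have "\<sigma> y \<in> A" using y by (auto simp: A_def B_def intro: converse_rtrancl_into_rtrancl)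
      then show False using y by (simp add: B_def)
    qed
    define VA where "VA = {v\<in>{..<n}. \<sigma> v \<in> A}"
    define VB where "VB = {v\<in>{..<n}. \<sigma> v \<in> B}"
    have cardV: "card {v\<in>{..<n}. \<sigma> v \<in> C} = (\<Sum>a\<in>C. csize \<sigma> a)" if "finite C" for C
    proof -
      have "{v\<in>{..<n}. \<sigma> v \<in> C} = (\<Union>a\<in>C. color_class n \<sigma> a)" by (auto simp: color_class_def)
      then show ?thesis unfolding csize_def using that
        by (simp only:) (intro card_UN_disjoint, auto simp: color_class_def)
    qed
    have "card VA \<le> (\<Sum>a\<in>A. s + 1)" unfolding VA_def cardV[OF fin(1)] by (rule sum_mono) (rule Aup)
    then have VA: "card VA \<le> card A * (s + 1)" by simp
    \<comment> \<open>Class \<open>i\<close> supplies the surplus 1 that makes the final inequality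
      strict.\<close>
    have "(\<Sum>a\<in>B. s + 1) + 1 \<le> (\<Sum>a\<in>B. csize \<sigma> a)"
    proof -
      have "(\<Sum>a\<in>B. s + 1) + 1 = (s + 1) + 1 + (\<Sum>a\<in>B - {i}. s + 1)"
        using iB fin by (subst sum.remove[of B i]) auto
      also have "\<dots> \<le> csize \<sigma> i + (\<Sum>a\<in>B - {i}. csize \<sigma> a)"
        using i2 B1 by (intro add_mono sum_mono) auto
      also have "\<dots> = (\<Sum>a\<in>B. csize \<sigma> a)" using iB fin by (subst sum.remove[of B i]) auto
      finally show ?thesis .
    qed
    then have VB: "card B * (s + 1) + 1 \<le> card VB" unfolding VB_def cardV[OF fin(2)] by simp
    then obtain y where y: "y \<in> VB" by (metis card.empty equals0I not_one_le_zero add_leD2)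
    have AD: "card A \<le> \<Delta>"
    proof -
      have "A \<subseteq> \<sigma> ` nb y" using nbA y by (auto simp: VB_def image_iff)
      then have "card A \<le> card (\<sigma> ` nb y)" by (intro card_mono) auto
      also have "\<dots> \<le> card (nb y)" by (rule card_image_le) simp
      finally show ?thesis using card_nb_le[of y] by simp
    qed
    have "card A * card VB = (\<Sum>y\<in>VB. card A)" by simp
    also have "\<dots> \<le> (\<Sum>y\<in>VB. card (nb y \<inter> VA))"
    proof (rule sum_mono)
      fix y assume y: "y \<in> VB"
      have "A \<subseteq> \<sigma> ` (nb y \<inter> VA)"
      proof
        fix a assume a: "a \<in> A"
        then obtain u where "u \<in> nb y" "\<sigma> u = a" using nbA y by (auto simp: VB_def)
        then show "a \<in> \<sigma> ` (nb y \<inter> VA)" using a nb_lt by (auto simp: VA_def)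
      qed
      then have "card A \<le> card (\<sigma> ` (nb y \<inter> VA))" by (intro card_mono) auto
      also have "\<dots> \<le> card (nb y \<inter> VA)" by (rule card_image_le) simp
      finally show "card A \<le> card (nb y \<inter> VA)" .
    qed
    also have "\<dots> = (\<Sum>y\<in>VB. \<Sum>x\<in>VA. of_bool (x \<in> nb y))"
    proof (intro sum.cong refl)
      fix y
      have "nb y \<inter> VA = {x \<in> VA. x \<in> nb y}" by auto
      then show "card (nb y \<inter> VA) = (\<Sum>x\<in>VA. of_bool (x \<in> nb y))"
        using sum.inter_filter[of VA "\<lambda>_. 1::nat" "\<lambda>x. x \<in> nb y"] by (simp add: VA_def of_bool_def)
    qed
    also have "\<dots> = (\<Sum>x\<in>VA. \<Sum>y\<in>VB. of_bool (x \<in> nb y))" by (rule sum.swap)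
    also have "\<dots> \<le> (\<Sum>x\<in>VA. \<Delta>)"
    proof (rule sum_mono)
      fix x
      have "(\<Sum>y\<in>VB. of_bool (x \<in> nb y)) = card {y \<in> VB. x \<in> nb y}"
        using sum.inter_filter[of VB "\<lambda>_. 1::nat" "\<lambda>y. x \<in> nb y"] by (simp add: VB_def of_bool_def)
      also have "\<dots> \<le> card (nb x)" using nb_sym by (intro card_mono) auto
      finally show "(\<Sum>y\<in>VB. of_bool (x \<in> nb y)) \<le> \<Delta>" using card_nb_le[of x] by simp
    qed
    also have "\<dots> \<le> \<Delta> * (card A * (s + 1))" using VA by (simp add: mult.commute)
    finally have "card A * card VB \<le> card A * (\<Delta> * (s + 1))" by (simp only: mult.left_commute[of \<Delta>])
    moreover have "0 < card A" using a0A fin by (auto simp: card_gt_0_iff)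
    ultimately have "card VB \<le> \<Delta> * (s + 1)" by (rule mult_left_le_imp_le)
    then have "card B * (s + 1) < \<Delta> * (s + 1)" using VB by linarith
    then have "card B < \<Delta>" by (rule mult_right_less_imp_less) simp
    moreover have "card A + card B = q"
    proof -
      have "card A + card B = card (A \<union> B)" using fin by (intro card_Un_disjoint[symmetric]) (auto simp: B_def)
      also have "A \<union> B = {1..q}" by (auto simp: A_def B_def)
      finally show ?thesis by simp
    qed
    ultimately show False using AD q_ge by simp
  qed
  then have "\<bar>int (csize \<sigma> i) - int (csize \<sigma> j)\<bar> \<le> 1" if "i \<in> {1..q}" "j \<in> {1..q}" for i j
    using that by (smt (verit) of_nat_1 of_nat_add of_nat_le_iff)
  then have "\<sigma> \<in> Eq" using \<sigma> unfolding equitable_colorings_def csize_def[symmetric] by blast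
  then show ?thesis by blast
qed

end

context colouring_graph begin

section \<open>Equitable colourings have polynomial density\<close>

lemma \<Delta>_lt_q: "\<Delta> + 1 \<le> q" using \<Delta>_pos q_ge by simp

text \<open>Recolouring \<open>u\<close> affects only the terms of \<open>u\<close> and of its
  neighbours, which are at most \<open>\<Delta> + 1 \<le> q\<close> in number.\<close>

lemma Lip_local_sum:
  assumes range: "\<And>v \<sigma>. 0 \<le> \<phi> v \<sigma> \<and> \<phi> v \<sigma> \<le> (1::real)"
    and loc: "\<And>v u \<sigma> c. u \<noteq> v \<Longrightarrow> u \<notin> nb v \<Longrightarrow> \<phi> v (\<sigma>(u := c)) = \<phi> v \<sigma>"
  shows "Lip (real q) (\<lambda>\<sigma>. \<Sum>v<n. \<phi> v \<sigma>)"
  unfolding Lip_def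
proof (intro ballI allI impI)
  fix \<sigma> u c assume u: "u < n"
  have "\<bar>(\<Sum>v<n. \<phi> v (\<sigma>(u := c))) - (\<Sum>v<n. \<phi> v \<sigma>)\<bar> \<le> (\<Sum>v<n. \<bar>\<phi> v (\<sigma>(u := c)) - \<phi> v \<sigma>\<bar>)"
    unfolding sum_subtractf[symmetric] by (rule sum_abs)
  also have "\<dots> = (\<Sum>v\<in>insert u (nb u). \<bar>\<phi> v (\<sigma>(u := c)) - \<phi> v \<sigma>\<bar>)"
  proof (rule sum.mono_neutral_right)
    show "insert u (nb u) \<subseteq> {..<n}" using u nb_lt by auto
    show "\<forall>v\<in>{..<n} - insert u (nb u). \<bar>\<phi> v (\<sigma>(u := c)) - \<phi> v \<sigma>\<bar> = 0"
      using loc nb_sym by auto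
  qed simp
  also have "\<dots> \<le> (\<Sum>v\<in>insert u (nb u). 1)"
  proof (rule sum_mono)
    fix v
    show "\<bar>\<phi> v (\<sigma>(u := c)) - \<phi> v \<sigma>\<bar> \<le> 1" using range[of v "\<sigma>(u := c)"] range[of v \<sigma>] by linarith
  qed
  also have "\<dots> \<le> real q" using nb_irrefl[of u] card_nb_le[of u] \<Delta>_lt_q by simp
  finally show "\<bar>(\<Sum>v<n. \<phi> v (\<sigma>(u := c))) - (\<Sum>v<n. \<phi> v \<sigma>)\<bar> \<le> real q" .
qed

definition recolour :: "(nat \<Rightarrow> nat) \<Rightarrow> (nat \<Rightarrow> nat) \<Rightarrow> nat \<Rightarrow> nat" where
  "recolour p \<sigma> = restrict (p \<circ> \<sigma>) {..<n}"

lemma bij_recolour: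
  assumes p: "bij_betw p {1..q} {1..q}"
  shows "bij_betw (recolour p) Pr Pr"
proof -
  have inj: "inj_on p {1..q}" and im: "p ` {1..q} = {1..q}" using p by (auto simp: bij_betw_def)
  have rec: "recolour p \<sigma> \<in> Pr" if \<sigma>: "\<sigma> \<in> Pr" for \<sigma>
  proof (rule PrI)
    have r: "\<sigma> v \<in> {1..q}" if "v < n" for v using \<Omega>_range[OF subsetD[OF Pr_\<Omega> \<sigma>] that] .
    then show "recolour p \<sigma> \<in> \<Omega>" using im by (auto simp: recolour_def \<Omega>_def simp del: atLeastAtMost_iff)
    fix u v assume uv: "u \<in> nb v"
    have "p (\<sigma> u) \<noteq> p (\<sigma> v)"
      using PrD[OF \<sigma> uv] inj r[OF nb_lt(1)[OF uv]] r[OF nb_lt(2)[OF uv]] by (auto dest: inj_onD)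
    then show "recolour p \<sigma> u \<noteq> recolour p \<sigma> v" using nb_lt[OF uv] by (simp add: recolour_def)
  qed
  have "inj_on (recolour p) Pr"
  proof (rule inj_onI, rule ext)
    fix \<sigma> \<tau> v assume *: "\<sigma> \<in> Pr" "\<tau> \<in> Pr" "recolour p \<sigma> = recolour p \<tau>"
    have \<Omega>: "\<sigma> \<in> \<Omega>" "\<tau> \<in> \<Omega>" using * Pr_\<Omega> by auto
    show "\<sigma> v = \<tau> v"
    proof (cases "v < n")
      case True
      then have "p (\<sigma> v) = p (\<tau> v)" using fun_cong[OF *(3), of v] by (simp add: recolour_def)
      then show ?thesis using inj \<Omega>_range[OF \<Omega>(1) True] \<Omega>_range[OF \<Omega>(2) True] by (auto dest: inj_onD)
    next
      case False
      then show ?thesis using \<Omega> by (simp add: \<Omega>_def PiE_iff extensional_def)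
    qed
  qed
  moreover have "recolour p ` Pr \<subseteq> Pr" using rec by auto
  then have "recolour p ` Pr = Pr" using calculation by (intro card_subset_eq) (auto simp: card_image)
  ultimately show ?thesis by (simp add: bij_betw_def)
qed

lemma mean_recolour: "bij_betw p {1..q} {1..q} \<Longrightarrow> mean (\<lambda>\<sigma>. f (recolour p \<sigma>)) = mean f"
  unfolding mean_def by (simp add: sum.reindex_bij_betw[OF bij_recolour])

lemma mean_sum: "finite A \<Longrightarrow> mean (\<lambda>\<sigma>. \<Sum>v\<in>A. f v \<sigma>) = (\<Sum>v\<in>A. mean (f v))"
  unfolding mean_def sum_divide_distrib[symmetric] by (subst sum.swap) simp

lemma mean_const: "mean (\<lambda>_. c) = c"
  using Pr_nonempty by (simp add: mean_def)

lemma bij_transpose: "i \<in> {1..q} \<Longrightarrow> j \<in> {1..q} \<Longrightarrow> bij_betw (Transposition.transpose i j) {1..q} {1..q}"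
  by (intro permutes_imp_bij permutes_swap_id) auto

text \<open>Transpositions of colours are symmetries of \<open>Pr\<close>, so the probabilities of
  the \<open>q\<close> colours at \<open>v\<close> agree, and they sum to 1.\<close>

lemma mean_colour:
  assumes v: "v < n" and c: "c \<in> {1..q}"
  shows "mean (\<lambda>\<sigma>. of_bool (\<sigma> v = c)) = 1 / real q"
proof -
  have eq: "mean (\<lambda>\<sigma>. of_bool (\<sigma> v = c')) = mean (\<lambda>\<sigma>. of_bool (\<sigma> v = c))" if c': "c' \<in> {1..q}" for c'
  proof -
    have "mean (\<lambda>\<sigma>. of_bool (\<sigma> v = c')) = mean (\<lambda>\<sigma>. of_bool (recolour (Transposition.transpose c c') \<sigma> v = c'))"
      by (rule mean_recolour[symmetric, OF bij_transpose[OF c c']])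
    moreover have "recolour (Transposition.transpose c c') \<sigma> v = c' \<longleftrightarrow> \<sigma> v = c" for \<sigma>
      using v by (auto simp: recolour_def Transposition.transpose_def)
    ultimately show ?thesis by simp
  qed
  have "1 = mean (\<lambda>_. 1)" by (simp add: mean_const)
  also have "\<dots> = mean (\<lambda>\<sigma>. \<Sum>c'\<in>{1..q}. of_bool (\<sigma> v = c'))"
    unfolding mean_def using Pr_\<Omega> \<Omega>_range v by (intro arg_cong2[where f = "(/)"] sum.cong) (auto simp: of_bool_def)
  also have "\<dots> = (\<Sum>c'\<in>{1..q}. mean (\<lambda>\<sigma>. of_bool (\<sigma> v = c')))" by (rule mean_sum) simp
  also have "\<dots> = (\<Sum>c'\<in>{1..q}. mean (\<lambda>\<sigma>. of_bool (\<sigma> v = c)))" by (intro sum.cong refl eq)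
  finally show ?thesis using q2 by (simp add: field_simps)
qed

text \<open>Prefix counts replace class sizes, because a switch between \<open>i\<close> and
  \<open>i + 1\<close> changes two class sizes but just one prefix count. The \<open>q - 1\<close>
  targets can thus be met one after the other.\<close>

definition upto :: "nat \<Rightarrow> (nat \<Rightarrow> nat) \<Rightarrow> nat" where
  "upto i \<sigma> = card {v\<in>{..<n}. \<sigma> v \<le> i}"

lemma card_filter_sum: "real (card {v\<in>{..<n}. P v}) = (\<Sum>v<n. of_bool (P v))"
  using sum.inter_filter[of "{..<n}" "\<lambda>_. 1::real" P] by (simp add: of_bool_def)

lemma mean_upto:
  assumes "i \<le> q"
  shows "mean (\<lambda>\<sigma>. real (upto i \<sigma>)) = real n * real i / real q"
proof -
  have "mean (\<lambda>\<sigma>. real (upto i \<sigma>)) = mean (\<lambda>\<sigma>. \<Sum>v<n. \<Sum>c\<in>{1..i}. of_bool (\<sigma> v = c))"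
  proof -
    have "real (upto i \<sigma>) = (\<Sum>v<n. \<Sum>c\<in>{1..i}. of_bool (\<sigma> v = c))" if "\<sigma> \<in> Pr" for \<sigma>
    proof -
      have "of_bool (\<sigma> v \<le> i) = (\<Sum>c\<in>{1..i}. of_bool (\<sigma> v = c) :: real)" if "v < n" for v
        using \<Omega>_range[OF subsetD[OF Pr_\<Omega> \<open>\<sigma> \<in> Pr\<close>] that] by (simp add: of_bool_def)
      then show ?thesis unfolding upto_def card_filter_sum by (intro sum.cong) auto
    qed
    then show ?thesis unfolding mean_def by simp
  qed
  also have "\<dots> = (\<Sum>v<n. \<Sum>c\<in>{1..i}. mean (\<lambda>\<sigma>. of_bool (\<sigma> v = c)))"
    by (subst mean_sum, simp) (intro sum.cong refl mean_sum, simp)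
  also have "\<dots> = (\<Sum>v<n. \<Sum>c\<in>{1..i}. 1 / real q)" using assms by (intro sum.cong refl mean_colour) auto
  finally show ?thesis by simp
qed

text \<open>
  The vertices of \<open>I\<close> that \<open>free\<close> collects can switch between the colours \<open>i\<close> and \<open>i + 1\<close>; such switches
  only change \<open>upto i\<close>.
\<close>

definition free :: "nat set \<Rightarrow> nat \<Rightarrow> (nat \<Rightarrow> nat) \<Rightarrow> nat set" where
  "free I i \<sigma> = {v \<in> I. \<sigma> v \<in> {i, Suc i} \<and> (\<forall>u\<in>nb v. \<sigma> u \<notin> {i, Suc i})}"

text \<open>The part of \<open>upto i\<close> that no switch at \<open>i\<close> can change; the
  rest is the number of free vertices of colour \<open>i\<close>.\<close>

definition base :: "nat set \<Rightarrow> nat \<Rightarrow> (nat \<Rightarrow> nat) \<Rightarrow> nat" where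
  "base I i \<sigma> = card {v\<in>{..<n}. v \<notin> free I i \<sigma> \<and> \<sigma> v \<le> i}"

definition switches :: "nat set \<Rightarrow> nat \<Rightarrow> (nat \<Rightarrow> nat) \<Rightarrow> (nat \<Rightarrow> nat) set" where
  "switches I i \<sigma> = {\<tau> \<in> Pr. (\<forall>v. v \<notin> free I i \<sigma> \<longrightarrow> \<tau> v = \<sigma> v) \<and> (\<forall>v\<in>free I i \<sigma>. \<tau> v \<in> {i, Suc i})}"

definition independent :: "nat set \<Rightarrow> bool" where
  "independent I \<longleftrightarrow> I \<subseteq> {..<n} \<and> (\<forall>u\<in>I. \<forall>v\<in>I. u \<notin> nb v)"

text \<open>Multiples of \<open>n / q\<close>, rounded down; consecutive ones differ by
  \<open>n div q\<close> or \<open>n div q + 1\<close>.\<close>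

definition target :: "nat \<Rightarrow> nat" where "target i = n * i div q"

section \<open>Switch classes and the targets that they meet\<close>

lemma switches_self: "\<sigma> \<in> Pr \<Longrightarrow> \<sigma> \<in> switches I i \<sigma>"
  by (auto simp: switches_def free_def)

text \<open>Independence of the union keeps the neighbours of \<open>J\<close> out of
  \<open>I\<close>, so these are not recoloured. The vertices that are recoloured stay within
  \<open>{i, Suc i}\<close>.\<close>

lemma switches_free:
  assumes I: "independent (I \<union> J)" and d: "J = I \<and> j = i \<or> I \<inter> J = {}" and \<tau>: "\<tau> \<in> switches I i \<sigma>"
  shows "free J j \<tau> = free J j \<sigma>"
proof -
  have out: "\<tau> v = \<sigma> v" if "v \<notin> free I i \<sigma>" for v using \<tau> that by (auto simp: switches_def)
  have inn: "\<tau> v \<in> {i, Suc i}" if "v \<in> free I i \<sigma>" for v using \<tau> that by (auto simp: switches_def)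
  have nbs: "\<tau> u = \<sigma> u" if "v \<in> J" "u \<in> nb v" for u v
  proof -
    have "u \<notin> I" using I that by (auto simp: independent_def)
    then show ?thesis by (intro out) (auto simp: free_def)
  qed
  have own: "\<tau> v \<in> {j, Suc j} \<longleftrightarrow> \<sigma> v \<in> {j, Suc j}" if v: "v \<in> J" for v
  proof (cases "v \<in> free I i \<sigma>")
    case True
    then have "v \<in> I" "\<sigma> v \<in> {i, Suc i}" by (auto simp: free_def)
    then have "j = i" using d v by auto
    then show ?thesis using inn[OF True] \<open>\<sigma> v \<in> {i, Suc i}\<close> by simp
  qed (simp add: out)
  show ?thesis unfolding free_def using nbs own by (auto simp del: insert_iff)
qed

text \<open>A switch does not alter the set of free vertices, so switch classes are equivalence
  classes, as \<open>sum_class_mean\<close> requires.\<close>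

lemma switches_class:
  assumes I: "independent I" and \<tau>: "\<tau> \<in> switches I i \<sigma>"
  shows "switches I i \<tau> = switches I i \<sigma>"
proof -
  have f: "free I i \<tau> = free I i \<sigma>" using switches_free[of I I i i \<tau> \<sigma>] I \<tau> by simp
  have "\<tau> v = \<sigma> v" if "v \<notin> free I i \<sigma>" for v using \<tau> that by (auto simp: switches_def)
  then show ?thesis unfolding switches_def f by auto
qed

lemma switches_upto:
  assumes \<tau>: "\<tau> \<in> switches I i \<sigma>" and ne: "j \<noteq> i"
  shows "upto j \<tau> = upto j \<sigma>"
proof -
  have "\<tau> v \<le> j \<longleftrightarrow> \<sigma> v \<le> j" for v
  proof (cases "v \<in> free I i \<sigma>")
    case True
    then have "\<tau> v \<in> {i, Suc i}" "\<sigma> v \<in> {i, Suc i}" using \<tau> by (auto simp: switches_def free_def)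
    then show ?thesis using ne by auto
  next
    case False
    then show ?thesis using \<tau> by (auto simp: switches_def)
  qed
  then show ?thesis by (simp add: upto_def)
qed

lemma switches_base:
  assumes I: "independent (I \<union> J)" and d: "J = I \<and> j = i \<or> I \<inter> J = {} \<and> j \<noteq> i" and \<tau>: "\<tau> \<in> switches I i \<sigma>"
  shows "base J j \<tau> = base J j \<sigma>"
proof -
  have f: "free J j \<tau> = free J j \<sigma>" using switches_free[OF I _ \<tau>, of j] d by blast
  have "\<tau> v \<le> j \<longleftrightarrow> \<sigma> v \<le> j" if v: "v \<notin> free J j \<sigma>" for v
  proof (cases "v \<in> free I i \<sigma>")
    case True
    then have "\<tau> v \<in> {i, Suc i}" "\<sigma> v \<in> {i, Suc i}" using \<tau> by (auto simp: switches_def free_def)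
    moreover have "j \<noteq> i" using d v True by auto
    ultimately show ?thesis by auto
  next
    case False
    then show ?thesis using \<tau> by (auto simp: switches_def)
  qed
  then show ?thesis unfolding base_def f by (intro arg_cong[where f = card]) auto
qed

text \<open>The set \<open>U\<close> of free vertices that receive \<open>i\<close> parametrises the
  class. Every \<open>U\<close> gives a proper colouring, because free vertices are pairwise
  non-adjacent and none of their neighbours has colour \<open>i\<close> or
  \<open>i + 1\<close>.\<close>

lemma switches_count:
  assumes I: "independent I" and \<sigma>: "\<sigma> \<in> Pr" and i: "1 \<le> i" "i < q"
  shows "card (switches I i \<sigma>) = 2 ^ card (free I i \<sigma>)"
    and "card {\<tau> \<in> switches I i \<sigma>. upto i \<tau> = base I i \<sigma> + k} = card (free I i \<sigma>) choose k"
proof -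
  let ?F = "free I i \<sigma>"
  have Fn: "?F \<subseteq> {..<n}" using I by (auto simp: free_def independent_def)
  then have fin: "finite ?F" by (rule finite_subset) simp
  define g where "g U v = (if v \<in> U then i else if v \<in> ?F then Suc i else \<sigma> v)" for U v
  have gP: "g U \<in> switches I i \<sigma>" if U: "U \<subseteq> ?F" for U
  proof -
    have "g U \<in> Pr"
    proof (rule PrI)
      show "g U \<in> \<Omega>" using U Fn i \<Omega>_range[OF subsetD[OF Pr_\<Omega> \<sigma>]] \<sigma> Pr_\<Omega>
        by (auto simp: \<Omega>_def PiE_iff g_def extensional_def)
      fix u v assume uv: "u \<in> nb v"
      have vu: "v \<in> nb u" using uv nb_sym by simp
      have "u \<notin> ?F \<or> v \<notin> ?F" using I uv by (auto simp: free_def independent_def)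
      moreover have "g U a \<noteq> g U b" if "a \<in> ?F" "b \<notin> ?F" "b \<in> nb a" for a b
      proof -
        have "g U a \<in> {i, Suc i}" using that(1) by (simp add: g_def)
        moreover have "g U b = \<sigma> b" using that(2) U by (auto simp: g_def)
        moreover have "\<sigma> b \<notin> {i, Suc i}" using that(1,3) unfolding free_def by blast
        ultimately show ?thesis by metis
      qed
      moreover have "g U u \<noteq> g U v" if "u \<notin> ?F" "v \<notin> ?F"
        using PrD[OF \<sigma> uv] that U by (auto simp: g_def)
      ultimately show "g U u \<noteq> g U v" using uv vu by metis
    qed
    then show ?thesis using U by (auto simp: switches_def g_def)
  qed
  have inj: "inj_on g (Pow ?F)"
  proof (rule inj_onI)
    fix U V assume *: "U \<in> Pow ?F" "V \<in> Pow ?F" "g U = g V"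
    have "v \<in> U \<longleftrightarrow> v \<in> V" for v using fun_cong[OF *(3), of v] *(1,2) by (auto simp: g_def split: if_splits)
    then show "U = V" by auto
  qed
  have surj: "\<tau> = g {v \<in> ?F. \<tau> v = i}" if "\<tau> \<in> switches I i \<sigma>" for \<tau>
    by (rule ext) (use that in \<open>auto simp: g_def switches_def\<close>)
  have bij: "bij_betw g (Pow ?F) (switches I i \<sigma>)"
  proof (rule bij_betw_imageI[OF inj], intro equalityI subsetI)
    fix \<tau> assume "\<tau> \<in> switches I i \<sigma>"
    then have "\<tau> = g {v \<in> ?F. \<tau> v = i}" by (rule surj)
    then show "\<tau> \<in> g ` Pow ?F" by (rule image_eqI) auto
  qed (use gP in auto)
  show "card (switches I i \<sigma>) = 2 ^ card ?F"
    using bij_betw_same_card[OF bij] fin by (simp add: card_Pow)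
  have up: "upto i (g U) = base I i \<sigma> + card U" if U: "U \<subseteq> ?F" for U
  proof -
    have "{v\<in>{..<n}. g U v \<le> i} = {v\<in>{..<n}. v \<notin> ?F \<and> \<sigma> v \<le> i} \<union> U"
      using U Fn by (auto simp: g_def)
    moreover have "{v\<in>{..<n}. v \<notin> ?F \<and> \<sigma> v \<le> i} \<inter> U = {}" using U by auto
    ultimately show ?thesis unfolding upto_def base_def
      using finite_subset[OF U fin] by (simp add: card_Un_disjoint)
  qed
  have img: "g ` {U. U \<subseteq> ?F \<and> card U = k} = {\<tau> \<in> switches I i \<sigma>. upto i \<tau> = base I i \<sigma> + k}"
  proof (intro equalityI subsetI)
    fix \<tau> assume \<tau>: "\<tau> \<in> {\<tau> \<in> switches I i \<sigma>. upto i \<tau> = base I i \<sigma> + k}"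
    let ?U = "{v \<in> ?F. \<tau> v = i}"
    have "\<tau> = g ?U" using \<tau> surj by simp
    moreover have "card ?U = k" using up[of ?U] \<tau> calculation by auto
    ultimately show "\<tau> \<in> g ` {U. U \<subseteq> ?F \<and> card U = k}" by blast
  qed (use gP up in auto)
  have "inj_on g {U. U \<subseteq> ?F \<and> card U = k}" using inj by (rule inj_on_subset) auto
  then have "card (g ` {U. U \<subseteq> ?F \<and> card U = k}) = card {U. U \<subseteq> ?F \<and> card U = k}"
    by (rule card_image)
  then have "card {\<tau> \<in> switches I i \<sigma>. upto i \<tau> = base I i \<sigma> + k} = card {U. U \<subseteq> ?F \<and> card U = k}"
    unfolding img .
  then show "card {\<tau> \<in> switches I i \<sigma>. upto i \<tau> = base I i \<sigma> + k} = card ?F choose k"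
    using n_subsets[OF fin] by simp
qed

text \<open>In probabilistic terms: a uniform element of the switch class meets the target with
  probability at least \<open>\<beta>\<close>. The first conjunct guards the truncated
  subtraction.\<close>

definition good :: "nat set \<Rightarrow> real \<Rightarrow> nat \<Rightarrow> (nat \<Rightarrow> nat) \<Rightarrow> bool" where
  "good I \<beta> i \<sigma> \<longleftrightarrow> base I i \<sigma> \<le> target i \<and>
     \<beta> * 2 ^ card (free I i \<sigma>) \<le> real (card (free I i \<sigma>) choose (target i - base I i \<sigma>))"

text \<open>The set \<open>X\<close> of good colourings that meet the first \<open>k\<close> targets
  is a union of switch classes at \<open>k + 1\<close>, because these switches affect no other
  prefix count and no free set or base. A share \<open>\<beta>\<close> of each class meets the next
  target. So each step costs a factor \<open>\<beta>\<close>, and no probabilistic independence has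
  to be shown.\<close>

lemma prefix_targets_density:
  assumes ind: "independent (\<Union>i\<in>{1..<q}. J i)" and dis: "\<And>i j. i \<in> {1..<q} \<Longrightarrow> j \<in> {1..<q} \<Longrightarrow> i \<noteq> j \<Longrightarrow> J i \<inter> J j = {}"
    and \<beta>: "0 \<le> \<beta>" and k: "k < q"
  shows "\<beta> ^ k * real (card {\<sigma> \<in> Pr. \<forall>i\<in>{1..<q}. good (J i) \<beta> i \<sigma>})
    \<le> real (card {\<sigma> \<in> Pr. (\<forall>i\<in>{1..<q}. good (J i) \<beta> i \<sigma>) \<and> (\<forall>i\<in>{1..k}. upto i \<sigma> = target i)})"
  using k
proof (induction k)
  case (Suc k)
  let ?i = "Suc k"
  define X where "X = {\<sigma> \<in> Pr. (\<forall>i\<in>{1..<q}. good (J i) \<beta> i \<sigma>) \<and> (\<forall>i\<in>{1..k}. upto i \<sigma> = target i)}"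
  have i: "?i \<in> {1..<q}" using Suc.prems by simp
  have indi: "independent (J ?i)" "independent (J ?i \<union> J j)" if "j \<in> {1..<q}" for j
    using ind i that unfolding independent_def by blast+
  have ind1: "independent (J ?i)" using indi(1)[OF i] .
  have closed: "\<tau> \<in> X" if \<sigma>: "\<sigma> \<in> X" and \<tau>: "\<tau> \<in> switches (J ?i) ?i \<sigma>" for \<sigma> \<tau>
  proof -
    have "good (J j) \<beta> j \<tau>" if j: "j \<in> {1..<q}" for j
    proof -
      have d: "J j = J ?i \<and> j = ?i \<or> J ?i \<inter> J j = {} \<and> j \<noteq> ?i" using dis[OF i j] by blast
      have "free (J j) j \<tau> = free (J j) j \<sigma>" using switches_free[OF indi(2)[OF j] _ \<tau>, of j] d by blast
      moreover have "base (J j) j \<tau> = base (J j) j \<sigma>" by (rule switches_base[OF indi(2)[OF j] d \<tau>])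
      ultimately show ?thesis using \<sigma> j by (simp add: X_def good_def)
    qed
    moreover have "upto j \<tau> = target j" if "j \<in> {1..k}" for j
      using switches_upto[OF \<tau>, of j] that \<sigma> by (auto simp: X_def)
    moreover have "\<tau> \<in> Pr" using \<tau> by (simp add: switches_def)
    ultimately show ?thesis by (auto simp: X_def)
  qed
  define f where "f \<tau> = (of_bool (upto ?i \<tau> = target ?i) :: real)" for \<tau>
  have finX: "finite X" by (simp add: X_def)
  have fins: "finite (switches (J ?i) ?i \<sigma>)" for \<sigma> by (rule finite_subset[of _ Pr]) (auto simp: switches_def)
  have "\<beta> * real (card X) = (\<Sum>\<sigma>\<in>X. \<beta>)" by simp
  also have "\<dots> \<le> (\<Sum>\<sigma>\<in>X. sum f (switches (J ?i) ?i \<sigma>) / real (card (switches (J ?i) ?i \<sigma>)))"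
  proof (rule sum_mono)
    fix \<sigma> assume \<sigma>: "\<sigma> \<in> X"
    then have P: "\<sigma> \<in> Pr" and g: "good (J ?i) \<beta> ?i \<sigma>" using i by (auto simp: X_def)
    define b where "b = target ?i - base (J ?i) ?i \<sigma>"
    have t: "target ?i = base (J ?i) ?i \<sigma> + b" using g by (simp add: good_def b_def)
    have "sum f (switches (J ?i) ?i \<sigma>) = real (card {\<tau> \<in> switches (J ?i) ?i \<sigma>. upto ?i \<tau> = base (J ?i) ?i \<sigma> + b})"
      unfolding f_def t using fins sum.inter_filter[of "switches (J ?i) ?i \<sigma>" "\<lambda>_. 1::real"] by (simp add: of_bool_def)
    also have "\<dots> = real (card (free (J ?i) ?i \<sigma>) choose b)"
      using switches_count(2)[OF ind1 P, of ?i b] i by simp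
    finally have "sum f (switches (J ?i) ?i \<sigma>) = real (card (free (J ?i) ?i \<sigma>) choose b)" .
    moreover have "real (card (switches (J ?i) ?i \<sigma>)) = 2 ^ card (free (J ?i) ?i \<sigma>)"
      using switches_count(1)[OF ind1 P, of ?i] i by simp
    ultimately show "\<beta> \<le> sum f (switches (J ?i) ?i \<sigma>) / real (card (switches (J ?i) ?i \<sigma>))"
      using g by (simp add: good_def b_def le_divide_eq)
  qed
  also have "\<dots> = sum f X"
  proof (rule sum_class_mean[OF finX])
    fix \<sigma> assume "\<sigma> \<in> X"
    then show "\<sigma> \<in> switches (J ?i) ?i \<sigma>" by (auto simp: X_def intro: switches_self)
  qed (use closed switches_class[OF ind1] in auto)
  also have "\<dots> = real (card {\<sigma> \<in> X. upto ?i \<sigma> = target ?i})"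
    unfolding f_def using finX sum.inter_filter[of X "\<lambda>_. 1::real"] by (simp add: of_bool_def)
  also have "{\<sigma> \<in> X. upto ?i \<sigma> = target ?i} = {\<sigma> \<in> Pr. (\<forall>i\<in>{1..<q}. good (J i) \<beta> i \<sigma>) \<and> (\<forall>i\<in>{1..Suc k}. upto i \<sigma> = target i)}"
    unfolding X_def by (auto simp: le_Suc_eq)
  finally have step: "\<beta> * real (card X) \<le> real (card {\<sigma> \<in> Pr. (\<forall>i\<in>{1..<q}. good (J i) \<beta> i \<sigma>) \<and> (\<forall>i\<in>{1..Suc k}. upto i \<sigma> = target i)})" .
  have "\<beta> ^ k * real (card {\<sigma> \<in> Pr. \<forall>i\<in>{1..<q}. good (J i) \<beta> i \<sigma>}) \<le> real (card X)"
    using Suc unfolding X_def by simp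
  then have "\<beta> * (\<beta> ^ k * real (card {\<sigma> \<in> Pr. \<forall>i\<in>{1..<q}. good (J i) \<beta> i \<sigma>})) \<le> \<beta> * real (card X)"
    using \<beta> by (rule mult_left_mono)
  then show ?case using step by (simp add: mult.assoc)
qed simp

lemma targets_equitable:
  assumes \<sigma>: "\<sigma> \<in> Pr" and t: "\<forall>i\<in>{1..q-1}. upto i \<sigma> = target i"
  shows "\<sigma> \<in> Eq"
proof -
  have r: "\<sigma> v \<in> {1..q}" if "v < n" for v using \<Omega>_range[OF subsetD[OF Pr_\<Omega> \<sigma>] that] .
  have u: "upto i \<sigma> = target i" if "i \<le> q" for i
  proof -
    consider "i = 0" | "i = q" | "i \<noteq> 0" "i \<noteq> q" by blast
    then show ?thesis
    proof cases
      case 1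
      have "{v \<in> {..<n}. \<sigma> v \<le> 0} = {}" using r by fastforce
      then show ?thesis using 1 by (simp add: upto_def target_def)
    next
      case 2
      have "{v \<in> {..<n}. \<sigma> v \<le> q} = {..<n}" using r by auto
      then show ?thesis using 2 q2 by (simp add: upto_def target_def)
    next
      case 3
      then have "i \<in> {1..q - 1}" using that by auto
      then show ?thesis using t by blast
    qed
  qed
  have c: "csize \<sigma> i \<in> {n div q, n div q + 1}" if i: "i \<in> {1..q}" for i
  proof -
    have "upto i \<sigma> = upto (i - 1) \<sigma> + csize \<sigma> i"
    proof -
      have "{v \<in> {..<n}. \<sigma> v \<le> i} = {v \<in> {..<n}. \<sigma> v \<le> i - 1} \<union> color_class n \<sigma> i"
        using i by (auto simp: color_class_def)
      moreover have "{v \<in> {..<n}. \<sigma> v \<le> i - 1} \<inter> color_class n \<sigma> i = {}" using i by (auto simp: color_class_def)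
      ultimately show ?thesis by (simp add: upto_def csize_def card_Un_disjoint)
    qed
    then have e: "target i = target (i - 1) + csize \<sigma> i" using u[of i] u[of "i - 1"] i by (simp add: le_diff_conv)
    have "n * i = n * (i - 1) + n" using i by (cases i) auto
    \<comment> \<open>Two remainders sum to less than \<open>2 * q\<close>, so the carry in the
      difference of consecutive targets is 0 or 1.\<close>
    moreover have "(n * (i - 1) mod q + n mod q) div q < 2"
      using q2 mod_less_divisor[of q "n * (i - 1)"] mod_less_divisor[of q n]
      by (intro less_mult_imp_div_less) linarith
    ultimately show ?thesis
      using e div_add1_eq[of "n * (i - 1)" n q] unfolding target_def by auto
  qed
  have "\<bar>int (csize \<sigma> i) - int (csize \<sigma> j)\<bar> \<le> 1" if "i \<in> {1..q}" "j \<in> {1..q}" for i j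
    using c[OF that(1)] c[OF that(2)] by auto
  then show ?thesis using \<sigma> unfolding equitable_colorings_def csize_def[symmetric] by blast
qed

corollary equitable_density:
  assumes ind: "independent (\<Union>i\<in>{1..<q}. J i)" and dis: "\<And>i j. i \<in> {1..<q} \<Longrightarrow> j \<in> {1..<q} \<Longrightarrow> i \<noteq> j \<Longrightarrow> J i \<inter> J j = {}"
    and \<beta>: "0 \<le> \<beta>"
  shows "\<beta> ^ (q - 1) * real (card {\<sigma> \<in> Pr. \<forall>i\<in>{1..<q}. good (J i) \<beta> i \<sigma>}) \<le> real (card Eq)"
proof -
  have "finite Eq" using Eq_Pr by (rule finite_subset) simp
  then have "card {\<sigma> \<in> Pr. (\<forall>i\<in>{1..<q}. good (J i) \<beta> i \<sigma>) \<and> (\<forall>i\<in>{1..q-1}. upto i \<sigma> = target i)} \<le> card Eq"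
    using targets_equitable by (intro card_mono) auto
  then show ?thesis using prefix_targets_density[OF ind dis \<beta>, of "q - 1"] q2 by simp
qed

end

context colouring_graph begin

section \<open>Concentration: most proper colourings are good\<close>

lemma M_le: "M \<le> n * q"
proof -
  have "length es = card E" using bij_betw_same_card[OF bij_edges] by simp
  also have "\<dots> \<le> card (\<Union>v\<in>{..<n}. {e \<in> E. v \<in> e})"
  proof (rule card_mono)
    show "E \<subseteq> (\<Union>v\<in>{..<n}. {e \<in> E. v \<in> e})"
    proof
      fix e assume e: "e \<in> E"
      obtain u v where "e = {u, v}" "u < n" by (rule edge_cases[OF e])
      with e show "e \<in> (\<Union>v\<in>{..<n}. {e \<in> E. v \<in> e})" by blast
    qed
  qed simp
  also have "\<dots> \<le> (\<Sum>v\<in>{..<n}. card {e \<in> E. v \<in> e})" by (rule card_UN_le) simp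
  also have "\<dots> \<le> (\<Sum>v\<in>{..<n}. \<Delta>)" using deg by (intro sum_mono) (simp add: degree_of_def)
  finally have "M \<le> n * (\<Delta> + 1)" by simp
  also have "\<dots> \<le> n * q" using \<Delta>_lt_q by (intro mult_le_mono2)
  finally show ?thesis .
qed

lemma mean_of_bool: "mean (\<lambda>\<sigma>. of_bool (P \<sigma>)) = real (card {\<sigma> \<in> Pr. P \<sigma>}) / real (card Pr)"
  unfolding mean_def using sum.inter_filter[of Pr "\<lambda>_. 1::real" P] by (simp add: of_bool_def)

text \<open>The neighbours of \<open>v\<close> are recoloured one by one while \<open>v\<close>
  itself is ignored. Each has to avoid \<open>i\<close>, \<open>i + 1\<close> and at most
  \<open>\<Delta> - 1\<close> colours of further neighbours, which works from
  \<open>\<Delta> + 2 \<le> q\<close> on; finally \<open>v\<close> takes colour \<open>i\<close>.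
  Under \<open>2 * \<Delta> \<le> q\<close> this excludes only \<open>q = 2\<close>.\<close>

lemma free_extension:
  assumes \<sigma>: "\<sigma> \<in> Pr" and v: "v < n" and i: "1 \<le> i" "i < q" and q: "\<Delta> + 2 \<le> q"
  shows "\<exists>\<tau>\<in>Pr. (\<forall>u. u \<notin> insert v (nb v) \<longrightarrow> \<tau> u = \<sigma> u) \<and> \<tau> v = i \<and> (\<forall>u\<in>nb v. \<tau> u \<notin> {i, Suc i})"
proof -
  have "\<exists>\<tau>\<in>\<Omega>. (\<forall>u. u \<notin> T \<longrightarrow> \<tau> u = \<sigma> u) \<and> (\<forall>a b. a \<in> nb b \<longrightarrow> a \<noteq> v \<longrightarrow> b \<noteq> v \<longrightarrow> \<tau> a \<noteq> \<tau> b) \<and> (\<forall>u\<in>T. \<tau> u \<notin> {i, Suc i})"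
    if "finite T" "T \<subseteq> nb v" for T
    using that
  proof (induction T rule: finite_induct)
    case empty
    then show ?case using \<sigma> Pr_\<Omega> PrD by blast
  next
    case (insert w T)
    then obtain \<tau> where \<tau>: "\<tau> \<in> \<Omega>" "\<And>u. u \<notin> T \<Longrightarrow> \<tau> u = \<sigma> u"
      "\<And>a b. a \<in> nb b \<Longrightarrow> a \<noteq> v \<Longrightarrow> b \<noteq> v \<Longrightarrow> \<tau> a \<noteq> \<tau> b" "\<And>u. u \<in> T \<Longrightarrow> \<tau> u \<notin> {i, Suc i}"
      by (metis insert_subset)
    have w: "w \<in> nb v" "v \<in> nb w" "w < n" using insert.prems nb_sym nb_lt by auto
    have "card (\<tau> ` (nb w - {v}) \<union> {i, Suc i}) \<le> card (\<tau> ` (nb w - {v})) + card {i, Suc i}" by (rule card_Un_le)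
    also have "card (\<tau> ` (nb w - {v})) \<le> card (nb w - {v})" by (rule card_image_le) simp
    also have "card (nb w - {v}) \<le> \<Delta> - 1" using w card_nb_le[of w] by simp
    finally have "card (\<tau> ` (nb w - {v}) \<union> {i, Suc i}) < card {1..q}" using q \<Delta>_pos by simp
    then have "\<not> {1..q} \<subseteq> \<tau> ` (nb w - {v}) \<union> {i, Suc i}"
      using card_mono[of "\<tau> ` (nb w - {v}) \<union> {i, Suc i}" "{1..q}"] by auto
    then obtain c where c: "c \<in> {1..q}" "c \<notin> \<tau> ` (nb w - {v})" "c \<notin> {i, Suc i}" by blast
    have "(\<tau>(w := c)) a \<noteq> (\<tau>(w := c)) b" if ab: "a \<in> nb b" "a \<noteq> v" "b \<noteq> v" for a b
    proof -
      have "b \<in> nb a" "a \<noteq> b" using ab nb_sym nb_irrefl by auto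
      then show ?thesis using \<tau>(3)[OF ab] c(2) ab by auto
    qed
    moreover have "\<tau>(w := c) \<in> \<Omega>" using \<tau>(1) w(3) c(1) by (rule \<Omega>_upd)
    moreover have "(\<tau>(w := c)) u \<notin> {i, Suc i}" if "u \<in> insert w T" for u
      using \<tau>(4)[of u] c(3) that by auto
    ultimately show ?case using \<tau>(2) by (intro bexI[of _ "\<tau>(w := c)"]) auto
  qed
  from this[of "nb v"] obtain \<tau> where \<tau>: "\<tau> \<in> \<Omega>" "\<And>u. u \<notin> nb v \<Longrightarrow> \<tau> u = \<sigma> u"
      "\<And>a b. a \<in> nb b \<Longrightarrow> a \<noteq> v \<Longrightarrow> b \<noteq> v \<Longrightarrow> \<tau> a \<noteq> \<tau> b" "\<And>u. u \<in> nb v \<Longrightarrow> \<tau> u \<notin> {i, Suc i}"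
    by auto
  have "\<tau>(v := i) \<in> Pr"
  proof (rule PrI)
    show "\<tau>(v := i) \<in> \<Omega>" using \<tau>(1) v i by (intro \<Omega>_upd) auto
    fix a b assume ab: "a \<in> nb b"
    then have "b \<in> nb a" "a \<noteq> b" using nb_sym nb_irrefl by auto
    then show "(\<tau>(v := i)) a \<noteq> (\<tau>(v := i)) b" using \<tau>(3)[OF ab] \<tau>(4)[of a] \<tau>(4)[of b] ab by auto
  qed
  then show ?thesis using \<tau> nb_irrefl by (intro bexI[of _ "\<tau>(v := i)"]) auto
qed

text \<open>Making \<open>v\<close> free changes \<open>\<sigma>\<close> on at most
  \<open>\<Delta> + 1 \<le> q\<close> vertices, and the result together with the old colours there
  determines \<open>\<sigma>\<close>. So at most \<open>q ^ q\<close> colourings share an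
  image.\<close>

lemma mean_free:
  assumes v: "v < n" "v \<in> I" and i: "1 \<le> i" "i < q" and q: "\<Delta> + 2 \<le> q"
  shows "1 / real q ^ q \<le> mean (\<lambda>\<sigma>. of_bool (v \<in> free I i \<sigma>))"
proof -
  let ?N = "insert v (nb v)" and ?G = "{\<sigma> \<in> Pr. v \<in> free I i \<sigma>}"
  have "\<forall>\<sigma>\<in>Pr. \<exists>\<tau>. \<tau> \<in> ?G \<and> (\<forall>u. u \<notin> ?N \<longrightarrow> \<tau> u = \<sigma> u)"
    using free_extension[OF _ v(1) i q] v(2) by (fastforce simp: free_def)
  then obtain \<phi> where \<phi>: "\<And>\<sigma>. \<sigma> \<in> Pr \<Longrightarrow> \<phi> \<sigma> \<in> ?G" "\<And>\<sigma> u. \<sigma> \<in> Pr \<Longrightarrow> u \<notin> ?N \<Longrightarrow> \<phi> \<sigma> u = \<sigma> u" by metis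
  have "inj_on (\<lambda>\<sigma>. (\<phi> \<sigma>, restrict \<sigma> ?N)) Pr"
  proof (rule inj_onI)
    fix \<sigma> \<tau> assume *: "\<sigma> \<in> Pr" "\<tau> \<in> Pr" "(\<phi> \<sigma>, restrict \<sigma> ?N) = (\<phi> \<tau>, restrict \<tau> ?N)"
    show "\<sigma> = \<tau>"
    proof
      fix u
      show "\<sigma> u = \<tau> u"
      proof (cases "u \<in> ?N")
        case True
        then show ?thesis using *(3) by (metis Pair_inject restrict_apply')
      next
        case False
        then show ?thesis using \<phi>(2)[OF *(1) False] \<phi>(2)[OF *(2) False] *(3) by simp
      qed
    qed
  qed
  moreover have "(\<lambda>\<sigma>. (\<phi> \<sigma>, restrict \<sigma> ?N)) ` Pr \<subseteq> ?G \<times> (?N \<rightarrow>\<^sub>E {1..q})"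
  proof -
    have "\<sigma> u \<in> {1..q}" if "\<sigma> \<in> Pr" "u \<in> ?N" for \<sigma> u
      using \<Omega>_range[OF subsetD[OF Pr_\<Omega> that(1)], of u] that(2) v(1) nb_lt by blast
    then have "restrict \<sigma> ?N \<in> ?N \<rightarrow>\<^sub>E {1..q}" if "\<sigma> \<in> Pr" for \<sigma>
      using that by (simp only: restrict_PiE_iff) blast
    then show ?thesis using \<phi>(1) by blast
  qed
  ultimately have "card Pr \<le> card (?G \<times> (?N \<rightarrow>\<^sub>E {1..q}))"
    by (rule card_inj_on_le) (auto intro!: finite_PiE)
  also have "\<dots> = card ?G * q ^ card ?N" by (simp add: card_cartesian_product card_PiE)
  also have "\<dots> \<le> card ?G * q ^ q"
    using card_nb_le[of v] nb_irrefl[of v] \<Delta>_lt_q q2 by (intro mult_le_mono2 power_increasing) auto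
  finally have "real (card Pr) \<le> real (card ?G) * real q ^ q" by (metis of_nat_le_iff of_nat_mult of_nat_power)
  then show ?thesis unfolding mean_of_bool using Pr_nonempty q2
    by (simp add: divide_simps card_gt_0_iff mult.commute)
qed

lemma free_local: "u \<noteq> v \<Longrightarrow> u \<notin> nb v \<Longrightarrow> v \<in> free I i (\<sigma>(u := c)) \<longleftrightarrow> v \<in> free I i \<sigma>"
  by (auto simp: free_def)

lemma card_free_sum: "I \<subseteq> {..<n} \<Longrightarrow> real (card (free I i \<sigma>)) = (\<Sum>v<n. of_bool (v \<in> free I i \<sigma>))"
proof -
  assume "I \<subseteq> {..<n}"
  then have "free I i \<sigma> = {v \<in> {..<n}. v \<in> free I i \<sigma>}" by (auto simp: free_def)
  then show ?thesis using card_filter_sum[of "\<lambda>v. v \<in> free I i \<sigma>"] by simp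
qed

text \<open>For proper colourings, the mean of \<open>upto i\<close> over the switch class, written
  as a sum of local terms so that \<open>Lip_local_sum\<close> applies.\<close>

definition centre :: "nat set \<Rightarrow> nat \<Rightarrow> (nat \<Rightarrow> nat) \<Rightarrow> real" where
  "centre I i \<sigma> = (\<Sum>v<n. if v \<in> free I i \<sigma> then 1 / 2 else of_bool (\<sigma> v \<le> i))"

lemma centre_eq:
  assumes "I \<subseteq> {..<n}"
  shows "centre I i \<sigma> = real (base I i \<sigma>) + real (card (free I i \<sigma>)) / 2"
proof -
  have "centre I i \<sigma> = (\<Sum>v<n. of_bool (v \<notin> free I i \<sigma> \<and> \<sigma> v \<le> i) + of_bool (v \<in> free I i \<sigma>) / 2)"
    unfolding centre_def by (intro sum.cong) auto
  then show ?thesis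
    by (simp only: sum.distrib sum_divide_distrib[symmetric] card_free_sum[OF assms] base_def card_filter_sum)
qed

lemma Lip_centre: "Lip (real q) (centre I i)"
  unfolding centre_def[abs_def] by (rule Lip_local_sum) (auto simp: free_local)

lemma Lip_card_free: "I \<subseteq> {..<n} \<Longrightarrow> Lip (real q) (\<lambda>\<sigma>. real (card (free I i \<sigma>)))"
  unfolding card_free_sum by (rule Lip_local_sum) (auto simp: free_local)

text \<open>Exchanging the colours \<open>i\<close> and \<open>i + 1\<close> preserves freeness and
  reverses the sign of the difference between \<open>upto i\<close> and the centre. Hence this
  difference has mean 0.\<close>

lemma mean_centre:
  assumes i: "1 \<le> i" "i < q" and I: "I \<subseteq> {..<n}"
  shows "mean (centre I i) = real n * real i / real q"
proof -
  define p where "p = Transposition.transpose i (Suc i)"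
  define d where "d \<sigma> = real (upto i \<sigma>) - centre I i \<sigma>" for \<sigma>
  have d: "d \<sigma> = (\<Sum>v<n. if v \<in> free I i \<sigma> then of_bool (\<sigma> v \<le> i) - 1 / 2 else 0)" for \<sigma>
    unfolding d_def upto_def card_filter_sum centre_def sum_subtractf[symmetric] by (intro sum.cong) auto
  have "d (recolour p \<sigma>) = - d \<sigma>" for \<sigma>
  proof -
    have r: "recolour p \<sigma> v = p (\<sigma> v)" if "v < n" for v using that by (simp add: recolour_def)
    have pin: "p x \<in> {i, Suc i} \<longleftrightarrow> x \<in> {i, Suc i}" for x by (auto simp: p_def Transposition.transpose_def)
    have "v \<in> free I i (recolour p \<sigma>) \<longleftrightarrow> v \<in> free I i \<sigma>" if "v < n" for v
      unfolding free_def mem_Collect_eq using r[OF that] r[OF nb_lt(1)] pin by metis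
    moreover have "of_bool (recolour p \<sigma> v \<le> i) - 1 / 2 = - (of_bool (\<sigma> v \<le> i) - 1 / 2 :: real)" if "v < n" "v \<in> free I i \<sigma>" for v
      using that r by (auto simp: free_def p_def)
    ultimately show ?thesis unfolding d sum_negf[symmetric] by (intro sum.cong) auto
  qed
  then have "mean d = mean (\<lambda>\<sigma>. - d \<sigma>)"
    using mean_recolour[OF bij_transpose, of i "Suc i" d] i unfolding p_def by simp
  then have "mean d = 0" by (simp add: mean_def sum_negf)
  moreover have "mean d = mean (\<lambda>\<sigma>. real (upto i \<sigma>)) - mean (centre I i)"
    by (simp add: mean_def d_def sum_subtractf diff_divide_distrib)
  ultimately show ?thesis using mean_upto[of i] i by simp
qed

text \<open>Numerical factors are swallowed by powers of \<open>q\<close>, as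
  \<open>2 \<le> q\<close>.\<close>

lemma pow_q: "k \<le> l \<Longrightarrow> c \<le> 2 ^ (l - k) \<Longrightarrow> c * real q ^ k \<le> real q ^ l"
proof -
  assume "k \<le> l" "c \<le> 2 ^ (l - k)"
  then have "c * real q ^ k \<le> 2 ^ (l - k) * real q ^ k" by (intro mult_right_mono) auto
  also have "\<dots> \<le> real q ^ (l - k) * real q ^ k" using q2 by (intro mult_right_mono power_mono) auto
  also have "\<dots> = real q ^ l" using \<open>k \<le> l\<close> by (simp add: power_add[symmetric])
  finally show ?thesis .
qed

text \<open>Chebyshev is applied to \<open>centre\<close> and to the number of free vertices, each
  time with failure probability at most \<open>1 / (4 * q)\<close>. Otherwise the target lies within
  order \<open>sqrt n\<close> of the centre and linearly many vertices are free, so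
  \<open>binomial_near_middle\<close> applies.\<close>

lemma mostly_good:
  assumes i: "1 \<le> i" "i < q" and q: "\<Delta> + 2 \<le> q" and I: "I \<subseteq> {..<n}" "real n / (2 * (real q)\<^sup>2) \<le> real (card I)"
    and n: "q ^ (2 * q + 40) \<le> n"
  shows "real (card {\<sigma> \<in> Pr. \<not> good I (1 / (2 * sqrt (real n) * 4 ^ (q ^ (q + 19)))) i \<sigma>}) \<le> real (card Pr) / (2 * real q)"
proof -
  let ?Z = "\<lambda>\<sigma>. real (card (free I i \<sigma>))" and ?a = "q ^ (q + 19)"
  define r where "r = sqrt (real n)"
  define Q where "Q = real q"
  have Q2: "2 \<le> Q" using q2 by (simp add: Q_def)
  have rr: "r * r = real n" "r\<^sup>2 = real n" by (simp_all add: r_def)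
  have "real q ^ (2 * q + 40) \<le> real n" using n by (metis of_nat_le_iff of_nat_power)
  then have nQ: "Q ^ (2 * q + 40) \<le> real n" by (simp add: Q_def)
  have rQ: "Q ^ (q + 20) \<le> r"
  proof (rule power2_le_imp_le)
    show "(Q ^ (q + 20))\<^sup>2 \<le> r\<^sup>2" using nQ unfolding rr power_mult[symmetric] by (simp add: algebra_simps)
  qed (simp add: r_def)
  have "1 \<le> Q ^ (q + 20)" using Q2 by (intro one_le_power) simp
  then have r1: "1 \<le> r" using rQ by simp
  have n1: "1 \<le> n" using n_pos by simp
  have Mq: "real M \<le> real n * Q" using M_le unfolding Q_def by (metis of_nat_le_iff of_nat_mult)
  define h where "h = real n / (4 * Q ^ (q + 2))"
  have Qp: "0 < Q ^ k" for k using Q2 by simp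
  have h0: "0 < h" unfolding h_def using n_pos
    by (intro divide_pos_pos mult_pos_pos) (simp, simp, rule Qp)
  \<comment> \<open>The threshold is such that the variance bound \<open>4 * Q ^ 5 * n\<close>,
    divided by its square, is exactly \<open>1 / (4 * Q)\<close>.\<close>
  let ?A = "{\<sigma> \<in> Pr. 4 * (Q ^ 3 * r) \<le> \<bar>centre I i \<sigma> - mean (centre I i)\<bar>}"
  let ?B = "{\<sigma> \<in> Pr. h \<le> \<bar>?Z \<sigma> - mean ?Z\<bar>}"
  have cA: "real (card ?A) \<le> real (card Pr) * (1 / (4 * Q))"
  proof -
    have "real (card ?A) \<le> real (card Pr) * (4 * Q\<^sup>2 * real M * Q\<^sup>2 / (4 * (Q ^ 3 * r))\<^sup>2)"
      unfolding Q_def by (rule chebyshev[OF Lip_centre Pr_nonempty]) (use Q2 r1 in \<open>simp add: Q_def[symmetric]\<close>)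
    also have "4 * Q\<^sup>2 * real M * Q\<^sup>2 / (4 * (Q ^ 3 * r))\<^sup>2 \<le> 4 * Q\<^sup>2 * (real n * Q) * Q\<^sup>2 / (4 * (Q ^ 3 * r))\<^sup>2"
      using Mq by (intro divide_right_mono mult_right_mono mult_left_mono) auto
    also have "\<dots> = 1 / (4 * Q)"
    proof -
      have "(4 * (Q ^ 3 * r))\<^sup>2 = 16 * Q ^ 6 * real n" by (simp add: power_mult_distrib rr)
      moreover have "4 * Q\<^sup>2 * (real n * Q) * Q\<^sup>2 = 4 * Q ^ 5 * real n" by (simp add: eval_nat_numeral)
      ultimately show ?thesis using n_pos Q2 by (simp add: field_simps eval_nat_numeral)
    qed
    finally show ?thesis by (simp add: mult_left_mono)
  qed
  have cB: "real (card ?B) \<le> real (card Pr) * (1 / (4 * Q))"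
  proof -
    have "real (card ?B) \<le> real (card Pr) * (4 * Q\<^sup>2 * real M * Q\<^sup>2 / h\<^sup>2)"
      unfolding Q_def by (rule chebyshev[OF Lip_card_free[OF I(1)] Pr_nonempty h0])
    also have "4 * Q\<^sup>2 * real M * Q\<^sup>2 / h\<^sup>2 \<le> 4 * Q\<^sup>2 * (real n * Q) * Q\<^sup>2 / h\<^sup>2"
      using Mq by (intro divide_right_mono mult_right_mono mult_left_mono) auto
    also have "\<dots> = 64 * Q ^ (2 * q + 9) / real n"
    proof -
      have e: "(q + 2) * 2 = 2 * q + 4" by simp
      have "h\<^sup>2 = (real n)\<^sup>2 / (16 * Q ^ (2 * q + 4))"
        by (simp only: h_def power_divide power_mult_distrib power_mult[symmetric] e) simp
      moreover have "4 * Q\<^sup>2 * (real n * Q) * Q\<^sup>2 = 4 * Q ^ 5 * real n" by (simp add: eval_nat_numeral)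
      ultimately have "4 * Q\<^sup>2 * (real n * Q) * Q\<^sup>2 / h\<^sup>2 = 64 * (Q ^ 5 * Q ^ (2 * q + 4)) / real n"
        using n_pos by (simp add: power2_eq_square)
      also have "Q ^ 5 * Q ^ (2 * q + 4) = Q ^ (2 * q + 9)"
        by (simp only: power_add[symmetric]) (simp add: add.commute)
      finally show ?thesis .
    qed
    also have "\<dots> \<le> 1 / (4 * Q)"
    proof -
      have "256 * Q ^ (2 * q + 10) \<le> Q ^ (2 * q + 40)" unfolding Q_def by (rule pow_q) auto
      then have "64 * Q ^ (2 * q + 9) * (4 * Q) \<le> real n" using nQ by (simp add: eval_nat_numeral algebra_simps)
      then show ?thesis using n_pos Q2 by (simp add: field_simps)
    qed
    finally show ?thesis by (simp add: mult_left_mono)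
  qed
  have meanZ: "2 * h \<le> mean ?Z"
  proof -
    have "mean ?Z = (\<Sum>v<n. mean (\<lambda>\<sigma>. of_bool (v \<in> free I i \<sigma>)))"
      unfolding card_free_sum[OF I(1)] by (rule mean_sum) simp
    also have "\<dots> \<ge> (\<Sum>v\<in>I. mean (\<lambda>\<sigma>. of_bool (v \<in> free I i \<sigma>)))"
      using I(1) by (intro sum_mono2) (auto simp: mean_def intro!: divide_nonneg_nonneg sum_nonneg)
    also have "(\<Sum>v\<in>I. mean (\<lambda>\<sigma>. of_bool (v \<in> free I i \<sigma>))) \<ge> (\<Sum>v\<in>I. 1 / Q ^ q)"
      unfolding Q_def using I(1) by (intro sum_mono mean_free i q) auto
    finally have "real (card I) / Q ^ q \<le> mean ?Z" by simp
    moreover have "real n / (2 * Q\<^sup>2) / Q ^ q \<le> real (card I) / Q ^ q"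
      using I(2) Qp[of q] unfolding Q_def[symmetric] by (intro divide_right_mono) auto
    moreover have "real n / (2 * Q\<^sup>2) / Q ^ q = 2 * h" by (simp add: h_def power_add power2_eq_square)
    ultimately show ?thesis by linarith
  qed
  have "{\<sigma> \<in> Pr. \<not> good I (1 / (2 * sqrt (real n) * 4 ^ ?a)) i \<sigma>} \<subseteq> ?A \<union> ?B"
  proof (rule ccontr)
    assume "\<not> ?thesis"
    then obtain \<sigma> where \<sigma>: "\<sigma> \<in> Pr" "\<not> good I (1 / (2 * sqrt (real n) * 4 ^ ?a)) i \<sigma>" "\<sigma> \<notin> ?A" "\<sigma> \<notin> ?B" by blast
    have c: "\<bar>centre I i \<sigma> - real n * real i / Q\<bar> < 4 * (Q ^ 3 * r)"
      using \<sigma> mean_centre[OF i I(1)] by (simp add: Q_def not_le)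
    have Zh: "h \<le> ?Z \<sigma>" using \<sigma> meanZ by (simp add: not_le abs_less_iff)
    \<comment> \<open>The deviation of the centre, plus 1 for the rounding in
      \<open>target\<close>.\<close>
    define x where "x = 4 * (Q ^ 3 * r) + 1"
    have Q3: "1 \<le> Q ^ 3 * r"
    proof -
      have "1 \<le> Q ^ 3" using Q2 by (intro one_le_power) simp
      then have "1 * 1 \<le> Q ^ 3 * r" using r1 Q2 by (intro mult_mono) auto
      then show ?thesis by simp
    qed
    have x6: "x + 1 \<le> 6 * (Q ^ 3 * r)" using Q3 by (simp only: x_def)
    have x1: "8 * (x + 1) \<le> ?Z \<sigma>"
    proof -
      have "192 * Q ^ (q + 5) \<le> Q ^ (q + 20)" unfolding Q_def by (rule pow_q) auto
      then have "192 * Q ^ (q + 5) * r \<le> r * r" using rQ r1 by (intro mult_right_mono) auto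
      then have "48 * (Q ^ 3 * r) * (4 * Q ^ (q + 2)) \<le> real n" unfolding rr by (simp add: power_add eval_nat_numeral mult_ac)
      then have "48 * (Q ^ 3 * r) \<le> h" using Qp[of "q + 2"] by (simp add: h_def pos_le_divide_eq)
      moreover have "8 * (x + 1) \<le> 48 * (Q ^ 3 * r)" using x6 by simp
      ultimately show ?thesis using Zh by linarith
    qed
    have x0: "0 \<le> x + 1" using Q3 by (simp add: x_def)
    have x2: "8 * (x + 1)\<^sup>2 \<le> real ?a * ?Z \<sigma>"
    proof -
      have "(x + 1)\<^sup>2 \<le> (6 * (Q ^ 3 * r))\<^sup>2" using x6 x0 by (rule power_mono)
      also have "\<dots> = 36 * Q ^ 6 * real n" by (simp add: power_mult_distrib rr)
      finally have "8 * (x + 1)\<^sup>2 \<le> 8 * (36 * Q ^ 6 * real n)" by (rule mult_left_mono) simp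
      also have "\<dots> = 288 * Q ^ 6 * real n" by simp
      also have "\<dots> \<le> Q ^ (q + 19) * h"
      proof -
        \<comment> \<open>This comparison dictates the exponent \<open>?a\<close>: it has to exceed
          \<open>8 * (x + 1)\<^sup>2 / h\<close>, which is of order
          \<open>Q ^ (q + 8)\<close>.\<close>
        have "1152 * Q ^ (q + 8) \<le> Q ^ (q + 19)" unfolding Q_def by (rule pow_q) auto
        then have "288 * Q ^ 6 * (4 * Q ^ (q + 2)) * real n \<le> Q ^ (q + 19) * real n"
          by (intro mult_right_mono) (simp_all add: power_add eval_nat_numeral mult_ac)
        then show ?thesis using Qp[of "q + 2"] by (simp add: h_def field_simps)
      qed
      also have "\<dots> \<le> Q ^ (q + 19) * ?Z \<sigma>" using Zh Qp by (intro mult_left_mono) (auto simp: less_imp_le)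
      finally show ?thesis by (simp add: Q_def)
    qed
    have t: "\<bar>real (target i) - real n * real i / Q\<bar> \<le> 1"
    proof -
      have "real (n * i) = real (q * (n * i div q)) + real (n * i mod q)"
        by (simp only: of_nat_add[symmetric] mult_div_mod_eq)
      then have "real n * real i / Q = real (target i) + real (n * i mod q) / Q"
        using Q2 by (simp add: target_def Q_def add_divide_distrib)
      moreover have "real (n * i mod q) / Q \<le> 1" "0 \<le> real (n * i mod q) / Q"
        using q2 by (simp_all add: Q_def divide_le_eq less_imp_le)
      ultimately show ?thesis by linarith
    qed
    have tb: "\<bar>real (target i) - real (base I i \<sigma>) - ?Z \<sigma> / 2\<bar> \<le> x"
      using t c unfolding centre_eq[OF I(1)] x_def by linarith
    have bt: "base I i \<sigma> \<le> target i"
    proof -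
      have "8 * x + 8 \<le> ?Z \<sigma>" using x1 by simp
      then have "real (base I i \<sigma>) \<le> real (target i)" using tb Q3 x_def by (simp add: abs_le_iff)
      then show ?thesis by simp
    qed
    have "card (free I i \<sigma>) \<le> card {..<n}" using I(1) by (intro card_mono) (auto simp: free_def)
    then have "2 ^ card (free I i \<sigma>) \<le> 2 * sqrt (real n) * 4 ^ ?a * real (card (free I i \<sigma>) choose (target i - base I i \<sigma>))"
      using tb bt x1 x2 n1 by (intro binomial_near_middle[where x = x]) (auto simp: of_nat_diff)
    then have "good I (1 / (2 * sqrt (real n) * 4 ^ ?a)) i \<sigma>"
      unfolding good_def using bt n1 by (simp add: field_simps)
    then show False using \<sigma> by blast
  qed
  then have "card {\<sigma> \<in> Pr. \<not> good I (1 / (2 * sqrt (real n) * 4 ^ ?a)) i \<sigma>} \<le> card (?A \<union> ?B)"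
    by (intro card_mono) auto
  also have "\<dots> \<le> card ?A + card ?B" by (rule card_Un_le)
  finally have "real (card {\<sigma> \<in> Pr. \<not> good I (1 / (2 * sqrt (real n) * 4 ^ ?a)) i \<sigma>}) \<le> real (card ?A) + real (card ?B)"
    by linarith
  also have "\<dots> \<le> real (card Pr) * (1 / (4 * Q)) + real (card Pr) * (1 / (4 * Q))" using cA cB by (rule add_mono)
  also have "\<dots> = real (card Pr) / (2 * Q)" by simp
  finally show ?thesis by (simp add: Q_def)
qed

text \<open>A largest class of any proper colouring will do.\<close>

lemma large_independent: "\<exists>I. independent I \<and> n \<le> q * card I"
proof -
  obtain \<sigma> where \<sigma>: "\<sigma> \<in> Pr" using Pr_nonempty by blast
  have "\<exists>c\<in>{1..q}. n \<le> q * csize \<sigma> c"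
  proof (rule ccontr)
    assume "\<not> ?thesis"
    then have "q * csize \<sigma> c < n" if "c \<in> {1..q}" for c using that by (meson not_le)
    then have "(\<Sum>c\<in>{1..q}. q * csize \<sigma> c) < (\<Sum>c\<in>{1..q}. n)" using q2 by (intro sum_strict_mono) auto
    moreover have "(\<Sum>c\<in>{1..q}. q * csize \<sigma> c) = q * n"
      unfolding sum_distrib_left[symmetric] using sum_csize \<sigma> Pr_\<Omega> by auto
    ultimately show False by simp
  qed
  then obtain c where "n \<le> q * csize \<sigma> c" by blast
  moreover have "independent (color_class n \<sigma> c)"
    using PrD[OF \<sigma>] by (fastforce simp: independent_def color_class_def)
  ultimately show ?thesis by (auto simp: csize_def)
qed

text \<open>A large independent set is numbered and cut into \<open>q - 1\<close> intervals of equal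
  length, and the remainder is dropped.\<close>

lemma independent_groups:
  assumes n: "q ^ (2 * q + 40) \<le> n"
  shows "\<exists>J. independent (\<Union>i\<in>{1..<q}. J i) \<and>
    (\<forall>i\<in>{1..<q}. \<forall>j\<in>{1..<q}. i \<noteq> j \<longrightarrow> J i \<inter> J j = {}) \<and>
    (\<forall>i\<in>{1..<q}. real n / (2 * (real q)\<^sup>2) \<le> real (card (J i)))"
proof -
  obtain I where I: "independent I" "n \<le> q * card I" using large_independent by blast
  have finI: "finite I" using I(1) unfolding independent_def by (auto intro: finite_subset)
  obtain f where f: "bij_betw f {0..<card I} I" using ex_bij_betw_nat_finite[OF finI] by blast
  define h where "h = card I div (q - 1)"
  have hq: "(q - 1) * h \<le> card I" by (simp add: h_def)
  define J where "J i = f ` {(i - 1) * h..<i * h}" for i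
  have sub: "{(i - 1) * h..<i * h} \<subseteq> {0..<card I}" if "i \<in> {1..<q}" for i
  proof -
    have "i * h \<le> card I" by (rule order_trans[OF mult_le_mono1 hq]) (use that in auto)
    then show ?thesis by auto
  qed
  have JI: "J i \<subseteq> I" if "i \<in> {1..<q}" for i
    using image_mono[OF sub[OF that], of f] f by (simp add: J_def bij_betw_def)
  have "independent (\<Union>i\<in>{1..<q}. J i)" using I(1) JI unfolding independent_def by blast
  moreover have "J i \<inter> J j = {}" if ij: "i \<in> {1..<q}" "j \<in> {1..<q}" "i \<noteq> j" for i j
  proof -
    have "{(i - 1) * h..<i * h} \<inter> {(j - 1) * h..<j * h} = {}"
    proof -
      have "a * h \<le> (b - 1) * h" if "a < b" for a b :: nat using that by (intro mult_le_mono1) auto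
      from this[of i j] this[of j i] show ?thesis using ij(3) by (auto simp: neq_iff)
    qed
    moreover have "inj_on f {0..<card I}" using f by (simp add: bij_betw_def)
    ultimately show ?thesis
      by (simp only: J_def inj_on_image_Int[OF _ sub[OF ij(1)] sub[OF ij(2)], symmetric]) simp
  qed
  moreover have "real n / (2 * (real q)\<^sup>2) \<le> real (card (J i))" if i: "i \<in> {1..<q}" for i
  proof -
    have "inj_on f {(i - 1) * h..<i * h}" by (rule inj_on_subset[OF bij_betw_imp_inj_on[OF f] sub[OF i]])
    then have "card (J i) = i * h - (i - 1) * h" by (simp add: J_def card_image)
    also have "\<dots> = h" using i by (cases i) auto
    finally have Jh: "card (J i) = h" .
    have "card I < (q - 1) * (h + 1)" unfolding h_def using q2 dividend_less_div_times[of "q - 1" "card I"] by (simp add: algebra_simps)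
    also have "\<dots> \<le> q * (h + 1)" by (intro mult_le_mono1) simp
    finally have "q * card I \<le> q * (q * (h + 1))" by simp
    then have 1: "n \<le> q * q * (h + 1)" unfolding mult.assoc by (rule order_trans[OF I(2)])
    \<comment> \<open>Large \<open>n\<close> absorbs the rounding in \<open>h\<close>; this is the
      factor 2 in the bound on the group sizes.\<close>
    have "2 * q\<^sup>2 \<le> n"
    proof -
      have "2 * q\<^sup>2 \<le> q * q\<^sup>2" using q2 by simp
      also have "\<dots> = q ^ 3" by (simp add: eval_nat_numeral)
      also have "\<dots> \<le> q ^ (2 * q + 40)" using q2 by (intro power_increasing) auto
      finally show ?thesis using n by simp
    qed
    then have "n \<le> 2 * q\<^sup>2 * h" using 1 by (simp add: power2_eq_square algebra_simps)
    then have "real n \<le> real (2 * q\<^sup>2 * h)" by (simp only: of_nat_le_iff)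
    then have "real n \<le> 2 * (real q)\<^sup>2 * real h" by simp
    then show ?thesis unfolding Jh using q2 by (simp add: divide_le_eq mult.commute)
  qed
  ultimately show ?thesis by blast
qed

text \<open>Each of the \<open>q - 1\<close> conditions fails for a share of at most
  \<open>1 / (2 * q)\<close>, so at least half of the proper colourings are good for all
  \<open>i\<close> at once.\<close>

lemma density_large:
  assumes q: "\<Delta> + 2 \<le> q" and n: "q ^ (2 * q + 40) \<le> n"
  shows "real (card Pr) \<le> 2 * (2 * sqrt (real n) * 4 ^ (q ^ (q + 19))) ^ (q - 1) * real (card Eq)"
proof -
  let ?\<beta> = "1 / (2 * sqrt (real n) * 4 ^ (q ^ (q + 19)))"
  obtain J where J: "independent (\<Union>i\<in>{1..<q}. J i)"
    "\<And>i j. i \<in> {1..<q} \<Longrightarrow> j \<in> {1..<q} \<Longrightarrow> i \<noteq> j \<Longrightarrow> J i \<inter> J j = {}"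
    "\<And>i. i \<in> {1..<q} \<Longrightarrow> real n / (2 * (real q)\<^sup>2) \<le> real (card (J i))"
    using independent_groups[OF n] by blast
  let ?G = "{\<sigma> \<in> Pr. \<forall>i\<in>{1..<q}. good (J i) ?\<beta> i \<sigma>}"
  have Jn: "J i \<subseteq> {..<n}" if "i \<in> {1..<q}" for i using J(1) that unfolding independent_def by blast
  have "card Pr \<le> card (?G \<union> (\<Union>i\<in>{1..<q}. {\<sigma> \<in> Pr. \<not> good (J i) ?\<beta> i \<sigma>}))"
    by (intro card_mono) auto
  also have "\<dots> \<le> card ?G + card (\<Union>i\<in>{1..<q}. {\<sigma> \<in> Pr. \<not> good (J i) ?\<beta> i \<sigma>})" by (rule card_Un_le)
  also have "card (\<Union>i\<in>{1..<q}. {\<sigma> \<in> Pr. \<not> good (J i) ?\<beta> i \<sigma>}) \<le> (\<Sum>i\<in>{1..<q}. card {\<sigma> \<in> Pr. \<not> good (J i) ?\<beta> i \<sigma>})"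
    by (rule card_UN_le) simp
  finally have "real (card Pr) \<le> real (card ?G) + (\<Sum>i\<in>{1..<q}. real (card {\<sigma> \<in> Pr. \<not> good (J i) ?\<beta> i \<sigma>}))"
    by (simp flip: of_nat_sum of_nat_add)
  also have "(\<Sum>i\<in>{1..<q}. real (card {\<sigma> \<in> Pr. \<not> good (J i) ?\<beta> i \<sigma>})) \<le> (\<Sum>i\<in>{1..<q}. real (card Pr) / (2 * real q))"
    using J(3) Jn q n by (intro sum_mono mostly_good) auto
  also have "\<dots> \<le> real (card Pr) / 2" using q2 by (simp add: field_simps of_nat_diff)
  finally have half: "real (card Pr) \<le> 2 * real (card ?G)" by simp
  have "?\<beta> ^ (q - 1) * real (card ?G) \<le> real (card Eq)"
    by (rule equitable_density[OF J(1,2)]) auto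
  moreover have "0 < (2 * sqrt (real n) * 4 ^ (q ^ (q + 19))) ^ (q - 1)" using n_pos by simp
  ultimately have "real (card ?G) \<le> (2 * sqrt (real n) * 4 ^ (q ^ (q + 19))) ^ (q - 1) * real (card Eq)"
    by (simp add: power_one_over divide_le_eq mult.commute)
  then show ?thesis using half by linarith
qed

text \<open>For \<open>q = 2\<close> every edge carries both colours, so only the isolated vertices matter.\<close>

lemma density_two:
  assumes "q = 2"
  shows "real (card Pr) \<le> 2 * sqrt (real n) * real (card Eq)"
proof -
  have D1: "\<Delta> = 1" using assms q_ge \<Delta>_pos by simp
  define I where "I = {v. v < n \<and> nb v = {}}"
  have ind: "independent I" by (auto simp: independent_def I_def)
  have g: "good I (1 / (2 * sqrt (real n))) 1 \<sigma>" if \<sigma>: "\<sigma> \<in> Pr" for \<sigma>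
  proof -
    have r: "\<sigma> v = 1 \<or> \<sigma> v = 2" if "v < n" for v
      using \<Omega>_range[OF subsetD[OF Pr_\<Omega> \<sigma>] that] assms by auto
    have F: "free I 1 \<sigma> = I" using r by (fastforce simp: free_def I_def numeral_2_eq_2)
    let ?V = "\<lambda>c. {v \<in> {..<n}. v \<notin> I \<and> \<sigma> v = c}"
    define f where "f v = the_elem (nb v)" for v
    have nbf: "nb v = {f v}" if "v < n" "v \<notin> I" for v
    proof -
      have "card (nb v) = 1" using that card_nb_le[of v] D1 by (auto simp: I_def card_gt_0_iff Suc_le_eq intro!: antisym)
      then obtain u where "nb v = {u}" by (rule card_1_singletonE)
      then show ?thesis by (simp add: f_def)
    qed
    have step: "f v < n \<and> f v \<notin> I \<and> f (f v) = v \<and> \<sigma> (f v) \<noteq> \<sigma> v" if v: "v < n" "v \<notin> I" for v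
    proof -
      have 1: "f v \<in> nb v" using nbf[OF v] by simp
      have 2: "v \<in> nb (f v)" using 1 nb_sym by simp
      have 3: "f v < n" "f v \<notin> I" using 1 2 nb_lt by (auto simp: I_def)
      show ?thesis using 2 3 nbf[OF 3] PrD[OF \<sigma> 1] by simp
    qed
    \<comment> \<open>A non-isolated vertex is matched with its only neighbour, so the two colours
      share these vertices equally. The target is then the exact middle for the isolated vertices,
      and every proper colouring is good.\<close>
    have "bij_betw f (?V 1) (?V 2)"
      by (rule bij_betw_byWitness[where f' = f]) (use step r in fastforce)+
    then have c: "card (?V 1) = card (?V 2)" by (rule bij_betw_same_card)
    have "n = card (?V 1 \<union> ?V 2 \<union> I)"
    proof -
      have "{..<n} = ?V 1 \<union> ?V 2 \<union> I" using r by (auto simp: I_def)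
      then show ?thesis by (metis card_lessThan)
    qed
    also have "\<dots> = card (?V 1) + card (?V 2) + card I"
      by (subst card_Un_disjoint; (subst card_Un_disjoint)?) (auto simp: I_def)
    finally have n: "n = 2 * card (?V 1) + card I" using c by simp
    have b: "base I 1 \<sigma> = card (?V 1)"
      unfolding base_def F using r by (intro arg_cong[where f = card]) fastforce
    have t: "target 1 = card (?V 1) + card I div 2" 
    proof -
      have "a * 1 div 2 = b + c div 2" if "a = 2 * b + c" for a b c :: nat using that by simp
      from this[OF n] show ?thesis unfolding target_def by (simp only: assms)
    qed
    have "card I \<le> n" using n by simp
    then have "2 ^ card I \<le> 2 * sqrt (real n) * real (card I choose (card I div 2))"
      using n_pos by (intro middle_binomial) auto
    then show ?thesis unfolding good_def F b t using n_pos by (simp add: field_simps)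
  qed
  have one: "{1..<q} = {1}" using assms by auto
  have "{\<sigma> \<in> Pr. \<forall>i\<in>{1..<q}. good I (1 / (2 * sqrt (real n))) i \<sigma>} = Pr"
    unfolding one using g by auto
  then have "(1 / (2 * sqrt (real n))) ^ (q - 1) * real (card Pr) \<le> real (card Eq)"
    using equitable_density[of "\<lambda>_. I" "1 / (2 * sqrt (real n))"] ind assms by auto
  then show ?thesis using assms n_pos by (simp add: field_simps)
qed

text \<open>For small \<open>n\<close> one equitable colouring suffices, because
  \<open>card Pr \<le> q ^ n\<close> is then bounded. An integer \<open>s\<close> takes the place of
  \<open>sqrt n\<close> because the machine has to compute the number of trials. The leading
  constant is generous enough for all three cases.\<close>

theorem density:
  assumes s: "n \<le> s\<^sup>2"
  shows "real (card Pr) \<le> 2 ^ (q ^ (2 * q + 60)) * real s ^ (q - 1) * real (card Eq)"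
proof -
  have rs: "sqrt (real n) \<le> real s" using s by (intro real_le_lsqrt) (auto simp flip: of_nat_power)
  have s1: "1 \<le> s" using s n_pos by (cases s) auto
  have finEq: "finite Eq" using Eq_Pr by (rule finite_subset) simp
  have Eq1: "1 \<le> real (card Eq)" using Eq_nonempty finEq by (simp add: Suc_le_eq card_gt_0_iff)
  have q2q: "q \<le> 2 ^ q" using less_exp[of q] by simp
  consider "n < q ^ (2 * q + 40)" | "q = 2" | "q ^ (2 * q + 40) \<le> n" "\<Delta> + 2 \<le> q"
    using \<Delta>_pos q_ge by linarith
  then show ?thesis
  proof cases
    case 1
    have "card Pr \<le> card \<Omega>" by (intro card_mono Pr_\<Omega>) simp
    also have "\<dots> = q ^ n" by (simp add: \<Omega>_def card_PiE)
    also have "\<dots> \<le> (2 ^ q) ^ n" using q2q by (rule power_mono) simp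
    also have "\<dots> = 2 ^ (q * n)" by (simp add: power_mult)
    also have "\<dots> \<le> 2 ^ (q ^ (2 * q + 60))"
    proof (rule power_increasing)
      have "q * n \<le> q * q ^ (2 * q + 40)" using 1 by (intro mult_le_mono2) simp
      also have "\<dots> = q ^ Suc (2 * q + 40)" by (simp only: power_Suc)
      also have "\<dots> \<le> q ^ (2 * q + 60)" using q2 by (intro power_increasing) auto
      finally show "q * n \<le> q ^ (2 * q + 60)" .
    qed simp
    finally have "real (card Pr) \<le> 2 ^ (q ^ (2 * q + 60))" by (metis of_nat_le_iff of_nat_numeral of_nat_power)
    also have "\<dots> = 2 ^ (q ^ (2 * q + 60)) * 1 * 1" by simp
    also have "\<dots> \<le> 2 ^ (q ^ (2 * q + 60)) * real s ^ (q - 1) * real (card Eq)"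
      using s1 Eq1 by (intro mult_mono one_le_power) auto
    finally show ?thesis .
  next
    case 2
    have "real (card Pr) \<le> 2 * sqrt (real n) * real (card Eq)" by (rule density_two[OF 2])
    also have "\<dots> \<le> 2 ^ (q ^ (2 * q + 60)) * real s * real (card Eq)"
    proof (intro mult_mono rs)
      have "1 \<le> q ^ (2 * q + 60)" using q2 by (intro one_le_power) simp
      then have "(2::real) ^ 1 \<le> 2 ^ (q ^ (2 * q + 60))" by (rule power_increasing) simp
      then show "(2::real) \<le> 2 ^ (q ^ (2 * q + 60))" by simp
    qed auto
    also have "real s = real s ^ (q - 1)" using 2 by (simp only:) simp
    finally show ?thesis .
  next
    case 3
    let ?a = "q ^ (q + 19)"
    have "real (card Pr) \<le> 2 * (2 * sqrt (real n) * 4 ^ ?a) ^ (q - 1) * real (card Eq)"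
      by (rule density_large[OF 3(2,1)])
    also have "\<dots> = 2 * (2 * 4 ^ ?a) ^ (q - 1) * sqrt (real n) ^ (q - 1) * real (card Eq)"
      by (simp add: power_mult_distrib mult_ac)
    also have "\<dots> \<le> 2 ^ (q ^ (2 * q + 60)) * real s ^ (q - 1) * real (card Eq)"
    proof (intro mult_mono power_mono rs)
      have "(2::real) * (2 * 4 ^ ?a) ^ (q - 1) = 2 ^ (1 + (1 + 2 * ?a) * (q - 1))"
      proof -
        have "(4::real) ^ ?a = 2 ^ (2 * ?a)" by (simp add: power_mult)
        then have E: "(2::real) * 4 ^ ?a = 2 ^ (1 + 2 * ?a)" by (simp only: power_add power_one_right)
        have "((2::real) * 4 ^ ?a) ^ (q - 1) = 2 ^ ((1 + 2 * ?a) * (q - 1))"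
          unfolding E by (rule power_mult[symmetric])
        then show ?thesis by (simp only: power_add[of 2 1] power_one_right)
      qed
      also have "\<dots> \<le> 2 ^ (q ^ (2 * q + 60))"
      proof (rule power_increasing)
        have a1: "1 \<le> ?a" using q2 by (intro one_le_power) simp
        have "1 + (1 + 2 * ?a) * (q - 1) \<le> ?a + (3 * ?a) * q" using a1 by (intro add_mono mult_mono) auto
        also have "\<dots> \<le> 4 * (?a * q)" using q2 by simp
        also have "\<dots> \<le> q ^ 2 * (?a * q)" using q2 power_mono[of 2 q 2] by (intro mult_le_mono1) simp
        also have "\<dots> = q ^ (q + 22)" by (simp add: power_add eval_nat_numeral mult_ac)
        also have "\<dots> \<le> q ^ (2 * q + 60)" using q2 by (intro power_increasing) auto
        finally show "1 + (1 + 2 * ?a) * (q - 1) \<le> q ^ (2 * q + 60)" .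
      qed simp
      finally show "(2::real) * (2 * 4 ^ ?a) ^ (q - 1) \<le> 2 ^ (q ^ (2 * q + 60))" .
    qed auto
    finally show ?thesis .
  qed
qed

end

context colouring_graph begin

section \<open>Rejection sampling along the chain\<close>

text \<open>The test that the machine makes. It sees class sizes only; an improper map may pass it
  too, and this belongs to the mixing error.\<close>

definition balanced :: "(nat \<Rightarrow> nat) \<Rightarrow> bool" where
  "balanced \<sigma> \<longleftrightarrow> (\<forall>i\<in>{1..q}. n div q \<le> csize \<sigma> i \<and> csize \<sigma> i \<le> n div q + 1)"

text \<open>The class sizes sum to \<open>n\<close>; if they differ by at most 1, they are confined
  to \<open>n div q\<close> and \<open>n div q + 1\<close>.\<close>

lemma balanced_iff:
  assumes \<sigma>: "\<sigma> \<in> Pr"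
  shows "balanced \<sigma> \<longleftrightarrow> \<sigma> \<in> Eq"
proof
  assume b: "balanced \<sigma>"
  have "\<bar>int (csize \<sigma> i) - int (csize \<sigma> j)\<bar> \<le> 1" if "i \<in> {1..q}" "j \<in> {1..q}" for i j
  proof -
    have "n div q \<le> csize \<sigma> i" "csize \<sigma> i \<le> n div q + 1" "n div q \<le> csize \<sigma> j" "csize \<sigma> j \<le> n div q + 1"
      using b that by (auto simp: balanced_def)
    then show ?thesis by linarith
  qed
  then show "\<sigma> \<in> Eq" using \<sigma> unfolding equitable_colorings_def csize_def[symmetric] by blast
next
  assume e: "\<sigma> \<in> Eq"
  have sum: "(\<Sum>j\<in>{1..q}. csize \<sigma> j) = n" using \<sigma> Pr_\<Omega> by (intro sum_csize) auto
  show "balanced \<sigma>" unfolding balanced_def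
  proof
    fix i assume i: "i \<in> {1..q}"
    have d: "\<bar>int (csize \<sigma> i) - int (csize \<sigma> j)\<bar> \<le> 1" if "j \<in> {1..q}" for j
      using e i that unfolding equitable_colorings_def csize_def[symmetric] by blast
    have c: "csize \<sigma> i \<le> csize \<sigma> j + 1" "csize \<sigma> j \<le> csize \<sigma> i + 1" if "j \<in> {1..q}" for j
      using d[OF that] by linarith+
    have "(\<Sum>j\<in>{1..q}. csize \<sigma> j) = csize \<sigma> i + (\<Sum>j\<in>{1..q} - {i}. csize \<sigma> j)"
      by (rule sum.remove) (use i in auto)
    then have s1: "n = csize \<sigma> i + (\<Sum>j\<in>{1..q} - {i}. csize \<sigma> j)" using sum by simp
    have cq: "card ({1..q} - {i}) = q - 1" using i by simp
    have "(\<Sum>j\<in>{1..q} - {i}. csize \<sigma> j) \<le> (\<Sum>j\<in>{1..q} - {i}. csize \<sigma> i + 1)"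
      using c by (intro sum_mono) auto
    then have "n \<le> csize \<sigma> i + (q - 1) * (csize \<sigma> i + 1)" using s1 cq by simp
    also have "\<dots> < q * (csize \<sigma> i + 1)" using q2 by (cases q) (auto simp: algebra_simps)
    finally have 1: "n div q < csize \<sigma> i + 1" using q2 by (simp add: div_less_iff_less_mult mult.commute)
    have "(\<Sum>j\<in>{1..q} - {i}. csize \<sigma> i) \<le> (\<Sum>j\<in>{1..q} - {i}. csize \<sigma> j + 1)"
      using c by (intro sum_mono) auto
    then have "(q - 1) * csize \<sigma> i \<le> (\<Sum>j\<in>{1..q} - {i}. csize \<sigma> j) + (q - 1)"
      by (simp only: sum_constant cq sum.distrib) simp
    then have "q * csize \<sigma> i \<le> n + (q - 1)" using s1 q2 by (cases q) auto
    also have "n + (q - 1) < q * (n div q) + q + q" using q2 mod_less_divisor[of q n] mult_div_mod_eq[of q n] by linarith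
    finally have "q * csize \<sigma> i < q * (n div q + 2)" by (simp add: algebra_simps)
    then have 2: "csize \<sigma> i < n div q + 2" by (rule mult_left_less_imp_less) simp
    show "n div q \<le> csize \<sigma> i \<and> csize \<sigma> i \<le> n div q + 1" using 1 2 by simp
  qed
qed

lemma finite_search [simp]: "finite (set_pmf (search (iter kernel t) balanced j \<sigma>))"
  by (induction j arbitrary: \<sigma>) auto

text \<open>An indicator has Lipschitz constant 1, so \<open>mixing\<close> controls every event,
  from any start.\<close>

lemma mixing_set:
  assumes "\<sigma> \<in> \<Omega>"
  shows "\<bar>expect (iter kernel t \<sigma>) (indicator S) - real (card (S \<inter> Pr)) / real (card Pr)\<bar> \<le> real n * \<kappa> ^ t"
proof -
  have "Lip 1 (indicator S)" by (auto simp: Lip_def indicator_def)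
  from mixing[OF this assms Pr_nonempty, of t]
  have "\<bar>expect (iter kernel t \<sigma>) (indicator S) - mean (indicator S)\<bar> \<le> real n * \<kappa> ^ t"
    by (simp only: avg_iter_def mult_1)
  moreover have "indicator S = (\<lambda>\<sigma>. of_bool (\<sigma> \<in> S) :: real)" by (rule ext) (simp add: indicator_def)
  then have "mean (indicator S) = real (card {\<sigma> \<in> Pr. \<sigma> \<in> S}) / real (card Pr)"
    by (simp only: mean_of_bool)
  moreover have "{\<sigma> \<in> Pr. \<sigma> \<in> S} = S \<inter> Pr" by blast
  ultimately show ?thesis by (simp only:)
qed

text \<open>One more trial turns the error bound \<open>b\<close> into
  \<open>2 * \<eta> + (1 - p / 2) * b\<close>, and the fixed point of this map is
  \<open>4 * \<eta> / p\<close>. The bound is uniform in \<open>\<sigma>\<close>, so the law of the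
  state after a failed trial does not matter.\<close>

lemma search_error:
  fixes p \<eta> :: real
  defines "p \<equiv> real (card Eq) / real (card Pr)"
  assumes \<eta>: "real n * \<kappa> ^ t \<le> \<eta>" "2 * \<eta> \<le> p" and \<sigma>: "\<sigma> \<in> \<Omega>"
  shows "\<bar>measure_pmf.prob (search (iter kernel t) balanced j \<sigma>) A - measure_pmf.prob (pmf_of_set Eq) A\<bar>
    \<le> (1 - p / 2) ^ j + 4 * \<eta> / p"
  using \<sigma>
proof (induction j arbitrary: \<sigma>)
  have finEq: "finite Eq" using Eq_Pr by (rule finite_subset) simp
  have cE: "0 < real (card Eq)" using Eq_nonempty finEq by (simp add: card_gt_0_iff)
  have cP: "0 < real (card Pr)" using Pr_nonempty by (simp add: card_gt_0_iff)
  have p0: "0 < p" unfolding p_def using cE cP by simp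
  have "card Eq \<le> card Pr" by (rule card_mono[OF _ Eq_Pr]) simp
  then have p1: "p \<le> 1" unfolding p_def using cP by simp
  have "0 \<le> real n * \<kappa> ^ t" using \<kappa>_bounds by simp
  then have \<eta>0: "0 \<le> \<eta>" using \<eta>(1) by linarith
  define a where "a = measure_pmf.prob (pmf_of_set Eq) A"
  have a01: "0 \<le> a" "a \<le> 1" by (simp_all add: a_def measure_pmf.prob_le_1)
  have a_eq: "a = real (card (Eq \<inter> A)) / real (card Eq)"
    unfolding a_def by (rule measure_pmf_of_set[OF Eq_nonempty finEq])
  {
    case 0
    have "(0::real) \<le> indicator A \<sigma> \<and> indicator A \<sigma> \<le> (1::real)" by (auto simp: indicator_def)
    then have "\<bar>indicator A \<sigma> - a\<bar> \<le> 1" using a01 by linarith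
    moreover have "0 \<le> 4 * \<eta> / p" using \<eta>0 p0 by simp
    ultimately show ?case unfolding a_def[symmetric] by (simp add: measure_return_pmf)
  next
    case (Suc j)
    let ?K = "iter kernel t \<sigma>" and ?S = "search (iter kernel t) balanced"
    define b where "b = (1 - p / 2) ^ j + 4 * \<eta> / p"
    have b0: "0 \<le> b" unfolding b_def using p0 p1 \<eta>0 by (intro add_nonneg_nonneg zero_le_power) auto
    define B where "B = {\<tau>. balanced \<tau>}"
    have int: "integrable (measure_pmf ?K) g" for g :: "(nat \<Rightarrow> nat) \<Rightarrow> real"
      by (rule integrable_measure_pmf_finite) simp
    have prob: "measure_pmf.prob (?S (Suc j) \<sigma>) A = expect ?K (\<lambda>y. if balanced y then indicator A y else measure_pmf.prob (?S j y) A)"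
    proof -
      have "measure_pmf.prob (?S (Suc j) \<sigma>) A = expect (?S (Suc j) \<sigma>) (indicator A)" by simp
      also have "\<dots> = expect ?K (\<lambda>y. expect (if balanced y then return_pmf y else ?S j y) (indicator A))"
        unfolding search.simps by (rule expect_bind) auto
      also have "\<dots> = expect ?K (\<lambda>y. if balanced y then indicator A y else measure_pmf.prob (?S j y) A)"
        by (intro Bochner_Integration.integral_cong refl) auto
      finally show ?thesis .
    qed
    \<comment> \<open>\<open>?h\<close> compares a success in the current trial with the ideal law,
      and \<open>?g\<close> carries the error of the later trials.\<close>
    let ?h = "\<lambda>y. indicator (B \<inter> A) y - a * indicator B y :: real"
    let ?g = "\<lambda>y. if balanced y then 0 else measure_pmf.prob (?S j y) A - a"
    have "measure_pmf.prob (?S (Suc j) \<sigma>) A - a = expect ?K (\<lambda>y. (if balanced y then indicator A y else measure_pmf.prob (?S j y) A) - a)"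
      unfolding prob using int by simp
    also have "\<dots> = expect ?K (\<lambda>y. ?h y + ?g y)"
      by (intro Bochner_Integration.integral_cong refl) (auto simp: indicator_def B_def)
    also have "\<dots> = expect ?K ?h + expect ?K ?g" using int int by (rule Bochner_Integration.integral_add)
    finally have split: "measure_pmf.prob (?S (Suc j) \<sigma>) A - a = expect ?K ?h + expect ?K ?g" .
    have BE: "B \<inter> Pr = Eq" using balanced_iff Eq_Pr by (auto simp: B_def)
    have mB: "\<bar>expect ?K (indicator B) - p\<bar> \<le> \<eta>"
      using mixing_set[OF Suc.prems, of t B] \<eta>(1) unfolding BE p_def by linarith
    have "B \<inter> A \<inter> Pr = Eq \<inter> A" using BE by blast
    then have mBA: "\<bar>expect ?K (indicator (B \<inter> A)) - a * p\<bar> \<le> \<eta>"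
      using mixing_set[OF Suc.prems, of t "B \<inter> A"] \<eta>(1) cE unfolding p_def a_eq by simp
    have "expect ?K ?h = expect ?K (indicator (B \<inter> A)) - a * expect ?K (indicator B)"
      using int by simp
    moreover have "\<bar>a * expect ?K (indicator B) - a * p\<bar> \<le> 1 * \<eta>"
      unfolding right_diff_distrib[symmetric] abs_mult using a01 mB by (intro mult_mono) auto
    ultimately have h: "\<bar>expect ?K ?h\<bar> \<le> 2 * \<eta>" using mBA by linarith
    have "\<bar>expect ?K ?g\<bar> \<le> expect ?K (\<lambda>y. \<bar>?g y\<bar>)" by (rule integral_abs_bound)
    also have "\<dots> \<le> expect ?K (\<lambda>y. b * (1 - indicator B y))"
    proof (rule expect_mono_finite)
      fix y assume "y \<in> set_pmf ?K"
      then have "y \<in> \<Omega>" using iter_\<Omega>[OF Suc.prems] by auto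
      then show "\<bar>?g y\<bar> \<le> b * (1 - indicator B y)"
        using Suc.IH[of y] by (auto simp: b_def a_def B_def)
    qed simp
    also have "\<dots> = b * (1 - expect ?K (indicator B))" using int by simp
    also have "\<dots> \<le> b * (1 - p / 2)" using mB \<eta>(2) b0 by (intro mult_left_mono) (auto simp: abs_le_iff)
    finally have "\<bar>measure_pmf.prob (?S (Suc j) \<sigma>) A - a\<bar> \<le> 2 * \<eta> + b * (1 - p / 2)" using h split by linarith
    also have "\<dots> = (1 - p / 2) ^ Suc j + 4 * \<eta> / p" unfolding b_def using p0 by (simp add: field_simps)
    finally show ?case by (simp add: a_def)
  }
qed

text \<open>\<open>N\<close> makes \<open>(1 - p / 2) ^ N\<close> and \<open>t\<close> makes
  \<open>4 * \<eta> / p\<close> at most half of \<open>1 / 2 ^ k\<close>. As \<open>1 / p\<close> is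
  at most \<open>W = 2 ^ e * s ^ (q - 1)\<close>, one trial has to be accurate to
  \<open>1 / (8 * 2 ^ k * W)\<close>. The summands of \<open>t\<close> account for
  \<open>2 ^ e\<close>, for \<open>n * s ^ (q - 1) \<le> 2 ^ (q * l)\<close>, for
  \<open>2 ^ k\<close> and for 8.\<close>

theorem search_accuracy:
  assumes s: "n \<le> s\<^sup>2" "s \<le> 2 ^ l" and l: "n \<le> 2 ^ l" and \<sigma>: "\<sigma> \<in> \<Omega>"
    and e: "e = q ^ (2 * q + 60)"
    and t: "t = M * q\<^sup>2 * (e + q * l + k + 3)" and N: "N = 2 * 2 ^ e * s ^ (q - 1) * (k + 2)"
  shows "\<bar>measure_pmf.prob (search (iter kernel t) balanced N \<sigma>) A - measure_pmf.prob (pmf_of_set Eq) A\<bar> \<le> 1 / 2 ^ k"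
proof -
  define p where "p = real (card Eq) / real (card Pr)"
  have finEq: "finite Eq" using Eq_Pr by (rule finite_subset) simp
  have cE: "0 < real (card Eq)" using Eq_nonempty finEq by (simp add: card_gt_0_iff)
  have cP: "0 < real (card Pr)" using Pr_nonempty by (simp add: card_gt_0_iff)
  have p0: "0 < p" unfolding p_def using cE cP by simp
  have "card Eq \<le> card Pr" by (rule card_mono[OF _ Eq_Pr]) simp
  then have p1: "p \<le> 1" unfolding p_def using cP by simp
  have s1: "1 \<le> s" using s(1) n_pos by (cases s) auto
  define W where "W = 2 ^ e * real s ^ (q - 1)"
  have W0: "0 < W" unfolding W_def using s1 by simp
  have pW: "1 \<le> p * W"
  proof -
    have "real (card Pr) \<le> W * real (card Eq)" unfolding W_def e by (rule density[OF s(1)])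
    then show ?thesis unfolding p_def using cP by (simp add: le_divide_eq mult.commute)
  qed
  have e2: "exp (- real x) \<le> 1 / 2 ^ x" for x
  proof -
    have "(2::real) ^ x \<le> exp 1 ^ x" using exp_ge_add_one_self[of 1] by (intro power_mono) auto
    then have "(2::real) ^ x \<le> exp (real x)" by (simp add: exp_of_nat_mult[symmetric])
    then show ?thesis by (simp add: exp_minus field_simps)
  qed
  define \<eta> where "\<eta> = 1 / (8 * 2 ^ k * W)"
  have "real n * \<kappa> ^ t \<le> \<eta>"
  proof -
    let ?x = "e + q * l + k + 3"
    have qM: "0 < (real q)\<^sup>2 * real M" using q2 n_pos by simp
    have "\<kappa> \<le> exp (- (1 / ((real q)\<^sup>2 * real M)))"
      using exp_ge_add_one_self[of "- (1 / ((real q)\<^sup>2 * real M))"] by (simp add: \<kappa>_def)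
    then have "\<kappa> ^ t \<le> exp (- (1 / ((real q)\<^sup>2 * real M))) ^ t" using \<kappa>_bounds by (intro power_mono) auto
    also have "\<dots> = exp (- (real t / ((real q)\<^sup>2 * real M)))" by (simp add: exp_of_nat_mult[symmetric])
    also have "real t / ((real q)\<^sup>2 * real M) = real ?x"
    proof -
      have tt: "real t = (real q)\<^sup>2 * real M * real ?x" unfolding t by (simp add: mult_ac)
      show ?thesis unfolding tt using qM by (intro nonzero_mult_div_cancel_left) (metis less_irrefl)
    qed
    finally have "\<kappa> ^ t \<le> 1 / 2 ^ ?x" using e2[of ?x] by linarith
    moreover have "real n \<le> 2 ^ l" using l by (metis of_nat_le_iff of_nat_numeral of_nat_power)
    ultimately have "real n * \<kappa> ^ t \<le> 2 ^ l * (1 / 2 ^ ?x)"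
      using \<kappa>_bounds by (intro mult_mono) auto
    also have "\<dots> = 1 / (8 * 2 ^ k * (2 ^ e * (2 ^ l) ^ (q - 1)))"
    proof -
      have "q * l = l + l * (q - 1)" using q2 by (cases q) auto
      then have "(2::real) ^ ?x = 2 ^ l * (8 * 2 ^ k * (2 ^ e * (2 ^ l) ^ (q - 1)))"
        by (simp add: power_add power_mult)
      then show ?thesis by simp
    qed
    also have "\<dots> \<le> \<eta>" unfolding \<eta>_def W_def
    proof (intro divide_left_mono mult_left_mono power_mono)
      have "real s \<le> real (2 ^ l)" using s(2) by (simp only: of_nat_le_iff)
      then show "real s \<le> 2 ^ l" by simp
    qed (use s1 in auto)
    finally show ?thesis .
  qed
  moreover have \<eta>p: "8 * 2 ^ k * \<eta> \<le> p" unfolding \<eta>_def using pW W0 by (simp add: divide_le_eq)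
  have k1: "1 \<le> (2::real) ^ k" by simp
  have \<eta>0: "0 \<le> \<eta>" unfolding \<eta>_def using W0 by simp
  have "2 * \<eta> \<le> p"
  proof -
    have "1 * \<eta> \<le> 2 ^ k * \<eta>" using \<eta>0 k1 by (intro mult_right_mono)
    then show ?thesis using \<eta>p \<eta>0 by simp
  qed
  ultimately have "\<bar>measure_pmf.prob (search (iter kernel t) balanced N \<sigma>) A - measure_pmf.prob (pmf_of_set Eq) A\<bar>
      \<le> (1 - p / 2) ^ N + 4 * \<eta> / p"
    unfolding p_def by (rule search_error[OF _ _ \<sigma>])
  also have "4 * \<eta> / p \<le> 1 / (2 * 2 ^ k)" using \<eta>p p0 by (simp add: field_simps)
  also have "(1 - p / 2) ^ N \<le> 1 / (2 * 2 ^ k)"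
  proof -
    have "1 - p / 2 \<le> exp (- (p / 2))" using exp_ge_add_one_self[of "- (p / 2)"] by simp
    then have "(1 - p / 2) ^ N \<le> exp (- (p / 2)) ^ N" using p1 by (intro power_mono) auto
    also have "\<dots> = exp (- (real N * (p / 2)))" by (simp add: exp_of_nat_mult[symmetric])
    also have "\<dots> \<le> exp (- real (k + 2))"
    proof -
      have "real N * (p / 2) = (p * W) * real (k + 2)" unfolding N W_def by (simp add: algebra_simps)
      moreover have "1 * real (k + 2) \<le> (p * W) * real (k + 2)" using pW by (intro mult_right_mono) auto
      ultimately have "real (k + 2) \<le> real N * (p / 2)" by (simp only: mult_1)
      then show ?thesis by (simp only: exp_le_cancel_iff neg_le_iff_le)
    qed
    also have "\<dots> \<le> 1 / 2 ^ (k + 2)" by (rule e2)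
    also have "\<dots> \<le> 1 / (2 * 2 ^ k)" by (simp add: field_simps)
    finally show ?thesis .
  qed
  finally show ?thesis by simp
qed

end

section \<open>The program\<close>

text \<open>
  Cells below 20 are scratch cells, the cells 20 to 41 hold constants: 20 the address of a copy of the input,
  21 \<open>\<Delta>\<close>, 22 \<open>q\<close>, 23 \<open>n\<close>, 24 the precision, 25 the number \<open>m\<close> of edges, 26 the adjacency table,
  27 its row length \<open>\<Delta> + 1\<close>, 28 the colours, 29 a buffer for pairs of colours, 30 the class sizes, 31 the
  number 1, 32 \<open>m + n\<close>, 33 the steps per trial, 34 the trials, 35 and 36 the two admissible class sizes,
  37 \<open>q\<^sup>2\<close>, 38 the address of the edges, 39 the number 0, 40 \<open>q + 1\<close>, 41 the successor of cell 36.
\<close>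

definition check_colour :: "nat \<Rightarrow> nat \<Rightarrow> com" where
  "check_colour rv rx = Blk [Mul 0 rv 27, Add 0 0 26, Load 1 0, Add 1 1 0] ;;
    DoWhile (Blk [Add 0 0 31, Load 2 0, Add 2 2 28, Load 3 2] ;;
      Unless 3 rx (Unless rx 3 (Blk [Const 13 1]))) 0 1"

text \<open>All \<open>q * q\<close> codes are tried and the compatible ones are put into the
  buffer, so that one random index suffices; rejection would make the running time random. The code
  \<open>c\<close> stands for the colours \<open>c div q + 1\<close> and
  \<open>c mod q + 1\<close>.\<close>

definition collect_pairs :: com where
  "collect_pairs = Blk [Const 14 0, Const 15 0] ;;
    DoWhile (
      Blk [Const 13 0, Div 12 15 22, Mul 4 12 22, Sub 11 15 4, Add 12 12 31, Add 11 11 31] ;;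
      check_colour 17 12 ;; check_colour 16 11 ;;
      Unless 12 11 (Unless 11 12 (Blk [Const 13 1])) ;;
      Unless 39 13 (Blk [Add 4 29 14, Store 4 15, Add 14 14 31]) ;;
      Blk [Add 15 15 31]) 15 37"

text \<open>Both ends first get the dummy colour 0, which is no candidate. After that,
  \<open>check_colour\<close> may scan all neighbours, the partner included.\<close>

definition resample_edge :: com where
  "resample_edge = Blk [Add 4 28 17, Store 4 39, Add 4 28 16, Store 4 39] ;; collect_pairs ;; Rnd 5 14 ;;
    Blk [Add 4 29 5, Load 5 4, Div 12 5 22, Mul 4 12 22, Sub 11 5 4, Add 12 12 31, Add 11 11 31,
      Add 4 28 17, Store 4 12, Add 4 28 16, Store 4 11]"

text \<open>\<open>Unless\<close> skips on strict comparison only. With \<open>m\<close> edges and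
  index \<open>r\<close>, the edge move is skipped if \<open>m < r + 1\<close>, the vertex move if
  \<open>r < m\<close>. A positive degree at the head of its row makes a vertex idle.\<close>

definition chain_step :: com where
  "chain_step = Rnd 10 32 ;; Blk [Add 4 10 31] ;;
    Unless 25 4 (Blk [Add 4 10 10, Add 4 4 38, Load 17 4, Add 4 4 31, Load 16 4] ;; resample_edge) ;;
    Unless 10 25 (Blk [Sub 17 10 25, Mul 4 17 27, Add 4 4 26, Load 4 4] ;;
      Unless 39 4 (Rnd 5 22 ;; Blk [Add 5 5 31, Add 4 28 17, Store 4 5]))"

definition check_balance :: com where
  "check_balance = Blk [Const 4 0] ;; DoWhile (Blk [Add 5 30 4, Store 5 39, Add 4 4 31]) 4 40 ;;
    Blk [Const 4 0] ;;
    DoWhile (Blk [Add 5 28 4, Load 5 5, Add 5 5 30, Load 6 5, Add 6 6 31, Store 5 6, Add 4 4 31]) 4 23 ;;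
    Blk [Const 13 0, Const 4 1] ;;
    DoWhile (Blk [Add 5 30 4, Load 5 5, Add 6 5 31] ;; Unless 35 6 (Blk [Const 13 1]) ;;
      Unless 5 41 (Blk [Const 13 1]) ;; Blk [Add 4 4 31]) 4 40"

definition trials :: com where
  "trials = Blk [Const 19 0] ;;
    DoWhile (Blk [Const 18 0] ;; DoWhile (chain_step ;; Blk [Add 18 18 31]) 18 33 ;;
      check_balance ;; Blk [Add 19 19 31] ;; Unless 39 13 (Blk [Add 19 34 39])) 19 34"

section \<open>Scanning neighbours and collecting colour pairs\<close>

lemma ensures_blk_seq:
  "all_small B is m \<Longrightarrow> ensures B c (exec_all is m) t' Q \<Longrightarrow> length is + t' \<le> t \<Longrightarrow> ensures B (Blk is ;; c) m t Q"
  by (rule ensures_seq[OF ensures_blk[where Q = "\<lambda>m'. m' = exec_all is m"]]) auto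

lemma achieves_ensures_seq:
  assumes "ensures B c1 m t1 Q" "\<And>m'. Q m' \<Longrightarrow> achieves B c2 m' t2 D J" "t1 + t2 \<le> t"
  shows "achieves B (c1 ;; c2) m t D J"
proof -
  have "achieves B (c1 ;; c2) m t (bind_pmf (return_pmf ()) (\<lambda>_. D)) J"
    by (rule achieves_seq[where J = "\<lambda>_. Q", OF achieves_ensures[OF assms(1)] _ assms(3)]) (rule assms(2))
  then show ?thesis by (simp add: bind_return_pmf)
qed

lemma achieves_blk_seq:
  "all_small B is m \<Longrightarrow> achieves B c (exec_all is m) t' D J \<Longrightarrow> length is + t' \<le> t \<Longrightarrow> achieves B (Blk is ;; c) m t D J"
  by (rule achieves_ensures_seq[OF ensures_blk[where Q = "\<lambda>m'. m' = exec_all is m"]]) auto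

lemma achieves_seq_ensures:
  assumes "achieves B c1 m t1 D J" "\<And>d m'. d \<in> set_pmf D \<Longrightarrow> J d m' \<Longrightarrow> ensures B c2 m' t2 (J' (g d))" "t1 + t2 \<le> t"
  shows "achieves B (c1 ;; c2) m t (map_pmf g D) J'"
  unfolding map_pmf_def
  by (rule achieves_seq[OF assms(1) _ assms(3)], rule achieves_ensures, rule assms(2))

text \<open>The memory \<open>m0\<close> after initialisation is a parameter, described by its
  layout. The changing areas start at \<open>Cb\<close> with the colours, followed by the pair
  buffer and the class sizes.\<close>

locale sampler = colouring_graph +
  fixes k t N B :: nat and m0 :: memory
  fixes b A Cb Fb Gb :: nat and adj :: "nat \<Rightarrow> nat list"
  assumes adr: "b = 128 * length es" "A = 2 * b" "Cb = A + n * (\<Delta> + 1)" "Fb = Cb + n" "Gb = Fb + q * q"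
    and tN: "0 < t" "0 < N"
    and B: "Gb + q + 1 \<le> B" "t \<le> B" "N \<le> B" "128 \<le> B"
    and adj: "\<And>v. v < n \<Longrightarrow> set (adj v) = nb v" "\<And>v. length (adj v) \<le> \<Delta>"
    and es_pos: "0 < length es"
    and m0_reg: "m0 20 = b" "m0 21 = \<Delta>" "m0 22 = q" "m0 23 = n" "m0 24 = k" "m0 25 = length es" "m0 26 = A"
      "m0 27 = \<Delta> + 1" "m0 28 = Cb" "m0 29 = Fb" "m0 30 = Gb" "m0 31 = 1" "m0 32 = M" "m0 33 = t" "m0 34 = N"
      "m0 35 = n div q" "m0 36 = n div q + 1" "m0 37 = q * q" "m0 38 = b + 5" "m0 39 = 0" "m0 40 = q + 1" "m0 41 = n div q + 2"
    and m0_edge: "\<And>r. r < length es \<Longrightarrow> m0 (b + 5 + 2 * r) = src r" "\<And>r. r < length es \<Longrightarrow> m0 (b + 6 + 2 * r) = tgt r"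
    and m0_deg: "\<And>v. v < n \<Longrightarrow> m0 (A + v * (\<Delta> + 1)) = length (adj v)"
    and m0_adj: "\<And>v j. v < n \<Longrightarrow> j < length (adj v) \<Longrightarrow> m0 (A + v * (\<Delta> + 1) + Suc j) = adj v ! j"
begin

lemma low: "128 \<le> b" "256 \<le> A" "256 \<le> Cb" "256 \<le> Fb" "256 \<le> Gb" "b + 5 + 2 * length es \<le> A" "A \<le> Cb"
  using es_pos adr by linarith+

lemma row: "v < n \<Longrightarrow> A + v * (\<Delta> + 1) + \<Delta> < Cb"
proof -
  assume "v < n"
  then have "(v + 1) * (\<Delta> + 1) \<le> n * (\<Delta> + 1)" by (intro mult_le_mono1) simp
  then show ?thesis unfolding adr(3) by simp
qed

definition stat :: "memory \<Rightarrow> bool" where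
  "stat m \<longleftrightarrow> (\<forall>a. 20 \<le> a \<longrightarrow> a < Cb \<longrightarrow> m a = m0 a)"

lemma statD:
  assumes "stat m"
  shows "m 20 = b" "m 21 = \<Delta>" "m 22 = q" "m 23 = n" "m 24 = k" "m 25 = length es" "m 26 = A"
      "m 27 = \<Delta> + 1" "m 28 = Cb" "m 29 = Fb" "m 30 = Gb" "m 31 = 1" "m 32 = M" "m 33 = t" "m 34 = N"
      "m 35 = n div q" "m 36 = n div q + 1" "m 37 = q * q" "m 38 = b + 5" "m 39 = 0" "m 40 = q + 1" "m 41 = n div q + 2"
proof -
  have "m a = m0 a" if "20 \<le> a" "a \<le> 41" for a
    using that assms low by (simp add: stat_def)
  then show "m 20 = b" "m 21 = \<Delta>" "m 22 = q" "m 23 = n" "m 24 = k" "m 25 = length es" "m 26 = A"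
      "m 27 = \<Delta> + 1" "m 28 = Cb" "m 29 = Fb" "m 30 = Gb" "m 31 = 1" "m 32 = M" "m 33 = t" "m 34 = N"
      "m 35 = n div q" "m 36 = n div q + 1" "m 37 = q * q" "m 38 = b + 5" "m 39 = 0" "m 40 = q + 1" "m 41 = n div q + 2"
    by (simp_all add: m0_reg)
qed

lemma stat_cong: "stat m \<Longrightarrow> (\<And>a. 20 \<le> a \<Longrightarrow> a < Cb \<Longrightarrow> m' a = m a) \<Longrightarrow> stat m'"
  by (simp add: stat_def)

text \<open>The flag in cell 13 is set but never cleared, so successive checks accumulate. The row
  must be nonempty because the loop runs at least once.\<close>

lemma check_colour_ensures:
  assumes st: "stat m" and col: "\<And>u. u < n \<Longrightarrow> m (Cb + u) = col u" and v: "v < n" "m rv = v" "m rx = x"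
    and rx: "4 \<le> rx" "rx \<noteq> 13" and ne: "nb v \<noteq> {}"
  shows "ensures B (check_colour rv rx) m (4 + \<Delta> * 8)
    (\<lambda>m'. (\<forall>a. a \<notin> {0, 1, 2, 3, 13} \<longrightarrow> m' a = m a) \<and> m' 13 = (if \<exists>u\<in>nb v. col u = x then 1 else m 13))"
proof -
  note r = statD[OF st] and l = low
  define p where "p = A + v * (\<Delta> + 1)"
  define d where "d = length (adj v)"
  have pC: "p + \<Delta> < Cb" "A \<le> p" using row[OF v(1)] by (simp_all add: p_def)
  have d: "0 < d" "d \<le> \<Delta>" using ne adj[of v] v by (auto simp: d_def)
  have BC: "Cb + n + q * q + q + 1 \<le> B" using B adr by simp
  have mp: "m p = d" using st l pC m0_deg[OF v(1)] by (simp add: stat_def p_def d_def)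
  have mj: "m (Suc (p + j)) = adj v ! j" if "j < d" for j
  proof -
    have "m (p + Suc j) = m0 (p + Suc j)" using st l pC d that by (simp add: stat_def)
    then show ?thesis using m0_adj[OF v(1), of j] that by (simp add: p_def d_def)
  qed
  have vp: "v * (\<Delta> + 1) \<le> p" by (simp add: p_def)
  define m1 where "m1 = exec_all [Mul 0 rv 27, Add 0 0 26, Load 1 0, Add 1 1 0] m"
  have m1: "m1 0 = p" "m1 1 = p + d" "\<forall>a. a \<notin> {0, 1, 2, 3, 13} \<longrightarrow> m1 a = m a" "m1 13 = m 13"
  proof -
    have p': "m rv * m 27 + m 26 = p" using v r by (simp add: p_def)
    show "m1 0 = p" "m1 1 = p + d" "\<forall>a. a \<notin> {0, 1, 2, 3, 13} \<longrightarrow> m1 a = m a" "m1 13 = m 13"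
      using p' mp pC l by (simp_all add: m1_def add.commute)
  qed
  define I where "I i m' \<longleftrightarrow> m' 0 = p + i \<and> m' 1 = p + d \<and> (\<forall>a. a \<notin> {0, 1, 2, 3, 13} \<longrightarrow> m' a = m a) \<and>
    m' 13 = (if \<exists>u\<in>set (take i (adj v)). col u = x then 1 else m 13)" for i m'
  have body: "ensures B (Blk [Add 0 0 31, Load 2 0, Add 2 2 28, Load 3 2] ;;
      Unless 3 rx (Unless rx 3 (Blk [Const 13 1]))) m' 7 (\<lambda>m'. I (Suc i) m' \<and> (m' 0 < m' 1 \<longleftrightarrow> Suc i < d))"
    if i: "i < d" and I: "I i m'" for i m'
  proof -
    define u where "u = adj v ! i"
    have u: "u \<in> nb v" "u < n" using i adj(1)[OF v(1)] nb_lt unfolding u_def d_def by (metis nth_mem)+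
    have fr: "m' a = m a" if "a \<notin> {0, 1, 2, 3, 13}" for a using I that by (simp add: I_def)
    have m': "m' 0 = p + i" "m' 1 = p + d" "m' 31 = 1" "m' 28 = Cb" "m' rx = x" "m' (Suc (p + i)) = u" "m' (u + Cb) = col u"
    proof -
      show "m' 0 = p + i" "m' 1 = p + d" using I by (simp_all add: I_def)
      show "m' 31 = 1" "m' 28 = Cb" "m' rx = x" using fr r rx v by simp_all
      show "m' (Suc (p + i)) = u" using fr[of "Suc (p + i)"] mj[OF i] pC l by (simp add: u_def)
      show "m' (u + Cb) = col u" using fr[of "Cb + u"] col[OF u(2)] l by (simp add: add.commute)
    qed
    define m2 where "m2 = exec_all [Add 0 0 31, Load 2 0, Add 2 2 28, Load 3 2] m'"
    have m2: "m2 0 = p + Suc i" "m2 1 = p + d" "m2 3 = col u" "m2 rx = x" "m2 13 = m' 13"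
      "\<And>a. a \<notin> {0, 1, 2, 3, 13} \<Longrightarrow> m2 a = m a"
      using m' rx l(3) by (simp_all add: m2_def fr)
    have sm: "all_small B [Add 0 0 31, Load 2 0, Add 2 2 28, Load 3 2] m'"
      using m' BC pC d i u l by simp
    have tk: "take (Suc i) (adj v) = take i (adj v) @ [u]"
      using i by (simp add: take_Suc_conv_app_nth u_def d_def)
    have skip: "I (Suc i) m2 \<and> (m2 0 < m2 1 \<longleftrightarrow> Suc i < d)" if "col u \<noteq> x"
      using m2 that I i unfolding I_def tk by simp
    have hit: "I (Suc i) (m2(13 := 1)) \<and> ((m2(13 := 1)) 0 < (m2(13 := 1)) 1 \<longleftrightarrow> Suc i < d)" if "col u = x"
      using m2 that I i unfolding I_def tk by simp
    show ?thesis
    proof (rule ensures_blk_seq[OF sm, folded m2_def])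
      show "ensures B (Unless 3 rx (Unless rx 3 (Blk [Const 13 1]))) m2 3 (\<lambda>m'. I (Suc i) m' \<and> (m' 0 < m' 1 \<longleftrightarrow> Suc i < d))"
      proof (rule ensures_unless)
        assume "m2 3 < m2 rx"
        then show "I (Suc i) m2 \<and> (m2 0 < m2 1 \<longleftrightarrow> Suc i < d)" using m2 by (intro skip) simp
      next
        assume *: "m2 rx \<le> m2 3"
        show "ensures B (Unless rx 3 (Blk [Const 13 1])) m2 2 (\<lambda>m'. I (Suc i) m' \<and> (m' 0 < m' 1 \<longleftrightarrow> Suc i < d))"
        proof (rule ensures_unless)
          assume "m2 rx < m2 3"
          then show "I (Suc i) m2 \<and> (m2 0 < m2 1 \<longleftrightarrow> Suc i < d)" using m2 by (intro skip) simp
        next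
          assume "m2 3 \<le> m2 rx"
          then have "col u = x" using * m2 by simp
          from hit[OF this] show "ensures B (Blk [Const 13 1]) m2 1 (\<lambda>m'. I (Suc i) m' \<and> (m' 0 < m' 1 \<longleftrightarrow> Suc i < d))"
            using B by (intro ensures_blk) simp_all
        qed simp
      qed simp
    qed simp
  qed
  have sm: "all_small B [Mul 0 rv 27, Add 0 0 26, Load 1 0, Add 1 1 0] m"
  proof -
    define w where "w = v * (\<Delta> + 1)"
    have w: "m rv * m 27 = w" "w + m 26 = p" "w \<le> p" using v r(7,8) by (simp_all add: w_def p_def)
    have "p + \<Delta> \<le> B" using pC BC by linarith
    then show ?thesis using w mp d(2) by (simp add: add.commute)
  qed
  have "I 0 m1" using m1 by (simp add: I_def)
  from ensures_loop[of d I, OF body this d(1), of "d * Suc 7"]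
  have "ensures B (DoWhile (Blk [Add 0 0 31, Load 2 0, Add 2 2 28, Load 3 2] ;;
      Unless 3 rx (Unless rx 3 (Blk [Const 13 1]))) 0 1) m1 (d * Suc 7) (I d)" by simp
  then have "ensures B (check_colour rv rx) m (4 + d * Suc 7) (I d)"
    unfolding check_colour_def m1_def by (rule ensures_blk_seq[OF sm]) simp
  moreover have "set (take d (adj v)) = nb v" using adj(1)[OF v(1)] by (simp add: d_def)
  then have "I d m' \<Longrightarrow> (\<forall>a. a \<notin> {0, 1, 2, 3, 13} \<longrightarrow> m' a = m a) \<and> m' 13 = (if \<exists>u\<in>nb v. col u = x then 1 else m 13)" for m'
    by (simp add: I_def)
  ultimately show ?thesis 
    using d(2) by (elim ensures_mono) simp_all
qed

definition pair_ok :: "nat \<Rightarrow> nat \<Rightarrow> (nat \<Rightarrow> nat) \<Rightarrow> nat \<Rightarrow> bool" where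
  "pair_ok v w col c \<longleftrightarrow> \<not> (\<exists>u\<in>nb v. col u = c div q + 1) \<and> \<not> (\<exists>u\<in>nb w. col u = c mod q + 1) \<and> c div q \<noteq> c mod q"

text \<open>The cells that survive are those of the callers: the block index in 10, the edge in 16
  and 17, the two loop counters in 18 and 19, and everything static together with the
  colours.\<close>

lemma collect_pairs_ensures:
  assumes st: "stat m" and col: "\<And>u. u < n \<Longrightarrow> m (Cb + u) = col u" and vw: "v < n" "w < n" "m 17 = v" "m 16 = w"
    and ne: "nb v \<noteq> {}" "nb w \<noteq> {}"
  shows "ensures B collect_pairs m (2 + q * q * (Suc (22 + \<Delta> * 16)))
    (\<lambda>m'. (\<forall>a. (a \<in> {10, 16, 17, 18, 19} \<or> 20 \<le> a \<and> a < Fb) \<longrightarrow> m' a = m a) \<and>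
      m' 14 = length (filter (pair_ok v w col) [0..<q * q]) \<and>
      (\<forall>j < length (filter (pair_ok v w col) [0..<q * q]). m' (Fb + j) = filter (pair_ok v w col) [0..<q * q] ! j))"
proof -
  define L where "L c = filter (pair_ok v w col) [0..<c]" for c
  define keep where "keep a \<longleftrightarrow> a \<in> {10, 16, 17, 18, 19} \<or> 20 \<le> a \<and> a < Fb" for a :: nat
  define I where "I c m' \<longleftrightarrow> (\<forall>a. keep a \<longrightarrow> m' a = m a) \<and> m' 15 = c \<and> m' 14 = length (L c) \<and>
    (\<forall>j < length (L c). m' (Fb + j) = L c ! j)" for c m'
  have BC: "Cb + n + q * q + q + 1 \<le> B" and Fb: "Fb = Cb + n" using B adr by simp_all
  have q0: "0 < q" using q2 by simp
  let ?b1 = "[Const 13 0, Div 12 15 22, Mul 4 12 22, Sub 11 15 4, Add 12 12 31, Add 11 11 31]"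
  have body: "ensures B (Blk ?b1 ;; check_colour 17 12 ;; check_colour 16 11 ;;
      Unless 12 11 (Unless 11 12 (Blk [Const 13 1])) ;;
      Unless 39 13 (Blk [Add 4 29 14, Store 4 15, Add 14 14 31]) ;; Blk [Add 15 15 31]) m' (22 + \<Delta> * 16)
      (\<lambda>m'. I (Suc c) m' \<and> (m' 15 < m' 37 \<longleftrightarrow> Suc c < q * q))" if c: "c < q * q" and I: "I c m'" for c m'
  proof -
    have kp: "m' a = m a" if "keep a" for a using I that by (simp add: I_def)
    have keepC: "keep a" if "20 \<le> a" "a < Fb" for a using that by (simp add: keep_def)
    have st': "stat m'" by (rule stat_cong[OF st kp]) (simp add: keep_def Fb)
    note r = statD[OF st']
    define x where "x = c div q + 1"
    define y where "y = c mod q + 1"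
    have xy: "x \<le> q" "y \<le> q" using c q0 by (auto simp: x_def y_def less_mult_imp_div_less Suc_le_eq)
    have cd: "c div q * q \<le> c" "c - c div q * q = c mod q" by (simp_all add: minus_div_mult_eq_mod)
    define m1 where "m1 = exec_all ?b1 m'"
    have m1: "m1 12 = x" "m1 11 = y" "m1 13 = 0" "\<And>a. a \<notin> {4, 11, 12, 13} \<Longrightarrow> m1 a = m' a"
      using r I cd by (simp_all add: m1_def I_def x_def y_def)
    have s1: "all_small B ?b1 m'"
    proof -
      have "c div q * q \<le> B" using div_times_less_eq_dividend[of c q] c BC by linarith
      moreover have "Suc (c div q) \<le> B" "Suc (c mod q) \<le> B" "m' 15 = c"
        using BC xy I by (simp_all add: x_def y_def I_def)
      ultimately
      show ?thesis using r cd(2) B(4) by simp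
    qed
    have st1: "stat m1" by (rule stat_cong[OF st']) (simp add: m1(4))
    have col1: "m1 (Cb + u) = col u" if "u < n" for u
      using m1(4)[of "Cb + u"] kp[of "Cb + u"] keepC[of "Cb + u"] col[OF that] that low Fb by simp
    have reg1: "m1 17 = v" "m1 16 = w" using m1(4) kp vw by (simp_all add: keep_def)
    have e1: "ensures B (check_colour 17 12) m1 (4 + \<Delta> * 8)
      (\<lambda>m2. (\<forall>a. a \<notin> {0, 1, 2, 3, 13} \<longrightarrow> m2 a = m1 a) \<and> m2 13 = (if \<exists>u\<in>nb v. col u = x then 1 else m1 13))"
      by (rule check_colour_ensures[OF st1 col1 vw(1) reg1(1) m1(1)]) (use ne in auto)
    show ?thesis
    proof (rule ensures_blk_seq[OF s1, folded m1_def, where t' = "16 + \<Delta> * 16"], rule ensures_seq[OF e1])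
      fix m2 assume *: "(\<forall>a. a \<notin> {0, 1, 2, 3, 13} \<longrightarrow> m2 a = m1 a) \<and> m2 13 = (if \<exists>u\<in>nb v. col u = x then 1 else m1 13)"
      have f2: "m2 a = m1 a" if "a \<notin> {0, 1, 2, 3, 13}" for a using * that by blast
      have st2: "stat m2" by (rule stat_cong[OF st1]) (simp add: f2)
      have col2: "m2 (Cb + u) = col u" if "u < n" for u using f2[of "Cb + u"] col1[OF that] low by simp
      have reg2: "m2 16 = w" "m2 11 = y" using f2 reg1 m1 by simp_all
      have e2: "ensures B (check_colour 16 11) m2 (4 + \<Delta> * 8)
        (\<lambda>m3. (\<forall>a. a \<notin> {0, 1, 2, 3, 13} \<longrightarrow> m3 a = m2 a) \<and> m3 13 = (if \<exists>u\<in>nb w. col u = y then 1 else m2 13))"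
        by (rule check_colour_ensures[OF st2 col2 vw(2) reg2]) (use ne in auto)
      show "ensures B (check_colour 16 11 ;; Unless 12 11 (Unless 11 12 (Blk [Const 13 1])) ;;
        Unless 39 13 (Blk [Add 4 29 14, Store 4 15, Add 14 14 31]) ;; Blk [Add 15 15 31]) m2 (12 + \<Delta> * 8)
        (\<lambda>m'. I (Suc c) m' \<and> (m' 15 < m' 37 \<longleftrightarrow> Suc c < q * q))"
      proof (rule ensures_seq[OF e2])
        fix m3 assume **: "(\<forall>a. a \<notin> {0, 1, 2, 3, 13} \<longrightarrow> m3 a = m2 a) \<and> m3 13 = (if \<exists>u\<in>nb w. col u = y then 1 else m2 13)"
        have f3: "m3 a = m' a" if "a \<notin> {0, 1, 2, 3, 4, 11, 12, 13}" for a
          using ** that f2[of a] m1(4)[of a] by auto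
        have reg3: "m3 12 = x" "m3 11 = y" using ** f2 m1 by simp_all
        have b3: "m3 13 = (if (\<exists>u\<in>nb v. col u = x) \<or> (\<exists>u\<in>nb w. col u = y) then 1 else 0)"
          using * ** m1(3) by simp
        define Q4 where "Q4 m4 \<longleftrightarrow> (\<forall>a. a \<notin> {0, 1, 2, 3, 4, 11, 12, 13} \<longrightarrow> m4 a = m' a) \<and> m4 13 = of_bool (\<not> pair_ok v w col c)" for m4
        have e4: "ensures B (Unless 12 11 (Unless 11 12 (Blk [Const 13 1]))) m3 3 Q4"
        proof (rule ensures_unless)
          assume "m3 12 < m3 11"
          then show "Q4 m3" using f3 reg3 b3 by (auto simp: Q4_def pair_ok_def x_def y_def)
        next
          assume le: "m3 11 \<le> m3 12"
          show "ensures B (Unless 11 12 (Blk [Const 13 1])) m3 2 Q4"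
          proof (rule ensures_unless)
            assume "m3 11 < m3 12"
            then show "Q4 m3" using f3 reg3 b3 by (auto simp: Q4_def pair_ok_def x_def y_def)
          next
            assume "m3 12 \<le> m3 11"
            then have "x = y" using le reg3 by simp
            then show "ensures B (Blk [Const 13 1]) m3 1 Q4"
              using f3 reg3 B by (intro ensures_blk) (auto simp: Q4_def pair_ok_def x_def y_def)
          qed simp
        qed simp
        show "ensures B (Unless 12 11 (Unless 11 12 (Blk [Const 13 1])) ;;
          Unless 39 13 (Blk [Add 4 29 14, Store 4 15, Add 14 14 31]) ;; Blk [Add 15 15 31]) m3 8
          (\<lambda>m'. I (Suc c) m' \<and> (m' 15 < m' 37 \<longleftrightarrow> Suc c < q * q))"
        proof (rule ensures_seq[OF e4])
          fix m4 assume Q4: "Q4 m4"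
          have f4: "m4 a = m' a" if "a \<notin> {0, 1, 2, 3, 4, 11, 12, 13}" for a using Q4 that by (simp add: Q4_def)
          have r4: "m4 39 = 0" "m4 29 = Fb" "m4 31 = 1" "m4 15 = c" "m4 14 = length (L c)" "m4 37 = q * q"
          proof -
        have "m' 15 = c" "m' 14 = length (L c)" using I by (simp_all add: I_def)
        then show "m4 39 = 0" "m4 29 = Fb" "m4 31 = 1" "m4 15 = c" "m4 14 = length (L c)" "m4 37 = q * q"
          by (simp_all add: f4 r)
      qed
          have k4: "m4 a = m a" if "keep a" for a using f4[of a] kp[OF that] that by (auto simp: keep_def)
          have len: "length (L c) \<le> c" unfolding L_def by (rule order_trans[OF length_filter_le]) simp
          have buf: "m4 (Fb + j) = L c ! j" if "j < length (L c)" for j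
            using f4[of "Fb + j"] I that low by (simp add: I_def)
          define Q5 where "Q5 m5 \<longleftrightarrow> (\<forall>a. keep a \<longrightarrow> m5 a = m a) \<and> m5 15 = c \<and> m5 14 = length (L (Suc c)) \<and>
            (\<forall>j < length (L (Suc c)). m5 (Fb + j) = L (Suc c) ! j)" for m5
          have e5: "ensures B (Unless 39 13 (Blk [Add 4 29 14, Store 4 15, Add 14 14 31])) m4 4 Q5"
          proof (rule ensures_unless)
            assume "m4 39 < m4 13"
            then have "\<not> pair_ok v w col c" using Q4 r4 by (auto simp: Q4_def)
            then have "L (Suc c) = L c" by (simp add: L_def)
            then show "Q5 m4" using k4 r4 buf by (simp add: Q5_def)
          next
            assume "m4 13 \<le> m4 39"
            then have "pair_ok v w col c" using Q4 r4 by (auto simp: Q4_def)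
            then have Lc: "L (Suc c) = L c @ [c]" by (simp add: L_def)
            show "ensures B (Blk [Add 4 29 14, Store 4 15, Add 14 14 31]) m4 3 Q5"
            proof (rule ensures_blk)
              show "all_small B [Add 4 29 14, Store 4 15, Add 14 14 31] m4"
                using r4 len c BC Fb low by simp
              show "Q5 (exec_all [Add 4 29 14, Store 4 15, Add 14 14 31] m4)"
                using r4 k4 buf low by (auto simp: Q5_def Lc nth_append keep_def less_Suc_eq)
            qed simp
          qed simp
          show "ensures B (Unless 39 13 (Blk [Add 4 29 14, Store 4 15, Add 14 14 31]) ;; Blk [Add 15 15 31]) m4 5
            (\<lambda>m'. I (Suc c) m' \<and> (m' 15 < m' 37 \<longleftrightarrow> Suc c < q * q))"
          proof (rule ensures_seq[OF e5])
            fix m5 assume Q5: "Q5 m5"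
            have r5: "m5 31 = 1" "m5 37 = q * q" using Q5 keepC[of 31] keepC[of 37] low statD[OF st] by (auto simp: Q5_def)
            show "ensures B (Blk [Add 15 15 31]) m5 1 (\<lambda>m'. I (Suc c) m' \<and> (m' 15 < m' 37 \<longleftrightarrow> Suc c < q * q))"
            proof (rule ensures_blk)
              show "all_small B [Add 15 15 31] m5" using Q5 r5 c BC by (simp add: Q5_def)
              show "I (Suc c) (exec_all [Add 15 15 31] m5) \<and> ((exec_all [Add 15 15 31] m5) 15 < (exec_all [Add 15 15 31] m5) 37 \<longleftrightarrow> Suc c < q * q)"
                using Q5 r5 low by (auto simp: Q5_def I_def keep_def)
            qed simp
          qed simp
        qed simp
      qed simp
    qed simp_all
  qed
  define m1 where "m1 = exec_all [Const 14 0, Const 15 0] m"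
  have "I 0 m1" by (simp add: I_def L_def m1_def keep_def)
  from ensures_loop[of "q * q" I, OF body this, of "q * q * Suc (22 + \<Delta> * 16)"] q0
  have "ensures B (DoWhile (Blk ?b1 ;; check_colour 17 12 ;; check_colour 16 11 ;;
      Unless 12 11 (Unless 11 12 (Blk [Const 13 1])) ;;
      Unless 39 13 (Blk [Add 4 29 14, Store 4 15, Add 14 14 31]) ;; Blk [Add 15 15 31]) 15 37) m1 (q * q * Suc (22 + \<Delta> * 16)) (I (q * q))"
    by simp
  then have "ensures B collect_pairs m (2 + q * q * Suc (22 + \<Delta> * 16)) (I (q * q))"
    unfolding collect_pairs_def m1_def by (intro ensures_blk_seq) auto
  then show ?thesis by (rule ensures_mono) (auto simp: I_def L_def keep_def)
qed

end

section \<open>Coupling the machine with the chain and the trials\<close>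

context sampler begin

text \<open>Membership in \<open>\<Omega>\<close> bounds the colours, which
  \<open>check_balance\<close> uses as offsets into the table of class sizes.\<close>

definition inv :: "(nat \<Rightarrow> nat) \<Rightarrow> memory \<Rightarrow> bool" where
  "inv \<sigma> m \<longleftrightarrow> stat m \<and> (\<forall>u<n. m (Cb + u) = \<sigma> u) \<and> \<sigma> \<in> \<Omega>"

definition step_time :: nat where "step_time = 50 + q * q * (23 + \<Delta> * 16)"

text \<open>With \<open>v\<close> and \<open>w\<close> at colour 0, the scan of all neighbours
  agrees with \<open>allowed\<close>, where the partner is left out. A uniform position in the
  buffer is therefore a uniform pair of \<open>heat_bath\<close>.\<close>

lemma bij_pair_codes:
  assumes vw: "w \<in> nb v" and L: "L = filter (pair_ok v w (\<sigma>(v := 0, w := 0))) [0..<q * q]"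
  shows "bij_betw (\<lambda>j. (L ! j div q + 1, L ! j mod q + 1)) {..<length L} (off_diag (allowed v w \<sigma>) (allowed w v \<sigma>))"
proof -
  have wv: "v \<in> nb w" "v \<noteq> w" using vw nb_sym nb_irrefl by auto
  have q0: "0 < q" using q2 by simp
  let ?dec = "\<lambda>c. (c div q + 1, c mod q + 1)"
  have al: "(\<not> (\<exists>u\<in>nb a. (\<sigma>(v := 0, w := 0)) u = x)) \<longleftrightarrow> x \<in> allowed a b \<sigma>"
    if "a = v \<and> b = w \<or> a = w \<and> b = v" "x \<in> {1..q}" for a b x
    using that wv vw nb_irrefl by (auto simp: allowed_def image_iff)
  have "bij_betw ((!) L) {..<length L} (set L)"
    by (rule bij_betw_nth) (auto simp: L)
  moreover have "bij_betw ?dec (set L) (off_diag (allowed v w \<sigma>) (allowed w v \<sigma>))"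
  proof (rule bij_betw_imageI)
    show "inj_on ?dec (set L)"
    proof (rule inj_onI)
      fix c c' assume "?dec c = ?dec c'"
      then have "c div q = c' div q" "c mod q = c' mod q" by auto
      then show "c = c'" by (metis div_mult_mod_eq)
    qed
    have dec_range: "c div q + 1 \<in> {1..q}" "c mod q + 1 \<in> {1..q}" if "c < q * q" for c
      using that q0 by (auto simp: less_mult_imp_div_less Suc_le_eq)
    show "?dec ` set L = off_diag (allowed v w \<sigma>) (allowed w v \<sigma>)"
    proof (intro equalityI subsetI)
      fix z assume "z \<in> ?dec ` set L"
      then obtain c where c: "c < q * q" "pair_ok v w (\<sigma>(v := 0, w := 0)) c" "z = ?dec c" by (auto simp: L)
      have "c div q + 1 \<in> allowed v w \<sigma>" "c mod q + 1 \<in> allowed w v \<sigma>"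
        using c(2) al[of v w "c div q + 1"] al[of w v "c mod q + 1"] dec_range[OF c(1)] unfolding pair_ok_def by blast+
      then show "z \<in> off_diag (allowed v w \<sigma>) (allowed w v \<sigma>)"
        using c(2,3) by (simp add: off_diag_def pair_ok_def)
    next
      fix z assume "z \<in> off_diag (allowed v w \<sigma>) (allowed w v \<sigma>)"
      then obtain x y where z: "z = (x, y)" "x \<in> allowed v w \<sigma>" "y \<in> allowed w v \<sigma>" "x \<noteq> y"
        by (auto simp: off_diag_def)
      have xy: "x \<in> {1..q}" "y \<in> {1..q}" using z by (auto simp: allowed_def)
      define c where "c = (x - 1) * q + (y - 1)"
      have "y - 1 < q" using xy q0 by auto
      then have cd: "c div q = x - 1" "c mod q = y - 1" by (simp_all add: c_def)
      have dec: "c div q + 1 = x" "c mod q + 1 = y" unfolding cd using xy by auto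
      have "c < q * q"
      proof -
        have "c < (x - 1) * q + q" using \<open>y - 1 < q\<close> by (simp add: c_def)
        also have "\<dots> = x * q" using xy by (cases x) auto
        also have "\<dots> \<le> q * q" using xy by (intro mult_le_mono1) auto
        finally show ?thesis .
      qed
      moreover have "pair_ok v w (\<sigma>(v := 0, w := 0)) c"
        unfolding pair_ok_def dec using al[of v w x] al[of w v y] z xy dec by auto
      ultimately have "c \<in> set L" by (simp add: L)
      then show "z \<in> ?dec ` set L" by (rule rev_image_eqI) (simp only: dec z)
    qed
  qed
  ultimately have "bij_betw (?dec \<circ> (!) L) {..<length L} (off_diag (allowed v w \<sigma>) (allowed w v \<sigma>))"
    by (rule bij_betw_trans)
  then show ?thesis by (simp add: comp_def)
qed

lemma resample_edge_achieves:
  assumes i: "inv \<sigma> m" and vw: "m 17 = v" "m 16 = w" "w \<in> nb v"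
  shows "achieves B resample_edge m (18 + q * q * (23 + \<Delta> * 16)) (heat_bath v w \<sigma>)
    (\<lambda>\<tau> m'. inv \<tau> m' \<and> m' 10 = m 10 \<and> m' 18 = m 18 \<and> m' 19 = m 19)"
proof -
  have wv: "v \<in> nb w" "v \<noteq> w" "v < n" "w < n" using vw nb_sym nb_irrefl nb_lt nb_lt[of v w] by auto
  have st: "stat m" and col: "\<And>u. u < n \<Longrightarrow> m (Cb + u) = \<sigma> u" and \<sigma>: "\<sigma> \<in> \<Omega>" using i by (auto simp: inv_def)
  have BC: "Cb + n + q * q + q + 1 \<le> B" and Fb: "Fb = Cb + n" using B adr by simp_all
  note r = statD[OF st]
  let ?b1 = "[Add 4 28 17, Store 4 39, Add 4 28 16, Store 4 39]"
  define m1 where "m1 = exec_all ?b1 m"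
  define \<sigma>0 where "\<sigma>0 = \<sigma>(v := 0, w := 0)"
  have m1: "m1 a = (if a = 4 then Cb + w else if a = Cb + v \<or> a = Cb + w then 0 else m a)" for a
    using r vw low by (simp add: m1_def)
  have s1: "all_small B ?b1 m" using r vw low wv BC by simp
  have st1: "stat m1" by (rule stat_cong[OF st]) (simp add: m1)
  have col1: "m1 (Cb + u) = \<sigma>0 u" if "u < n" for u
    using col[OF that] low by (simp add: m1 \<sigma>0_def)
  have reg1: "m1 17 = v" "m1 16 = w" using vw low by (simp_all add: m1)
  define L where "L = filter (pair_ok v w \<sigma>0) [0..<q * q]"
  have e2: "ensures B collect_pairs m1 (2 + q * q * (Suc (22 + \<Delta> * 16)))
    (\<lambda>m'. (\<forall>a. (a \<in> {10, 16, 17, 18, 19} \<or> 20 \<le> a \<and> a < Fb) \<longrightarrow> m' a = m1 a) \<and>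
      m' 14 = length L \<and> (\<forall>j < length L. m' (Fb + j) = L ! j))"
    unfolding L_def by (rule collect_pairs_ensures[OF st1 col1 wv(3,4) reg1]) (use vw wv in auto)
  note bij = bij_pair_codes[OF vw(3) L_def[unfolded \<sigma>0_def]]
  have Lne: "0 < length L"
  proof (rule ccontr)
    assume "\<not> 0 < length L"
    then have "off_diag (allowed v w \<sigma>) (allowed w v \<sigma>) = {}" using bij by (simp add: bij_betw_def)
    then show False using allowed_pairs_ne[OF vw(3)] by blast
  qed
  let ?g = "\<lambda>j. \<sigma>(v := L ! j div q + 1, w := L ! j mod q + 1)"
  have law: "heat_bath v w \<sigma> = map_pmf ?g (pmf_of_set {..<length L})"
  proof -
    have dec: "map_pmf (\<lambda>j. (L ! j div q + 1, L ! j mod q + 1)) (pmf_of_set {..<length L}) = pmf_of_set (off_diag (allowed v w \<sigma>) (allowed w v \<sigma>))"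
      using Lne by (intro map_pmf_of_set_bij_betw bij) auto
    then show ?thesis unfolding heat_bath_def by (simp add: map_pmf_comp flip: dec)
  qed
  let ?b3 = "[Add 4 29 5, Load 5 4, Div 12 5 22, Mul 4 12 22, Sub 11 5 4, Add 12 12 31, Add 11 11 31,
      Add 4 28 17, Store 4 12, Add 4 28 16, Store 4 11]"
  have "achieves B resample_edge m (18 + q * q * (23 + \<Delta> * 16)) (map_pmf ?g (pmf_of_set {..<length L}))
    (\<lambda>\<tau> m'. inv \<tau> m' \<and> m' 10 = m 10 \<and> m' 18 = m 18 \<and> m' 19 = m 19)"
    unfolding resample_edge_def
  proof (rule achieves_blk_seq[OF s1, folded m1_def, where t' = "14 + q * q * (23 + \<Delta> * 16)"], rule achieves_ensures_seq[where ?t2.0 = 12, OF e2])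
    fix m2 assume *: "(\<forall>a. (a \<in> {10, 16, 17, 18, 19} \<or> 20 \<le> a \<and> a < Fb) \<longrightarrow> m2 a = m1 a) \<and>
      m2 14 = length L \<and> (\<forall>j < length L. m2 (Fb + j) = L ! j)"
    have f2: "m2 a = m1 a" if "a \<in> {10, 16, 17, 18, 19} \<or> 20 \<le> a \<and> a < Fb" for a using * that by blast
    have m2_14: "m2 14 = length L" using * by blast
    have st2: "stat m2" by (rule stat_cong[OF st1]) (rule f2, simp add: Fb)
    note r2 = statD[OF st2]
    have "achieves B (Rnd 5 14) m2 1 (pmf_of_set {..<m2 14}) (\<lambda>j m3. j < length L \<and> m3 = m2(5 := j))"
      by (rule achieves_rnd) (use m2_14 Lne in auto)
    then have a3: "achieves B (Rnd 5 14) m2 1 (pmf_of_set {..<length L}) (\<lambda>j m3. j < length L \<and> m3 = m2(5 := j))"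
      by (simp only: m2_14)
    show "achieves B (Rnd 5 14 ;; Blk ?b3) m2 12 (map_pmf ?g (pmf_of_set {..<length L}))
      (\<lambda>\<tau> m'. inv \<tau> m' \<and> m' 10 = m 10 \<and> m' 18 = m 18 \<and> m' 19 = m 19)"
    proof (rule achieves_seq_ensures[OF a3])
      fix j m3 assume j: "j < length L \<and> m3 = m2(5 := j)"
      define c where "c = L ! j"
      have "c \<in> set L" using j by (simp add: c_def)
      then have cq: "c < q * q" by (simp add: L_def)
      have len: "length L \<le> q * q" unfolding L_def by (rule order_trans[OF length_filter_le]) simp
      have q0: "0 < q" using q2 by simp
      have xy: "c div q + 1 \<in> {1..q}" "c mod q + 1 \<in> {1..q}"
        using cq q0 by (auto simp: less_mult_imp_div_less Suc_le_eq)
      have cB: "c div q * q \<le> B" "Suc (c div q) \<le> B" "Suc (c mod q) \<le> B" "Fb + j \<le> B" "Cb + v \<le> B" "Cb + w \<le> B"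
      proof -
        show "c div q * q \<le> B" using div_times_less_eq_dividend[of c q] cq BC by linarith
      qed (use BC xy wv j len Fb in auto)
      have cd: "c - c div q * q = c mod q" by (simp add: minus_div_mult_eq_mod)
      have b3: "m2 (Fb + j) = c" using * j by (simp add: c_def)
      have reg3: "m2 17 = v" "m2 16 = w" using f2 reg1 by simp_all
      define m4 where "m4 = exec_all ?b3 m3"
      have m4: "m4 a = (if a = Cb + w then c mod q + 1 else if a = Cb + v then c div q + 1 else m2 a)"
        if "a \<notin> {4, 5, 11, 12}" for a
        using j r2 reg3 b3 cd low that by (simp add: m4_def)
      have s3: "all_small B ?b3 m3"
        using j r2 reg3 b3 cd low cB by simp
      have "inv (?g j) m4"
        unfolding inv_def
      proof (intro conjI allI impI)
        show "stat m4" by (rule stat_cong[OF st2]) (simp add: m4)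
        show "?g j \<in> \<Omega>" using xy \<sigma> wv unfolding c_def by (intro \<Omega>_upd)
        fix u assume u: "u < n"
        have "m2 (Cb + u) = \<sigma>0 u" using f2[of "Cb + u"] col1[OF u] low u Fb by simp
        then show "m4 (Cb + u) = ?g j u" using m4[of "Cb + u"] low by (simp add: c_def \<sigma>0_def)
      qed
      moreover have "m4 10 = m 10 \<and> m4 18 = m 18 \<and> m4 19 = m 19"
        using m4 f2 low by (simp add: m1)
      ultimately show "ensures B (Blk ?b3) m3 11 (\<lambda>m'. inv (?g j) m' \<and> m' 10 = m 10 \<and> m' 18 = m 18 \<and> m' 19 = m 19)"
        by (intro ensures_blk[OF s3, folded m4_def]) simp_all
    qed simp
  qed simp_all
  then show ?thesis by (simp only: law)
qed

lemma chain_step_achieves: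
  assumes i: "inv \<sigma> m"
  shows "achieves B chain_step m step_time (kernel \<sigma>) (\<lambda>\<tau> m'. inv \<tau> m' \<and> m' 18 = m 18 \<and> m' 19 = m 19)"
proof -
  let ?J = "\<lambda>\<tau> m'. inv \<tau> m' \<and> m' 18 = m 18 \<and> m' 19 = m 19"
  let ?T = "18 + q * q * (23 + \<Delta> * 16)"
  have st: "stat m" and \<sigma>: "\<sigma> \<in> \<Omega>" using i by (auto simp: inv_def)
  have BC: "Cb + n + q * q + q + 1 \<le> B" and Fb: "Fb = Cb + n" using B adr by simp_all
  have MB: "M + 1 \<le> B" using B adr by simp
  have inv_cong: "inv \<tau> m2" if "inv \<tau> m1" "\<And>a. 20 \<le> a \<Longrightarrow> m2 a = m1 a" for \<tau> m1 m2
    using that low by (auto simp: inv_def intro: stat_cong)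
  have M0: "0 < m 32" "m 32 = M" using statD(13)[OF st] n_pos by auto
  have "achieves B (Rnd 10 32) m 1 (pmf_of_set {..<m 32}) (\<lambda>r m1. r < M \<and> m1 = m(10 := r))"
    by (rule achieves_rnd) (use M0 in auto)
  then have a1: "achieves B (Rnd 10 32) m 1 (pmf_of_set {..<M}) (\<lambda>r m1. r < M \<and> m1 = m(10 := r))"
    by (simp only: M0)
  show ?thesis unfolding chain_step_def kernel_def
  proof (rule achieves_seq[where ?t2.0 = "?T + 20", OF a1])
    fix r m1 assume r: "r < M \<and> m1 = m(10 := r)"
    have i1: "inv \<sigma> m1" by (rule inv_cong[OF i]) (use r in simp)
    have m1: "m1 10 = r" "m1 18 = m 18" "m1 19 = m 19" using r by simp_all
    define m2 where "m2 = exec_all [Add 4 10 31] m1"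
    have st1: "stat m1" using i1 by (simp add: inv_def)
    have m2: "m2 4 = r + 1" "m2 10 = r" "m2 18 = m 18" "m2 19 = m 19" "\<And>a. 20 \<le> a \<Longrightarrow> m2 a = m1 a"
      using m1 statD(12)[OF st1] by (simp_all add: m2_def)
    have i2: "inv \<sigma> m2" by (rule inv_cong[OF i1]) (rule m2(5))
    have st2: "stat m2" using i2 by (simp add: inv_def)
    note r2 = statD[OF st2]
    let ?b3 = "[Add 4 10 10, Add 4 4 38, Load 17 4, Add 4 4 31, Load 16 4]"
    let ?b4 = "[Sub 17 10 25, Mul 4 17 27, Add 4 4 26, Load 4 4]"
    let ?e = "Unless 25 4 (Blk ?b3 ;; resample_edge)"
    let ?v = "Unless 10 25 (Blk ?b4 ;; Unless 39 4 (Rnd 5 22 ;; Blk [Add 5 5 31, Add 4 28 17, Store 4 5]))"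
    have s2: "all_small B [Add 4 10 31] m1" using m1 statD(12)[OF st1] r MB by simp
    show "achieves B (Blk [Add 4 10 31] ;; ?e ;; ?v) m1 (?T + 20) (move r \<sigma>) ?J"
    proof (rule achieves_blk_seq[OF s2, folded m2_def, where t' = "?T + 19"])
      show "achieves B (?e ;; ?v) m2 (?T + 19) (move r \<sigma>) ?J"
      proof (cases "r < length es")
        case True
        have rB: "b + 6 + 2 * r \<le> B" "b + 6 + 2 * r < Cb" using True low BC by linarith+
        define m3 where "m3 = exec_all ?b3 m2"
        have ed: "m2 (b + 5 + 2 * r) = src r" "m2 (b + 6 + 2 * r) = tgt r"
          using st2 m0_edge[OF True] rB low by (simp_all add: stat_def)
        have ed': "m2 (r + r + (b + 5)) = src r" "m2 (Suc (r + r + (b + 5))) = tgt r"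
          using ed by (simp_all add: algebra_simps numeral_eq_Suc)
        have m3: "m3 17 = src r" "m3 16 = tgt r" "m3 10 = r" "m3 18 = m 18" "m3 19 = m 19" "\<And>a. 20 \<le> a \<Longrightarrow> m3 a = m2 a"
          using m2(1-4) r2(12,19) ed' low(1) by (simp_all add: m3_def)
        have s3: "all_small B ?b3 m2" using m2(1-4) r2(12,19) rB by simp
        have i3: "inv \<sigma> m3" by (rule inv_cong[OF i2]) (rule m3(6))
        have "achieves B (Blk ?b3 ;; resample_edge) m2 (5 + ?T) (heat_bath (src r) (tgt r) \<sigma>)
          (\<lambda>\<tau> m'. inv \<tau> m' \<and> m' 10 = m3 10 \<and> m' 18 = m3 18 \<and> m' 19 = m3 19)"
          by (rule achieves_blk_seq[OF s3, folded m3_def, OF resample_edge_achieves[OF i3 m3(1,2) edge_at_nb(2)[OF True]]]) simp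
        then have e: "achieves B ?e m2 (6 + ?T) (heat_bath (src r) (tgt r) \<sigma>)
          (\<lambda>\<tau> m'. inv \<tau> m' \<and> m' 10 = r \<and> m' 18 = m 18 \<and> m' 19 = m 19)"
          unfolding m3(3-5) by (rule achieves_unless[rotated]) (use m2(1) r2(6) True in simp_all)
        have "achieves B (?e ;; ?v) m2 (?T + 19) (map_pmf (\<lambda>\<tau>. \<tau>) (heat_bath (src r) (tgt r) \<sigma>)) ?J"
        proof (rule achieves_seq_ensures[where ?t2.0 = 1, OF e])
          fix \<tau> m' assume *: "inv \<tau> m' \<and> m' 10 = r \<and> m' 18 = m 18 \<and> m' 19 = m 19"
          then have "m' 25 = length es" using statD(6) by (simp add: inv_def)
          then show "ensures B ?v m' 1 (?J \<tau>)" using * True by (intro ensures_unless[where t' = 0]) simp_all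
        qed simp
        then show ?thesis using True by (simp add: move_def)
      next
        case False
        define v where "v = r - length es"
        have v: "v < n" using False conjunct1[OF r] unfolding v_def by linarith
        have e: "ensures B ?e m2 1 (\<lambda>m'. m' = m2)"
          by (rule ensures_unless[where t' = 0]) (use m2(1) r2(6) False in simp_all)
        define p where "p = A + v * (\<Delta> + 1)"
        have pC: "p + \<Delta> < Cb" "v * (\<Delta> + 1) \<le> p" using row[OF v] by (simp_all add: p_def)
        have mp: "m2 p = length (adj v)" using st2 pC low m0_deg[OF v] by (simp add: stat_def p_def)
        define m3 where "m3 = exec_all ?b4 m2"
        have m3: "m3 17 = v" "m3 4 = length (adj v)" "m3 18 = m 18" "m3 19 = m 19" "\<And>a. 20 \<le> a \<Longrightarrow> m3 a = m2 a"
          using m2(1-4) r2(6-8) mp low(2) unfolding m3_def by (simp_all add: v_def[symmetric] p_def add.commute)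
        have s3: "all_small B ?b4 m2"
        proof -
          define vw where "vw = v * (\<Delta> + 1)"
          have "vw \<le> B" "vw + A \<le> B" using pC BC unfolding vw_def p_def by linarith+
          then show ?thesis using m2(1-4) r2(6-8) by (simp add: v_def[symmetric] vw_def)
        qed
        have i3: "inv \<sigma> m3" by (rule inv_cong[OF i2]) (rule m3(5))
        have st3: "stat m3" using i3 by (simp add: inv_def)
        note r3 = statD[OF st3]
        have len0: "length (adj v) = 0 \<longleftrightarrow> nb v = {}" using adj(1)[OF v] by auto
        have w: "achieves B (Unless 39 4 (Rnd 5 22 ;; Blk [Add 5 5 31, Add 4 28 17, Store 4 5])) m3 5 (move r \<sigma>) ?J"
        proof (rule achieves_unless[where t' = 4])
          assume "m3 39 < m3 4"
          then have "nb v \<noteq> {}" using r3 m3 len0 by auto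
          then have "move r \<sigma> = return_pmf \<sigma>" using False by (simp add: move_def v_def)
          then show "\<exists>d. move r \<sigma> = return_pmf d \<and> ?J d m3" using i3 m3 by auto
        next
          assume "m3 4 \<le> m3 39"
          then have iso: "nb v = {}" using r3 m3 len0 by auto
          have "achieves B (Rnd 5 22) m3 1 (pmf_of_set {..<m3 22}) (\<lambda>x m4. x < q \<and> m4 = m3(5 := x))"
            by (rule achieves_rnd) (use r3 q2 in auto)
          then have a4: "achieves B (Rnd 5 22) m3 1 (pmf_of_set {..<q}) (\<lambda>x m4. x < q \<and> m4 = m3(5 := x))"
            by (simp only: r3)
          have "achieves B (Rnd 5 22 ;; Blk [Add 5 5 31, Add 4 28 17, Store 4 5]) m3 4
              (map_pmf (\<lambda>x. \<sigma>(v := x + 1)) (pmf_of_set {..<q})) ?J"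
          proof (rule achieves_seq_ensures[where ?t2.0 = 3, OF a4])
            fix x m4 assume x: "x < q \<and> m4 = m3(5 := x)"
            define m5 where "m5 = exec_all [Add 5 5 31, Add 4 28 17, Store 4 5] m4"
            have m5: "m5 a = (if a = Cb + v then x + 1 else m3 a)" if "a \<notin> {4, 5}" for a
              using x r3 m3 low that by (simp add: m5_def)
            have s5: "all_small B [Add 5 5 31, Add 4 28 17, Store 4 5] m4"
              using x r3 m3 low v BC by simp
            have "inv (\<sigma>(v := x + 1)) m5" unfolding inv_def
            proof (intro conjI allI impI)
              show "stat m5" by (rule stat_cong[OF st3]) (simp add: m5)
              show "\<sigma>(v := x + 1) \<in> \<Omega>" using x v \<sigma> by (intro \<Omega>_upd) auto
              fix u assume "u < n"
              then show "m5 (Cb + u) = (\<sigma>(v := x + 1)) u" using i3 low m5[of "Cb + u"] by (simp add: inv_def)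
            qed
            then show "ensures B (Blk [Add 5 5 31, Add 4 28 17, Store 4 5]) m4 3 (?J (\<sigma>(v := x + 1)))"
              using m5 m3 low by (intro ensures_blk[OF s5, folded m5_def]) simp_all
          qed simp
          moreover have "move r \<sigma> = map_pmf (\<lambda>x. \<sigma>(v := x + 1)) (pmf_of_set {..<q})"
          proof -
            have bj: "bij_betw Suc {..<q} {1..q}"
              by (rule bij_betw_byWitness[where f' = "\<lambda>x. x - 1"]) auto
            have "pmf_of_set {1..q} = map_pmf Suc (pmf_of_set {..<q})"
              by (rule map_pmf_of_set_bij_betw[symmetric, OF bj]) (use q2 in \<open>auto simp: lessThan_empty_iff\<close>)
            then show ?thesis using False iso by (simp add: move_def v_def map_pmf_comp)
          qed
          ultimately show "achieves B (Rnd 5 22 ;; Blk [Add 5 5 31, Add 4 28 17, Store 4 5]) m3 4 (move r \<sigma>) ?J" by simp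
        qed simp
        have "achieves B (Blk ?b4 ;; Unless 39 4 (Rnd 5 22 ;; Blk [Add 5 5 31, Add 4 28 17, Store 4 5])) m2 9 (move r \<sigma>) ?J"
          by (rule achieves_blk_seq[OF s3, folded m3_def, OF w]) simp
        then have vv: "achieves B ?v m2 10 (move r \<sigma>) ?J"
          by (rule achieves_unless[rotated]) (use m2(1,2) r2(6) False in simp_all)
        show ?thesis by (rule achieves_ensures_seq[where ?t2.0 = 10, OF e]) (use vv in simp_all)
      qed
    qed simp
  qed (simp add: step_time_def)
qed

lemma check_balance_ensures:
  assumes i: "inv \<sigma> m"
  shows "ensures B check_balance m (6 + (q + 1) * 4 + n * 8 + q * 9)
    (\<lambda>m'. inv \<sigma> m' \<and> m' 19 = m 19 \<and> m' 13 = of_bool (\<not> balanced \<sigma>))"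
proof -
  have st: "stat m" and col: "\<And>u. u < n \<Longrightarrow> m (Cb + u) = \<sigma> u" and \<sigma>: "\<sigma> \<in> \<Omega>" using i by (auto simp: inv_def)
  have BC: "Gb + q + 1 \<le> B" and Gb: "Gb = Cb + n + q * q" using B adr by simp_all
  note r = statD[OF st]
  define fr where "fr m' \<longleftrightarrow> (\<forall>a. (a = 19 \<or> 20 \<le> a \<and> a < Gb) \<longrightarrow> m' a = m a)" for m'
  have frD: "m' 39 = 0" "m' 30 = Gb" "m' 31 = 1" "m' 40 = q + 1" "m' 28 = Cb" "m' 23 = n" "m' 35 = n div q" "m' 41 = n div q + 2"
    "\<And>u. u < n \<Longrightarrow> m' (Cb + u) = \<sigma> u" "m' 19 = m 19" if "fr m'" for m'
  proof -
    have k: "m' a = m a" if "a = 19 \<or> 20 \<le> a \<and> a < Gb" for a using \<open>fr m'\<close> that unfolding fr_def by blast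
    show "m' 39 = 0" "m' 30 = Gb" "m' 31 = 1" "m' 40 = q + 1" "m' 28 = Cb" "m' 23 = n" "m' 35 = n div q" "m' 41 = n div q + 2" "m' 19 = m 19"
      using low(5) by (simp_all add: k r)
    show "m' (Cb + u) = \<sigma> u" if "u < n" for u using k[of "Cb + u"] that col low(3) Gb by simp
  qed
  have fr_inv: "inv \<sigma> m'" if "fr m'" for m'
    unfolding inv_def using frD(9)[OF that] \<sigma> that Gb by (auto simp: fr_def intro!: stat_cong[OF st])
  have range: "\<sigma> u \<in> {1..q}" if "u < n" for u using \<Omega>_range[OF \<sigma> that] .
  \<comment> \<open>There are \<open>q + 1\<close> counters, one of them for the colour 0 that does
    not occur, so that colours can serve as offsets directly.\<close>
  define I1 where "I1 i m' \<longleftrightarrow> fr m' \<and> m' 4 = i \<and> (\<forall>j<i. m' (Gb + j) = 0)" for i m'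
  have l1: "ensures B (DoWhile (Blk [Add 5 30 4, Store 5 39, Add 4 4 31]) 4 40) m' ((q + 1) * 4) (I1 (q + 1))"
    if "I1 0 m'" for m'
  proof (rule ensures_loop[where I = I1, OF _ that])
    fix i m' assume i: "i < q + 1" and I: "I1 i m'"
    note f = frD[OF I[unfolded I1_def, THEN conjunct1]]
    have m4: "m' 4 = i" using I by (simp add: I1_def)
    show "ensures B (Blk [Add 5 30 4, Store 5 39, Add 4 4 31]) m' 3 (\<lambda>m'. I1 (Suc i) m' \<and> (m' 4 < m' 40 \<longleftrightarrow> Suc i < q + 1))"
    proof (rule ensures_blk)
      show "all_small B [Add 5 30 4, Store 5 39, Add 4 4 31] m'" using f m4 low i BC by simp
      show "I1 (Suc i) (exec_all [Add 5 30 4, Store 5 39, Add 4 4 31] m') \<and>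
        ((exec_all [Add 5 30 4, Store 5 39, Add 4 4 31] m') 4 < (exec_all [Add 5 30 4, Store 5 39, Add 4 4 31] m') 40 \<longleftrightarrow> Suc i < q + 1)"
        using f m4 low I by (simp add: I1_def fr_def less_Suc_eq)
    qed simp
  qed simp_all
  define I2 where "I2 i m' \<longleftrightarrow> fr m' \<and> m' 4 = i \<and> (\<forall>c\<le>q. m' (Gb + c) = card {u. u < i \<and> \<sigma> u = c})" for i m'
  let ?b2 = "[Add 5 28 4, Load 5 5, Add 5 5 30, Load 6 5, Add 6 6 31, Store 5 6, Add 4 4 31]"
  have l2: "ensures B (DoWhile (Blk ?b2) 4 23) m' (n * 8) (I2 n)" if "I2 0 m'" for m'
  proof (rule ensures_loop[where I = I2, OF _ that])
    fix i m' assume i: "i < n" and I: "I2 i m'"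
    note f = frD[OF I[unfolded I2_def, THEN conjunct1]]
    have m4: "m' 4 = i" using I by (simp add: I2_def)
    define c where "c = \<sigma> i"
    have c: "c \<le> q" using range[OF i] by (simp add: c_def)
    have cnt: "m' (Gb + c) = card {u. u < i \<and> \<sigma> u = c}" using I c by (simp add: I2_def)
    have "card {u. u < i \<and> \<sigma> u = c} \<le> card {..<i}" by (intro card_mono) auto
    then have cb: "card {u. u < i \<and> \<sigma> u = c} \<le> i" by simp
    have upd: "card {u. u < Suc i \<and> \<sigma> u = c'} = (if c' = c then Suc (card {u. u < i \<and> \<sigma> u = c'}) else card {u. u < i \<and> \<sigma> u = c'})" for c'
    proof (cases "c' = c")
      case True
      then have "{u. u < Suc i \<and> \<sigma> u = c'} = insert i {u. u < i \<and> \<sigma> u = c'}" by (auto simp: c_def less_Suc_eq)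
      then show ?thesis using True by simp
    next
      case False
      then have "{u. u < Suc i \<and> \<sigma> u = c'} = {u. u < i \<and> \<sigma> u = c'}" by (auto simp: c_def less_Suc_eq)
      then show ?thesis using False by simp
    qed
    have ci: "m' (Cb + i) = c" using f(9)[OF i] by (simp add: c_def)
    have cnt': "m' (c + Gb) = card {u. u < i \<and> \<sigma> u = c}" using cnt by (simp add: add.commute)
    show "ensures B (Blk ?b2) m' 7 (\<lambda>m'. I2 (Suc i) m' \<and> (m' 4 < m' 23 \<longleftrightarrow> Suc i < n))"
    proof (rule ensures_blk)
      show "all_small B ?b2 m'" using f m4 low i BC Gb ci cnt' c cb by simp
      have e: "(exec_all ?b2 m') a = (if a = 4 then Suc i else if a = Gb + c then Suc (card {u. u < i \<and> \<sigma> u = c}) else m' a)"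
        if "a \<notin> {5, 6}" for a
        using f m4 low ci cnt' that by (simp add: add.commute)
      have "fr (exec_all ?b2 m')" unfolding fr_def
        using I low by (auto simp: e I2_def fr_def simp del: exec_all.simps)
      moreover have "\<forall>c'\<le>q. (exec_all ?b2 m') (Gb + c') = card {u. u < Suc i \<and> \<sigma> u = c'}"
        using I low unfolding upd by (simp add: e I2_def del: exec_all.simps)
      ultimately show "I2 (Suc i) (exec_all ?b2 m') \<and> ((exec_all ?b2 m') 4 < (exec_all ?b2 m') 23 \<longleftrightarrow> Suc i < n)"
        using low f by (simp add: I2_def e del: exec_all.simps)
    qed simp
  qed (use n_pos in simp_all)
  have cs: "card {u. u < n \<and> \<sigma> u = c} = csize \<sigma> c" for c by (simp add: csize_def color_class_def)
  have csn: "csize \<sigma> c \<le> n" for c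
  proof -
    have "csize \<sigma> c \<le> card {..<n}" unfolding csize_def by (intro card_mono) (auto simp: color_class_def)
    then show ?thesis by simp
  qed
  define okc where "okc c \<longleftrightarrow> n div q \<le> csize \<sigma> c \<and> csize \<sigma> c \<le> n div q + 1" for c
  define I3 where "I3 i m' \<longleftrightarrow> fr m' \<and> m' 4 = Suc i \<and> (\<forall>c\<le>q. m' (Gb + c) = csize \<sigma> c) \<and> m' 13 = of_bool (\<not> (\<forall>c\<in>{1..i}. okc c))" for i m'
  have l3: "ensures B (DoWhile (Blk [Add 5 30 4, Load 5 5, Add 6 5 31] ;; Unless 35 6 (Blk [Const 13 1]) ;;
      Unless 5 41 (Blk [Const 13 1]) ;; Blk [Add 4 4 31]) 4 40) m' (q * 9) (I3 q)" if "I3 0 m'" for m'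
  proof (rule ensures_loop[where I = I3, OF _ that])
    fix i m' assume i: "i < q" and I: "I3 i m'"
    note f = frD[OF I[unfolded I3_def, THEN conjunct1]]
    define s where "s = csize \<sigma> (Suc i)"
    have m4: "m' 4 = Suc i" "m' (Suc (Gb + i)) = s"
    proof -
      have "m' (Gb + Suc i) = s" using I i unfolding I3_def s_def by (simp only: Suc_le_eq)
      then show "m' 4 = Suc i" "m' (Suc (Gb + i)) = s" using I by (simp_all add: I3_def)
    qed
    \<comment> \<open>Cell 6 holds \<open>s + 1\<close> and cell 41 holds
      \<open>n div q + 2\<close>, which turns the two weak comparisons into strict ones.\<close>
    define m1 where "m1 = exec_all [Add 5 30 4, Load 5 5, Add 6 5 31] m'"
    have m1: "m1 5 = s" "m1 6 = Suc s" "\<And>a. a \<notin> {5, 6} \<Longrightarrow> m1 a = m' a"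
      using f m4 low by (simp_all add: m1_def)
    define J where "J b m'' \<longleftrightarrow> (\<forall>a. a \<notin> {5, 6, 13} \<longrightarrow> m'' a = m' a) \<and> m'' 5 = s \<and> m'' 13 = of_bool (\<not> (\<forall>c\<in>{1..i}. okc c) \<or> b)" for b m''
    have J1: "J False m1" using m1 I by (simp add: J_def I3_def)
    have e1: "ensures B (Unless 35 6 (Blk [Const 13 1])) m1 2 (J (s < n div q))"
    proof (rule ensures_unless)
      assume "m1 35 < m1 6"
      then show "J (s < n div q) m1" using J1 m1 f by (simp add: J_def)
    next
      assume "m1 6 \<le> m1 35"
      then have "s < n div q" using m1 f by simp
      then show "ensures B (Blk [Const 13 1]) m1 1 (J (s < n div q))"
        using J1 B by (intro ensures_blk) (simp_all add: J_def)
    qed simp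
    have e2: "ensures B (Unless 5 41 (Blk [Const 13 1])) m'' 2 (J (s < n div q \<or> n div q + 2 \<le> s))" if J: "J (s < n div q) m''" for m''
    proof (rule ensures_unless)
      assume "m'' 5 < m'' 41"
      then show "J (s < n div q \<or> n div q + 2 \<le> s) m''" using J f by (simp add: J_def)
    next
      assume "m'' 41 \<le> m'' 5"
      then have "n div q + 2 \<le> s" using J f by (simp add: J_def)
      then show "ensures B (Blk [Const 13 1]) m'' 1 (J (s < n div q \<or> n div q + 2 \<le> s))"
        using J B by (intro ensures_blk) (simp_all add: J_def)
    qed simp
    have bad: "(s < n div q \<or> n div q + 2 \<le> s) \<longleftrightarrow> \<not> okc (Suc i)" by (auto simp: okc_def s_def)
    have e3: "ensures B (Blk [Add 4 4 31]) m'' 1 (\<lambda>m'. I3 (Suc i) m' \<and> (m' 4 < m' 40 \<longleftrightarrow> Suc i < q))" if J: "J (\<not> okc (Suc i)) m''" for m''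
    proof (rule ensures_blk)
      have f'': "m'' a = m' a" if "a \<notin> {5, 6, 13}" for a using J that by (simp add: J_def)
      show "all_small B [Add 4 4 31] m''" using f'' f m4 i BC by simp
      define m3 where "m3 = exec_all [Add 4 4 31] m''"
      have m3: "m3 4 = Suc (Suc i)" "\<And>a. a \<notin> {4, 5, 6, 13} \<Longrightarrow> m3 a = m' a" "m3 13 = m'' 13"
        using f'' f m4 by (simp_all add: m3_def)
      have "fr m3" using I m3(2) low unfolding fr_def I3_def by simp
      moreover have "\<forall>c\<le>q. m3 (Gb + c) = csize \<sigma> c" using I m3(2) low by (simp add: I3_def)
      moreover have "m3 13 = of_bool (\<not> (\<forall>c\<in>{1..Suc i}. okc c))"
        using J m3(3) by (auto simp: J_def atLeastAtMostSuc_conv)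
      ultimately show "I3 (Suc i) m3 \<and> (m3 4 < m3 40 \<longleftrightarrow> Suc i < q)" using m3 frD[of m3] by (simp add: I3_def)
    qed simp
    show "ensures B (Blk [Add 5 30 4, Load 5 5, Add 6 5 31] ;; Unless 35 6 (Blk [Const 13 1]) ;;
      Unless 5 41 (Blk [Const 13 1]) ;; Blk [Add 4 4 31]) m' 8 (\<lambda>m'. I3 (Suc i) m' \<and> (m' 4 < m' 40 \<longleftrightarrow> Suc i < q))"
    proof (rule ensures_blk_seq[where t' = 5])
      show "all_small B [Add 5 30 4, Load 5 5, Add 6 5 31] m'"
        using f m4 low i BC csn[of "Suc i"] Gb by (simp add: s_def)
      show "ensures B (Unless 35 6 (Blk [Const 13 1]) ;; Unless 5 41 (Blk [Const 13 1]) ;; Blk [Add 4 4 31])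
          (exec_all [Add 5 30 4, Load 5 5, Add 6 5 31] m') 5 (\<lambda>m'. I3 (Suc i) m' \<and> (m' 4 < m' 40 \<longleftrightarrow> Suc i < q))"
        unfolding m1_def[symmetric]
        by (rule ensures_seq[where ?t2.0 = 3, OF e1 ensures_seq[OF e2 e3[unfolded bad[symmetric]]]]) simp_all
    qed simp
  qed (use q2 in simp_all)
  have fin: "inv \<sigma> m' \<and> m' 19 = m 19 \<and> m' 13 = of_bool (\<not> balanced \<sigma>)" if "I3 q m'" for m'
    using that fr_inv[of m'] frD(10)[of m'] by (simp add: I3_def balanced_def okc_def)
  have start: "ensures B (Blk [Const 4 0]) m 1 (I1 0)"
    by (rule ensures_blk) (simp_all add: I1_def fr_def)
  have mid: "ensures B (Blk [Const 4 0]) m' 1 (I2 0)" if "I1 (q + 1) m'" for m'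
    using that low by (intro ensures_blk) (simp_all add: I1_def I2_def fr_def)
  have mid2: "ensures B (Blk [Const 13 0, Const 4 1]) m' 2 (I3 0)" if "I2 n m'" for m'
    using that low B by (intro ensures_blk) (simp_all add: I2_def I3_def fr_def cs)
  show ?thesis unfolding check_balance_def
    apply (rule ensures_seq[where ?t2.0 = "5 + (q + 1) * 4 + n * 8 + q * 9", OF start])
     apply (rule ensures_seq[where ?t2.0 = "5 + n * 8 + q * 9", OF l1], assumption)
      apply (rule ensures_seq[where ?t2.0 = "4 + n * 8 + q * 9", OF mid], assumption)
       apply (rule ensures_seq[where ?t2.0 = "4 + q * 9", OF l2], assumption)
        apply (rule ensures_seq[where ?t2.0 = "q * 9", OF mid2], assumption)
         apply (rule ensures_mono[OF l3], assumption)
          apply (erule fin)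
         apply simp_all
    done
qed

definition trial_time :: nat where
  "trial_time = t * (step_time + 2) + (q + 1) * 4 + n * 8 + q * 9 + 20"

lemma trials_achieves:
  assumes i: "inv \<sigma> m"
  shows "achieves B trials m (1 + N * Suc trial_time) (search (iter kernel t) balanced N \<sigma>) inv"
proof -
  define I where "I i \<tau> m' \<longleftrightarrow> inv \<tau> m' \<and> m' 19 = i" for i :: nat and \<tau> m'
  have cong: "inv \<tau> m2" if "inv \<tau> m1" "\<And>a. 20 \<le> a \<Longrightarrow> m2 a = m1 a" for \<tau> m1 m2
    using that low by (auto simp: inv_def intro: stat_cong)
  let ?steps = "DoWhile (chain_step ;; Blk [Add 18 18 31]) 18 33"
  have steps: "achieves B ?steps m' (t * Suc (step_time + 1)) (iter kernel t \<tau>) (\<lambda>\<tau>' m''. inv \<tau>' m'' \<and> m'' 19 = i)"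
    if "I i \<tau> m'" "m' 18 = 0" for i \<tau> m'
  proof -
    define I' where "I' s \<tau> m' \<longleftrightarrow> I i \<tau> m' \<and> m' 18 = s" for s :: nat and \<tau> m'
    have "achieves B ?steps m' (t * Suc (step_time + 1)) (iter kernel t \<tau>) (I' t)"
    proof (rule achieves_iter[where I = I'])
      fix s \<tau> m' assume s: "s < t" and I': "I' s \<tau> m'"
      have "achieves B (chain_step ;; Blk [Add 18 18 31]) m' (step_time + 1) (map_pmf (\<lambda>\<tau>. \<tau>) (kernel \<tau>))
          (\<lambda>\<tau>' m''. I' (Suc s) \<tau>' m'' \<and> (m'' 18 < m'' 33 \<longleftrightarrow> Suc s < t))"
      proof (rule achieves_seq_ensures[OF chain_step_achieves])
        show "inv \<tau> m'" using I' by (simp add: I'_def I_def)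
        fix \<tau>' m'' assume *: "inv \<tau>' m'' \<and> m'' 18 = m' 18 \<and> m'' 19 = m' 19"
        have r: "m'' 31 = 1" "m'' 33 = t" using * statD[of m''] by (simp_all add: inv_def)
        have "inv \<tau>' (m''(18 := Suc s))" by (rule cong[of _ m'']) (use * in simp_all)
        then show "ensures B (Blk [Add 18 18 31]) m'' 1 (\<lambda>m''. I' (Suc s) \<tau>' m'' \<and> (m'' 18 < m'' 33 \<longleftrightarrow> Suc s < t))"
          using * r I' s B by (intro ensures_blk) (simp_all add: I'_def I_def)
      qed simp
      then show "achieves B (chain_step ;; Blk [Add 18 18 31]) m' (step_time + 1) (kernel \<tau>)
          (\<lambda>\<tau>' m''. I' (Suc s) \<tau>' m'' \<and> (m'' 18 < m'' 33 \<longleftrightarrow> Suc s < t))" by simp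
    qed (use that tN in \<open>simp_all add: I'_def\<close>)
    then show ?thesis by (rule achieves_map[where g = "\<lambda>x. x"]) (simp_all add: I'_def I_def)
  qed
  let ?tail = "check_balance ;; Blk [Add 19 19 31] ;; Unless 39 13 (Blk [Add 19 34 39])"
  \<comment> \<open>On success the counter jumps to \<open>N\<close>, as the exit clause of
    \<open>achieves_search\<close> demands.\<close>
  let ?Q = "\<lambda>i \<tau> m'. if balanced \<tau> then inv \<tau> m' \<and> m' 34 \<le> m' 19 else I (Suc i) \<tau> m' \<and> (m' 19 < m' 34 \<longleftrightarrow> Suc i < N)"
  have tail: "ensures B ?tail m' ((q + 1) * 4 + n * 8 + q * 9 + 9) (?Q i \<tau>)"
    if i: "i < N" and m': "inv \<tau> m' \<and> m' 19 = i" for i \<tau> m'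
  proof (rule ensures_seq[where ?t2.0 = 3, OF check_balance_ensures[of \<tau>]])
    show "inv \<tau> m'" using m' by simp
    fix m2 assume m2: "inv \<tau> m2 \<and> m2 19 = m' 19 \<and> m2 13 = of_bool (\<not> balanced \<tau>)"
    have r2: "m2 31 = 1" "m2 34 = N" "m2 39 = 0" using m2 statD[of m2] by (simp_all add: inv_def)
    define m3 where "m3 = exec_all [Add 19 19 31] m2"
    have m3: "m3 19 = Suc i" "m3 13 = of_bool (\<not> balanced \<tau>)" "m3 34 = N" "m3 39 = 0" "\<And>a. 20 \<le> a \<Longrightarrow> m3 a = m2 a"
      using m2 m' r2 by (simp_all add: m3_def)
    have i3: "inv \<tau> m3" by (rule cong[of _ m2]) (use m2 m3 in simp_all)
    show "ensures B (Blk [Add 19 19 31] ;; Unless 39 13 (Blk [Add 19 34 39])) m2 3 (?Q i \<tau>)"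
    proof (rule ensures_blk_seq[where t' = 2])
      show "all_small B [Add 19 19 31] m2" using m2 m' r2 i B by simp
      show "ensures B (Unless 39 13 (Blk [Add 19 34 39])) (exec_all [Add 19 19 31] m2) 2 (?Q i \<tau>)"
        unfolding m3_def[symmetric]
      proof (rule ensures_unless)
        assume "m3 39 < m3 13"
        then show "?Q i \<tau> m3" using m3 i3 by (auto simp: I_def split: if_splits)
      next
        assume "m3 13 \<le> m3 39"
        then have b: "balanced \<tau>" using m3 by (auto split: if_splits)
        have "inv \<tau> (m3(19 := N))" by (rule cong[OF i3]) simp
        then show "ensures B (Blk [Add 19 34 39]) m3 1 (?Q i \<tau>)"
          using b m3 B by (intro ensures_blk) simp_all
      qed simp
    qed simp
  qed simp
  have body: "achieves B (Blk [Const 18 0] ;; ?steps ;; ?tail) m' trial_time (iter kernel t \<tau>) (?Q i)"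
    if i: "i < N" and I: "I i \<tau> m'" for i \<tau> m'
  proof (rule achieves_blk_seq[where t' = "t * Suc (step_time + 1) + ((q + 1) * 4 + n * 8 + q * 9 + 9)"])
    define m1 where "m1 = exec_all [Const 18 0] m'"
    have "inv \<tau> m1" by (rule cong[of _ m']) (use I in \<open>simp_all add: I_def m1_def\<close>)
    then have "I i \<tau> m1" "m1 18 = 0" using I by (simp_all add: I_def m1_def)
    note st = steps[OF this]
    have "achieves B (?steps ;; ?tail) m1 (t * Suc (step_time + 1) + ((q + 1) * 4 + n * 8 + q * 9 + 9))
        (map_pmf (\<lambda>x. x) (iter kernel t \<tau>)) (?Q i)"
    proof (rule achieves_seq_ensures[OF st])
      fix d m'' assume "inv d m'' \<and> m'' 19 = i"
      then show "ensures B ?tail m'' ((q + 1) * 4 + n * 8 + q * 9 + 9) (?Q i d)" by (rule tail[OF i])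
    qed simp
    then show "achieves B (?steps ;; ?tail) (exec_all [Const 18 0] m') (t * Suc (step_time + 1) + ((q + 1) * 4 + n * 8 + q * 9 + 9)) (iter kernel t \<tau>) (?Q i)"
      unfolding m1_def by simp
  qed (simp_all add: trial_time_def)
  define m1 where "m1 = exec_all [Const 19 0] m"
  have "inv \<sigma> m1" by (rule cong[OF i]) (simp add: m1_def)
  then have I0: "I 0 \<sigma> m1" by (simp add: I_def m1_def)
  have "achieves B (DoWhile (Blk [Const 18 0] ;; ?steps ;; ?tail) 19 34) m1 (N * Suc trial_time)
      (search (iter kernel t) balanced N \<sigma>) inv"
    by (rule achieves_search[where I = I, OF body _ I0]) (use tN in \<open>auto simp: I_def\<close>)
  then show ?thesis unfolding trials_def m1_def by (rule achieves_blk_seq[rotated]) simp_all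
qed

end

section \<open>Code for initialisation and output\<close>

definition copy_cells :: "nat list \<Rightarrow> instr list" where
  "copy_cells is = concat (map (\<lambda>i. [Const 0 i, Add 0 0 4, Store 0 i]) is)"

text \<open>
  The input occupies the low cells, which are needed as registers, and is moved to the address \<open>b = 128 m\<close>.
  For the first 64 cells this has to be done without a loop: only cell 0 is free, and cell 4, which holds \<open>m\<close>,
  takes \<open>b\<close>.
\<close>

definition setup_copy :: com where
  "setup_copy = Blk (replicate 7 (Add 4 4 4) @ Store 4 0 # copy_cells ([1, 2, 3] @ [5..<64])) ;;
    Blk [Const 31 1, Const 39 0, Const 0 128, Add 20 4 39, Div 25 4 0, Add 1 25 25, Const 2 5, Add 1 1 2, Const 3 64] ;;
    DoWhile (Blk [Load 5 3, Add 6 3 20, Store 6 5, Add 3 3 31]) 3 1"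

definition setup_registers :: com where
  "setup_registers = Blk [Load 21 20, Add 22 20 31, Load 22 22, Const 0 2, Add 23 20 0, Load 23 23, Const 0 3,
      Add 24 20 0, Load 24 24] ;;
    Blk [Add 26 20 20, Add 27 21 31, Mul 0 23 27, Add 28 26 0, Add 29 28 23, Mul 37 22 22, Add 30 29 37,
      Add 32 25 23, Div 35 23 22, Add 36 35 31, Add 41 36 31, Const 0 5, Add 38 20 0, Add 40 22 31]"

text \<open>The degree at the head of the row is raised first; its new value is the offset of the
  new entry.\<close>

definition append_cell :: "nat \<Rightarrow> nat \<Rightarrow> instr list" where
  "append_cell x y = [Mul 7 x 27, Add 7 7 26, Load 8 7, Add 8 8 31, Store 7 8, Add 7 7 8, Store 7 y]"

text \<open>Row \<open>v\<close> of the adjacency table holds the degree of \<open>v\<close> and then its neighbours.\<close>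

definition setup_adjacency :: com where
  "setup_adjacency = Blk [Add 3 38 39, Add 1 25 25, Add 1 1 3] ;;
    DoWhile (Blk ([Load 5 3, Add 4 3 31, Load 6 4] @ append_cell 5 6 @ append_cell 6 5 @ [Add 3 4 31])) 3 1"

definition setup_colours :: com where
  "setup_colours = Blk [Const 4 0] ;; DoWhile (Blk [Add 5 28 4, Store 5 31, Add 4 4 31]) 4 23"

text \<open>Each move reads the base address of the colours from cell 28, so that cell can only be
  overwritten last.\<close>

definition fetch_cells :: "nat list \<Rightarrow> instr list" where
  "fetch_cells is = concat (map (\<lambda>i. [Const i (i - 1), Add i i 28, Load i i]) is)"

text \<open>The output cells overlap the registers. Cells from 64 on are filled by a loop, the lower
  ones by straight-line code that relies on cell 28 alone. The 1 in cell 0 reports success in every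
  run.\<close>

definition write_output :: com where
  "write_output = Blk [Const 3 63] ;;
    DoWhile (Blk [Add 4 28 3, Load 5 4, Add 6 3 31, Store 6 5, Add 3 3 31]) 3 23 ;;
    Blk (fetch_cells ([1..<28] @ [29..<64]) @ [Const 0 27, Add 28 28 0, Load 28 28, Const 0 1])"

lemma exec_all_append: "exec_all (xs @ ys) m = exec_all ys (exec_all xs m)"
  by (induction xs arbitrary: m) auto

lemma all_small_append: "all_small B (xs @ ys) m \<longleftrightarrow> all_small B xs m \<and> all_small B ys (exec_all xs m)"
  by (induction xs arbitrary: m) auto

text \<open>Seven doublings turn the number of edges into \<open>128 * length es\<close> within one
  cell.\<close>

lemma doubling:
  "2 ^ j * m a \<le> B \<Longrightarrow> all_small B (replicate j (Add a a a)) m \<and> exec_all (replicate j (Add a a a)) m = m(a := 2 ^ j * m a)"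
proof (induction j arbitrary: m)
  case (Suc j)
  have "2 * m a \<le> 2 ^ Suc j * m a" by simp
  then have "m a + m a \<le> B" using Suc.prems by linarith
  moreover have "m(a := m a + m a) = m(a := 2 * m a)" by (simp add: mult_2)
  ultimately show ?case using Suc.IH[of "m(a := 2 * m a)"] Suc.prems
    by (simp add: mult.assoc mult.left_commute fun_upd_same del: fun_upd_apply)
qed simp

text \<open>Sources lie below 64 and targets at or above \<open>b \<ge> 64\<close>, so the copies do
  not disturb each other.\<close>

lemma copy_cells:
  assumes "\<And>i. i \<in> set is \<Longrightarrow> i \<noteq> 0 \<and> i \<noteq> 4 \<and> i < 64" "m 4 = b" "64 \<le> b" "b + 64 \<le> B"
  shows "all_small B (copy_cells is) m \<and>
    (\<forall>a. a \<noteq> 0 \<longrightarrow> exec_all (copy_cells is) m a = (if b \<le> a \<and> a - b \<in> set is then m (a - b) else m a))"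
  using assms(1,2)
proof (induction "is" arbitrary: m)
  case (Cons i "is")
  have i: "i \<noteq> 0" "i \<noteq> 4" "i < 64" and is_ok: "\<And>j. j \<in> set is \<Longrightarrow> j \<noteq> 0 \<and> j \<noteq> 4 \<and> j < 64"
    using Cons.prems(1)[of i] Cons.prems(1) by auto
  define m1 where "m1 = exec_all [Const 0 i, Add 0 0 4, Store 0 i] m"
  have m1: "m1 a = (if a = i + b then m i else m a)" if "a \<noteq> 0" for a
    using i Cons.prems(2) assms(3) that by (simp add: m1_def)
  have s1: "all_small B [Const 0 i, Add 0 0 4, Store 0 i] m"
    using i Cons.prems(2) assms(3,4) by simp
  have IH: "all_small B (copy_cells is) m1 \<and>
    (\<forall>a. a \<noteq> 0 \<longrightarrow> exec_all (copy_cells is) m1 a = (if b \<le> a \<and> a - b \<in> set is then m1 (a - b) else m1 a))"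
    using is_ok m1[of 4] i assms(3) Cons.prems(2) by (intro Cons.IH) auto
  have split: "copy_cells (i # is) = [Const 0 i, Add 0 0 4, Store 0 i] @ copy_cells is" by (simp add: copy_cells_def)
  have "exec_all (copy_cells is) m1 a = (if b \<le> a \<and> a - b \<in> set (i # is) then m (a - b) else m a)" if a: "a \<noteq> 0" for a
  proof (cases "b \<le> a \<and> a - b \<in> set is")
    case True
    then have "a - b \<noteq> 0" "a - b < 64" using is_ok[of "a - b"] by blast+
    then have "m1 (a - b) = m (a - b)" using m1[of "a - b"] assms(3) by simp
    then show ?thesis using IH a True by simp
  next
    case False
    then have "exec_all (copy_cells is) m1 a = m1 a" using IH a by auto
    then show ?thesis using m1[OF a] False by auto
  qed
  then show ?case unfolding split exec_all_append all_small_append m1_def[symmetric] using IH s1 by blast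
qed (simp add: copy_cells_def)

lemma fetch_cells:
  assumes "\<And>i. i \<in> set is \<Longrightarrow> 0 < i \<and> i \<noteq> 28 \<and> i < 64" "m 28 = b" "64 \<le> b" "b + 64 \<le> B"
  shows "all_small B (fetch_cells is) m \<and>
    (\<forall>a. exec_all (fetch_cells is) m a = (if a \<in> set is then m (b + (a - 1)) else m a))"
  using assms(1,2)
proof (induction "is" arbitrary: m)
  case (Cons i "is")
  have i: "0 < i" "i \<noteq> 28" "i < 64" and is_ok: "\<And>j. j \<in> set is \<Longrightarrow> 0 < j \<and> j \<noteq> 28 \<and> j < 64"
    using Cons.prems(1)[of i] Cons.prems(1) by auto
  let ?i = "[Const i (i - 1), Add i i 28, Load i i]"
  define m1 where "m1 = exec_all ?i m"
  have ib: "b + i - Suc 0 \<noteq> i" "i - Suc 0 \<le> B" "i + b - Suc 0 \<le> B" using i assms(3,4) by linarith+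
  have m1: "m1 a = (if a = i then m (b + (i - 1)) else m a)" for a
    using i ib Cons.prems(2) assms(3) by (simp add: m1_def add.commute)
  have s1: "all_small B ?i m" using i Cons.prems(2) ib by simp
  have IH: "all_small B (fetch_cells is) m1 \<and>
    (\<forall>a. exec_all (fetch_cells is) m1 a = (if a \<in> set is then m1 (b + (a - 1)) else m1 a))"
    using is_ok m1[of 28] i Cons.prems(2) by (intro Cons.IH) auto
  have split: "fetch_cells (i # is) = ?i @ fetch_cells is" by (simp add: fetch_cells_def)
  have "exec_all (fetch_cells is) m1 a = (if a \<in> set (i # is) then m (b + (a - 1)) else m a)" for a
    using IH m1[of a] m1[of "b + (a - 1)"] i assms(3) by auto
  then show ?case unfolding split exec_all_append all_small_append m1_def[symmetric] using IH s1 by blast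
qed (simp add: fetch_cells_def)

text \<open>The counter may start above 0: started at 1 with limit \<open>q\<close>, the loop yields
  the exponent \<open>q - 1\<close>.\<close>

lemma power_loop:
  assumes m: "m 12 = i0" "m x = c" "m y = p" "m z = J" "m 31 = 1" and J: "i0 < J" "J \<le> B"
    and p: "1 \<le> p" "c * p ^ (J - i0) \<le> B" and distinct: "x \<noteq> 12" "x \<noteq> 31" "y \<noteq> 12" "y \<noteq> x" "z \<noteq> 12" "z \<noteq> x"
  shows "ensures B (DoWhile (Blk [Mul x x y, Add 12 12 31]) 12 z) m (J * 3) (\<lambda>m'. m' = m(x := c * p ^ (J - i0), 12 := J))"
proof -
  define I where "I i m' \<longleftrightarrow> m' = m(x := c * p ^ i, 12 := i0 + i)" for i m'
  have "ensures B (DoWhile (Blk [Mul x x y, Add 12 12 31]) 12 z) m (J * 3) (I (J - i0))"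
  proof (rule ensures_loop[where I = I])
    fix i m' assume i: "i < J - i0" and I: "I i m'"
    have "p ^ Suc i \<le> p ^ (J - i0)" using i p by (intro power_increasing) auto
    then have "c * p ^ Suc i \<le> B" using p(2) by (meson le_trans mult_le_mono2)
    then have cp: "c * p ^ i * p \<le> B" by (simp only: power_Suc mult_ac)
    have m': "m' x = c * p ^ i" "m' y = p" "m' 12 = i0 + i" "m' 31 = 1" "m' z = J"
      using I m distinct by (simp_all add: I_def)
    have new: "exec_all [Mul x x y, Add 12 12 31] m' = m(x := c * p ^ Suc i, 12 := i0 + Suc i)"
      using I m distinct by (auto simp: I_def fun_eq_iff)
    show "ensures B (Blk [Mul x x y, Add 12 12 31]) m' 2 (\<lambda>m'. I (Suc i) m' \<and> (m' 12 < m' z \<longleftrightarrow> Suc i < J - i0))"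
    proof (rule ensures_blk)
      show "all_small B [Mul x x y, Add 12 12 31] m'" using m' cp distinct i J by simp
      show "I (Suc i) (exec_all [Mul x x y, Add 12 12 31] m') \<and>
        ((exec_all [Mul x x y, Add 12 12 31] m') 12 < (exec_all [Mul x x y, Add 12 12 31] m') z \<longleftrightarrow> Suc i < J - i0)"
        unfolding new I_def using m distinct by auto
    qed simp
  qed (use m distinct J in \<open>auto simp: I_def fun_eq_iff\<close>)
  then show ?thesis by (rule ensures_mono) (use J in \<open>simp_all add: I_def\<close>)
qed

section \<open>Setting up the chain\<close>

text \<open>The entries come in the order in which the machine appends them, so that after
  \<open>i\<close> edges the table is described by \<open>take i es\<close>.\<close>

definition adjacency :: "(nat \<times> nat) list \<Rightarrow> nat \<Rightarrow> nat list" where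
  "adjacency es x = concat (map (\<lambda>(u, v). (if u = x then [v] else []) @ (if v = x then [u] else [])) es)"

lemma adjacency_append: "adjacency (xs @ ys) x = adjacency xs x @ adjacency ys x"
  by (simp add: adjacency_def)

lemma in_adjacency: "y \<in> set (adjacency es x) \<longleftrightarrow> (\<exists>p\<in>set es. fst p = x \<and> snd p = y \<or> snd p = x \<and> fst p = y)"
proof (induction es)
  case (Cons p es)
  obtain u v where p: "p = (u, v)" by force
  have "adjacency (p # es) x = (if u = x then [v] else []) @ (if v = x then [u] else []) @ adjacency es x"
    by (simp add: adjacency_def p)
  then have "y \<in> set (adjacency (p # es) x) \<longleftrightarrow> (u = x \<and> v = y) \<or> (v = x \<and> u = y) \<or> y \<in> set (adjacency es x)"
    using [[simproc del: list_to_set_comprehension]] by (simp add: eq_commute)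
  then show ?case unfolding Cons.IH by (simp add: p disj_assoc)
qed (simp add: adjacency_def)

text \<open>Without loops an edge at \<open>x\<close> contributes one entry and not two.\<close>

lemma length_adjacency:
  assumes "\<And>u v. (u, v) \<in> set es \<Longrightarrow> u \<noteq> v"
  shows "length (adjacency es x) = length (filter (\<lambda>e. x \<in> e) (map (\<lambda>(u, v). {u, v}) es))"
  using assms
proof (induction es)
  case (Cons e es)
  obtain u v where e: "e = (u, v)" by force
  then have "u \<noteq> v" using Cons.prems by auto
  moreover have "length (adjacency es x) = length (filter (\<lambda>e. x \<in> e) (map (\<lambda>(u, v). {u, v}) es))"
    using Cons.prems by (intro Cons.IH) auto
  ultimately show ?case by (auto simp: adjacency_def e)
qed (simp add: adjacency_def)

lemma nth_concat_pairs:
  "r < length es \<Longrightarrow> concat (map (\<lambda>(u, v). [u, v]) es) ! (2 * r) = fst (es ! r) \<and>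
    concat (map (\<lambda>(u, v). [u, v]) es) ! Suc (2 * r) = snd (es ! r)"
proof (induction es arbitrary: r)
  case (Cons e es)
  then show ?case by (cases r) (auto simp: case_prod_unfold)
qed simp

lemma length_concat_pairs: "length (concat (map (\<lambda>(u, v). [u, v]) es)) = 2 * length es"
  by (induction es) (auto simp: case_prod_unfold)

context colouring_graph begin

lemma edge_distinct: "(u, v) \<in> set es \<Longrightarrow> u \<noteq> v \<and> u < n \<and> v < n"
proof -
  assume "(u, v) \<in> set es"
  then have "{u, v} \<in> E" using es by (force simp: lists_edges_def)
  then show ?thesis using edgeD by auto
qed

lemma set_adjacency: "set (adjacency es x) = nb x"
proof -
  have E: "E = (\<lambda>(u, v). {u, v}) ` set es" using es by (simp add: lists_edges_def)
  have "y \<in> nb x \<longleftrightarrow> (\<exists>p\<in>set es. {y, x} = {fst p, snd p})" for y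
  proof -
    have "y \<in> nb x \<longleftrightarrow> {y, x} \<in> E" by (simp add: nb_def)
    also have "\<dots> \<longleftrightarrow> {y, x} \<in> (\<lambda>(u, v). {u, v}) ` set es" by (subst E) (rule refl)
    finally show ?thesis by (simp add: image_iff case_prod_unfold)
  qed
  moreover have "y \<in> set (adjacency es x) \<longleftrightarrow> (\<exists>p\<in>set es. fst p = x \<and> snd p = y \<or> snd p = x \<and> fst p = y)" for y
    by (rule in_adjacency)
  ultimately have "y \<in> set (adjacency es x) \<longleftrightarrow> y \<in> nb x" for y by (auto simp: doubleton_eq_iff)
  then show ?thesis by auto
qed

lemma length_adjacency_le: "length (adjacency es x) \<le> \<Delta>"
proof -
  let ?es = "map (\<lambda>(u, v). {u, v}) es"
  have "length (adjacency es x) = length (filter (\<lambda>e. x \<in> e) ?es)"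
    using edge_distinct by (intro length_adjacency) blast
  also have "\<dots> = card (set (filter (\<lambda>e. x \<in> e) ?es))"
    using es by (intro distinct_card[symmetric] distinct_filter) (simp add: lists_edges_def)
  also have "\<dots> = degree_of E x"
    using es by (simp add: lists_edges_def degree_of_def del: set_map)
  finally show ?thesis using deg by simp
qed

end

section \<open>Input memory, parameters and word bounds\<close>

locale sampler_input = colouring_graph +
  fixes k :: nat
  assumes es_pos: "0 < length es"
begin

definition b :: nat where "b = 128 * length es"
definition A :: nat where "A = 2 * b"
definition Cb :: nat where "Cb = A + n * (\<Delta> + 1)"
definition Fb :: nat where "Fb = Cb + n"
definition Gb :: nat where "Gb = Fb + q * q"
text \<open>Here and for \<open>l\<close>, the least value is what a search loop finds; the lower
  bound 1 is there because such a loop advances before its first test.\<close>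

definition s :: nat where "s = (LEAST s. 1 \<le> s \<and> n \<le> s * s)"
definition l :: nat where "l = (LEAST l. 1 \<le> l \<and> n \<le> 2 ^ l)"
definition e :: nat where "e = q ^ (2 * q + 60)"
definition t :: nat where "t = M * (q * q) * (e + q * l + k + 3)"
definition N :: nat where "N = 2 * 2 ^ e * s ^ (q - 1) * (k + 2)"

definition input :: "nat list" where
  "input = [\<Delta>, q, n, k, length es] @ concat (map (\<lambda>(u, v). [u, v]) es)"

definition mi :: memory where "mi = snd (initial_state input)"

lemma length_input: "length input = 5 + 2 * length es"
  by (simp add: input_def length_concat_pairs)

lemma mi: "mi 0 = \<Delta>" "mi (Suc 0) = q" "mi 2 = n" "mi 3 = k" "mi 4 = length es"
    "r < length es \<Longrightarrow> mi (5 + 2 * r) = src r" "r < length es \<Longrightarrow> mi (6 + 2 * r) = tgt r"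
    "5 + 2 * length es \<le> a \<Longrightarrow> mi a = 0"
proof -
  have *: "mi i = (if i < 5 + 2 * length es then input ! i else 0)" for i
    by (simp add: mi_def initial_state_def length_input)
  show "mi 0 = \<Delta>" "mi (Suc 0) = q" "mi 2 = n" "mi 3 = k" "mi 4 = length es"
    by (simp_all add: * input_def numeral_eq_Suc)
  show "mi a = 0" if "5 + 2 * length es \<le> a" using that by (simp add: *)
  assume r: "r < length es"
  have "input ! (5 + i) = concat (map (\<lambda>(u, v). [u, v]) es) ! i" for i
    by (simp add: input_def numeral_eq_Suc)
  from this[of "2 * r"] this[of "Suc (2 * r)"] nth_concat_pairs[OF r]
  show "mi (5 + 2 * r) = src r" "mi (6 + 2 * r) = tgt r"
    using r by (simp_all add: * src_def tgt_def)
qed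

text \<open>Minimality gives \<open>(s - 1)\<^sup>2 < n\<close> when \<open>s > 1\<close>, so
  rounding up the root costs only a constant factor.\<close>

lemma least_s: "1 \<le> s" "n \<le> s * s" "s \<le> n" "s * s \<le> 4 * n" "\<And>i. 1 \<le> i \<Longrightarrow> i < s \<Longrightarrow> i * i < n"
proof -
  have n1: "1 \<le> n \<and> n \<le> n * n" using n_pos by simp
  have "1 \<le> s \<and> n \<le> s * s" unfolding s_def by (rule LeastI[of "\<lambda>s. 1 \<le> s \<and> n \<le> s * s", OF n1])
  then show s: "1 \<le> s" "n \<le> s * s" by simp_all
  show "s \<le> n" unfolding s_def by (rule Least_le[of "\<lambda>s. 1 \<le> s \<and> n \<le> s * s", OF n1])
  show least: "\<And>i. 1 \<le> i \<Longrightarrow> i < s \<Longrightarrow> i * i < n"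
    unfolding s_def using not_less_Least by fastforce
  show "s * s \<le> 4 * n"
  proof (cases "s = 1")
    case False
    define i where "i = s - 1"
    have i: "s = i + 1" "1 \<le> i" using s False by (simp_all add: i_def)
    have "i * i < n" using least[of i] i by simp
    moreover have "i \<le> i * i" using i by simp
    moreover have "s * s = i * i + 2 * i + 1" using i by simp
    ultimately show ?thesis by linarith
  qed (use n_pos in simp)
qed

lemma least_l: "1 \<le> l" "n \<le> 2 ^ l" "l \<le> n" "2 ^ l \<le> 2 * n" "\<And>i. 1 \<le> i \<Longrightarrow> i < l \<Longrightarrow> 2 ^ i < n"
proof -
  have n1: "1 \<le> n \<and> n \<le> 2 ^ n" using n_pos less_exp[of n] by simp
  have "1 \<le> l \<and> n \<le> 2 ^ l" unfolding l_def by (rule LeastI[of "\<lambda>l. 1 \<le> l \<and> n \<le> 2 ^ l", OF n1])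
  then show l: "1 \<le> l" "n \<le> 2 ^ l" by simp_all
  show "l \<le> n" unfolding l_def by (rule Least_le[of "\<lambda>l. 1 \<le> l \<and> n \<le> 2 ^ l", OF n1])
  show least: "\<And>i. 1 \<le> i \<Longrightarrow> i < l \<Longrightarrow> 2 ^ i < n"
    unfolding l_def using not_less_Least by fastforce
  show "2 ^ l \<le> 2 * n"
  proof (cases "l = 1")
    case False
    define i where "i = l - 1"
    have i: "l = Suc i" "1 \<le> i" using l False by (simp_all add: i_def)
    then have "2 ^ i < n" using least[of i] by simp
    then show ?thesis using i by simp
  qed (use n_pos in simp)
qed

lemma q_pow: "1 \<le> e" "1 \<le> q - 1" "q \<le> e" "2 * q + 60 \<le> e"
proof -
  show "1 \<le> e" using q2 by (simp add: e_def)
  show "1 \<le> q - 1" using q2 by simp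
  have "2 * q + 60 < 2 ^ (2 * q + 60)" by (rule less_exp)
  also have "2 ^ (2 * q + 60) \<le> e" unfolding e_def by (rule power_mono) (use q2 in auto)
  finally show "2 * q + 60 \<le> e" by simp
  then show "q \<le> e" by simp
qed

lemma low: "128 \<le> b" "256 \<le> A" "256 \<le> Cb" "b + 5 + 2 * length es \<le> A" "A \<le> Cb"
  using es_pos unfolding b_def A_def Cb_def by linarith+

end

locale sampler_bounds = sampler_input +
  fixes B :: nat
  assumes B: "Gb + q + 64 \<le> B" "t \<le> B" "N \<le> B" "4 * n \<le> B" "k \<le> B"
begin

text \<open>The factors of \<open>t\<close> are at least 1, so the intermediate results of its
  computation do not exceed \<open>t\<close>. The same idea gives \<open>N_bounds\<close>.\<close>

lemma t_bounds: "e + q * l + k + 3 \<le> B" "(e + q * l + k + 3) * (q * q) \<le> B" "e \<le> B" "0 < t"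
proof -
  have M1: "1 \<le> M" using n_pos by simp
  have q1: "1 \<le> q * q" using q2 by (simp add: Suc_le_eq)
  have "(e + q * l + k + 3) * (q * q) * 1 \<le> (e + q * l + k + 3) * (q * q) * M" by (rule mult_le_mono2[OF M1])
  also have "\<dots> = t" by (simp add: t_def mult_ac)
  finally show 1: "(e + q * l + k + 3) * (q * q) \<le> B" using B by simp
  have 2: "(e + q * l + k + 3) * 1 \<le> (e + q * l + k + 3) * (q * q)" by (rule mult_le_mono2[OF q1])
  show 3: "e + q * l + k + 3 \<le> B" using order_trans[OF 2 1] by (simp only: mult_1_right)
  then show "e \<le> B" by linarith
  show "0 < t" using n_pos q2 by (simp add: t_def)
qed

lemma N_bounds: "2 * 2 ^ e \<le> B" "2 * 2 ^ e * s ^ (q - 1) \<le> B" "k + 2 \<le> B" "0 < N"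
proof -
  have s1: "1 \<le> s ^ (q - 1)" using least_s(1) by simp
  have "2 * 2 ^ e * s ^ (q - 1) * 1 \<le> 2 * 2 ^ e * s ^ (q - 1) * (k + 2)" by (intro mult_le_mono2) simp
  also have "\<dots> \<le> B" using B(3) by (simp only: N_def)
  finally show 1: "2 * 2 ^ e * s ^ (q - 1) \<le> B" by simp
  have "2 * 2 ^ e * 1 \<le> 2 * 2 ^ e * s ^ (q - 1)" by (rule mult_le_mono2[OF s1])
  with 1 show "2 * 2 ^ e \<le> B" by linarith
  show "k + 2 \<le> B" using t_bounds(1) by linarith
  show "0 < N" using least_s(1) by (simp add: N_def)
qed

lemma cell_bounds: "b + 64 \<le> B" "A \<le> B" "n * (\<Delta> + 1) \<le> B" "Cb \<le> B" "Fb \<le> B" "q * q \<le> B" "Gb \<le> B" "128 \<le> B"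
    "n \<le> B" "q + 1 \<le> B" "\<Delta> + 1 \<le> B" "length es + n \<le> B" "n div q + 2 \<le> B" "256 \<le> B"
proof -
  have d: "n div q \<le> n" "\<Delta> \<le> q" using q_ge by simp_all
  show "b + 64 \<le> B" "A \<le> B" "n * (\<Delta> + 1) \<le> B" "Cb \<le> B" "Fb \<le> B" "q * q \<le> B" "Gb \<le> B" "128 \<le> B"
    "n \<le> B" "q + 1 \<le> B" "\<Delta> + 1 \<le> B" "256 \<le> B"
    using B(1) low d unfolding Gb_def Fb_def Cb_def A_def by linarith+
  show "length es + n \<le> B" "n div q + 2 \<le> B"
    using B(1) low d unfolding Gb_def Fb_def Cb_def A_def b_def by linarith+
qed

lemma mi_bounded: "mem_bounded B mi"
  unfolding mem_bounded_def
proof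
  fix a
  have "input ! i \<le> B" if "i < length input" for i
  proof -
    have "input ! i \<in> set input" using that by simp
    then have "input ! i \<in> {\<Delta>, q, n, k, length es} \<or> input ! i < n"
      using edge_distinct by (fastforce simp: input_def)
    then show ?thesis using cell_bounds B by auto
  qed
  then show "mi a \<le> B" by (simp add: mi_def initial_state_def)
qed

text \<open>Position 4 is exempt: its content has become \<open>b\<close> before the copying, and
  the number of edges is recovered in cell 25 as \<open>b div 128\<close>. The zeros from
  \<open>2 * b\<close> on serve as initial degrees.\<close>

definition copied :: "memory \<Rightarrow> bool" where
  "copied m \<longleftrightarrow> m 20 = b \<and> m 25 = length es \<and> m 31 = 1 \<and> m 39 = 0 \<and>
    (\<forall>j<5 + 2 * length es. j \<noteq> 4 \<longrightarrow> m (b + j) = mi j) \<and> (\<forall>a\<ge>2 * b. m a = 0)"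

lemma setup_copy_ensures: "ensures B setup_copy mi (300 + 10 * length es) copied"
proof -
  define "is" where is_def: "is = [1, 2, 3] @ [5..<64::nat]"
  let ?b1 = "replicate 7 (Add 4 4 4) @ Store 4 0 # copy_cells is"
  let ?b2 = "[Const 31 1, Const 39 0, Const 0 128, Add 20 4 39, Div 25 4 0, Add 1 25 25, Const 2 5, Add 1 1 2, Const 3 64]"
  define mA where "mA = mi(4 := b, b := \<Delta>)"
  have dbl: "all_small B (replicate 7 (Add 4 4 4)) mi" "exec_all (replicate 7 (Add 4 4 4)) mi = mi(4 := b)"
    using doubling[of 7 mi 4 B] cell_bounds(1) by (simp_all add: mi b_def)
  have mA: "exec_all [Store 4 0] (mi(4 := b)) = mA" using low by (simp add: mA_def mi)
  define mB where "mB = exec_all ?b1 mi"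
  have mB_eq: "mB = exec_all (copy_cells is) mA"
    unfolding mB_def exec_all_append dbl mA[symmetric] by simp
  have in_is: "i \<in> set is \<longleftrightarrow> i < 64 \<and> i \<noteq> 0 \<and> i \<noteq> 4" for i
    unfolding is_def set_append set_upt list.set by auto
  have cc: "all_small B (copy_cells is) mA \<and>
    (\<forall>a. a \<noteq> 0 \<longrightarrow> exec_all (copy_cells is) mA a = (if b \<le> a \<and> a - b \<in> set is then mA (a - b) else mA a))"
    by (rule copy_cells) (use low cell_bounds(1) in \<open>simp_all add: mA_def in_is\<close>)
  have s1: "all_small B ?b1 mi"
    unfolding all_small_append dbl(2) using dbl(1) cc mA by simp
  have mB: "mB a = (if b \<le> a \<and> a - b \<in> set is then mA (a - b) else mA a)" if "a \<noteq> 0" for a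
    unfolding mB_eq using cc that by blast
  have mB4: "mB 4 = b" using mB[of 4] low by (simp add: mA_def)
  have mBb: "mB (b + j) = mi j" if "j < 64" "j \<noteq> 4" for j
    using mB[of "b + j"] that in_is[of j] low by (cases "j = 0") (simp_all add: mA_def mi)
  have mBm: "mB a = mi a" if "64 \<le> a" "a < b" for a
    using mB[of a] that low by (simp add: mA_def)
  have mB0: "mB a = 0" if "2 * b \<le> a" for a
  proof -
    have "a - b \<notin> set is" unfolding in_is using that low by simp
    moreover have "5 + 2 * length es \<le> a" using that low by (simp add: b_def)
    ultimately show ?thesis using mB[of a] that low by (simp add: mA_def mi)
  qed
  \<comment> \<open>The loop copies cell 64 even if the input ends earlier; it then only moves a
    zero.\<close>
  define K where "K = max 65 (5 + 2 * length es)"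
  have K: "65 \<le> K" "K \<le> b" "5 + 2 * length es \<le> K" "K - 64 \<le> 2 * length es" "K = 65 \<or> K = 5 + 2 * length es"
    using es_pos low by (auto simp: K_def b_def)
  define I where "I i m' \<longleftrightarrow> m' 20 = b \<and> m' 25 = length es \<and> m' 31 = 1 \<and> m' 39 = 0 \<and> m' 1 = 5 + 2 * length es \<and>
    m' 3 = 64 + i \<and> (\<forall>j<64 + i. j \<noteq> 4 \<longrightarrow> m' (b + j) = mi j) \<and> (\<forall>a. 64 \<le> a \<and> a < b \<longrightarrow> m' a = mi a) \<and> (\<forall>a\<ge>2 * b. m' a = 0)" for i m'
  define mC where "mC = exec_all ?b2 mB"
  have I0: "I 0 mC"
  proof -
    have hi: "mC a = mB a" if "64 \<le> a" for a using that by (simp add: mC_def)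
    have "mC 20 = b \<and> mC 25 = length es \<and> mC 31 = 1 \<and> mC 39 = 0 \<and> mC 1 = 5 + 2 * length es \<and> mC 3 = 64"
      using mB4 by (simp add: mC_def b_def)
    then show ?thesis unfolding I_def using hi mBb mBm mB0 low by simp
  qed
  have s2: "all_small B ?b2 mB"
    using mB4 cell_bounds low by (simp add: b_def)
  have loop: "ensures B (DoWhile (Blk [Load 5 3, Add 6 3 20, Store 6 5, Add 3 3 31]) 3 1) mC (10 * length es) (I (K - 64))"
  proof (rule ensures_loop[where I = I, OF _ I0])
    fix i m' assume i: "i < K - 64" and I: "I i m'"
    note I' = I[unfolded I_def]
    have ib: "64 + i < K" using i by linarith
    show "ensures B (Blk [Load 5 3, Add 6 3 20, Store 6 5, Add 3 3 31]) m' 4 (\<lambda>m'. I (Suc i) m' \<and> (m' 3 < m' 1 \<longleftrightarrow> Suc i < K - 64))"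
    proof (rule ensures_blk)
      let ?m = "exec_all [Load 5 3, Add 6 3 20, Store 6 5, Add 3 3 31] m'"
      have x: "m' 3 = 64 + i" "m' 20 = b" "m' 31 = 1" "m' (64 + i) = mi (64 + i)" using I' ib K by auto
      show "all_small B [Load 5 3, Add 6 3 20, Store 6 5, Add 3 3 31] m'"
        using x ib K low cell_bounds(2) unfolding A_def by simp
      have m: "?m a = (if a = b + 64 + i then mi (64 + i) else if a = 3 then 65 + i else m' a)" if "a \<noteq> 5" "a \<noteq> 6" for a
        using x low that by (simp add: add_ac)
      have "\<forall>j<64 + Suc i. j \<noteq> 4 \<longrightarrow> ?m (b + j) = mi j"
      proof (intro allI impI)
        fix j assume j: "j < 64 + Suc i" "j \<noteq> 4"
        show "?m (b + j) = mi j"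
          unfolding m[of "b + j", OF less_imp_neq[symmetric] less_imp_neq[symmetric]]
          using I' j low m[of "b + j"] by (cases "j = 64 + i") (auto simp: m)
      qed
      moreover have "\<forall>a. 64 \<le> a \<and> a < b \<longrightarrow> ?m a = mi a" using I' by (auto simp: m simp del: exec_all.simps)
      moreover have "\<forall>a\<ge>2 * b. ?m a = 0" using I' ib K low by (auto simp: m simp del: exec_all.simps)
      moreover have "?m 20 = b \<and> ?m 25 = length es \<and> ?m 31 = 1 \<and> ?m 39 = 0 \<and> ?m 1 = 5 + 2 * length es \<and> ?m 3 = 64 + Suc i"
        using I' low by (simp add: m del: exec_all.simps)
      ultimately have "I (Suc i) ?m" unfolding I_def by blast
      moreover from this have "?m 3 < ?m 1 \<longleftrightarrow> Suc i < K - 64" using K ib unfolding I_def by linarith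
      ultimately show "I (Suc i) ?m \<and> (?m 3 < ?m 1 \<longleftrightarrow> Suc i < K - 64)" by blast
    qed simp
  qed (use K in simp_all)
  have fin: "copied m'" if "I (K - 64) m'" for m'
    using that K unfolding copied_def I_def by auto
  have len: "length ?b1 = 194"
    by (simp add: copy_cells_def length_concat comp_def sum_list_triv is_def del: upt_Suc)
  show ?thesis unfolding setup_copy_def is_def[symmetric]
  proof (rule ensures_blk_seq[OF s1, folded mB_def, where t' = "20 + 10 * length es"])
    show "ensures B (Blk ?b2 ;; DoWhile (Blk [Load 5 3, Add 6 3 20, Store 6 5, Add 3 3 31]) 3 1) mB (20 + 10 * length es) copied"
      by (rule ensures_blk_seq[OF s2, folded mC_def, OF ensures_mono[OF loop]]) (use fin in auto)
  qed (use len in simp)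
qed

text \<open>Cells 33 and 34 are left out, since they are computed later from these
  registers.\<close>

definition regs :: "memory \<Rightarrow> bool" where
  "regs m \<longleftrightarrow> m 20 = b \<and> m 21 = \<Delta> \<and> m 22 = q \<and> m 23 = n \<and> m 24 = k \<and> m 25 = length es \<and> m 26 = A \<and>
      m 27 = \<Delta> + 1 \<and> m 28 = Cb \<and> m 29 = Fb \<and> m 30 = Gb \<and> m 31 = 1 \<and> m 32 = M \<and>
      m 35 = n div q \<and> m 36 = n div q + 1 \<and> m 37 = q * q \<and> m 38 = b + 5 \<and> m 39 = 0 \<and> m 40 = q + 1 \<and> m 41 = n div q + 2"

lemma regs_cong: "regs m \<Longrightarrow> (\<And>a. 20 \<le> a \<Longrightarrow> a \<le> 41 \<Longrightarrow> a \<noteq> 33 \<Longrightarrow> a \<noteq> 34 \<Longrightarrow> m' a = m a) \<Longrightarrow> regs m'"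
  by (simp add: regs_def)

definition loaded :: "memory \<Rightarrow> bool" where
  "loaded m \<longleftrightarrow> regs m \<and> (\<forall>r<length es. m (b + 5 + 2 * r) = src r \<and> m (b + 6 + 2 * r) = tgt r)"

lemma setup_registers_ensures:
  assumes c: "copied m"
  shows "ensures B setup_registers m 23 (\<lambda>m'. loaded m' \<and> (\<forall>a\<ge>2 * b. m' a = 0))"
proof -
  let ?b1 = "[Load 21 20, Add 22 20 31, Load 22 22, Const 0 2, Add 23 20 0, Load 23 23, Const 0 3,
      Add 24 20 0, Load 24 24]"
  let ?b2 = "[Add 26 20 20, Add 27 21 31, Mul 0 23 27, Add 28 26 0, Add 29 28 23, Mul 37 22 22, Add 30 29 37,
      Add 32 25 23, Div 35 23 22, Add 36 35 31, Add 41 36 31, Const 0 5, Add 38 20 0, Add 40 22 31]"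
  have in_cells: "m (b + j) = mi j" if "j < 5 + 2 * length es" "j \<noteq> 4" for j
    using c that by (simp add: copied_def)
  have x: "m b = \<Delta>" "m (Suc b) = q" "m (b + 2) = n" "m (b + 3) = k" "m 20 = b" "m 31 = 1" "m 25 = length es" "m 39 = 0"
    using in_cells[of 0] in_cells[of 1] in_cells[of 2] in_cells[of 3] c by (simp_all add: mi copied_def)
  define m1 where "m1 = exec_all ?b1 m"
  have m1: "m1 20 = b" "m1 21 = \<Delta>" "m1 22 = q" "m1 23 = n" "m1 24 = k" "m1 25 = length es" "m1 31 = 1" "m1 39 = 0"
    "\<And>a. 64 \<le> a \<Longrightarrow> m1 a = m a"
    using x low(1) by (simp_all add: m1_def)
  have s1: "all_small B ?b1 m" using x low(1) cell_bounds(1,8) by simp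
  define m2 where "m2 = exec_all ?b2 m1"
  have hi: "m2 a = m a" if "64 \<le> a" for a using m1(9)[OF that] that by (simp add: m2_def)
  have "regs m2" unfolding regs_def m2_def
    using m1(1-8) by (simp add: Gb_def Fb_def Cb_def A_def mult_2)
  moreover have "m2 (b + 5 + 2 * r) = src r" "m2 (b + 6 + 2 * r) = tgt r" if "r < length es" for r
    using hi in_cells[of "5 + 2 * r"] in_cells[of "6 + 2 * r"] mi(6,7)[OF that] that low by (simp_all add: add.assoc)
  moreover have "m2 a = 0" if "2 * b \<le> a" for a using hi[of a] c that low by (simp add: copied_def)
  ultimately have m2: "loaded m2 \<and> (\<forall>a\<ge>2 * b. m2 a = 0)" by (simp add: loaded_def)
  have s2: "all_small B ?b2 m1"
  proof -
    define w where "w = n * (\<Delta> + 1)"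
    have w: "m1 23 * (m1 21 + m1 31) = w" "A + w = Cb" "w \<le> B" "b + b = A" "Cb + n = Fb" "Fb + q * q = Gb" "b + 5 \<le> B"
      using m1 cell_bounds by (simp_all add: w_def Cb_def A_def Fb_def Gb_def)
    show ?thesis using w m1(1-8) cell_bounds by (simp add: w_def[symmetric])
  qed
  have "ensures B (Blk ?b2) m1 14 (\<lambda>m'. loaded m' \<and> (\<forall>a\<ge>2 * b. m' a = 0))"
    by (rule ensures_blk[OF s2, folded m2_def]) (use m2 in simp_all)
  then show ?thesis unfolding setup_registers_def
    by (rule ensures_blk_seq[OF s1, folded m1_def]) simp
qed

end

definition compute_root :: com where
  "compute_root = Blk [Const 7 0] ;; DoWhile (Blk [Add 7 7 31, Mul 8 7 7]) 8 23"

definition compute_log :: com where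
  "compute_log = Blk [Const 9 1, Const 10 0] ;; DoWhile (Blk [Add 9 9 9, Add 10 10 31]) 9 23"

definition compute_steps :: com where
  "compute_steps = Blk [Const 11 1, Const 12 0, Const 0 60, Add 13 22 22, Add 13 13 0] ;;
    DoWhile (Blk [Mul 11 11 22, Add 12 12 31]) 12 13 ;;
    Blk [Mul 0 22 10, Add 0 11 0, Add 0 0 24, Const 1 3, Add 0 0 1, Mul 0 0 37, Mul 33 0 32]"

definition compute_trials :: com where
  "compute_trials = Blk [Const 15 2, Const 14 2, Const 12 0] ;; DoWhile (Blk [Mul 14 14 15, Add 12 12 31]) 12 11 ;;
    Blk [Const 12 1] ;; DoWhile (Blk [Mul 14 14 7, Add 12 12 31]) 12 22 ;;
    Blk [Const 0 2, Add 0 24 0, Mul 34 14 0]"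

definition initialise :: com where
  "initialise = setup_copy ;; setup_registers ;; setup_adjacency ;; compute_root ;; compute_log ;; compute_steps ;;
    compute_trials ;; setup_colours"

section \<open>Correctness of initialisation and output\<close>

context sampler_bounds begin

definition row :: "nat \<Rightarrow> nat" where "row v = A + v * (\<Delta> + 1)"

definition table :: "memory \<Rightarrow> (nat \<Rightarrow> nat list) \<Rightarrow> bool" where
  "table m f \<longleftrightarrow> (\<forall>v<n. m (row v) = length (f v) \<and> (\<forall>j<length (f v). m (row v + Suc j) = f v ! j))"

text \<open>Rows have length \<open>\<Delta> + 1\<close>, and division by it recovers the row of an
  address.\<close>

lemma row_apart:
  assumes "j \<le> \<Delta>" "j' \<le> \<Delta>" "row v + j = row v' + j'"
  shows "v = v' \<and> j = j'"
proof -
  have "(j + v * (\<Delta> + 1)) div (\<Delta> + 1) = v" if "j \<le> \<Delta>" for j v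
    using that by (subst div_mult_self1) simp_all
  from this[of j v] this[of j' v'] have "v = v'" using assms by (simp add: row_def add_ac)
  then show ?thesis using assms(3) by simp
qed

lemma row_less: "v < n \<Longrightarrow> row v + \<Delta> < Cb"
proof -
  assume "v < n"
  then have "(v + 1) * (\<Delta> + 1) \<le> n * (\<Delta> + 1)" by (intro mult_le_mono1) simp
  then show ?thesis unfolding row_def Cb_def by simp
qed

text \<open>\<open>length (f u) < \<Delta>\<close> keeps the new entry inside its own row, so the
  other rows are untouched.\<close>

lemma append_cell:
  assumes tb: "table m f" and r: "m 26 = A" "m 27 = \<Delta> + 1" "m 31 = 1" and xy: "x \<in> {5, 6}" "y \<in> {5, 6}"
    and u: "m x = u" "u < n" and v: "m y = v" and len: "\<And>w. length (f w) \<le> \<Delta>" "length (f u) < \<Delta>"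
  shows "all_small B (append_cell x y) m" "table (exec_all (append_cell x y) m) (f(u := f u @ [v]))"
    "a \<notin> {7, 8} \<Longrightarrow> a < A \<Longrightarrow> exec_all (append_cell x y) m a = m a"
proof -
  define d where "d = length (f u)"
  have R: "m (row u) = d" using tb u by (simp add: table_def d_def)
  have Rlo: "256 \<le> row u" "row u + d + 1 \<le> B" "A \<le> row u" "d < \<Delta>"
    using row_less[OF u(2)] low cell_bounds(4) len(2) by (simp_all add: row_def d_def)
  have xy': "x < 7" "y < 7" using xy by auto
  define w where "w = u * (\<Delta> + 1)"
  have w1: "m x * m 27 = w" "w + A = row u" using u r by (simp_all add: w_def row_def)
  have w2: "w \<le> B" using w1 Rlo by linarith
  have sm: "d + 1 \<le> B" "row u + (d + 1) \<le> B" "row u \<le> B" using Rlo by linarith+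
  show "all_small B (append_cell x y) m"
    unfolding append_cell_def using w1 w2 r(1,3) R Rlo xy' sm by simp
  have ex: "exec_all (append_cell x y) m a = (if a = row u + (d + 1) then v else if a = row u then d + 1
      else if a = 7 then row u + (d + 1) else if a = 8 then d + 1 else m a)" for a
    unfolding append_cell_def using w1 r(1,3) R Rlo v xy' by simp
  show "exec_all (append_cell x y) m a = m a" if "a \<notin> {7, 8}" "a < A" for a
    using that Rlo by (simp add: ex)
  have new: "exec_all (append_cell x y) m (row v' + j) = m (row v' + j)" if "v' \<noteq> u" "j \<le> \<Delta>" for v' j
    using that row_apart[of j "d + 1" v' u] row_apart[of j 0 v' u] Rlo low(2) by (auto simp: ex row_def)
  show "table (exec_all (append_cell x y) m) (f(u := f u @ [v]))"
    unfolding table_def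
  proof (intro allI impI conjI)
    fix v' assume v': "v' < n"
    show "exec_all (append_cell x y) m (row v') = length ((f(u := f u @ [v])) v')"
    proof (cases "v' = u")
      case False
      then show ?thesis using new[OF False, of 0] tb v' by (simp add: table_def)
    qed (simp add: ex d_def)
    fix j assume j: "j < length ((f(u := f u @ [v])) v')"
    show "exec_all (append_cell x y) m (row v' + Suc j) = (f(u := f u @ [v])) v' ! j"
    proof (cases "v' = u")
      case True
      then have jd: "j \<le> d" using j by (simp add: d_def)
      have "m (row u + Suc j) = f u ! j" if "j < d" using tb u that by (simp add: table_def d_def)
      then show ?thesis using True jd Rlo by (cases "j = d") (simp_all add: ex nth_append d_def[symmetric])
    next
      case False
      then have "Suc j \<le> \<Delta>" using j len(1)[of v'] by simp
      then show ?thesis using new[OF False, of "Suc j"] tb v' j False by (simp add: table_def)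
    qed
  qed
qed

lemma setup_adjacency_ensures:
  assumes m: "loaded m" "\<forall>a\<ge>2 * b. m a = 0"
  shows "ensures B setup_adjacency m (3 + length es * 19) (\<lambda>m'. loaded m' \<and> table m' (adjacency es))"
proof -
  let ?w = "length es"
  define I where "I i m' \<longleftrightarrow> loaded m' \<and> m' 3 = b + 5 + 2 * i \<and> m' 1 = b + 5 + 2 * ?w \<and> table m' (adjacency (take i es))" for i m'
  let ?l = "[Load 5 3, Add 4 3 31, Load 6 4]"
  let ?b = "?l @ append_cell 5 6 @ append_cell 6 5 @ [Add 3 4 31]"
  have cong: "loaded m2" if "loaded m1" "\<And>a. 20 \<le> a \<Longrightarrow> a < A \<Longrightarrow> m2 a = m1 a" for m1 m2
    using that low regs_cong[of m1 m2] by (auto simp: loaded_def)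
  have regD: "m' 20 = b" "m' 25 = ?w" "m' 26 = A" "m' 27 = \<Delta> + 1" "m' 31 = 1" "m' 38 = b + 5" "m' 39 = 0" if "loaded m'" for m'
    using that by (simp_all add: loaded_def regs_def)
  have edgeD: "m' (b + 5 + 2 * i) = src i" "m' (b + 6 + 2 * i) = tgt i" if "loaded m'" "i < ?w" for m' i
    using that by (simp_all add: loaded_def)
  have bA: "b + 5 + 2 * ?w \<le> A" "A \<le> B" using low cell_bounds(2) by simp_all
  have body: "ensures B (Blk ?b) m' 18 (\<lambda>m'. I (Suc i) m' \<and> (m' 3 < m' 1 \<longleftrightarrow> Suc i < ?w))"
    if i: "i < ?w" and I: "I i m'" for i m'
  proof -
    define u where "u = src i"
    define v where "v = tgt i"
    define f where "f = adjacency (take i es)"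
    define f1 where "f1 = f(u := f u @ [v])"
    have ld: "loaded m'" and p: "m' 3 = b + 5 + 2 * i" "m' 1 = b + 5 + 2 * ?w" and tb: "table m' f"
      using I by (simp_all add: I_def f_def)
    have esi: "es ! i = (u, v)" by (simp add: u_def v_def src_def tgt_def)
    then have uv: "u \<noteq> v" "u < n" "v < n" using edge_distinct[of u v] i nth_mem[OF i] by simp_all
    have tk: "adjacency (take (Suc i) es) = f1(v := f1 v @ [u])"
      using i uv(1) unfolding take_Suc_conv_app_nth[OF i] esi
      by (auto simp: fun_eq_iff adjacency_append f1_def f_def) (auto simp: adjacency_def)
    \<comment> \<open>A prefix of the edge list gives no vertex more than its final degree, so no
      row overflows at any time.\<close>
    have tot: "length (adjacency (take j es) x) \<le> \<Delta>" for j x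
      using length_adjacency_le[of x] adjacency_append[of "take j es" "drop j es" x] by simp
    have len: "length (f x) \<le> \<Delta>" for x using tot by (simp add: f_def)
    have len1: "length (f u) < \<Delta>" "length (f1 x) \<le> \<Delta>" "length (f1 v) < \<Delta>" for x
      using tot[of "Suc i" u] tot[of "Suc i" v] tot[of "Suc i" x] uv(1) unfolding tk
      by (auto simp: f1_def split: if_splits)
    define m1 where "m1 = exec_all ?l m'"
    note r = regD[OF ld]
    have ad: "m' (b + 5 + 2 * i) = u" "m' (Suc (b + 5 + 2 * i)) = v"
    proof -
      have "b + 6 + 2 * i = Suc (b + 5 + 2 * i)" by simp
      then show "m' (b + 5 + 2 * i) = u" "m' (Suc (b + 5 + 2 * i)) = v"
        using edgeD[OF ld i] by (simp_all only: u_def v_def)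
    qed
    have far: "b + 5 + 2 * i \<noteq> 5" "Suc (b + 5 + 2 * i) \<noteq> 5" "b + 5 + 2 * i \<noteq> 4" "Suc (b + 5 + 2 * i) \<noteq> 4" using low(1) by simp_all
    have m1: "m1 5 = u" "m1 6 = v" "m1 4 = Suc (b + 5 + 2 * i)" "\<And>a. a \<notin> {4, 5, 6} \<Longrightarrow> m1 a = m' a"
      unfolding m1_def using p(1) r(5) ad far by (simp_all del: add_Suc add_Suc_right)
    have s1: "all_small B ?l m'" using p(1) r(5) bA i far by simp
    have tb1: "table m1 f" using tb m1(4) low(2) unfolding table_def row_def by simp
    define m2 where "m2 = exec_all (append_cell 5 6) m1"
    have r1: "m1 26 = A" "m1 27 = \<Delta> + 1" "m1 31 = 1" using r m1(4) by simp_all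
    note a1 = append_cell[OF tb1 r1 _ _ m1(1) uv(2) m1(2) len len1(1), folded m2_def f1_def]
    have m2: "m2 a = m1 a" if "a \<notin> {7, 8}" "a < A" for a using a1(3)[OF _ _ that] by simp
    have r2: "m2 26 = A" "m2 27 = \<Delta> + 1" "m2 31 = 1" "m2 6 = v" "m2 5 = u" using r1 m1 m2 low(2) by simp_all
    have tb2: "table m2 f1" using a1(2) by simp
    define m3 where "m3 = exec_all (append_cell 6 5) m2"
    note a2 = append_cell[OF tb2 r2(1-3) _ _ r2(4) uv(3) r2(5) len1(2,3), folded m3_def tk]
    have m3: "m3 a = m' a" if "a \<notin> {4, 5, 6, 7, 8}" "a < A" for a using a2(3)[of a] m2[of a] m1(4)[of a] that by simp
    have m34: "m3 4 = Suc (b + 5 + 2 * i)" using a2(3)[of 4] m2[of 4] m1(3) low(2) by simp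
    have tb3: "table m3 (adjacency (take (Suc i) es))" using a2(2) by simp
    define m4 where "m4 = exec_all [Add 3 4 31] m3"
    have m4: "m4 3 = b + 5 + 2 * Suc i" "\<And>a. a \<noteq> 3 \<Longrightarrow> m4 a = m3 a"
      using m34 m3[of 31] r(5) low(2) by (simp_all add: m4_def)
    have s4: "all_small B [Add 3 4 31] m3" using m34 m3[of 31] r(5) low(2) bA i by simp
    have ex: "exec_all ?b m' = m4"
      by (simp only: exec_all_append m1_def m2_def m3_def m4_def)
    have sm: "all_small B ?b m'"
      unfolding all_small_append m1_def[symmetric] m2_def[symmetric] m3_def[symmetric]
      using s1 s4 a1(1) a2(1) by simp
    show ?thesis
    proof (rule ensures_blk[OF sm], unfold ex)
      show "length ?b \<le> 18" by (simp add: append_cell_def)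
      have "loaded m4" by (rule cong[OF ld]) (use m4(2) m3 in simp)
      moreover have "m4 1 = b + 5 + 2 * ?w" using m4(2)[of 1] m3[of 1] p(2) low(2) by simp
      moreover have "table m4 (adjacency (take (Suc i) es))"
        using tb3 m4(2) low(2) unfolding table_def row_def by simp
      moreover from \<open>m4 1 = b + 5 + 2 * ?w\<close> have "m4 3 < m4 1 \<longleftrightarrow> Suc i < ?w" unfolding m4(1) by arith
      ultimately show "I (Suc i) m4 \<and> (m4 3 < m4 1 \<longleftrightarrow> Suc i < ?w)" using m4(1) by (simp add: I_def)
    qed
  qed
  let ?s = "[Add 3 38 39, Add 1 25 25, Add 1 1 3]"
  define m1 where "m1 = exec_all ?s m"
  note r = regD[OF m(1)]
  have m1: "m1 3 = b + 5" "m1 1 = b + 5 + 2 * ?w" "\<And>a. 4 \<le> a \<Longrightarrow> m1 a = m a" using r by (simp_all add: m1_def)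
  have s1: "all_small B ?s m" using r bA by simp
  have "table m1 (adjacency (take 0 es))"
    using m(2) m1(3) low unfolding table_def row_def by (simp add: adjacency_def A_def)
  moreover have "loaded m1" by (rule cong[OF m(1)]) (use m1(3) in simp)
  ultimately have I0: "I 0 m1" using m1 by (simp add: I_def)
  have "ensures B (DoWhile (Blk ?b) 3 1) m1 (?w * 19) (I ?w)"
    by (rule ensures_loop[where I = I, OF body _ es_pos]) (use I0 in simp_all)
  then show ?thesis unfolding setup_adjacency_def
    by (intro ensures_blk_seq[OF s1, folded m1_def]) (auto simp: I_def elim!: ensures_mono)
qed

lemma compute_root_ensures:
  assumes m: "regs m"
  shows "ensures B compute_root m (1 + n * 3) (\<lambda>m'. (\<forall>a. a \<noteq> 7 \<and> a \<noteq> 8 \<longrightarrow> m' a = m a) \<and> m' 7 = s)"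
proof -
  define I where "I i m' \<longleftrightarrow> (\<forall>a. a \<noteq> 7 \<and> a \<noteq> 8 \<longrightarrow> m' a = m a) \<and> m' 7 = i" for i m'
  have "ensures B (DoWhile (Blk [Add 7 7 31, Mul 8 7 7]) 8 23) (m(7 := 0)) (n * 3) (I s)"
  proof (rule ensures_loop[where I = I])
    fix i m' assume i: "i < s" and I: "I i m'"
    have r: "m' 31 = 1" "m' 23 = n" "m' 7 = i" using I m by (simp_all add: I_def regs_def)
    have "Suc i * Suc i \<le> s * s" using i by (intro mult_le_mono) auto
    then have sq: "Suc i * Suc i \<le> B" using least_s(4) B(4) by linarith
    have less: "Suc i * Suc i < n \<longleftrightarrow> Suc i < s"
    proof (cases "Suc i < s")
      case False
      then have "Suc i = s" using i by simp
      then show ?thesis using least_s(2) by simp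
    qed (use least_s(5)[of "Suc i"] in simp)
    show "ensures B (Blk [Add 7 7 31, Mul 8 7 7]) m' 2 (\<lambda>m'. I (Suc i) m' \<and> (m' 8 < m' 23 \<longleftrightarrow> Suc i < s))"
    proof (rule ensures_blk)
      have "Suc i \<le> B" using sq by simp
      then show "all_small B [Add 7 7 31, Mul 8 7 7] m'" using r sq by simp
      show "I (Suc i) (exec_all [Add 7 7 31, Mul 8 7 7] m') \<and>
        ((exec_all [Add 7 7 31, Mul 8 7 7] m') 8 < (exec_all [Add 7 7 31, Mul 8 7 7] m') 23 \<longleftrightarrow> Suc i < s)"
        using I r less by (simp add: I_def)
    qed simp
  qed (use least_s in \<open>simp_all add: I_def\<close>)
  then show ?thesis unfolding compute_root_def I_def by (intro ensures_blk_seq[where t' = "n * 3"]) simp_all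
qed

lemma compute_log_ensures:
  assumes m: "regs m"
  shows "ensures B compute_log m (2 + n * 3) (\<lambda>m'. (\<forall>a. a \<noteq> 9 \<and> a \<noteq> 10 \<longrightarrow> m' a = m a) \<and> m' 10 = l)"
proof -
  define I where "I i m' \<longleftrightarrow> (\<forall>a. a \<noteq> 9 \<and> a \<noteq> 10 \<longrightarrow> m' a = m a) \<and> m' 9 = 2 ^ i \<and> m' 10 = i" for i m'
  have "ensures B (DoWhile (Blk [Add 9 9 9, Add 10 10 31]) 9 23) (m(9 := 1, 10 := 0)) (n * 3) (I l)"
  proof (rule ensures_loop[where I = I])
    fix i m' assume i: "i < l" and I: "I i m'"
    have r: "m' 31 = 1" "m' 23 = n" "m' 9 = 2 ^ i" "m' 10 = i" using I m by (simp_all add: I_def regs_def)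
    have "(2::nat) ^ Suc i \<le> 2 ^ l" using i by (intro power_increasing) auto
    then have pw: "2 ^ i + 2 ^ i \<le> B" using least_l(4) B(4) by simp
    have less: "2 ^ i + 2 ^ i < n \<longleftrightarrow> Suc i < l"
    proof (cases "Suc i < l")
      case False
      then have "Suc i = l" using i by simp
      moreover have "(2::nat) ^ Suc i = 2 ^ i + 2 ^ i" by simp
      ultimately have "(2::nat) ^ l = 2 ^ i + 2 ^ i" by simp
      then show ?thesis using least_l(2) False by simp
    qed (use least_l(5)[of "Suc i"] in simp)
    show "ensures B (Blk [Add 9 9 9, Add 10 10 31]) m' 2 (\<lambda>m'. I (Suc i) m' \<and> (m' 9 < m' 23 \<longleftrightarrow> Suc i < l))"
    proof (rule ensures_blk)
      have "Suc i \<le> B" using i least_l(3) cell_bounds(9) by simp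
      then show "all_small B [Add 9 9 9, Add 10 10 31] m'" using r pw by simp
      show "I (Suc i) (exec_all [Add 9 9 9, Add 10 10 31] m') \<and>
        ((exec_all [Add 9 9 9, Add 10 10 31] m') 9 < (exec_all [Add 9 9 9, Add 10 10 31] m') 23 \<longleftrightarrow> Suc i < l)"
        using I r less by (simp add: I_def)
    qed simp
  qed (use least_l in \<open>simp_all add: I_def\<close>)
  then have "ensures B compute_log m (2 + n * 3) (I l)"
    unfolding compute_log_def by (intro ensures_blk_seq[where t' = "n * 3"]) (use cell_bounds(8) in simp_all)
  then show ?thesis by (rule ensures_mono) (simp_all add: I_def)
qed

lemma compute_steps_ensures:
  assumes m: "regs m" "m 10 = l"
  shows "ensures B compute_steps m (12 + e * 3) (\<lambda>m'. (\<forall>a. 16 \<le> a \<and> a \<noteq> 33 \<or> a = 7 \<longrightarrow> m' a = m a) \<and> m' 11 = e \<and> m' 33 = t)"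
proof -
  let ?b1 = "[Const 11 1, Const 12 0, Const 0 60, Add 13 22 22, Add 13 13 0]"
  let ?b2 = "[Mul 0 22 10, Add 0 11 0, Add 0 0 24, Const 1 3, Add 0 0 1, Mul 0 0 37, Mul 33 0 32]"
  have r: "m 22 = q" "m 24 = k" "m 31 = 1" "m 32 = M" "m 37 = q * q" using m by (simp_all add: regs_def)
  define m1 where "m1 = exec_all ?b1 m"
  have m1: "m1 12 = 0" "m1 11 = 1" "m1 13 = 2 * q + 60" "\<And>a. a \<notin> {0, 11, 12, 13} \<Longrightarrow> m1 a = m a"
    using r by (simp_all add: m1_def)
  have eB: "2 * q + 60 \<le> B" using q_pow(4) t_bounds(3) by simp
  have s1: "all_small B ?b1 m" using r eB by simp
  have lp: "ensures B (DoWhile (Blk [Mul 11 11 22, Add 12 12 31]) 12 13) m1 ((2 * q + 60) * 3)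
      (\<lambda>m'. m' = m1(11 := 1 * q ^ (2 * q + 60 - 0), 12 := 2 * q + 60))"
    by (rule power_loop) (use m1 r q2 eB t_bounds(3) in \<open>simp_all add: e_def\<close>)
  define m2 where "m2 = m1(11 := 1 * q ^ (2 * q + 60 - 0), 12 := 2 * q + 60)"
  have m2: "m2 11 = e" "\<And>a. a \<notin> {0, 11, 12, 13} \<Longrightarrow> m2 a = m a" using m1 by (simp_all add: m2_def e_def)
  define u where "u = e + q * l + k + 3"
  have u: "q * l \<le> u" "e + q * l \<le> u" "e + q * l + k \<le> u" "u \<le> B" "u * (q * q) \<le> B" "u * (q * q) * M = t"
    using t_bounds by (simp_all add: u_def t_def mult_ac)
  define y where "y = q * q"
  have y: "m 37 = y" "u * y \<le> B" "u * y * (m 32) = t" using u r by (simp_all add: y_def)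
  have s2: "all_small B ?b2 m2"
    using m2 m(2) r(1,2) y u B(2) cell_bounds(8) by (simp add: u_def[symmetric] del: distrib_left_numeral)
  have q2: "exec_all ?b2 m2 33 = t"
    using m2 m(2) r(1,2) y(1,3) by (simp add: u_def)
  show ?thesis unfolding compute_steps_def
  proof (rule ensures_blk_seq[OF s1, folded m1_def, where t' = "7 + e * 3"])
    show "ensures B (DoWhile (Blk [Mul 11 11 22, Add 12 12 31]) 12 13 ;; Blk ?b2) m1 (7 + e * 3)
      (\<lambda>m'. (\<forall>a. 16 \<le> a \<and> a \<noteq> 33 \<or> a = 7 \<longrightarrow> m' a = m a) \<and> m' 11 = e \<and> m' 33 = t)"
    proof (rule ensures_seq[OF lp])
      fix m' assume "m' = m1(11 := 1 * q ^ (2 * q + 60 - 0), 12 := 2 * q + 60)"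
      then have m': "m' = m2" by (simp add: m2_def)
      show "ensures B (Blk ?b2) m' 7 (\<lambda>m'. (\<forall>a. 16 \<le> a \<and> a \<noteq> 33 \<or> a = 7 \<longrightarrow> m' a = m a) \<and> m' 11 = e \<and> m' 33 = t)"
        unfolding m'
      proof (rule ensures_blk[OF s2])
        show "(\<forall>a. 16 \<le> a \<and> a \<noteq> 33 \<or> a = 7 \<longrightarrow> exec_all ?b2 m2 a = m a) \<and> exec_all ?b2 m2 11 = e \<and> exec_all ?b2 m2 33 = t"
          unfolding q2 using m2 by auto
      qed simp
    qed (use q_pow(4) in simp)
  qed simp
qed

lemma compute_trials_ensures:
  assumes m: "regs m" "m 11 = e" "m 7 = s"
  shows "ensures B compute_trials m (7 + e * 6) (\<lambda>m'. (\<forall>a. 16 \<le> a \<and> a \<noteq> 34 \<longrightarrow> m' a = m a) \<and> m' 34 = N)"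
proof -
  let ?b1 = "[Const 15 2, Const 14 2, Const 12 0]"
  let ?b3 = "[Const 0 2, Add 0 24 0, Mul 34 14 0]"
  let ?l1 = "DoWhile (Blk [Mul 14 14 15, Add 12 12 31]) 12 11"
  let ?l2 = "DoWhile (Blk [Mul 14 14 7, Add 12 12 31]) 12 22"
  let ?Q = "\<lambda>m'. (\<forall>a. 16 \<le> a \<and> a \<noteq> 34 \<longrightarrow> m' a = m a) \<and> m' 34 = N"
  have r: "m 22 = q" "m 24 = k" "m 31 = 1" using m by (simp_all add: regs_def)
  define m1 where "m1 = exec_all ?b1 m"
  have m1: "m1 15 = 2" "m1 14 = 2" "m1 12 = 0" "\<And>a. a \<notin> {12, 14, 15} \<Longrightarrow> m1 a = m a"
    by (simp_all add: m1_def)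
  have s1: "all_small B ?b1 m" using cell_bounds(8) by simp
  have l1: "ensures B ?l1 m1 (e * 3) (\<lambda>m'. m' = m1(14 := 2 * 2 ^ (e - 0), 12 := e))"
    by (rule power_loop) (use m1 m r q_pow(1) t_bounds(3) N_bounds(1) in simp_all)
  define m2 where "m2 = m1(14 := 2 * 2 ^ (e - 0), 12 := e)"
  define m3 where "m3 = exec_all [Const 12 1] m2"
  have m3: "m3 12 = 1" "m3 14 = 2 * 2 ^ e" "\<And>a. a \<notin> {12, 14, 15} \<Longrightarrow> m3 a = m a" using m1 by (simp_all add: m2_def m3_def)
  have s3: "all_small B [Const 12 1] m2" using cell_bounds(8) by simp
  have qB: "q \<le> B" using cell_bounds(10) by simp
  have l2: "ensures B ?l2 m3 (q * 3) (\<lambda>m'. m' = m3(14 := 2 * 2 ^ e * s ^ (q - 1), 12 := q))"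
    by (rule power_loop) (use m3 m r q2 qB least_s(1) N_bounds(2) in simp_all)
  define m4 where "m4 = m3(14 := 2 * 2 ^ e * s ^ (q - 1), 12 := q)"
  define u where "u = 2 * 2 ^ e * s ^ (q - 1)"
  have m4: "m4 14 = u" "\<And>a. a \<notin> {12, 14, 15} \<Longrightarrow> m4 a = m a" using m3 by (simp_all add: m4_def u_def)
  have uN: "u * (k + 2) = N" "N \<le> B" "k + 2 \<le> B" "2 \<le> B" using B(3) N_bounds(3) by (simp_all add: u_def N_def)
  have s4: "all_small B ?b3 m4" using m4 uN r by simp
  have Q4: "?Q (exec_all ?b3 m4)" using m4 uN r by simp
  have e4: "ensures B (Blk ?b3) m4 3 ?Q" 
  proof (rule ensures_blk[OF s4])
    show "?Q (exec_all ?b3 m4)" by (rule Q4)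
  qed simp
  have e3: "ensures B (?l2 ;; Blk ?b3) m3 (q * 3 + 3) ?Q"
    by (rule ensures_seq[OF l2, where ?t2.0 = 3]) (use e4 in \<open>simp_all add: m4_def\<close>)
  have e2: "ensures B (Blk [Const 12 1] ;; ?l2 ;; Blk ?b3) m2 (q * 3 + 4) ?Q"
    by (rule ensures_blk_seq[OF s3, folded m3_def, OF e3]) simp
  have e1: "ensures B (?l1 ;; Blk [Const 12 1] ;; ?l2 ;; Blk ?b3) m1 (e * 3 + (q * 3 + 4)) ?Q"
    by (rule ensures_seq[OF l1, where ?t2.0 = "q * 3 + 4"]) (use e2 in \<open>simp_all add: m2_def\<close>)
  show ?thesis unfolding compute_trials_def
    by (rule ensures_blk_seq[OF s1, folded m1_def, OF e1]) (use q_pow(3) in simp)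
qed

lemma setup_colours_ensures:
  assumes m: "regs m"
  shows "ensures B setup_colours m (1 + n * 4) (\<lambda>m'. (\<forall>a. 20 \<le> a \<and> a < Cb \<longrightarrow> m' a = m a) \<and> (\<forall>u<n. m' (Cb + u) = 1))"
proof -
  define I where "I i m' \<longleftrightarrow> (\<forall>a. 20 \<le> a \<and> a < Cb \<longrightarrow> m' a = m a) \<and> m' 4 = i \<and> (\<forall>u<i. m' (Cb + u) = 1)" for i m'
  have "ensures B (DoWhile (Blk [Add 5 28 4, Store 5 31, Add 4 4 31]) 4 23) (m(4 := 0)) (n * 4) (I n)"
  proof (rule ensures_loop[where I = I])
    fix i m' assume i: "i < n" and I: "I i m'"
    have r: "m' 31 = 1" "m' 23 = n" "m' 28 = Cb" "m' 4 = i" using I m low(3) by (simp_all add: I_def regs_def)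
    have Ci: "Cb + n \<le> B" using cell_bounds(5) by (simp add: Fb_def)
    show "ensures B (Blk [Add 5 28 4, Store 5 31, Add 4 4 31]) m' 3 (\<lambda>m'. I (Suc i) m' \<and> (m' 4 < m' 23 \<longleftrightarrow> Suc i < n))"
    proof (rule ensures_blk)
      show "all_small B [Add 5 28 4, Store 5 31, Add 4 4 31] m'" using r i Ci low(3) by simp
      show "I (Suc i) (exec_all [Add 5 28 4, Store 5 31, Add 4 4 31] m') \<and>
        ((exec_all [Add 5 28 4, Store 5 31, Add 4 4 31] m') 4 < (exec_all [Add 5 28 4, Store 5 31, Add 4 4 31] m') 23 \<longleftrightarrow> Suc i < n)"
        using I r low(3) by (simp add: I_def less_Suc_eq)
    qed simp
  qed (use n_pos in \<open>simp_all add: I_def\<close>)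
  then have "ensures B setup_colours m (1 + n * 4) (I n)" unfolding setup_colours_def by (intro ensures_blk_seq[where t' = "n * 4"]) simp_all
  then show ?thesis by (rule ensures_mono) (simp_all add: I_def)
qed

definition ready :: "memory \<Rightarrow> bool" where
  "ready m \<longleftrightarrow> loaded m \<and> table m (adjacency es) \<and> m 33 = t \<and> m 34 = N \<and> (\<forall>u<n. m (Cb + u) = 1)"

definition initialise_time :: nat where "initialise_time = 400 + 30 * length es + 10 * n + 9 * e"

lemma initialise_ensures: "ensures B initialise mi initialise_time ready"
proof -
  \<comment> \<open>The later stages change only scratch cells, the cells 33 and 34, and the colours
    from \<open>Cb\<close> on.\<close>
  define keep where "keep m m' \<longleftrightarrow> (\<forall>a. 20 \<le> a \<and> a \<noteq> 33 \<and> a \<noteq> 34 \<and> a < Cb \<longrightarrow> m' a = m a)" for m m' :: memory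
  define P where "P m \<longleftrightarrow> loaded m \<and> table m (adjacency es)" for m
  have P_cong: "P m'" if "P m" "keep m m'" for m m'
  proof -
    have "m' (row v + j) = m (row v + j)" if "v < n" "j \<le> \<Delta>" for v j
      using \<open>keep m m'\<close> row_less[OF that(1)] that(2) low(2) by (simp add: keep_def row_def)
    note row_eq = this
    have tb: "table m (adjacency es)" using \<open>P m\<close> by (simp add: P_def)
    have "table m' (adjacency es)" unfolding table_def
    proof (intro allI impI conjI)
      fix v j assume v: "v < n"
      show "m' (row v) = length (adjacency es v)" using row_eq[OF v, of 0] tb v by (simp add: table_def)
      assume j: "j < length (adjacency es v)"
      then have "Suc j \<le> \<Delta>" using length_adjacency_le[of v] by linarith
      then have "m' (row v + Suc j) = m (row v + Suc j)" by (rule row_eq[OF v])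
      also have "\<dots> = adjacency es v ! j" using tb v j unfolding table_def by blast
      finally show "m' (row v + Suc j) = adjacency es v ! j" .
    qed
    moreover have "regs m'" by (rule regs_cong[of m]) (use that low(3) in \<open>simp_all add: P_def loaded_def keep_def\<close>)
    moreover have "m' (b + 5 + 2 * r) = m (b + 5 + 2 * r)" "m' (b + 6 + 2 * r) = m (b + 6 + 2 * r)" if "r < length es" for r
      using \<open>keep m m'\<close> that low unfolding keep_def by simp_all
    ultimately show ?thesis using \<open>P m\<close> by (simp add: P_def loaded_def)
  qed
  have regsD: "regs m" if "P m" for m using that by (simp add: P_def loaded_def)
  \<comment> \<open>The stages are composed from the last one backwards. Scratch values handed on
    between them are \<open>s\<close> in cell 7, \<open>l\<close> in cell 10 and \<open>e\<close> in
    cell 11.\<close>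
  have e8: "ensures B setup_colours m (1 + n * 4) ready" if "P m" "m 33 = t" "m 34 = N" for m
    by (rule ensures_mono[OF setup_colours_ensures[OF regsD[OF that(1)]]])
      (use P_cong[OF that(1)] that low(3) in \<open>simp_all add: ready_def P_def keep_def\<close>)
  have e7: "ensures B (compute_trials ;; setup_colours) m (8 + n * 4 + e * 6) ready"
    if m: "P m" "m 33 = t" "m 11 = e" "m 7 = s" for m
  proof (rule ensures_seq[OF compute_trials_ensures[OF regsD[OF m(1)] m(3,4)]])
    fix m' assume *: "(\<forall>a. 16 \<le> a \<and> a \<noteq> 34 \<longrightarrow> m' a = m a) \<and> m' 34 = N"
    then have "keep m m'" by (simp add: keep_def)
    then show "ensures B setup_colours m' (1 + n * 4) ready" by (intro e8 P_cong[OF m(1)]) (use * m in simp_all)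
  qed simp
  have e6: "ensures B (compute_steps ;; compute_trials ;; setup_colours) m (20 + n * 4 + e * 9) ready"
    if m: "P m" "m 10 = l" "m 7 = s" for m
  proof (rule ensures_seq[OF compute_steps_ensures[OF regsD[OF m(1)] m(2)]])
    fix m' assume *: "(\<forall>a. 16 \<le> a \<and> a \<noteq> 33 \<or> a = 7 \<longrightarrow> m' a = m a) \<and> m' 11 = e \<and> m' 33 = t"
    then have "keep m m'" by (simp add: keep_def)
    then show "ensures B (compute_trials ;; setup_colours) m' (8 + n * 4 + e * 6) ready"
      by (intro e7 P_cong[OF m(1)]) (use * m in simp_all)
  qed simp
  have e5: "ensures B (compute_log ;; compute_steps ;; compute_trials ;; setup_colours) m (22 + n * 7 + e * 9) ready"
    if m: "P m" "m 7 = s" for m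
  proof (rule ensures_seq[OF compute_log_ensures[OF regsD[OF m(1)]]])
    fix m' assume *: "(\<forall>a. a \<noteq> 9 \<and> a \<noteq> 10 \<longrightarrow> m' a = m a) \<and> m' 10 = l"
    then have "keep m m'" by (simp add: keep_def)
    then show "ensures B (compute_steps ;; compute_trials ;; setup_colours) m' (20 + n * 4 + e * 9) ready"
      by (intro e6 P_cong[OF m(1)]) (use * m in simp_all)
  qed simp
  have e4: "ensures B (compute_root ;; compute_log ;; compute_steps ;; compute_trials ;; setup_colours) m (23 + n * 10 + e * 9) ready"
    if m: "P m" for m
  proof (rule ensures_seq[OF compute_root_ensures[OF regsD[OF m(1)]]])
    fix m' assume *: "(\<forall>a. a \<noteq> 7 \<and> a \<noteq> 8 \<longrightarrow> m' a = m a) \<and> m' 7 = s"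
    then have "keep m m'" by (simp add: keep_def)
    then show "ensures B (compute_log ;; compute_steps ;; compute_trials ;; setup_colours) m' (22 + n * 7 + e * 9) ready"
      by (intro e5 P_cong[OF m(1)]) (use * m in simp_all)
  qed simp
  show ?thesis unfolding initialise_def
  proof (rule ensures_seq[OF setup_copy_ensures])
    fix m assume "copied m"
    then show "ensures B (setup_registers ;; setup_adjacency ;; compute_root ;; compute_log ;; compute_steps ;;
      compute_trials ;; setup_colours) m (49 + length es * 19 + n * 10 + e * 9) ready"
    proof (rule ensures_seq[OF setup_registers_ensures])
      fix m' assume "loaded m' \<and> (\<forall>a\<ge>2 * b. m' a = 0)"
      then show "ensures B (setup_adjacency ;; compute_root ;; compute_log ;; compute_steps ;;
          compute_trials ;; setup_colours) m' (26 + length es * 19 + n * 10 + e * 9) ready"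
        by (intro ensures_seq[OF setup_adjacency_ensures e4]) (simp_all add: P_def)
    qed simp
  qed (simp add: initialise_time_def)
qed

lemma write_output_ensures:
  assumes \<sigma>: "\<sigma> \<in> \<Omega>" and m: "m 23 = n" "m 28 = Cb" "m 31 = 1" "\<And>u. u < n \<Longrightarrow> m (Cb + u) = \<sigma> u"
  shows "ensures B write_output m (n * 6 + 200) (\<lambda>m'. decode_output n m' = Some \<sigma>)"
proof -
  \<comment> \<open>The loop runs at least once. For \<open>n \<le> 63\<close> it writes one
    meaningless value into cell 64, beyond the cells that are decoded.\<close>
  define K where "K = max 64 n"
  have K: "64 \<le> K" "n \<le> K" "K \<le> n + 64" "K = 64 \<or> K = n" by (auto simp: K_def)
  have KC: "K < Cb" using K low unfolding Cb_def by simp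
  have CB: "Cb + n + 64 \<le> B" using B(1) by (simp add: Gb_def Fb_def)
  let ?b = "[Add 4 28 3, Load 5 4, Add 6 3 31, Store 6 5, Add 3 3 31]"
  define I where "I i m' \<longleftrightarrow> m' 3 = 63 + i \<and> m' 23 = n \<and> m' 28 = Cb \<and> m' 31 = 1 \<and> (\<forall>u<n. m' (Cb + u) = \<sigma> u) \<and>
    (\<forall>u. 63 \<le> u \<and> u < 63 + i \<and> u < n \<longrightarrow> m' (Suc u) = \<sigma> u)" for i m'
  have loop: "ensures B (DoWhile (Blk ?b) 3 23) (m(3 := 63)) (n * 6 + 6) (I (K - 63))"
  proof (rule ensures_loop[where I = I])
    fix i m' assume i: "i < K - 63" and I: "I i m'"
    note I' = I[unfolded I_def]
    have iK: "63 + i < K" using i by linarith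
    have r: "m' 3 = 63 + i" "m' 23 = n" "m' 28 = Cb" "m' 31 = 1" using I' by simp_all
    let ?m = "exec_all ?b m'"
    have ex: "?m a = (if a = 3 then 64 + i else if a = 64 + i then m' (Cb + 63 + i) else m' a)" if "a \<noteq> 4" "a \<noteq> 5" "a \<noteq> 6" for a
      using r that low(3) by (simp add: add_ac)
    show "ensures B (Blk ?b) m' 5 (\<lambda>m'. I (Suc i) m' \<and> (m' 3 < m' 23 \<longleftrightarrow> Suc i < K - 63))"
    proof (rule ensures_blk)
      show "all_small B ?b m'" using r iK K CB low(3) by simp
      have "\<forall>u<n. ?m (Cb + u) = \<sigma> u" using I' KC iK low(3) by (auto simp: ex simp del: exec_all.simps)
      moreover have "?m (Suc u) = \<sigma> u" if u: "63 \<le> u" "u < 63 + Suc i" "u < n" for u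
      proof (cases "u = 63 + i")
        case True
        have "m' (Cb + (63 + i)) = \<sigma> (63 + i)" using I' u True by blast
        then show ?thesis using True by (simp add: ex add_ac del: exec_all.simps)
      next
        case False
        then show ?thesis using u I' by (simp add: ex del: exec_all.simps)
      qed
      moreover have h: "?m 3 = 63 + Suc i" "?m 23 = n" "?m 28 = Cb" "?m 31 = 1" using r by (simp_all add: ex del: exec_all.simps)
      ultimately have "I (Suc i) ?m" unfolding I_def by blast
      moreover have "63 + Suc i < n \<longleftrightarrow> Suc i < K - 63" using K iK by arith
      ultimately show "I (Suc i) ?m \<and> (?m 3 < ?m 23 \<longleftrightarrow> Suc i < K - 63)" unfolding h by blast
    qed simp
  qed (use K m low(3) in \<open>auto simp: I_def\<close>)
  define L where L_def: "L = [1..<28] @ [29..<64::nat]"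
  have in_L: "a \<in> set L \<longleftrightarrow> 1 \<le> a \<and> a < 64 \<and> a \<noteq> 28" for a
    unfolding L_def set_append set_upt by auto
  let ?f = "[Const 0 27, Add 28 28 0, Load 28 28, Const 0 1]"
  have fin: "ensures B (Blk (fetch_cells L @ ?f)) m1 190 (\<lambda>m'. decode_output n m' = Some \<sigma>)" if I: "I (K - 63) m1" for m1
  proof -
    have I1: "m1 28 = Cb" "\<And>u. u < n \<Longrightarrow> m1 (Cb + u) = \<sigma> u" "\<And>u. 63 \<le> u \<Longrightarrow> u < n \<Longrightarrow> m1 (Suc u) = \<sigma> u"
      using I K by (auto simp: I_def)
    have fc: "all_small B (fetch_cells L) m1 \<and>
      (\<forall>a. exec_all (fetch_cells L) m1 a = (if a \<in> set L then m1 (Cb + (a - 1)) else m1 a))"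
      by (rule fetch_cells) (use I1 low(3) CB in_L in auto)
    define m2 where "m2 = exec_all (fetch_cells L) m1"
    have m2: "m2 a = (if 1 \<le> a \<and> a < 64 \<and> a \<noteq> 28 then m1 (Cb + (a - 1)) else m1 a)" for a
      using fc unfolding in_L m2_def by blast
    define m3 where "m3 = exec_all ?f m2"
    have m3: "m3 0 = 1" "m3 28 = m1 (Cb + 27)" "\<And>a. a \<notin> {0, 28} \<Longrightarrow> m3 a = m2 a"
      using low(3) I1(1) by (simp_all add: m3_def m2 add.commute)
    have out: "m3 (Suc v) = \<sigma> v" if v: "v < n" for v
    proof -
      consider "63 \<le> v" | "v = 27" | "v < 63" "v \<noteq> 27" by linarith
      then show ?thesis
        by cases (use m3 m2 I1 v in auto)
    qed
    have "restrict (\<lambda>v. m3 (v + 1)) {..<n} = \<sigma>"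
    proof
      fix v
      show "restrict (\<lambda>v. m3 (v + 1)) {..<n} v = \<sigma> v"
        using out[of v] PiE_arb[of \<sigma> "{..<n}" "\<lambda>_. {1..q}" v] \<sigma> by (cases "v < n") (auto simp: \<Omega>_def)
    qed
    then have dec: "decode_output n m3 = Some \<sigma>" using m3(1) by (simp add: decode_output_def)
    have sm: "all_small B (fetch_cells L @ ?f) m1"
      unfolding all_small_append m2_def[symmetric] using fc I1(1) CB low(3) by (simp add: m2)
    have "length (fetch_cells L @ ?f) \<le> 190" by (simp add: fetch_cells_def length_concat comp_def sum_list_triv L_def del: upt_Suc)
    then show ?thesis using dec by (intro ensures_blk[OF sm]) (simp_all only: exec_all_append m2_def m3_def)
  qed
  have "ensures B (DoWhile (Blk ?b) 3 23 ;; Blk (fetch_cells L @ ?f)) (m(3 := 63)) (n * 6 + 196) (\<lambda>m'. decode_output n m' = Some \<sigma>)"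
    by (rule ensures_seq[OF loop fin]) simp_all
  then show ?thesis unfolding write_output_def L_def[symmetric]
    by (intro ensures_blk_seq[where t' = "n * 6 + 196"]) (use low(3) CB in simp_all)
qed

end

section \<open>Assembly: law of the output, word size and running time\<close>

lemma given_success_map_Some: "given_success (map_pmf Some D) = D"
proof -
  have "cond_pmf (map_pmf Some D) (range Some) = map_pmf Some D"
  proof (rule pmf_eqI)
    fix x
    obtain d where "d \<in> set_pmf D" using set_pmf_not_empty[of D] by blast
    then have "Some d \<in> set_pmf (map_pmf Some D) \<inter> range Some" by simp
    then have ne: "set_pmf (map_pmf Some D) \<inter> range Some \<noteq> {}" by blast
    have 1: "measure_pmf.prob (map_pmf Some D) (range Some) = 1"
      by (subst measure_pmf.prob_eq_1) (auto simp: AE_measure_pmf_iff)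
    show "pmf (cond_pmf (map_pmf Some D) (range Some)) x = pmf (map_pmf Some D) x"
    proof (cases "x \<in> range Some")
      case False
      then have "x \<notin> set_pmf (map_pmf Some D)" by auto
      then show ?thesis using False pmf_cond[OF ne] by (simp add: pmf_eq_0_set_pmf)
    qed (simp add: pmf_cond[OF ne] 1 del: measure_map_pmf)
  qed
  then show ?thesis by (simp add: given_success_def map_pmf_comp)
qed

lemma success_prob_map_Some: "success_prob (map_pmf Some D) = 1"
  unfolding success_prob_def by (subst measure_pmf.prob_eq_1) (auto simp: AE_measure_pmf_iff)

lemma tv_dist_le: "(\<And>A. \<bar>measure_pmf.prob \<nu> A - measure_pmf.prob \<mu> A\<bar> \<le> x) \<Longrightarrow> tv_dist \<nu> \<mu> \<le> x"
  unfolding tv_dist_def by (rule cSUP_least) auto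

definition program :: "instr list" where
  "program = compile 0 (initialise ;; trials ;; write_output)"

text \<open>The constant \<open>K3 * K4 + 4 * K5\<close> that arises in
  \<open>total_time_le\<close>.\<close>

definition time_const :: "nat \<Rightarrow> nat \<Rightarrow> nat" where
  "time_const q d = (let e = q ^ (2 * q + 60) in
    2 ^ (e + q) * 6 * (q * q * q * (3 * e + 5 * q + 12) * (52 + q * q * (23 + d * 16)) + 3 * (13 * q + 33)) +
    4 * (617 + 30 * q + 9 * e))"

definition word_const :: "nat \<Rightarrow> nat" where
  "word_const q = (let e = q ^ (2 * q + 60) in q * q * q * (e + q + 4) + 2 ^ (e + 2) + (259 * q + q * q + 70))"

context sampler_input begin

definition result :: "(nat \<Rightarrow> nat) pmf" where
  "result = search (iter kernel t) balanced N (\<lambda>v\<in>{..<n}. 1)"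

definition total_time :: nat where
  "total_time = (400 + 30 * length es + 10 * n + 9 * e) +
    (1 + N * Suc (t * (52 + q * q * (23 + \<Delta> * 16)) + (q + 1) * 4 + n * 8 + q * 9 + 20) + (n * 6 + 200))"

lemma result_accuracy: "\<bar>measure_pmf.prob result X - measure_pmf.prob (pmf_of_set Eq) X\<bar> \<le> 1 / 2 ^ k"
  unfolding result_def
proof (rule search_accuracy)
  show "n \<le> s\<^sup>2" using least_s(2) by (simp add: power2_eq_square)
  show "s \<le> 2 ^ l" using least_s(3) least_l(2) by simp
  show "t = M * q\<^sup>2 * (e + q * l + k + 3)" by (simp add: t_def power2_eq_square)
qed (use least_l(2) const_\<Omega> in \<open>simp_all add: e_def N_def\<close>)

text \<open>The word bound has to be a pure power of \<open>z = n + k + 1\<close>. As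
  \<open>z \<ge> 2\<close>, a constant factor \<open>K\<close> is at most \<open>z ^ K\<close> and
  moves into the exponent.\<close>

lemma word_bounds:
  assumes n2: "2 \<le> n"
  shows "Gb + q + 64 \<le> (n + k + 1) ^ (word_const q + q + 1)" "t \<le> (n + k + 1) ^ (word_const q + q + 1)"
    "N \<le> (n + k + 1) ^ (word_const q + q + 1)" "4 * n \<le> (n + k + 1) ^ (word_const q + q + 1)"
    "k \<le> (n + k + 1) ^ (word_const q + q + 1)"
proof -
  define K where "K = word_const q"
  define z where "z = n + k + 1"
  have K: "K = q * q * q * (e + q + 4) + 2 ^ (e + 2) + (259 * q + q * q + 70)"
    by (simp add: K_def word_const_def e_def Let_def)
  have z: "2 \<le> z" "n \<le> z" "k \<le> z" "k + 2 \<le> 2 * z" "1 \<le> z" "k + 3 \<le> 4 * z" using n2 by (simp_all add: z_def)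
  have "K \<le> 2 ^ K" by (rule less_imp_le, rule less_exp)
  also have "\<dots> \<le> z ^ K" by (rule power_mono) (use z in auto)
  finally have KK: "K * z ^ (q + 1) \<le> z ^ (K + q + 1)"
    unfolding power_add by (simp add: mult.assoc)
  have pz: "z \<le> z ^ (q + 1)" using z by (intro self_le_power) auto
  have "z ^ 2 \<le> z ^ (q + 1)" using z q2 by (intro power_increasing) auto
  then have pz2: "z * z \<le> z ^ (q + 1)" by (simp add: power2_eq_square)
  have red: "x \<le> z ^ (K + q + 1)" if "x \<le> a * z ^ (q + 1)" "a \<le> K" for x a
    using that(1) mult_le_mono1[OF that(2), of "z ^ (q + 1)"] KK by linarith
  have red1: "x \<le> z ^ (K + q + 1)" if "x \<le> a * z" "a \<le> K" for x a
    by (rule red[OF order_trans[OF that(1) mult_le_mono2[OF pz]] that(2)])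
  have Mn: "M \<le> n * q" by (rule M_le)
  have nz: "n * q \<le> z * q" by (rule mult_le_mono1[OF z(2)])
  have dq: "\<Delta> \<le> q" using q_ge by simp
  have Gb: "Gb + q + 64 \<le> (259 * q + q * q + 70) * z"
  proof -
    have "n * \<Delta> \<le> n * q" using dq by (rule mult_le_mono2)
    moreover have "q * q \<le> q * q * z" "q \<le> z * q" using z(5) by simp_all
    moreover have "Gb + q + 64 = 256 * length es + n * \<Delta> + 2 * n + q * q + q + 64"
      by (simp add: Gb_def Fb_def Cb_def A_def b_def)
    moreover have "(259 * q + q * q + 70) * z = 259 * (z * q) + q * q * z + 70 * z" by (simp add: algebra_simps)
    ultimately show ?thesis using Mn nz z by linarith
  qed
  show "Gb + q + 64 \<le> (n + k + 1) ^ (word_const q + q + 1)"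
    unfolding z_def[symmetric] K_def[symmetric] by (rule red1[OF Gb]) (simp add: K)
  show "4 * n \<le> (n + k + 1) ^ (word_const q + q + 1)"
    unfolding z_def[symmetric] K_def[symmetric] by (rule red1[of _ 4]) (use z K in simp_all)
  show "k \<le> (n + k + 1) ^ (word_const q + q + 1)"
    unfolding z_def[symmetric] K_def[symmetric] by (rule red1[of _ 1]) (use z K in simp_all)
  have "t \<le> q * q * q * (e + q + 4) * (z * z)"
  proof -
    have "q * l \<le> q * z" "e \<le> e * z" using least_l(3) z by simp_all
    moreover have "(e + q + 4) * z = e * z + q * z + 4 * z" by (simp add: algebra_simps)
    ultimately have "e + q * l + k + 3 \<le> (e + q + 4) * z" using z(6) by linarith
    moreover have "M \<le> z * q" using Mn nz by linarith
    ultimately have "t \<le> (z * q) * (q * q) * ((e + q + 4) * z)"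
      unfolding t_def by (intro mult_le_mono) auto
    then show ?thesis by (simp only: mult_ac)
  qed
  also have "\<dots> \<le> q * q * q * (e + q + 4) * z ^ (q + 1)" by (rule mult_le_mono2[OF pz2])
  finally show "t \<le> (n + k + 1) ^ (word_const q + q + 1)"
    unfolding z_def[symmetric] K_def[symmetric] by (rule red) (simp add: K)
  have "N \<le> 2 * 2 ^ e * z ^ (q - 1) * (2 * z)"
    unfolding N_def using least_s(3) z by (intro mult_le_mono power_mono) auto
  also have "\<dots> = 2 ^ (e + 2) * z ^ q" using q2 by (cases q) (simp_all add: power_add mult_ac)
  also have "\<dots> \<le> 2 ^ (e + 2) * z ^ (q + 1)" using z by simp
  finally show "N \<le> (n + k + 1) ^ (word_const q + q + 1)"
    unfolding z_def[symmetric] K_def[symmetric] by (rule red) (simp add: K)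
qed

text \<open>With \<open>u = ln n * L\<close>, one trial takes \<open>O(n * u)\<close> steps, and the
  number of trials is \<open>O(n powr ((q - 1) / 2) * L)\<close>. Both \<open>ln n\<close> and
  \<open>L\<close> are at least \<open>2 / 3\<close>, so sums of logarithms and constants are
  bounded by multiples of the product \<open>u\<close>.\<close>

lemma total_time_le:
  fixes L :: real
  assumes n2: "2 \<le> n" and L: "2 / 3 \<le> L" "real k \<le> 3 * L"
  shows "real total_time \<le> real (time_const q \<Delta>) * real n powr ((real q + 1) / 2) * ln (real n) * L\<^sup>2"
proof -
  define lam where "lam = ln (real n)"
  define R where "R = real n powr ((real q - 1) / 2)"
  define u where "u = lam * L"
  have l2: "2 / 3 \<le> ln (2::real)" by (rule ln2_ge_two_thirds)
  have l2n: "ln 2 \<le> lam" unfolding lam_def using n2 by simp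
  then have lam: "2 / 3 \<le> lam" using l2 by simp
  have u: "1 \<le> 9 / 4 * u" "lam \<le> 3 / 2 * u" "L \<le> 3 / 2 * u" "0 \<le> u"
  proof -
    have "(2 / 3) * (2 / 3) \<le> lam * L" by (rule mult_mono) (use lam L in auto)
    then show "1 \<le> 9 / 4 * u" "0 \<le> u" by (simp_all add: u_def)
    have "lam * (2 / 3) \<le> lam * L" by (rule mult_left_mono) (use lam L in auto)
    then show "lam \<le> 3 / 2 * u" by (simp add: u_def)
    have "(2 / 3) * L \<le> lam * L" by (rule mult_right_mono) (use lam L in auto)
    then show "L \<le> 3 / 2 * u" by (simp add: u_def)
  qed
  have lb: "real l \<le> 3 * lam"
  proof -
    have "real (2 ^ l) \<le> real (2 * n)" using least_l(4) by (rule of_nat_mono)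
    then have "ln (2 ^ l) \<le> ln (2 * real n)" using n2 by (intro ln_mono) auto
    then have "real l * ln 2 \<le> ln 2 + lam" using n2 by (simp add: ln_realpow ln_mult lam_def)
    moreover have "real l * (2 / 3) \<le> real l * ln 2" by (rule mult_left_mono[OF l2]) simp
    ultimately show ?thesis using l2n by linarith
  qed
  have n1: "1 \<le> real n" using n2 by simp
  have Mr: "real (length es) + real n \<le> real n * real q" using M_le by (metis of_nat_add of_nat_le_iff of_nat_mult)
  define K2 where "K2 = q * q * q * (3 * e + 5 * q + 12)"
  have tb: "real t \<le> real n * u * real K2"
  proof -
    have "real q * real l \<le> real q * (9 / 2 * u)" using lb u by (intro mult_left_mono) linarith+
    also have "\<dots> = 9 / 2 * (real q * u)" by simp
    finally have 1: "real q * real l \<le> 9 / 2 * (real q * u)" .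
    have "(real e + 3) * 1 \<le> (real e + 3) * (9 / 4 * u)" by (rule mult_left_mono[OF u(1)]) simp
    also have "\<dots> = 9 / 4 * (real e * u) + 27 / 4 * u" by (simp add: algebra_simps)
    finally have 2: "real e + 3 \<le> 9 / 4 * (real e * u) + 27 / 4 * u" by simp
    have 3: "real k \<le> 9 / 2 * u" using L(2) u(3) by linarith
    have "0 \<le> real e * u" "0 \<le> real q * u" using u(4) by simp_all
    moreover have "(3 * real e + 5 * real q + 12) * u = 3 * (real e * u) + 5 * (real q * u) + 12 * u"
      by (simp add: algebra_simps)
    ultimately have "real e + real q * real l + real k + 3 \<le> (3 * real e + 5 * real q + 12) * u"
      using 1 2 3 u(4) by linarith
    then have "(real (length es) + real n) * (real q * real q) * (real e + real q * real l + real k + 3)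
        \<le> (real n * real q) * (real q * real q) * ((3 * real e + 5 * real q + 12) * u)"
      by (intro mult_mono Mr order_refl) auto
    then show ?thesis unfolding t_def K2_def by (simp add: mult_ac)
  qed
  have sb: "real s ^ (q - 1) \<le> 2 ^ (q - 1) * R"
  proof -
    have "real (s * s) \<le> real (4 * n)" using least_s(4) by (rule of_nat_mono)
    then have "real s ^ 2 \<le> 4 * real n" by (simp add: power2_eq_square)
    then have "real s \<le> sqrt (4 * real n)" by (rule real_le_rsqrt)
    also have "\<dots> = 2 * real n powr (1 / 2)" by (simp add: real_sqrt_mult powr_half_sqrt)
    finally have "real s ^ (q - 1) \<le> (2 * real n powr (1 / 2)) ^ (q - 1)" by (intro power_mono) auto
    also have "\<dots> = 2 ^ (q - 1) * R"
    proof -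
      have "(real n powr (1 / 2)) ^ (q - 1) = real n powr (real (q - 1) * (1 / 2))"
        using n2 by (subst powr_power) auto
      then show ?thesis using q2 by (simp add: power_mult_distrib R_def of_nat_diff)
    qed
    finally show ?thesis .
  qed
  have R0: "0 \<le> R" by (simp add: R_def)
  have Nb: "real N \<le> 2 ^ (e + q) * 6 * R * L"
  proof -
    have "real k + 2 \<le> 6 * L" using L by linarith
    then have "2 * 2 ^ e * real s ^ (q - 1) * (real k + 2) \<le> 2 * 2 ^ e * (2 ^ (q - 1) * R) * (6 * L)"
      using sb R0 L by (intro mult_mono order_refl) auto
    also have "\<dots> = 2 ^ (e + q) * 6 * R * L" using q2 by (cases q) (simp_all add: power_add mult_ac)
    finally show ?thesis by (simp only: N_def of_nat_mult of_nat_power of_nat_add of_nat_numeral)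
  qed
  define d where "d = 52 + q * q * (23 + \<Delta> * 16)"
  define K4 where "K4 = K2 * d + 3 * (13 * q + 33)"
  define tt where "tt = Suc (t * d + (q + 1) * 4 + n * 8 + q * 9 + 20)"
  have ttb: "real tt \<le> real n * u * real K4"
  proof -
    have "tt \<le> t * d + n * (13 * q + 33)"
    proof -
      have "1 * q \<le> n * q" using n2 by (intro mult_le_mono1) simp
      moreover have "n * (13 * q + 33) = 13 * (n * q) + 33 * n" by (simp add: algebra_simps)
      moreover have "tt = t * d + 13 * q + 8 * n + 25" by (simp add: tt_def)
      ultimately show ?thesis using n2 by linarith
    qed
    then have "real tt \<le> real (t * d + n * (13 * q + 33))" by (rule of_nat_mono)
    also have "\<dots> = real t * real d + real n * (13 * real q + 33) * 1" by simp
    also have "\<dots> \<le> (real n * u * real K2) * real d + real n * (13 * real q + 33) * (3 * u)"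
    proof (rule add_mono)
      show "real t * real d \<le> (real n * u * real K2) * real d" by (rule mult_right_mono[OF tb]) simp
      show "real n * (13 * real q + 33) * 1 \<le> real n * (13 * real q + 33) * (3 * u)"
        by (rule mult_left_mono) (use u in auto)
    qed
    also have "\<dots> = real n * u * real K4" by (simp add: K4_def algebra_simps)
    finally show ?thesis .
  qed
  define K3 where "K3 = 2 ^ (e + q) * (6::nat)"
  have nR: "real n * R = real n powr ((real q + 1) / 2)"
  proof -
    have "real n * R = real n powr 1 * R" using n2 by simp
    also have "\<dots> = real n powr (1 + (real q - 1) / 2)" unfolding R_def by (rule powr_add[symmetric])
    also have "1 + (real q - 1) / 2 = (real q + 1) / 2" by (simp add: field_simps)
    finally show ?thesis .
  qed
  define F where "F = real n powr ((real q + 1) / 2) * lam * L\<^sup>2"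
  have main: "real N * real tt \<le> real (K3 * K4) * F"
  proof -
    have "real N * real tt \<le> (2 ^ (e + q) * 6 * R * L) * (real n * u * real K4)"
      using Nb ttb R0 L by (intro mult_mono) auto
    also have "\<dots> = real (K3 * K4) * ((real n * R) * lam * L\<^sup>2)"
      by (simp add: K3_def u_def power2_eq_square mult_ac)
    finally show ?thesis by (simp only: nR F_def)
  qed
  have nF: "real n \<le> 4 * F"
  proof -
    have "real n powr 1 \<le> real n powr ((real q + 1) / 2)" using n1 q2 by (intro powr_mono) auto
    then have "real n \<le> real n powr ((real q + 1) / 2)" using n2 by simp
    moreover have "1 \<le> 4 * (lam * L\<^sup>2)"
    proof -
      have "(2 / 3) * ((2 / 3) * (2 / 3)) \<le> lam * (L * L)" by (intro mult_mono) (use lam L in auto)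
      then show ?thesis by (simp add: power2_eq_square)
    qed
    ultimately have "real n * 1 \<le> real n powr ((real q + 1) / 2) * (4 * (lam * L\<^sup>2))" by (intro mult_mono) auto
    then show ?thesis by (simp add: F_def mult_ac)
  qed
  define K5 where "K5 = 617 + 30 * q + 9 * e"
  have rest: "real (400 + 30 * length es + 10 * n + 9 * e + 1 + (n * 6 + 200)) \<le> real (4 * K5) * F"
  proof -
    have "e * 1 \<le> e * n" using n2 by (intro mult_le_mono2) simp
    then have "e \<le> e * n" by (simp only: mult_1_right)
    moreover have "K5 * n = 617 * n + 30 * (n * q) + 9 * (e * n)" by (simp add: K5_def algebra_simps)
    moreover have "length es \<le> n * q" using M_le by simp
    ultimately have "400 + 30 * length es + 10 * n + 9 * e + 1 + (n * 6 + 200) \<le> K5 * n"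
      using n2 by linarith
    then have "real (400 + 30 * length es + 10 * n + 9 * e + 1 + (n * 6 + 200)) \<le> real (K5 * n)" by (rule of_nat_mono)
    also have "\<dots> \<le> real K5 * (4 * F)" using nF by (simp add: mult_left_mono)
    finally show ?thesis by simp
  qed
  have "total_time = 400 + 30 * length es + 10 * n + 9 * e + 1 + (n * 6 + 200) + N * tt"
    by (simp add: total_time_def tt_def d_def)
  then have "real total_time = real (400 + 30 * length es + 10 * n + 9 * e + 1 + (n * 6 + 200)) + real N * real tt"
    by (simp only: of_nat_add of_nat_mult)
  also have "\<dots> \<le> real (4 * K5) * F + real (K3 * K4) * F" by (rule add_mono[OF rest main])
  also have "\<dots> = real (K3 * K4 + 4 * K5) * F" by (simp add: algebra_simps)
  also have "K3 * K4 + 4 * K5 = time_const q \<Delta>"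
    by (simp add: time_const_def K3_def K4_def K5_def K2_def d_def Let_def e_def)
  finally show ?thesis by (simp add: F_def lam_def mult.assoc)
qed

end

text \<open>The ghost value of the whole run has the law \<open>result\<close>, and the coupling
  \<open>?J\<close> says that the decoded output equals it. The relation of laws thereby becomes an
  equality.\<close>

lemma (in sampler_bounds) program_run:
  shows "halts_within program input total_time" "words_bounded program input B"
    "output_dist program input total_time n = map_pmf Some result"
proof -
  let ?J = "\<lambda>\<sigma> m'. decode_output n m' = Some \<sigma>"
  have "achieves B (initialise ;; trials ;; write_output) mi total_time result ?J"
  proof (rule achieves_ensures_seq[OF initialise_ensures])
    fix m assume rd: "ready m"
    have rg: "regs m" and ld: "loaded m" and tb: "table m (adjacency es)" using rd by (simp_all add: ready_def loaded_def)
    interpret S: sampler n \<Delta> q E es k t N B m b A Cb Fb Gb "adjacency es"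
    proof
      show "Gb + q + 1 \<le> B" "t \<le> B" "N \<le> B" "128 \<le> B" using B cell_bounds by simp_all
      show "0 < t" "0 < N" using t_bounds N_bounds by simp_all
      show "set (adjacency es v) = nb v" for v by (rule set_adjacency)
      show "length (adjacency es v) \<le> \<Delta>" for v by (rule length_adjacency_le)
      show "m 33 = t" "m 34 = N" using rd by (simp_all add: ready_def)
      show "m (b + 5 + 2 * r) = src r" "m (b + 6 + 2 * r) = tgt r" if "r < length es" for r
        using ld that by (simp_all add: loaded_def)
      show "m (A + v * (\<Delta> + 1)) = length (adjacency es v)" if "v < n" for v
        using tb that by (simp add: table_def row_def)
      show "m (A + v * (\<Delta> + 1) + Suc j) = adjacency es v ! j" if "v < n" "j < length (adjacency es v)" for v j
        using tb that by (simp add: table_def row_def)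
    qed (use rg es_pos in \<open>simp_all add: regs_def b_def A_def Cb_def Fb_def Gb_def\<close>)
    have i: "S.inv (\<lambda>v\<in>{..<n}. 1) m"
      using rd const_\<Omega> by (simp add: S.inv_def S.stat_def ready_def)
    have tt: "S.trial_time = t * (52 + q * q * (23 + \<Delta> * 16)) + (q + 1) * 4 + n * 8 + q * 9 + 20"
      by (simp add: S.trial_time_def S.step_time_def)
    have "achieves B (trials ;; write_output) m (1 + N * Suc S.trial_time + (n * 6 + 200)) (map_pmf (\<lambda>\<sigma>. \<sigma>) result) ?J"
      unfolding result_def
    proof (rule achieves_seq_ensures[OF S.trials_achieves[OF i]])
      fix \<sigma> m' assume "S.inv \<sigma> m'"
      then have st: "S.stat m'" and c: "\<And>u. u < n \<Longrightarrow> m' (Cb + u) = \<sigma> u" and \<sigma>: "\<sigma> \<in> \<Omega>" by (simp_all add: S.inv_def)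
      show "ensures B write_output m' (n * 6 + 200) (?J \<sigma>)"
        using S.statD(4,9,12)[OF st] by (intro write_output_ensures \<sigma> c)
    qed simp
    then show "achieves B (trials ;; write_output) m (1 + N * Suc (t * (52 + q * q * (23 + \<Delta> * 16)) + (q + 1) * 4 + n * 8 + q * 9 + 20) + (n * 6 + 200)) result ?J"
      by (simp only: tt map_pmf_ident)
  qed (simp add: total_time_def initialise_time_def)
  then obtain M' where M': "sem B (initialise ;; trials ;; write_output) mi M' total_time" "rel_pmf ?J result M'"
    by (auto simp: achieves_def)
  note run = sem_run[OF M'(1)[unfolded mi_def] mi_bounded[unfolded mi_def], folded program_def]
  show "halts_within program input total_time" "words_bounded program input B" by (rule run)+
  have "rel_pmf (=) (map_pmf Some result) (map_pmf (decode_output n) M')"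
    unfolding pmf.rel_map by (rule pmf.rel_mono_strong[OF M'(2)]) simp
  then have "map_pmf (decode_output n) M' = map_pmf Some result" by (simp add: pmf.rel_eq)
  then show "output_dist program input total_time n = map_pmf Some result"
    unfolding output_dist_def run(1) by (simp add: map_pmf_comp)
qed

lemma precision_ge: "0 < \<epsilon> \<Longrightarrow> 1 / 2 ^ precision \<epsilon> \<le> \<epsilon>"
proof -
  assume e: "0 < \<epsilon>"
  have "log 2 (1 / \<epsilon>) \<le> real (precision \<epsilon>)" unfolding precision_def by linarith
  then have "1 / \<epsilon> \<le> 2 powr real (precision \<epsilon>)" using e by (simp add: log_le_iff)
  then show ?thesis using e by (simp add: powr_realpow field_simps)
qed

text \<open>For \<open>\<epsilon> \<le> 1 / 2\<close> the logarithm stays away from 0 and absorbs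
  the 1 lost in rounding up.\<close>

lemma precision_le:
  assumes "0 < \<epsilon>" "\<epsilon> \<le> 1 / 2"
  shows "2 / 3 \<le> ln (1 / \<epsilon>)" "real (precision \<epsilon>) \<le> 3 * ln (1 / \<epsilon>)"
proof -
  define L where "L = ln (1 / \<epsilon>)"
  have "ln 2 \<le> L" unfolding L_def using assms by (subst ln_le_cancel_iff) (simp_all add: field_simps)
  then show L: "2 / 3 \<le> ln (1 / \<epsilon>)" using ln2_ge_two_thirds by (simp add: L_def)
  have "L / ln 2 \<le> L / (2 / 3)" using L ln2_ge_two_thirds unfolding L_def by (intro divide_left_mono) auto
  then have "log 2 (1 / \<epsilon>) \<le> 3 / 2 * L" unfolding log_def L_def by simp
  moreover have "0 \<le> log 2 (1 / \<epsilon>)" using L ln2_ge_two_thirds unfolding log_def by (intro divide_nonneg_nonneg) auto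
  moreover from this have "real (precision \<epsilon>) \<le> log 2 (1 / \<epsilon>) + 1" unfolding precision_def by linarith
  ultimately show "real (precision \<epsilon>) \<le> 3 * ln (1 / \<epsilon>)" using L unfolding L_def by linarith
qed

text \<open>A vertex of degree \<open>\<Delta> \<ge> 1\<close> forces an edge. So neither an empty
  edge list occurs, for which \<open>b\<close> would be 0, nor \<open>n = 1\<close>, for which
  \<open>ln n\<close> vanishes.\<close>

lemma sampler_input_encode:
  assumes \<Delta>: "1 \<le> \<Delta>" and q: "2 * \<Delta> \<le> q" and n: "0 < n" and E: "simple_graph n E" and d: "max_degree n E = \<Delta>"
    and es: "lists_edges es E"
  shows "sampler_input n \<Delta> q E es" "2 \<le> n"
proof -
  have ex: "\<exists>v<n. degree_of E v = \<Delta>"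
  proof -
    have "Max (degree_of E ` {..<n}) \<in> degree_of E ` {..<n}" using n by (intro Max_in) auto
    then show ?thesis using d by (auto simp: max_degree_def)
  qed
  then obtain v where v: "v < n" "degree_of E v = \<Delta>" by blast
  have "E \<noteq> {}" using v \<Delta> by (auto simp: degree_of_def)
  then obtain e where "e \<in> E" by blast
  then have "e \<in> {{u, v} |u v. u < n \<and> v < n \<and> u \<noteq> v}" using E by (auto simp: simple_graph_def)
  then show "2 \<le> n" by auto
  show "sampler_input n \<Delta> q E es"
  proof
    fix v
    show "degree_of E v \<le> \<Delta>"
    proof (cases "v < n")
      case True
      then have "degree_of E v \<le> Max (degree_of E ` {..<n})" by (intro Max_ge) auto
      then show ?thesis using d by (simp add: max_degree_def)
    next
      case False
      have "e \<in> {{u, v} |u v. u < n \<and> v < n \<and> u \<noteq> v}" if "e \<in> E" for e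
        using that E by (auto simp: simple_graph_def)
      then have empty: "{e \<in> E. v \<in> e} = {}" using False by fastforce
      show ?thesis unfolding degree_of_def empty by simp
    qed
    show "0 < length es" using \<open>E \<noteq> {}\<close> es by (auto simp: lists_edges_def)
  qed (use assms in auto)
qed

text \<open>The program reads \<open>\<Delta>\<close> and \<open>q\<close> from its input, so one
  program serves all of them. As it never reports failure, the zero sequence is taken for
  \<open>\<delta>\<close>. The time bound is confined to \<open>\<epsilon> \<le> 1 / 2\<close>
  because \<open>ln (1 / \<epsilon>)\<close> tends to 0 as \<open>\<epsilon>\<close> tends to
  1.\<close>

theorem mainTheorem1:
  shows "\<exists>P :: instr list. \<forall>\<Delta> q :: nat. 1 \<le> \<Delta> \<and> 2 * \<Delta> \<le> q \<longrightarrow>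
    (\<exists>(C :: real) (c :: nat) (\<delta> :: nat \<Rightarrow> real). \<delta> \<longlonglongrightarrow> 0 \<and>
      (\<forall>(n :: nat) E es (\<epsilon> :: real).
         0 < n \<and> simple_graph n E \<and> max_degree n E = \<Delta> \<and> lists_edges es E \<and>
         0 < \<epsilon> \<and> \<epsilon> < 1 \<longrightarrow>
         (let xs = encode_input \<Delta> q n es \<epsilon> in
          words_bounded P xs ((n + precision \<epsilon> + 1) ^ c) \<and>
          (\<exists>T :: nat.
             (\<epsilon> \<le> 1 / 2 \<longrightarrow>
               real T \<le> C * real n powr ((real q + 1) / 2) * ln (real n) * (ln (1 / \<epsilon>))\<^sup>2) \<and>
             halts_within P xs T \<and>
             (let \<nu> = output_dist P xs T n in
              0 < success_prob \<nu> \<and> 1 - \<delta> n \<le> success_prob \<nu> \<and>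
              approx_samples \<epsilon> (given_success \<nu>)
                (pmf_of_set (equitable_colorings n E q)))))))"
proof (rule exI[of _ program], intro allI impI, elim conjE)
  fix \<Delta> q :: nat
  assume \<Delta>: "1 \<le> \<Delta>" and q: "2 * \<Delta> \<le> q"
  have main: "let xs = encode_input \<Delta> q n es \<epsilon> in
      words_bounded program xs ((n + precision \<epsilon> + 1) ^ (word_const q + q + 1)) \<and>
      (\<exists>T :: nat.
         (\<epsilon> \<le> 1 / 2 \<longrightarrow>
           real T \<le> real (time_const q \<Delta>) * real n powr ((real q + 1) / 2) * ln (real n) * (ln (1 / \<epsilon>))\<^sup>2) \<and>
         halts_within program xs T \<and>
         (let \<nu> = output_dist program xs T n in
          0 < success_prob \<nu> \<and> 1 - 0 \<le> success_prob \<nu> \<and>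
          approx_samples \<epsilon> (given_success \<nu>) (pmf_of_set (equitable_colorings n E q))))"
    if n: "0 < n" and E: "simple_graph n E" and d: "max_degree n E = \<Delta>" and es: "lists_edges es E"
      and \<epsilon>: "0 < \<epsilon>" "\<epsilon> < 1" for n E es and \<epsilon> :: real
  proof -
    define k where "k = precision \<epsilon>"
    note inp = sampler_input_encode[OF \<Delta> q n E d es]
    interpret sampler_input n \<Delta> q E es k by (rule inp(1))
    interpret sampler_bounds n \<Delta> q E es k "(n + k + 1) ^ (word_const q + q + 1)"
      by unfold_locales (rule word_bounds[OF inp(2)])+
    have xs: "encode_input \<Delta> q n es \<epsilon> = input" by (simp add: encode_input_def input_def flip: k_def)
    have acc: "tv_dist result (pmf_of_set (equitable_colorings n E q)) \<le> \<epsilon>"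
      by (rule tv_dist_le[OF order_trans[OF result_accuracy precision_ge[OF \<epsilon>(1), folded k_def]]])
    have time: "real total_time \<le> real (time_const q \<Delta>) * real n powr ((real q + 1) / 2) * ln (real n) * (ln (1 / \<epsilon>))\<^sup>2"
      if "\<epsilon> \<le> 1 / 2"
      by (rule total_time_le[OF inp(2) precision_le[OF \<epsilon>(1) that, folded k_def]])
    show ?thesis
      unfolding Let_def xs k_def[symmetric]
    proof (intro conjI exI[of _ total_time] impI)
      show "words_bounded program input ((n + k + 1) ^ (word_const q + q + 1))" "halts_within program input total_time"
        by (rule program_run)+
    qed (use time acc in \<open>simp_all add: program_run(3) success_prob_map_Some given_success_map_Some approx_samples_def\<close>)
  qed
  show "\<exists>(C :: real) (c :: nat) (\<delta> :: nat \<Rightarrow> real). \<delta> \<longlonglongrightarrow> 0 \<and>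
      (\<forall>(n :: nat) E es (\<epsilon> :: real).
         0 < n \<and> simple_graph n E \<and> max_degree n E = \<Delta> \<and> lists_edges es E \<and>
         0 < \<epsilon> \<and> \<epsilon> < 1 \<longrightarrow>
         (let xs = encode_input \<Delta> q n es \<epsilon> in
          words_bounded program xs ((n + precision \<epsilon> + 1) ^ c) \<and>
          (\<exists>T :: nat.
             (\<epsilon> \<le> 1 / 2 \<longrightarrow>
               real T \<le> C * real n powr ((real q + 1) / 2) * ln (real n) * (ln (1 / \<epsilon>))\<^sup>2) \<and>
             halts_within program xs T \<and>
             (let \<nu> = output_dist program xs T n in
              0 < success_prob \<nu> \<and> 1 - \<delta> n \<le> success_prob \<nu> \<and>
              approx_samples \<epsilon> (given_success \<nu>)
                (pmf_of_set (equitable_colorings n E q))))))"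
    by (intro exI[of _ "real (time_const q \<Delta>)"] exI[of _ "word_const q + q + 1"] exI[of _ "\<lambda>_. 0 :: real"] conjI
      tendsto_const allI impI, elim conjE, rule main)
qed

end
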